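(* Let $\mathcal{G}=(G,\mathcal{T},\mathcal{P})$ be a template-acyclic directed parametric graph template whose template graph has $n$ vertices and $m$ edges, and let $A$ be a rooted tree with $k$ vertices (edges directed away from the root). There is a randomized algorithm, correct with high probability, that decides for all vertices $v$ of the template graph whether $A$ occurs in the instantiation of $\mathcal{G}$ rooted at (an instance of) $v$, in $k^{O(k)}m\log n$ time. If all parameters satisfy $P_i\geq k$, it takes $2^{O(k)}m\log n$ time.
   Context: A parametric graph template $\mathcal{G}=(G,\mathcal{T},\mathcal{P})$ consists of a directed template graph $G=(V,E)$ with $n$ vertices and $m$ edges, a list of templates $\mathcal{T}=T_0,\dots,T_{k'-1}$ with $\emptyset\neq T_i\subseteq V$, and positive integer parameters $\mathcal{P}=P_0,\dots,P_{k'-1}$. For $i\neq j$, either $T_i\cap T_j=\emptyset$, $T_i\subsetneq T_j$, or $T_j\subsetneq T_i$; the root template is $T_0=V$ with $P_0=1$. Inclusion induces a rooted template tree. For $v\in V$, $T(v)$ is the smallest template containing $v$. Standing assumption (no skipping): for every edge $(u,v)$ with $T(u)\neq T(v)$, one of $T(u),T(v)$ is the parent of the other. The instantiation is obtained as follows: while more than one template remains, pick a leaf template $T_i\neq T_0$; replace each vertex $v\in T_i$ (in $V$ and in every template containing it) by $P_i$ copies $v_1,\dots,v_{P_i}$ (instances of $v$); replace each edge $(u,v)$ with both endpoints in $T_i$ by $(u_j,v_j)$, $j=1,\dots,P_i$; replace each edge $(u,v)$ with only $u\in T_i$ by $(u_j,v)$, $j=1,\dots,P_i$, and symmetrically; then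 delete $T_i$ and $P_i$. Instances are transitive. A template-cycle is a directed path $p_1,\dots,p_r$ in the template graph with indices $a<b<c$ such that $T(p_a)=T(p_c)\neq T(p_b)$; $\mathcal{G}$ is template-acyclic if it has no template-cycle. A pattern $A$ occurs in a graph $H$ if there is an injective map $\phi$ from vertices of $A$ to vertices of $H$ such that for every edge $(x,y)$ of $A$, $(\phi(x),\phi(y))$ is an edge of $H$; it occurs rooted at $v$ if $\phi$ maps the root of $A$ to an instance of $v$.
   Formalization: The running times are proved with max(m,n) in place of m and log max(2,n) in place of log n, since the literal bound is zero for m = 0 or n = 1 although n answers must be written; P_i ≥ k is required only of non-root templates. *)

theory Defs
  imports
    "HOL-Probability.Probability_Mass_Function"
    "Graph_Theory.Pair_Digraph"
    "Graph_Theory.Vertex_Walk"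
begin

section \<open>Parametric graph templates\<close>

record 'a pgt =
  tgraph :: "'a pair_pre_digraph"
  templates :: "'a set list"
  params :: "nat list"

definition parametric_graph_template :: "'a pgt \<Rightarrow> bool" where
  "parametric_graph_template \<G> \<longleftrightarrow>
     pair_fin_digraph (tgraph \<G>) \<and>
     templates \<G> \<noteq> [] \<and>
     length (params \<G>) = length (templates \<G>) \<and>
     (\<forall>T \<in> set (templates \<G>). T \<noteq> {} \<and> T \<subseteq> pverts (tgraph \<G>)) \<and>
     (\<forall>P \<in> set (params \<G>). 0 < P) \<and>
     templates \<G> ! 0 = pverts (tgraph \<G>) \<and>
     params \<G> ! 0 = 1 \<and>
     (\<forall>i < length (templates \<G>). \<forall>j < length (templates \<G>). i \<noteq> j \<longrightarrow>
        templates \<G> ! i \<inter> templates \<G> ! j = {} \<or>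
        templates \<G> ! i \<subset> templates \<G> ! j \<or>
        templates \<G> ! j \<subset> templates \<G> ! i)"

text \<open>Index of the smallest template containing a vertex. In a parametric graph template distinct
  indices carry distinct templates, so comparing indices amounts to comparing templates.\<close>

definition tmpl :: "'a pgt \<Rightarrow> 'a \<Rightarrow> nat" where
  "tmpl \<G> v = (THE i. i < length (templates \<G>) \<and> v \<in> templates \<G> ! i \<and>
     (\<forall>j < length (templates \<G>). v \<in> templates \<G> ! j \<longrightarrow> templates \<G> ! i \<subseteq> templates \<G> ! j))"

definition tmpl_parent :: "'a pgt \<Rightarrow> nat \<Rightarrow> nat \<Rightarrow> bool" where
  "tmpl_parent \<G> i j \<longleftrightarrow>
     i < length (templates \<G>) \<and> j < length (templates \<G>) \<and>
     templates \<G> ! j \<subset> templates \<G> ! i \<and>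
     \<not> (\<exists>l < length (templates \<G>).
          templates \<G> ! j \<subset> templates \<G> ! l \<and> templates \<G> ! l \<subset> templates \<G> ! i)"

definition no_skipping :: "'a pgt \<Rightarrow> bool" where
  "no_skipping \<G> \<longleftrightarrow>
     (\<forall>(u, v) \<in> parcs (tgraph \<G>). tmpl \<G> u \<noteq> tmpl \<G> v \<longrightarrow>
        tmpl_parent \<G> (tmpl \<G> u) (tmpl \<G> v) \<or> tmpl_parent \<G> (tmpl \<G> v) (tmpl \<G> u))"

text \<open>The directed path of a template-cycle may revisit vertices (\<^const>\<open>vwalk\<close> rather than
  \<^const>\<open>vpath\<close>): with edges \<open>(u, v)\<close> and \<open>(v, u)\<close> between two templates, the path \<open>u, v, u\<close>
  returns to the template of \<open>u\<close> and is a template-cycle.\<close>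

definition template_cycle :: "'a pgt \<Rightarrow> 'a list \<Rightarrow> bool" where
  "template_cycle \<G> p \<longleftrightarrow>
     vwalk p (with_proj (tgraph \<G>)) \<and>
     (\<exists>a b c. a < b \<and> b < c \<and> c < length p \<and>
        tmpl \<G> (p ! a) = tmpl \<G> (p ! c) \<and> tmpl \<G> (p ! a) \<noteq> tmpl \<G> (p ! b))"

definition template_acyclic :: "'a pgt \<Rightarrow> bool" where
  "template_acyclic \<G> \<longleftrightarrow> \<not> (\<exists>p. template_cycle \<G> p)"


section \<open>Instantiation\<close>

text \<open>To stay within one vertex type, a vertex of a (partially) instantiated template is a pair
  \<open>(v, js)\<close>, where \<open>v\<close> is the vertex of the template graph of which it is a (transitive) instance
  and \<open>js\<close> lists the copy indices it received, the latest one first.\<close>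

fun copy_vert :: "nat \<Rightarrow> 'a \<times> nat list \<Rightarrow> 'a \<times> nat list" where
  "copy_vert j (v, js) = (v, j # js)"

definition copy_set ::
  "('a \<times> nat list) set \<Rightarrow> nat \<Rightarrow> ('a \<times> nat list) set \<Rightarrow> ('a \<times> nat list) set" where
  "copy_set S P X = (X - S) \<union> {copy_vert j x | j x. x \<in> X \<inter> S \<and> j \<in> {1..P}}"

definition copy_arcs ::
  "('a \<times> nat list) set \<Rightarrow> nat \<Rightarrow> ('a \<times> nat list) rel \<Rightarrow> ('a \<times> nat list) rel" where
  "copy_arcs S P E =
     {(x, y) | x y. (x, y) \<in> E \<and> x \<notin> S \<and> y \<notin> S} \<union>
     {(copy_vert j x, copy_vert j y) | j x y. (x, y) \<in> E \<and> x \<in> S \<and> y \<in> S \<and> j \<in> {1..P}} \<union>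
     {(copy_vert j x, y) | j x y. (x, y) \<in> E \<and> x \<in> S \<and> y \<notin> S \<and> j \<in> {1..P}} \<union>
     {(x, copy_vert j y) | j x y. (x, y) \<in> E \<and> x \<notin> S \<and> y \<in> S \<and> j \<in> {1..P}}"

definition leaf_template :: "'a pgt \<Rightarrow> nat \<Rightarrow> bool" where
  "leaf_template \<G> i \<longleftrightarrow> i < length (templates \<G>) \<and>
     \<not> (\<exists>j < length (templates \<G>). templates \<G> ! j \<subset> templates \<G> ! i)"

definition remove_nth :: "nat \<Rightarrow> 'b list \<Rightarrow> 'b list" where
  "remove_nth i xs = take i xs @ drop (Suc i) xs"

definition expand_template :: "nat \<Rightarrow> ('a \<times> nat list) pgt \<Rightarrow> ('a \<times> nat list) pgt" where
  "expand_template i \<G> =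
     (let S = templates \<G> ! i; P = params \<G> ! i in
      \<lparr> tgraph = \<lparr> pverts = copy_set S P (pverts (tgraph \<G>)),
                    parcs = copy_arcs S P (parcs (tgraph \<G>)) \<rparr>,
        templates = map (copy_set S P) (remove_nth i (templates \<G>)),
        params = remove_nth i (params \<G>) \<rparr>)"

inductive inst_step :: "('a \<times> nat list) pgt \<Rightarrow> ('a \<times> nat list) pgt \<Rightarrow> bool" where
  "i \<noteq> 0 \<Longrightarrow> leaf_template \<G> i \<Longrightarrow> inst_step \<G> (expand_template i \<G>)"

definition initial_pgt :: "'a pgt \<Rightarrow> ('a \<times> nat list) pgt" where
  "initial_pgt \<G> =
     \<lparr> tgraph = \<lparr> pverts = (\<lambda>v. (v, [])) ` pverts (tgraph \<G>),
                   parcs = (\<lambda>(u, v). ((u, []), (v, []))) ` parcs (tgraph \<G>) \<rparr>,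
       templates = map (image (\<lambda>v. (v, []))) (templates \<G>),
       params = params \<G> \<rparr>"

text \<open>The copy indices of an instance of \<open>v\<close> follow the chain of templates containing \<open>v\<close>, hence
  the result does not depend on the order in which the leaves are picked.\<close>

definition is_instantiation :: "'a pgt \<Rightarrow> ('a \<times> nat list) pair_pre_digraph \<Rightarrow> bool" where
  "is_instantiation \<G> H \<longleftrightarrow>
     (\<exists>\<G>'. inst_step\<^sup>*\<^sup>* (initial_pgt \<G>) \<G>' \<and> length (templates \<G>') = 1 \<and> H = tgraph \<G>')"


section \<open>Patterns\<close>

text \<open>Edges directed away from the root: every vertex is reached from the root by exactly one
  walk.\<close>

definition rooted_tree :: "'b pair_pre_digraph \<Rightarrow> 'b \<Rightarrow> bool" where
  "rooted_tree A r \<longleftrightarrow>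
     pair_fin_digraph A \<and> r \<in> pverts A \<and>
     (\<forall>v \<in> pverts A. \<exists>!p. pre_digraph.awalk (with_proj A) r p v)"

definition occurrence ::
  "'b pair_pre_digraph \<Rightarrow> 'c pair_pre_digraph \<Rightarrow> ('b \<Rightarrow> 'c) \<Rightarrow> bool" where
  "occurrence A H \<phi> \<longleftrightarrow>
     inj_on \<phi> (pverts A) \<and> \<phi> ` pverts A \<subseteq> pverts H \<and>
     (\<forall>(x, y) \<in> parcs A. (\<phi> x, \<phi> y) \<in> parcs H)"

definition occurs_rooted_at :: "'b pair_pre_digraph \<Rightarrow> 'b \<Rightarrow> 'a pgt \<Rightarrow> 'a \<Rightarrow> bool" where
  "occurs_rooted_at A r \<G> v \<longleftrightarrow>
     (\<exists>H \<phi>. is_instantiation \<G> H \<and> occurrence A H \<phi> \<and> fst (\<phi> r) = v)"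


section \<open>Randomized word RAM\<close>

text \<open>A program has finitely many registers and a random access memory. All cells hold words of
  \<open>w\<close> bits, and arithmetic is modulo \<open>2 ^ w\<close>; subtraction is truncated at 0. Every transition costs
  one unit of time.\<close>

datatype binop = Add | Sub | Mul | Div | Mod

datatype com =
    Const nat nat
  | Arith nat binop nat nat
  | Load nat nat
  | Store nat nat
  | Rand nat nat
  | Seq com com
  | Cond nat com com
  | Loop nat com

fun binop_sem :: "binop \<Rightarrow> nat \<Rightarrow> nat \<Rightarrow> nat" where
  "binop_sem Add x y = x + y"
| "binop_sem Sub x y = x - y"
| "binop_sem Mul x y = x * y"
| "binop_sem Div x y = x div y"
| "binop_sem Mod x y = x mod y"

type_synonym ram_state = "(nat \<Rightarrow> nat) \<times> (nat \<Rightarrow> nat)"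

text \<open>A configuration is the stack of commands still to be executed together with the register and
  memory contents.\<close>

fun ram_step :: "nat \<Rightarrow> com list \<times> ram_state \<Rightarrow> (com list \<times> ram_state) pmf" where
  "ram_step w ([], s) = return_pmf ([], s)"
| "ram_step w (Const r x # K, (R, M)) = return_pmf (K, (R(r := x mod 2 ^ w), M))"
| "ram_step w (Arith r f a b # K, (R, M)) =
     return_pmf (K, (R(r := binop_sem f (R a) (R b) mod 2 ^ w), M))"
| "ram_step w (Load r a # K, (R, M)) = return_pmf (K, (R(r := M (R a)), M))"
| "ram_step w (Store a r # K, (R, M)) = return_pmf (K, (R, M(R a := R r)))"
| "ram_step w (Rand r a # K, (R, M)) =
     map_pmf (\<lambda>x. (K, (R(r := x), M))) (pmf_of_set {..<max 1 (R a)})"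
| "ram_step w (Seq c d # K, s) = return_pmf (c # d # K, s)"
| "ram_step w (Cond r c d # K, (R, M)) =
     return_pmf ((if R r \<noteq> 0 then c else d) # K, (R, M))"
| "ram_step w (Loop r c # K, (R, M)) =
     return_pmf (if R r \<noteq> 0 then c # Loop r c # K else K, (R, M))"

fun ram_run :: "nat \<Rightarrow> nat \<Rightarrow> com list \<times> ram_state \<Rightarrow> (com list \<times> ram_state) pmf" where
  "ram_run w 0 cfg = return_pmf cfg"
| "ram_run w (Suc t) cfg = bind_pmf (ram_step w cfg) (ram_run w t)"

definition input_state :: "nat list \<Rightarrow> ram_state" where
  "input_state xs = (\<lambda>_. 0, \<lambda>a. if a < length xs then xs ! a else 0)"

definition ram_outcome :: "nat \<Rightarrow> com \<Rightarrow> nat list \<Rightarrow> nat \<Rightarrow> (com list \<times> ram_state) pmf" where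
  "ram_outcome w p xs t = ram_run w t ([p], input_state xs)"

text \<open>Termination within \<open>t\<close> steps for all outcomes of the random choices.\<close>

definition halts_within :: "nat \<Rightarrow> com \<Rightarrow> nat list \<Rightarrow> nat \<Rightarrow> bool" where
  "halts_within w p xs t \<longleftrightarrow> (\<forall>(K, s) \<in> set_pmf (ram_outcome w p xs t). K = [])"

text \<open>Probability that after \<open>t\<close> steps the memory cells \<open>0, \<dots>, n - 1\<close> hold the truth values of
  \<open>Q 0, \<dots>, Q (n - 1)\<close>, a nonzero word meaning true.\<close>

definition prob_decides ::
  "nat \<Rightarrow> com \<Rightarrow> nat list \<Rightarrow> nat \<Rightarrow> nat \<Rightarrow> (nat \<Rightarrow> bool) \<Rightarrow> real" where
  "prob_decides w p xs t n Q =
     measure_pmf.prob (ram_outcome w p xs t) {(K, R, M). \<forall>v < n. M v \<noteq> 0 \<longleftrightarrow> Q v}"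


section \<open>Input\<close>

text \<open>The laminar family of templates is given by its rooted tree: \<open>tmpl \<G> v\<close> for every vertex
  \<open>v\<close> and the parent of every template (0 for the root), which takes space linear in \<open>n\<close>, whereas
  listing the members of all templates may take quadratic space.\<close>

definition parent_index :: "'a pgt \<Rightarrow> nat \<Rightarrow> nat" where
  "parent_index \<G> i = (if i = 0 then 0 else THE j. tmpl_parent \<G> j i)"

definition encode_arcs :: "(nat \<times> nat) list \<Rightarrow> nat list" where
  "encode_arcs es = concat (map (\<lambda>(u, v). [u, v]) es)"

definition encode_input ::
  "nat pgt \<Rightarrow> nat \<Rightarrow> (nat \<times> nat) list \<Rightarrow> nat \<Rightarrow> nat \<Rightarrow> (nat \<times> nat) list \<Rightarrow> nat list" where
  "encode_input \<G> n es k r as =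
     [n, length es, length (templates \<G>), k, r] @
     encode_arcs es @ map (tmpl \<G>) [0..<n] @
     map (parent_index \<G>) [0..<length (templates \<G>)] @ params \<G> @
     encode_arcs as"

text \<open>Words of \<open>c * (k log k + log N)\<close> bits, where \<open>N\<close> bounds the length and the entries of the
  input, so that a word can hold every input number and the address of every cell reachable in time
  \<open>(k ^ k * N) ^ O(1)\<close>.\<close>

definition word_length_ok :: "nat \<Rightarrow> nat \<Rightarrow> nat list \<Rightarrow> nat \<Rightarrow> bool" where
  "word_length_ok c k xs w \<longleftrightarrow>
     real c * (real k * log 2 (real k) + log 2 (real (length xs + Max (set xs)))) \<le> real w"

text \<open>Conventions for the running time: \<open>k\<^bsup>O(k)\<^esup>\<close> and \<open>2\<^bsup>O(k)\<^esup>\<close> become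
  \<open>c * k ^ (c * k)\<close> and \<open>2 ^ (c * k)\<close>, the former with a leading constant because of \<open>k = 1\<close>. The
  factors \<open>m\<close> and \<open>log n\<close> become \<open>max m n\<close> and \<open>log 2 (max 2 n)\<close>, which only matters when there are
  fewer edges than vertices or \<open>n = 1\<close>: already writing \<open>n\<close> answers takes \<open>n\<close> steps, and \<open>m\<close> or
  \<open>log n\<close> may be 0. The condition \<open>P\<^sub>i \<ge> k\<close> excludes the root template, whose parameter is fixed
  to be 1.\<close>

end

theory Submission
  imports Defs
begin

text \<open>An occurrence of the pattern \<open>A\<close> is a homomorphism from \<open>A\<close> to the template graph together
  with the choice of a copy at every arc of \<open>A\<close> that enters a template: as there is no template-cycle,
  a walk that has left a template never comes back, so the list of the copies entered on the way from
  the root determines the instance that a node is mapped to. At most \<open>k\<close> copies of a template are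
  needed, which leaves at most \<open>(k + 1) ^ k\<close> lists. If all parameters are at least \<open>k\<close>, every entering
  arc may take a fresh copy; then lists are not needed at all, and only nodes in the same component,
  i.e. not separated by an entering arc, must be mapped to different vertices.

  In both cases it remains to embed \<open>A\<close> into a target graph injectively on every component, which is
  done by color coding: under a random coloring with \<open>k\<close> colors, a fixed image receives distinct colors
  with probability at least \<open>1 / 4 ^ k\<close>, and colorful embeddings are found by a dynamic program over
  the arcs of \<open>A\<close> and the subsets of the colors. The trials are independent as they run on disjoint
  copies of the target graph, and \<open>O(4 ^ k * log n)\<close> of them suffice for all vertices
  simultaneously. All colors are drawn before the dynamic program is run, hence the remaining
  program is deterministic.\<close>

section \<open>Colorful tree embeddings\<close>

text \<open>The instantiation can be exponentially larger than the template, so instances need short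
  names. No skipping together with acyclicity provides them: a walk crosses template boundaries one
  level at a time and goes up only before it first goes down. Hence a node shares with the root the
  copies of the templates that were never left, and every other template around it was entered on
  the way, in the order of nesting; fewer than \<open>k\<close> entries, each below
  \<open>k\<close>, describe these copies. The first entered template does not contain the image of
  the root, which is why different lists over the same vertex mean different instances. If all
  parameters are at least \<open>k\<close>, the head of an entering arc can serve as the number of
  its copy; then different components never meet and may reuse colors, which removes the factor
  \<open>(k + 1) ^ k\<close>. Simplicity of the program is bought with factors that the exponent
  absorbs: repeated passes over the unsorted arcs of \<open>A\<close> and a full scan of all pairs
  of color sets cost only powers of \<open>k\<close> and of \<open>2 ^ k\<close>.\<close>

locale arc_tree =
  fixes tas :: "(nat \<times> nat) list" and k r :: nat and d :: "nat \<Rightarrow> nat"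
  assumes length_tas: "length tas = k - 1"
    and root: "r < k" "d r = 0"
    and arc: "(x, y) \<in> set tas \<Longrightarrow> x < k \<and> y < k \<and> d y = Suc (d x)"
    and parent_unique: "(x, y) \<in> set tas \<Longrightarrow> (x', y) \<in> set tas \<Longrightarrow> x = x'"
    and parent_exists: "y < k \<Longrightarrow> y \<noteq> r \<Longrightarrow> \<exists>x. (x, y) \<in> set tas"
    and depth_less: "x < k \<Longrightarrow> d x < k"
    and distinct_tas: "distinct tas"
begin

lemma tree_induct [consumes 1, case_names root arc]:
  assumes "x < k" "P r" "\<And>x y. (x, y) \<in> set tas \<Longrightarrow> P x \<Longrightarrow> P y"
  shows "P x"
  using assms(1)
proof (induction "d x" arbitrary: x rule: less_induct)
  case less
  show ?case
  proof (cases "x = r")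
    case False
    then obtain y where y: "(y, x) \<in> set tas" using parent_exists less.prems by blast
    then show ?thesis using less.hyps[of y] arc[OF y] assms(3) by auto
  qed (use assms(2) in simp)
qed

text \<open>Every node has only one parent, so a value at the root can be pushed down along the
  arcs. Labels and component names of a given embedding are built in this way.\<close>

lemma tree_rec: "\<exists>h. h r = a \<and> (\<forall>(x, y) \<in> set tas. h y = g x y (h x))"
proof -
  define par where "par y = (THE x. (x, y) \<in> set tas)" for y
  have par: "par y = x" if "(x, y) \<in> set tas" for x y
    unfolding par_def using that parent_unique by blast
  \<comment> \<open>The recursion runs over the depth, not over the nodes: \<open>f i y\<close> is
    meaningful only if \<open>i = d y\<close>, and the parent of \<open>y\<close> is then looked up
    one level higher.\<close>
  define f where "f = rec_nat (\<lambda>_. a) (\<lambda>n F y. g (par y) y (F (par y)))"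
  have f: "f 0 y = a" "f (Suc n) y = g (par y) y (f n (par y))" for n y
    by (simp_all add: f_def)
  show ?thesis
    by (rule exI[of _ "\<lambda>x. f (d x) x"]) (use f par arc root in auto)
qed

abbreviation desc :: "nat \<Rightarrow> nat \<Rightarrow> bool" where
  "desc x y \<equiv> (x, y) \<in> (set tas)\<^sup>*"

lemma desc_depth: "desc x y \<Longrightarrow> d x \<le> d y"
  by (induction rule: rtrancl_induct) (use arc in fastforce)+

lemma desc_less: "desc x y \<Longrightarrow> x < k \<Longrightarrow> y < k"
  by (induction rule: rtrancl_induct) (use arc in fastforce)+

lemma root_desc: "x < k \<Longrightarrow> desc r x"
  by (induction rule: tree_induct) auto

text \<open>The ancestors of a node form a chain because parents are unique.\<close>

lemma desc_join:
  "desc x w \<Longrightarrow> desc y w \<Longrightarrow> desc x y \<or> desc y x"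
proof (induction arbitrary: y rule: rtrancl_induct)
  case (step v w)
  then show ?case
  proof (cases "y = w")
    case True
    then show ?thesis using step by (meson rtrancl.rtrancl_into_rtrancl)
  next
    case False
    then obtain v' where "desc y v'" "(v', w) \<in> set tas"
      using step.prems by (metis rtranclE)
    then show ?thesis using step parent_unique by metis
  qed
qed auto

text \<open>Two ancestors of \<open>w\<close> are comparable, and comparable nodes of equal depth
  coincide.\<close>

lemma desc_siblings:
  assumes "(x, y) \<in> set tas" "(x, y') \<in> set tas" "desc y w" "desc y' w"
  shows "y = y'"
proof -
  have *: "d y = d y'" using arc[OF assms(1)] arc[OF assms(2)] by simp
  have "u = v" if "desc u v" "d u = d v" for u v
    using that
  proof (cases rule: converse_rtranclE)
    case (step c)
    then show ?thesis using arc[OF step(1)] desc_depth[OF step(2)] that by simp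
  qed
  then show ?thesis using desc_join[OF assms(3,4)] * by metis
qed

text \<open>The part of the subtree of \<open>x\<close> that has been assembled after the first
  \<open>j\<close> arcs of the list. The counter runs over all arcs, not only those of
  \<open>x\<close>, so that one counter serves all nodes.\<close>

definition sub :: "nat \<Rightarrow> nat \<Rightarrow> nat set" where
  "sub x j = insert x {w. \<exists>i < j. \<exists>y. tas ! i = (x, y) \<and> desc y w}"

lemma sub_0: "sub x 0 = {x}"
  by (simp add: sub_def)

lemma sub_Suc_other: "fst (tas ! j) \<noteq> x \<Longrightarrow> sub x (Suc j) = sub x j"
  by (auto simp: sub_def less_Suc_eq)

lemma sub_Suc_arc: "tas ! j = (x, y) \<Longrightarrow> sub x (Suc j) = sub x j \<union> {w. desc y w}"
  by (auto simp: sub_def less_Suc_eq)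

lemma sub_full: "sub x (k - 1) = {w. desc x w}"
proof -
  have "desc x w" if "i < k - 1" "tas ! i = (x, y)" "desc y w" for i y w
    using that length_tas by (metis nth_mem converse_rtrancl_into_rtrancl)
  moreover have "\<exists>i < k - 1. \<exists>y. tas ! i = (x, y) \<and> desc y w" if "desc x w" "w \<noteq> x" for w
    using that length_tas by (metis converse_rtranclE in_set_conv_nth)
  ultimately show ?thesis by (auto simp: sub_def)
qed

lemma sub_desc: "j \<le> k - 1 \<Longrightarrow> w \<in> sub x j \<Longrightarrow> desc x w"
  using sub_full[of x] by (force simp: sub_def)

text \<open>A node in both parts would lie below two children of \<open>x\<close>; these coincide,
  and then the arc to that child would be listed twice. This is what makes the next subtree an
  independent piece.\<close>

lemma sub_disjoint:
  assumes "tas ! j = (x, y)" "j < k - 1" "w \<in> sub x j" "desc y w"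
  shows False
proof -
  have xy: "(x, y) \<in> set tas" using assms length_tas by (metis nth_mem)
  show False
  proof (cases "w = x")
    case True
    then show ?thesis using desc_depth[OF assms(4)] arc[OF xy] by simp
  next
    case False
    then obtain i y' where i: "i < j" "tas ! i = (x, y')" "desc y' w"
      using assms(3) by (auto simp: sub_def)
    then have "(x, y') \<in> set tas" using assms(2) length_tas
      by (metis nth_mem less_trans)
    then have "y = y'" using desc_siblings[OF xy _ assms(4) i(3)] by simp
    then show False using i assms distinct_tas length_tas
      by (metis less_trans nat_neq_iff nth_eq_iff_index_eq)
  qed
qed

text \<open>\<open>\<kappa>\<close> names the component of a node by the node at which the component
  is entered, with \<open>r\<close> for the component of the root. Arcs mapped to \<open>E0\<close>
  stay in the component and those mapped to \<open>E1\<close> start a new one; if \<open>E1\<close>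
  is empty, this is plain injectivity of \<open>\<psi>\<close>.\<close>

definition embeds :: "nat rel \<Rightarrow> nat rel \<Rightarrow> nat \<Rightarrow> (nat \<Rightarrow> nat) \<Rightarrow> (nat \<Rightarrow> nat) \<Rightarrow> bool" where
  "embeds E0 E1 z \<psi> \<kappa> \<longleftrightarrow> \<psi> r = z \<and> \<kappa> r = r \<and>
     (\<forall>(x, y) \<in> set tas.
        (\<psi> x, \<psi> y) \<in> E0 \<and> \<kappa> y = \<kappa> x \<or> (\<psi> x, \<psi> y) \<in> E1 \<and> \<kappa> y = y) \<and>
     inj_on (\<lambda>x. (\<psi> x, \<kappa> x)) {..<k}"

end

locale color_coding = arc_tree +
  fixes N :: nat and E0 E1 :: "nat rel" and col :: "nat \<Rightarrow> nat"
  assumes arcs_less: "E0 \<subseteq> {..<N} \<times> {..<N}" "E1 \<subseteq> {..<N} \<times> {..<N}"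
    and color_less: "z < N \<Longrightarrow> col z < k"
begin

text \<open>\<open>colorful z x j S\<close>: the part of the tree consisting of \<open>x\<close> and the subtrees entered through
  the arcs of \<open>x\<close> among the first \<open>j\<close> arcs embeds with \<open>x\<close> at \<open>z\<close> such that the component of \<open>x\<close>
  (up to the arcs of \<open>E1\<close>) receives pairwise distinct colors, which form the set \<open>S\<close>.\<close>

inductive colorful :: "nat \<Rightarrow> nat \<Rightarrow> nat \<Rightarrow> nat set \<Rightarrow> bool" where
  base: "z < N \<Longrightarrow> x < k \<Longrightarrow> colorful z x 0 {col z}"
| other: "colorful z x j S \<Longrightarrow> j < k - 1 \<Longrightarrow> fst (tas ! j) \<noteq> x \<Longrightarrow> colorful z x (Suc j) S"
| inner: "colorful z x j S \<Longrightarrow> j < k - 1 \<Longrightarrow> tas ! j = (x, y) \<Longrightarrow> (z, z') \<in> E0 \<Longrightarrow>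
    colorful z' y (k - 1) S' \<Longrightarrow> S \<inter> S' = {} \<Longrightarrow> colorful z x (Suc j) (S \<union> S')"
| reset: "colorful z x j S \<Longrightarrow> j < k - 1 \<Longrightarrow> tas ! j = (x, y) \<Longrightarrow> (z, z') \<in> E1 \<Longrightarrow>
    colorful z' y (k - 1) S' \<Longrightarrow> colorful z x (Suc j) S"

lemma colorful_bounds:
  "colorful z x j S \<Longrightarrow> z < N \<and> x < k \<and> j \<le> k - 1 \<and> S \<subseteq> {..<k}"
  by (induction rule: colorful.induct) (use color_less in auto)

text \<open>A partial version of \<open>embeds\<close> with top node \<open>x\<close>. Colors are
  recorded only for the component of \<open>x\<close>, since it is the only one that later arcs can
  still enlarge.\<close>

definition fits :: "nat \<Rightarrow> nat set \<Rightarrow> nat set \<Rightarrow> (nat \<Rightarrow> nat) \<Rightarrow> (nat \<Rightarrow> nat) \<Rightarrow> bool" where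
  "fits x W S \<psi> \<kappa> \<longleftrightarrow> \<kappa> x = x \<and> \<kappa> ` W \<subseteq> W \<and>
     (\<forall>(u, v) \<in> set tas. u \<in> W \<longrightarrow> v \<in> W \<longrightarrow>
        (\<psi> u, \<psi> v) \<in> E0 \<and> \<kappa> v = \<kappa> u \<or> (\<psi> u, \<psi> v) \<in> E1 \<and> \<kappa> v = v) \<and>
     (\<forall>u \<in> W. \<forall>v \<in> W. \<kappa> u = \<kappa> v \<longrightarrow> \<psi> u = \<psi> v \<longrightarrow> u = v) \<and>
     (\<forall>u \<in> W. \<kappa> u = x \<longrightarrow> col (\<psi> u) \<in> S)"

text \<open>The subtree of \<open>y\<close> is glued to the part of \<open>x\<close>. Along
  \<open>E0\<close> the component \<open>y\<close> is renamed to \<open>t = x\<close>, and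
  disjointness of the colors keeps the merged component injective; along \<open>E1\<close> it keeps
  its name and its colors are forgotten.\<close>

lemma fits_join:
  assumes f1: "fits x (sub x j) S \<psi>1 \<kappa>1" and f2: "fits y {w. desc y w} S' \<psi>2 \<kappa>2"
    and j: "tas ! j = (x, y)" "j < k - 1"
    and e: "(\<psi>1 x, \<psi>2 y) \<in> E0 \<and> S \<inter> S' = {} \<and> t = x \<and> S'' = S \<union> S' \<or>
       (\<psi>1 x, \<psi>2 y) \<in> E1 \<and> t = y \<and> S'' = S"
  shows "fits x (sub x (Suc j)) S'' (\<lambda>w. if desc y w then \<psi>2 w else \<psi>1 w)
     (\<lambda>w. if desc y w then (if \<kappa>2 w = y then t else \<kappa>2 w) else \<kappa>1 w)"
proof -
  let ?D = "{w. desc y w}" and ?W = "sub x j"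
  have W: "sub x (Suc j) = ?W \<union> ?D" by (rule sub_Suc_arc[OF j(1)])
  have disj: "\<And>w. w \<in> ?W \<Longrightarrow> desc y w \<Longrightarrow> False" using sub_disjoint[OF j] by blast
  have x: "x \<in> ?W" by (simp add: sub_def)
  have nx: "\<not> desc y x" using disj x by blast
  have xy: "(x, y) \<in> set tas" using j length_tas by (metis nth_mem)
  have k1: "\<kappa>1 x = x" "\<And>w. w \<in> ?W \<Longrightarrow> \<kappa>1 w \<in> ?W"
    "\<And>u v. (u, v) \<in> set tas \<Longrightarrow> u \<in> ?W \<Longrightarrow> v \<in> ?W \<Longrightarrow>
       (\<psi>1 u, \<psi>1 v) \<in> E0 \<and> \<kappa>1 v = \<kappa>1 u \<or> (\<psi>1 u, \<psi>1 v) \<in> E1 \<and> \<kappa>1 v = v"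
    "\<And>u v. u \<in> ?W \<Longrightarrow> v \<in> ?W \<Longrightarrow> \<kappa>1 u = \<kappa>1 v \<Longrightarrow> \<psi>1 u = \<psi>1 v \<Longrightarrow> u = v"
    "\<And>u. u \<in> ?W \<Longrightarrow> \<kappa>1 u = x \<Longrightarrow> col (\<psi>1 u) \<in> S"
    using f1 unfolding fits_def by blast+
  have k2: "\<kappa>2 y = y" "\<And>w. desc y w \<Longrightarrow> desc y (\<kappa>2 w)"
    "\<And>u v. (u, v) \<in> set tas \<Longrightarrow> desc y u \<Longrightarrow> desc y v \<Longrightarrow>
       (\<psi>2 u, \<psi>2 v) \<in> E0 \<and> \<kappa>2 v = \<kappa>2 u \<or> (\<psi>2 u, \<psi>2 v) \<in> E1 \<and> \<kappa>2 v = v"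
    "\<And>u v. desc y u \<Longrightarrow> desc y v \<Longrightarrow> \<kappa>2 u = \<kappa>2 v \<Longrightarrow> \<psi>2 u = \<psi>2 v \<Longrightarrow> u = v"
    "\<And>u. desc y u \<Longrightarrow> \<kappa>2 u = y \<Longrightarrow> col (\<psi>2 u) \<in> S'"
    using f2 unfolding fits_def by blast+
  have ent: "u = x \<and> v = y" if "(u, v) \<in> set tas" "\<not> desc y u" "desc y v" for u v
    using that xy parent_unique by (metis rtranclE)
  have ty: "t = y \<or> t = x" using e by blast
  define \<psi> where "\<psi> = (\<lambda>w. if desc y w then \<psi>2 w else \<psi>1 w)"
  define \<kappa> where "\<kappa> = (\<lambda>w. if desc y w then (if \<kappa>2 w = y then t else \<kappa>2 w) else \<kappa>1 w)"
  have v1: "\<psi> w = \<psi>1 w" "\<kappa> w = \<kappa>1 w" if "w \<in> ?W" for w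
    using that disj by (auto simp: \<psi>_def \<kappa>_def)
  have v2: "\<psi> w = \<psi>2 w" "\<kappa> w = (if \<kappa>2 w = y then t else \<kappa>2 w)" if "desc y w" for w
    using that by (auto simp: \<psi>_def \<kappa>_def)
  \<comment> \<open>Component names stay inside their part, so a clash between the two parts can
    only happen in the merged component, where the color sets are disjoint.\<close>
  have cross: False if "u \<in> ?W" "desc y v" "\<kappa> u = \<kappa> v" "\<psi> u = \<psi> v" for u v
  proof -
    have "\<kappa>1 u \<in> ?W" using k1 that by blast
    then have "\<not> desc y (\<kappa> v)" using disj v1(2)[OF that(1)] that by auto
    then have "\<kappa>2 v = y" "t = x" using v2(2)[OF that(2)] k2(2)[OF that(2)] ty
      by (metis, metis rtrancl.rtrancl_refl)
    then have "\<kappa>1 u = x" using v1(2)[OF that(1)] v2(2)[OF that(2)] that(3) by simp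
    then have "col (\<psi> u) \<in> S" "col (\<psi> v) \<in> S'"
      using k1(5)[OF that(1)] k2(5)[OF that(2) \<open>\<kappa>2 v = y\<close>] v1(1)[OF that(1)] v2(1)[OF that(2)]
      by auto
    moreover have "S \<inter> S' = {}" using e \<open>t = x\<close> nx by auto
    ultimately show False using that(4) by auto
  qed
  have "fits x (?W \<union> ?D) S'' \<psi> \<kappa>"
    unfolding fits_def
  proof (intro conjI ballI impI subsetI)
    show "\<kappa> x = x" using v1 x k1 by simp
  next
    fix w assume "w \<in> \<kappa> ` (?W \<union> ?D)"
    then show "w \<in> ?W \<union> ?D"
    proof
      fix u assume u: "w = \<kappa> u" "u \<in> ?W \<union> ?D"
      show ?thesis
      proof (cases "desc y u")
        case True
        then show ?thesis using u v2[OF True] k2(2)[OF True] ty x by auto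
      next
        case False
        then show ?thesis using u v1 k1 by auto
      qed
    qed
  next
    fix a assume "a \<in> set tas"
    then obtain u v where a: "a = (u, v)" "(u, v) \<in> set tas" by (metis prod.collapse)
    have "(\<psi> u, \<psi> v) \<in> E0 \<and> \<kappa> v = \<kappa> u \<or> (\<psi> u, \<psi> v) \<in> E1 \<and> \<kappa> v = v"
      if "u \<in> ?W \<union> ?D" "v \<in> ?W \<union> ?D"
    proof (cases "desc y u")
      case True
      then have dv: "desc y v" using a(2) by (meson rtrancl.rtrancl_into_rtrancl)
      \<comment> \<open>Renaming the component \<open>y\<close> does not spoil
        \<open>\<kappa>2 v = v\<close>, as an arc inside the subtree never has its top
        \<open>y\<close> as head.\<close>
      have "v \<noteq> y" using desc_depth[OF True] arc[OF a(2)] by auto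
      then show ?thesis using k2(3)[OF a(2) True dv] v2[OF True] v2[OF dv] by auto
    next
      case F: False
      show ?thesis
      proof (cases "desc y v")
        case True
        then have "u = x" "v = y" using ent[OF a(2) F] by auto
        then show ?thesis using e v1[OF x] v2[OF True] k1(1) k2(1) by auto
      next
        case False
        then have w: "u \<in> ?W" "v \<in> ?W" using F that by auto
        then show ?thesis using k1(3)[OF a(2) w] v1[OF w(1)] v1[OF w(2)] by auto
      qed
    qed
    then show "case a of (u, v) \<Rightarrow> u \<in> ?W \<union> ?D \<longrightarrow> v \<in> ?W \<union> ?D \<longrightarrow>
      (\<psi> u, \<psi> v) \<in> E0 \<and> \<kappa> v = \<kappa> u \<or> (\<psi> u, \<psi> v) \<in> E1 \<and> \<kappa> v = v" using a by simp
  next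
    fix u v assume uv: "u \<in> ?W \<union> ?D" "v \<in> ?W \<union> ?D" "\<kappa> u = \<kappa> v" "\<psi> u = \<psi> v"
    consider "u \<in> ?W" "v \<in> ?W" | "desc y u" "desc y v" | "u \<in> ?W" "desc y v"
      | "v \<in> ?W" "desc y u"
      using uv by blast
    then show "u = v"
    proof cases
      case 1
      then show ?thesis using k1(4)[OF 1] v1[OF 1(1)] v1[OF 1(2)] uv by auto
    next
      case 2
      \<comment> \<open>No component below \<open>y\<close> has the name \<open>x\<close> yet, hence
        the renaming merges no two components of the subtree.\<close>
      have t': "\<kappa>2 w = t \<Longrightarrow> t = y" if "desc y w" for w
        using k2(2)[OF that] ty nx by auto
      have "\<kappa>2 u = \<kappa>2 v"
        using uv(3) v2(2)[OF 2(1)] v2(2)[OF 2(2)] t'[OF 2(1)] t'[OF 2(2)]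
        by (auto split: if_splits)
      then show ?thesis using k2(4)[OF 2] v2(1)[OF 2(1)] v2(1)[OF 2(2)] uv by auto
    next
      case 3
      then show ?thesis using cross uv by blast
    next
      case 4
      then show ?thesis using cross[OF 4] uv by metis
    qed
  next
    fix u assume u: "u \<in> ?W \<union> ?D" "\<kappa> u = x"
    show "col (\<psi> u) \<in> S''"
    proof (cases "desc y u")
      case True
      then have "\<kappa>2 u = y" "t = x" using u v2(2)[OF True] k2(2)[OF True] nx ty by (auto split: if_splits)
      then show ?thesis using k2(5)[OF True] v2(1)[OF True] e nx by auto
    next
      case False
      then have "u \<in> ?W" using u by auto
      then show ?thesis using k1(5)[of u] v1[of u] u e by auto
    qed
  qed
  then show ?thesis unfolding W \<psi>_def \<kappa>_def .
qed

lemma colorful_sound: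
  "colorful z x j S \<Longrightarrow> \<exists>\<psi> \<kappa>. \<psi> x = z \<and> fits x (sub x j) S \<psi> \<kappa>"
proof (induction rule: colorful.induct)
  case (base z x)
  have "(x, x) \<notin> set tas" using arc[of x x] by auto
  then show ?case
    by (intro exI[of _ "\<lambda>w. if w = x then z else w"] exI[of _ "\<lambda>w. w"] conjI)
      (auto simp: fits_def sub_0)
next
  case (other z x j S)
  then show ?case by (simp add: sub_Suc_other)
next
  case (inner z x j S y z' S')
  then obtain \<psi>1 \<kappa>1 \<psi>2 \<kappa>2 where *: "\<psi>1 x = z" "fits x (sub x j) S \<psi>1 \<kappa>1"
    "\<psi>2 y = z'" "fits y {w. desc y w} S' \<psi>2 \<kappa>2"
    unfolding sub_full by blast
  have "\<not> desc y x" using sub_disjoint[OF inner(3,2), of x] by (auto simp: sub_def)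
  then show ?case using fits_join[OF *(2,4) inner(3,2), of x "S \<union> S'"] * inner
    by (intro exI conjI) (auto simp del: Un_iff)
next
  case (reset z x j S y z' S')
  then obtain \<psi>1 \<kappa>1 \<psi>2 \<kappa>2 where *: "\<psi>1 x = z" "fits x (sub x j) S \<psi>1 \<kappa>1"
    "\<psi>2 y = z'" "fits y {w. desc y w} S' \<psi>2 \<kappa>2"
    unfolding sub_full by blast
  have "\<not> desc y x" using sub_disjoint[OF reset(3,2), of x] by (auto simp: sub_def)
  then show ?case using fits_join[OF *(2,4) reset(3,2), of y S] * reset
    by (intro exI conjI) auto
qed

lemma colorful_imp_embeds:
  assumes "colorful z r (k - 1) S"
  shows "\<exists>\<psi> \<kappa>. embeds E0 E1 z \<psi> \<kappa>"
proof -
  obtain \<psi> \<kappa> where *: "\<psi> r = z" "fits r {w. desc r w} S \<psi> \<kappa>"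
    using colorful_sound[OF assms] unfolding sub_full by blast
  have W: "{w. desc r w} = {..<k}" using root_desc desc_less root by auto
  have "embeds E0 E1 z \<psi> \<kappa>"
    using * arc unfolding W fits_def embeds_def inj_on_def by fast
  then show ?thesis by blast
qed

text \<open>The induction goes from the leaves upwards, on \<open>k - d x\<close>, which decreases
  along arcs. \<open>S\<close> is bounded by the colors of those nodes of the component of
  \<open>x\<close> that are already placed; two of them with the same image would violate
  \<open>embeds\<close>, so their colors are distinct and the sets to be joined are
  disjoint.\<close>

lemma embeds_imp_colorful:
  assumes emb: "embeds E0 E1 z \<psi> \<kappa>" and z: "z < N" and inj: "inj_on col (\<psi> ` {..<k})"
  shows "\<exists>S. colorful z r (k - 1) S"
proof -
  have e: "(\<psi> x, \<psi> y) \<in> E0 \<and> \<kappa> y = \<kappa> x \<or> (\<psi> x, \<psi> y) \<in> E1 \<and> \<kappa> y = y"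
    if "(x, y) \<in> set tas" for x y
    using emb that by (auto simp: embeds_def)
  have N: "\<psi> x < N" if "x < k" for x
    using that
  proof (induction rule: tree_induct)
    case root
    then show ?case using emb z by (simp add: embeds_def)
  next
    case (arc x y)
    then show ?case using e[OF arc(1)] arcs_less by blast
  qed
  have diff: "col (\<psi> u) \<noteq> col (\<psi> v)" if "u < k" "v < k" "u \<noteq> v" "\<kappa> u = \<kappa> v" for u v
    using that emb inj unfolding embeds_def inj_on_def by auto
  have "\<exists>S. colorful (\<psi> x) x j S \<and> S \<subseteq> (col \<circ> \<psi>) ` {w \<in> sub x j. \<kappa> w = \<kappa> x}"
    if "x < k" "j \<le> k - 1" for x j
    using that
  proof (induction "k - d x" arbitrary: x j rule: less_induct)
    case less
    from less.prems(2) show ?case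
    proof (induction j)
      case 0
      then show ?case using base[OF N[OF less.prems(1)] less.prems(1)]
        by (intro exI[of _ "{col (\<psi> x)}"]) (auto simp: sub_0)
    next
      case (Suc j)
      then have j: "j < k - 1" by simp
      obtain S where S: "colorful (\<psi> x) x j S" "S \<subseteq> (col \<circ> \<psi>) ` {w \<in> sub x j. \<kappa> w = \<kappa> x}"
        using Suc by auto
      show ?case
      proof (cases "fst (tas ! j) = x")
        case False
        then show ?thesis using other[OF S(1) j] S(2) by (auto simp: sub_Suc_other)
      next
        case True
        then obtain y where y: "tas ! j = (x, y)" by (metis prod.collapse)
        then have xy: "(x, y) \<in> set tas" using j length_tas by (metis nth_mem)
        have "k - d y < k - d x" "y < k"
          using arc[OF xy] depth_less[of x] less.prems(1) by auto
        then obtain S' where S': "colorful (\<psi> y) y (k - 1) S'"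
          "S' \<subseteq> (col \<circ> \<psi>) ` {w \<in> sub y (k - 1). \<kappa> w = \<kappa> y}"
          using less.hyps[of y "k - 1"] by blast
        have sub: "sub x (Suc j) = sub x j \<union> sub y (k - 1)"
          using sub_Suc_arc[OF y] sub_full by simp
        show ?thesis
        proof (cases "(\<psi> x, \<psi> y) \<in> E0 \<and> \<kappa> y = \<kappa> x")
          case True
          have "S \<inter> S' = {}"
          proof (rule ccontr)
            assume "S \<inter> S' \<noteq> {}"
            then obtain u v where uv: "u \<in> sub x j" "\<kappa> u = \<kappa> x" "v \<in> sub y (k - 1)"
              "\<kappa> v = \<kappa> y" "col (\<psi> u) = col (\<psi> v)"
              using S(2) S'(2) by fastforce
            then have "u \<noteq> v" using sub_disjoint[OF y j] sub_full by auto
            moreover have "u < k" "v < k"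
              using uv sub_desc[of j u x] sub_full j desc_less \<open>y < k\<close> less.prems(1) by auto
            ultimately show False using diff[of u v] uv True by auto
          qed
          then have "colorful (\<psi> x) x (Suc j) (S \<union> S')"
            using inner[OF S(1) j y _ S'(1)] True by blast
          moreover have "S \<union> S' \<subseteq> (col \<circ> \<psi>) ` {w \<in> sub x (Suc j). \<kappa> w = \<kappa> x}"
            using S(2) S'(2) True unfolding sub by auto
          ultimately show ?thesis by blast
        next
          case False
          then have "(\<psi> x, \<psi> y) \<in> E1" using e[OF xy] by blast
          then have "colorful (\<psi> x) x (Suc j) S"
            using reset[OF S(1) j y _ S'(1)] by blast
          moreover have "S \<subseteq> (col \<circ> \<psi>) ` {w \<in> sub x (Suc j). \<kappa> w = \<kappa> x}"
            using S(2) unfolding sub by auto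
          ultimately show ?thesis by blast
        qed
      qed
    qed
  qed
  then show ?thesis using root(1) emb by (force simp: embeds_def)
qed

end

section \<open>Instantiations\<close>

lemma cas_snoc:
  "pre_digraph.cas (with_proj A) u (p @ [e]) v \<longleftrightarrow>
     pre_digraph.cas (with_proj A) u p (fst e) \<and> snd e = v"
  by (induction p arbitrary: u) (auto simp: pre_digraph.cas.simps)

text \<open>The depth of a node is the length of the unique walk to it. Two parents of a node would
  yield two walks, and counting the heads of arcs shows that there are \<open>k - 1\<close>
  arcs.\<close>

lemma rooted_tree_imp_arc_tree:
  assumes tree: "rooted_tree A r" and verts: "pverts A = {..<k}"
    and arcs: "parcs A = set tas" and dist: "distinct tas"
  shows "\<exists>d. arc_tree tas k r d"
proof -
  let ?W = "\<lambda>p v. pre_digraph.awalk (with_proj A) r p v"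
  have fin: "pair_fin_digraph A" and r: "r < k" using tree verts by (auto simp: rooted_tree_def)
  have uniq: "\<exists>!p. ?W p v" if "v < k" for v
    using tree verts that by (auto simp: rooted_tree_def)
  have wf: "pair_wf_digraph A" using fin by (simp add: pair_fin_digraph_def)
  have W: "?W p v \<longleftrightarrow> set p \<subseteq> set tas \<and> pre_digraph.cas (with_proj A) r p v" for p v
    using r verts arcs by (simp add: pre_digraph.awalk_def)
  have in_verts: "x < k" "y < k" if "(x, y) \<in> set tas" for x y
    using that arcs verts pair_wf_digraph.arc_fst_in_verts[OF wf, of "(x, y)"]
      pair_wf_digraph.arc_snd_in_verts[OF wf, of "(x, y)"] by auto
  have ext: "?W (p @ [(x, y)]) y" if "(x, y) \<in> set tas" "?W p x" for p x y
    using that by (simp add: W cas_snoc)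
  have nil: "?W [] r" by (simp add: W pre_digraph.cas.simps)
  define d where "d v = length (THE p. ?W p v)" for v
  have d: "d v = length p" if "?W p v" "v < k" for p v
    using that uniq[OF that(2)] unfolding d_def by (metis the1_equality)
  have W_ex: "\<exists>p. ?W p v" if "v < k" for v
    using uniq[OF that] by blast
  have arc: "d y = Suc (d x)" if xy: "(x, y) \<in> set tas" for x y
  proof -
    obtain p where p: "?W p x" using W_ex in_verts[OF xy] by blast
    then show ?thesis using d[OF p] d[OF ext[OF xy p]] in_verts[OF xy] by simp
  qed
  have pu: "x = x'" if xy: "(x, y) \<in> set tas" and xy': "(x', y) \<in> set tas" for x x' y
  proof -
    obtain p p' where p: "?W p x" "?W p' x'"
      using W_ex in_verts[OF xy] in_verts[OF xy'] by blast
    then have "p @ [(x, y)] = p' @ [(x', y)]"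
      using uniq in_verts(2)[OF xy] ext[OF xy p(1)] ext[OF xy' p(2)] by blast
    then show ?thesis by simp
  qed
  have d0: "d r = 0" using d[OF nil r] by simp
  have pe: "\<exists>x. (x, y) \<in> set tas" if "y < k" "y \<noteq> r" for y
  proof -
    obtain p where p: "?W p y" using W_ex \<open>y < k\<close> by blast
    with that(2) have "p \<noteq> []" by (auto simp: W pre_digraph.cas.simps)
    then obtain q e where "p = q @ [e]" by (metis rev_exhaust)
    then have "e \<in> set tas" "snd e = y" using p by (auto simp: W cas_snoc)
    then show ?thesis by (metis prod.collapse)
  qed
  have "bij_betw snd (set tas) ({..<k} - {r})"
    unfolding bij_betw_def
  proof
    show "inj_on snd (set tas)" using pu by (auto simp: inj_on_def)
    show "snd ` set tas = {..<k} - {r}"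
    proof
      show "snd ` set tas \<subseteq> {..<k} - {r}" using in_verts arc d0 by fastforce
      show "{..<k} - {r} \<subseteq> snd ` set tas" using pe by (force simp: image_iff)
    qed
  qed
  then have "card (set tas) = k - 1" using r by (simp add: bij_betw_same_card)
  then have len: "length tas = k - 1" using dist by (simp add: distinct_card)
  \<comment> \<open>All smaller depths occur as well, so a node of depth \<open>i\<close> forces at
    least \<open>i + 1\<close> nodes; this is how the bound by \<open>k\<close> arises.\<close>
  have levels: "\<exists>u < k. d u = i" if "v < k" "i \<le> d v" for v i
    using that
  proof (induction "d v" arbitrary: v rule: less_induct)
    case less
    show ?case
    proof (cases "i = d v \<or> v = r")
      case False
      then obtain x where x: "(x, v) \<in> set tas" using pe less.prems by blast
      then show ?thesis using less.hyps[of x] arc[OF x] in_verts[OF x] less.prems False by auto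
    qed (use less.prems d0 in auto)
  qed
  have less: "d v < k" if "v < k" for v
  proof -
    have "{..d v} \<subseteq> d ` {..<k}" using levels[OF that] by fastforce
    then have "card {..d v} \<le> card (d ` {..<k})" by (intro card_mono) auto
    also have "\<dots> \<le> k" using card_image_le[of "{..<k}" d] by simp
    finally have "card {..d v} \<le> k" .
    then show ?thesis by simp
  qed
  have "arc_tree tas k r d"
  proof
    show "length tas = k - 1" by (rule len)
    show "r < k" "d r = 0" by (rule r d0)+
    show "x < k \<and> y < k \<and> d y = Suc (d x)" if "(x, y) \<in> set tas" for x y
      using in_verts[OF that] arc[OF that] by simp
    show "x = x'" if "(x, y) \<in> set tas" "(x', y) \<in> set tas" for x x' y
      by (rule pu[OF that])
    show "\<exists>x. (x, y) \<in> set tas" if "y < k" "y \<noteq> r" for y by (rule pe[OF that])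
    show "d x < k" if "x < k" for x by (rule less[OF that])
  qed (rule dist)
  then show ?thesis by (intro exI[of _ d])
qed

lemma remove_nth_filter:
  assumes "distinct xs" "i < length xs"
  shows "remove_nth i xs = filter (\<lambda>x. x \<noteq> xs ! i) xs"
proof -
  have 1: "xs = take i xs @ xs ! i # drop (Suc i) xs" by (rule id_take_nth_drop[OF assms(2)])
  have "distinct (take i xs @ xs ! i # drop (Suc i) xs)"
    unfolding 1[symmetric] by (rule assms(1))
  then have "xs ! i \<notin> set (take i xs) \<union> set (drop (Suc i) xs)"
    by simp
  then have 2: "filter (\<lambda>x. x \<noteq> xs ! i) (take i xs) = take i xs"
    "filter (\<lambda>x. x \<noteq> xs ! i) (drop (Suc i) xs) = drop (Suc i) xs"
    by (auto simp: filter_id_conv)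
  have "filter (\<lambda>x. x \<noteq> xs ! i) xs = filter (\<lambda>x. x \<noteq> xs ! i) (take i xs @ xs ! i # drop (Suc i) xs)"
    by (rule arg_cong[OF 1])
  also have "\<dots> = remove_nth i xs" using 2 by (simp only: filter_append remove_nth_def) simp
  finally show ?thesis ..
qed

text \<open>Treats all four kinds of copied arcs at once: a single copy index is applied to
  whichever ends lie in \<open>S\<close>.\<close>

lemma copy_arcsI:
  assumes "(x, y) \<in> E" "j \<in> {1..P}"
  shows "(if x \<in> S then copy_vert j x else x, if y \<in> S then copy_vert j y else y) \<in> copy_arcs S P E"
proof (cases "x \<in> S"; cases "y \<in> S")
  assume "x \<in> S" "y \<in> S"
  moreover from this assms have "\<exists>j' x' y'. (copy_vert j x, copy_vert j y) = (copy_vert j' x', copy_vert j' y') \<and>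
      (x', y') \<in> E \<and> x' \<in> S \<and> y' \<in> S \<and> j' \<in> {1..P}" by blast
  ultimately show ?thesis
    unfolding copy_arcs_def Un_iff mem_Collect_eq by (simp del: split_paired_Ex)
next
  assume "x \<in> S" "y \<notin> S"
  moreover from this assms have "\<exists>j' x' y'. (copy_vert j x, y) = (copy_vert j' x', y') \<and>
      (x', y') \<in> E \<and> x' \<in> S \<and> y' \<notin> S \<and> j' \<in> {1..P}" by blast
  ultimately show ?thesis
    unfolding copy_arcs_def Un_iff mem_Collect_eq by (simp del: split_paired_Ex)
next
  assume "x \<notin> S" "y \<in> S"
  moreover from this assms have "\<exists>j' x' y'. (x, copy_vert j y) = (x', copy_vert j' y') \<and>
      (x', y') \<in> E \<and> x' \<notin> S \<and> y' \<in> S \<and> j' \<in> {1..P}" by blast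
  ultimately show ?thesis
    unfolding copy_arcs_def Un_iff mem_Collect_eq by (simp del: split_paired_Ex)
next
  assume "x \<notin> S" "y \<notin> S"
  then show ?thesis using assms
    unfolding copy_arcs_def Un_iff mem_Collect_eq by (simp del: split_paired_Ex)
qed

section \<open>Closed form of the instantiation\<close>

locale template_graph =
  fixes G :: "'a pgt"
  assumes pgt: "parametric_graph_template G"
begin

abbreviation "V \<equiv> pverts (tgraph G)"
abbreviation "E \<equiv> parcs (tgraph G)"
abbreviation "T i \<equiv> templates G ! i"
abbreviation "P i \<equiv> params G ! i"
abbreviation "h \<equiv> length (templates G)"

lemma finite_V: "finite V"
  using pgt by (simp add: parametric_graph_template_def pair_fin_digraph.axioms
      pair_fin_digraph_axioms_def pair_fin_digraph_def)

lemma E_verts: "(u, v) \<in> E \<Longrightarrow> u \<in> V \<and> v \<in> V"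
  using pgt pair_wf_digraph.arc_fst_in_verts[of "tgraph G" "(u, v)"]
    pair_wf_digraph.arc_snd_in_verts[of "tgraph G" "(u, v)"]
  by (auto simp: parametric_graph_template_def pair_fin_digraph_def)

lemma h_pos: "0 < h"
  using pgt by (simp add: parametric_graph_template_def)

lemma T_0: "T 0 = V"
  using pgt by (simp add: parametric_graph_template_def)

lemma T_sub: "i < h \<Longrightarrow> T i \<noteq> {} \<and> T i \<subseteq> V"
  using pgt by (simp add: parametric_graph_template_def)

lemma length_params: "length (params G) = h"
  using pgt by (simp add: parametric_graph_template_def)

lemma P_pos: "i < h \<Longrightarrow> 0 < P i"
  using pgt length_params by (auto simp: parametric_graph_template_def)

lemma laminar:
  "i < h \<Longrightarrow> j < h \<Longrightarrow> i \<noteq> j \<Longrightarrow> T i \<inter> T j = {} \<or> T i \<subset> T j \<or> T j \<subset> T i"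
  using pgt unfolding parametric_graph_template_def by blast

lemma laminar_common:
  assumes "i < h" "j < h" "v \<in> T i" "v \<in> T j"
  shows "T i \<subseteq> T j \<or> T j \<subset> T i"
  using laminar[OF assms(1,2)] assms(3,4) by (cases "i = j") auto

lemma T_inj: "i < h \<Longrightarrow> j < h \<Longrightarrow> T i = T j \<Longrightarrow> i = j"
  using laminar[of i j] T_sub[of i] by auto

text \<open>Among the templates that contain \<open>v\<close>, one of least cardinality is
  comparable to every other by laminarity, hence contained in it.\<close>

lemma tmpl:
  assumes "v \<in> V"
  shows "tmpl G v < h" "v \<in> T (tmpl G v)"
    and tmpl_least: "i < h \<Longrightarrow> v \<in> T i \<Longrightarrow> T (tmpl G v) \<subseteq> T i"
proof -
  let ?P = "\<lambda>i. i < h \<and> v \<in> T i \<and> (\<forall>j < h. v \<in> T j \<longrightarrow> T i \<subseteq> T j)"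
  have "\<exists>i. (i < h \<and> v \<in> T i) \<and> (\<forall>j. j < h \<and> v \<in> T j \<longrightarrow> card (T i) \<le> card (T j))"
    using h_pos assms T_0 by (intro ex_has_least_nat[where k = 0]) auto
  then obtain i where i: "i < h" "v \<in> T i" "\<And>j. j < h \<Longrightarrow> v \<in> T j \<Longrightarrow> card (T i) \<le> card (T j)"
    by blast
  have "T i \<subseteq> T j" if "j < h" "v \<in> T j" for j
    using laminar_common[OF i(1) that(1) i(2) that(2)] i(3)[OF that] T_sub[OF i(1)] finite_V
    by (meson finite_subset leD psubset_card_mono)
  then have "?P i" using i by blast
  moreover have "j = i" if "?P j" for j
    using that \<open>?P i\<close> T_inj by (meson subset_antisym)
  ultimately have "?P (tmpl G v)" unfolding tmpl_def by (rule theI)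
  then show "tmpl G v < h" "v \<in> T (tmpl G v)"
    "i < h \<Longrightarrow> v \<in> T i \<Longrightarrow> T (tmpl G v) \<subseteq> T i" for i by blast+
qed

lemma mem_T_iff: "v \<in> V \<Longrightarrow> i < h \<Longrightarrow> v \<in> T i \<longleftrightarrow> T (tmpl G v) \<subseteq> T i"
  using tmpl[of v] by blast

text \<open>The root template is excluded because it is never expanded and thus contributes no copy
  index.\<close>

definition inner_templates :: "'a \<Rightarrow> nat set" where
  "inner_templates v = {i. 0 < i \<and> i < h \<and> v \<in> T i}"

text \<open>One copy for every template of the whole family. An arc between instances arises exactly
  if a single such choice produces both ends, which encodes that the ends agree on all templates
  containing both.\<close>

definition copy_choice :: "(nat \<Rightarrow> nat) \<Rightarrow> bool" where
  "copy_choice f \<longleftrightarrow> (\<forall>i < h. 1 \<le> f i \<and> f i \<le> P i)"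

lemma copy_choice_ex: "copy_choice (\<lambda>_. 1)"
  using P_pos by (auto simp: copy_choice_def Suc_leI)

text \<open>The instance of \<open>v\<close> lying in copy \<open>f i\<close> of every template \<open>i\<close>, after the templates \<open>X\<close>
  have been expanded, the latest one first.\<close>

definition inst_vert :: "nat list \<Rightarrow> (nat \<Rightarrow> nat) \<Rightarrow> 'a \<Rightarrow> 'a \<times> nat list" where
  "inst_vert X f v = (v, map f (filter (\<lambda>i. v \<in> T i) X))"

definition inst_verts :: "nat list \<Rightarrow> 'a set \<Rightarrow> ('a \<times> nat list) set" where
  "inst_verts X S = {inst_vert X f v | f v. v \<in> S \<and> copy_choice f}"

definition inst_graph :: "nat list \<Rightarrow> ('a \<times> nat list) pair_pre_digraph" where
  "inst_graph X = \<lparr> pverts = inst_verts X V,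
     parcs = {(inst_vert X f u, inst_vert X f v) | f u v. (u, v) \<in> E \<and> copy_choice f} \<rparr>"

definition inst_pgt :: "nat list \<Rightarrow> nat list \<Rightarrow> ('a \<times> nat list) pgt" where
  "inst_pgt X Y = \<lparr> tgraph = inst_graph X, templates = map (\<lambda>i. inst_verts X (T i)) Y,
     params = map P Y \<rparr>"

lemma fst_inst_vert [simp]: "fst (inst_vert X f v) = v"
  by (simp add: inst_vert_def)

lemma inst_vert_Cons:
  "inst_vert (a # X) f v = (if v \<in> T a then copy_vert (f a) (inst_vert X f v) else inst_vert X f v)"
  by (simp add: inst_vert_def)

lemma inst_vert_upd: "a \<notin> set X \<Longrightarrow> inst_vert X (f(a := j)) v = inst_vert X f v"
  by (auto simp: inst_vert_def)

lemma inst_vert_in: "copy_choice f \<Longrightarrow> inst_vert X f v \<in> inst_verts X S \<longleftrightarrow> v \<in> S"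
  unfolding inst_verts_def by (auto dest: arg_cong[where f = fst])

lemma copy_choice_upd: "copy_choice f \<Longrightarrow> j \<in> {1..P a} \<Longrightarrow> copy_choice (f(a := j))"
  by (simp add: copy_choice_def)

lemma copy_set_inst:
  assumes "a < h" "a \<notin> set X"
  shows "copy_set (inst_verts X (T a)) (P a) (inst_verts X S) = inst_verts (a # X) S"
proof (intro set_eqI iffI)
  fix x assume "x \<in> copy_set (inst_verts X (T a)) (P a) (inst_verts X S)"
  then consider "x \<in> inst_verts X S" "x \<notin> inst_verts X (T a)"
    | j y where "x = copy_vert j y" "y \<in> inst_verts X S" "y \<in> inst_verts X (T a)" "j \<in> {1..P a}"
    unfolding copy_set_def by blast
  then show "x \<in> inst_verts (a # X) S"
  proof cases
    case 1
    then obtain f v where "x = inst_vert X f v" "v \<in> S" "copy_choice f" "v \<notin> T a"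
      by (auto simp: inst_verts_def)
    then show ?thesis unfolding inst_verts_def by (force simp: inst_vert_Cons)
  next
    case 2
    then obtain f v where f: "y = inst_vert X f v" "v \<in> S" "copy_choice f"
      by (auto simp: inst_verts_def)
    then have "v \<in> T a" using 2 inst_vert_in by blast
    \<comment> \<open>Changing the choice at \<open>a\<close> only produces copy \<open>j\<close>;
      as \<open>a\<close> is not in \<open>X\<close>, nothing else changes.\<close>
    then have "x = inst_vert (a # X) (f(a := j)) v"
      using 2 f by (simp add: inst_vert_Cons inst_vert_upd assms)
    then show ?thesis using f copy_choice_upd[OF f(3) 2(4)] unfolding inst_verts_def by blast
  qed
next
  fix x assume "x \<in> inst_verts (a # X) S"
  then obtain f v where f: "x = inst_vert (a # X) f v" "v \<in> S" "copy_choice f"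
    by (auto simp: inst_verts_def)
  then show "x \<in> copy_set (inst_verts X (T a)) (P a) (inst_verts X S)"
  proof (cases "v \<in> T a")
    case True
    have "f a \<in> {1..P a}" using f(3) assms(1) by (simp add: copy_choice_def)
    moreover have "x = copy_vert (f a) (inst_vert X f v)" using f True by (simp add: inst_vert_Cons)
    moreover have "inst_vert X f v \<in> inst_verts X S \<inter> inst_verts X (T a)"
      using f True by (simp add: inst_vert_in)
    ultimately show ?thesis unfolding copy_set_def by blast
  next
    case False
    then show ?thesis using f unfolding copy_set_def by (auto simp: inst_vert_Cons inst_vert_in)
  qed
qed

lemma copy_arcs_inst:
  assumes "a < h" "a \<notin> set X"
  shows "copy_arcs (inst_verts X (T a)) (P a) (parcs (inst_graph X)) = parcs (inst_graph (a # X))"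
proof (intro set_eqI iffI)
  let ?S = "inst_verts X (T a)"
  have in_S: "inst_vert X f v \<in> ?S \<longleftrightarrow> v \<in> T a" if "copy_choice f" for f v
    using inst_vert_in[OF that] .
  fix e assume "e \<in> copy_arcs ?S (P a) (parcs (inst_graph X))"
  then obtain x y j where xy: "(x, y) \<in> parcs (inst_graph X)"
    and e: "e = (if x \<in> ?S then copy_vert j x else x, if y \<in> ?S then copy_vert j y else y)"
    and j: "x \<in> ?S \<or> y \<in> ?S \<Longrightarrow> j \<in> {1..P a}"
    unfolding copy_arcs_def Un_iff mem_Collect_eq by (elim disjE exE conjE) fastforce+
  then obtain f u v where f: "x = inst_vert X f u" "y = inst_vert X f v" "(u, v) \<in> E"
    "copy_choice f"
    by (auto simp: inst_graph_def)
  \<comment> \<open>If neither end lies in \<open>T a\<close>, then \<open>j\<close> is an arbitrary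
    number and may not be used as a copy.\<close>
  define g where "g = (if u \<in> T a \<or> v \<in> T a then f(a := j) else f)"
  have "copy_choice g"
    using j in_S[OF f(4)] f copy_choice_upd[OF f(4), of j a] by (auto simp: g_def)
  moreover have "e = (inst_vert (a # X) g u, inst_vert (a # X) g v)"
    using e in_S[OF f(4)] f(1,2) by (auto simp: g_def inst_vert_Cons inst_vert_upd assms)
  ultimately show "e \<in> parcs (inst_graph (a # X))"
    using f(3) by (auto simp: inst_graph_def)
next
  let ?S = "inst_verts X (T a)"
  fix e assume "e \<in> parcs (inst_graph (a # X))"
  then obtain f u v where f: "e = (inst_vert (a # X) f u, inst_vert (a # X) f v)" "(u, v) \<in> E"
    "copy_choice f"
    by (auto simp: inst_graph_def)
  have j: "f a \<in> {1..P a}" using f(3) assms(1) by (simp add: copy_choice_def)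
  have in_S: "inst_vert X f w \<in> ?S \<longleftrightarrow> w \<in> T a" for w
    using inst_vert_in[OF f(3)] .
  have xy: "(inst_vert X f u, inst_vert X f v) \<in> parcs (inst_graph X)"
    using f by (auto simp: inst_graph_def)
  have "e = (if inst_vert X f u \<in> ?S then copy_vert (f a) (inst_vert X f u) else inst_vert X f u,
      if inst_vert X f v \<in> ?S then copy_vert (f a) (inst_vert X f v) else inst_vert X f v)"
    using f(1) by (simp add: in_S inst_vert_Cons)
  then show "e \<in> copy_arcs ?S (P a) (parcs (inst_graph X))"
    using copy_arcsI[OF xy j] by simp
qed

lemma remove_nth_map: "remove_nth i (map f xs) = map f (remove_nth i xs)"
  by (simp add: remove_nth_def take_map drop_map)

lemma expand_inst:
  assumes "i < length Y" "Y ! i < h" "Y ! i \<notin> set X"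
  shows "expand_template i (inst_pgt X Y) = inst_pgt (Y ! i # X) (remove_nth i Y)"
  using assms copy_set_inst[OF assms(2,3)] copy_arcs_inst[OF assms(2,3)]
  by (simp add: expand_template_def inst_pgt_def remove_nth_map inst_graph_def Let_def comp_def)

lemma inst_verts_Nil: "inst_verts [] S = (\<lambda>v. (v, [])) ` S"
  using copy_choice_ex by (auto simp: inst_verts_def inst_vert_def)

lemma initial_inst: "initial_pgt G = inst_pgt [] [0..<h]"
proof -
  have "map (image (\<lambda>v. (v, []))) (templates G) = map (\<lambda>i. inst_verts [] (T i)) [0..<h]"
    by (rule nth_equalityI) (auto simp: inst_verts_Nil)
  moreover have "params G = map P [0..<h]"
    by (rule nth_equalityI) (auto simp: length_params)
  moreover have "(\<lambda>(u, v). ((u, []), (v, []))) ` E = parcs (inst_graph [])"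
    using copy_choice_ex by (force simp: inst_graph_def inst_vert_def)
  ultimately show ?thesis
    by (simp add: initial_pgt_def inst_pgt_def inst_graph_def inst_verts_Nil)
qed

lemma remove_nth_props:
  assumes "distinct Y" "i < length Y"
  shows "distinct (remove_nth i Y)" "set (remove_nth i Y) = set Y - {Y ! i}"
  using remove_nth_filter[OF assms] assms(1) by auto

text \<open>The invariant for any order of expansion: \<open>X\<close> lists the templates already
  expanded and \<open>Y\<close> the remaining ones. Index 0 is never picked, so the root template
  stays in front.\<close>

lemma inst_steps:
  assumes "inst_step\<^sup>*\<^sup>* (initial_pgt G) G'"
  shows "\<exists>X Y. G' = inst_pgt X Y \<and> Y \<noteq> [] \<and> Y ! 0 = 0 \<and> distinct (X @ Y) \<and> set (X @ Y) = {..<h}"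
  using assms
proof (induction rule: rtranclp_induct)
  case base
  show ?case using h_pos
    by (intro exI[of _ "[]"] exI[of _ "[0..<h]"]) (auto simp: initial_inst)
next
  case (step G1 G2)
  then obtain X Y where XY: "G1 = inst_pgt X Y" "Y \<noteq> []" "Y ! 0 = 0" "distinct (X @ Y)"
    "set (X @ Y) = {..<h}" by blast
  from step(2) obtain i where i: "i \<noteq> 0" "leaf_template G1 i" "G2 = expand_template i G1"
    by (auto elim: inst_step.cases)
  have iY: "i < length Y" using i(2) XY(1) by (simp add: leaf_template_def inst_pgt_def)
  then have Yi: "Y ! i \<in> set Y" by simp
  have "G2 = inst_pgt (Y ! i # X) (remove_nth i Y)"
    using expand_inst[OF iY, of X] XY Yi i(3) by auto
  moreover have "remove_nth i Y \<noteq> [] \<and> remove_nth i Y ! 0 = 0"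
    using i(1) iY XY(2,3) by (cases Y; cases i) (auto simp: remove_nth_def)
  moreover have "distinct ((Y ! i # X) @ remove_nth i Y)" "set ((Y ! i # X) @ remove_nth i Y) = {..<h}"
    using remove_nth_props[of Y i] iY XY(4,5) Yi by auto
  ultimately show ?case by blast
qed

lemma instantiationE:
  assumes "is_instantiation G H"
  obtains X where "H = inst_graph X" "set X = {1..<h}"
proof -
  obtain G' where G': "inst_step\<^sup>*\<^sup>* (initial_pgt G) G'" "length (templates G') = 1" "H = tgraph G'"
    using assms by (auto simp: is_instantiation_def)
  obtain X Y where XY: "G' = inst_pgt X Y" "Y \<noteq> []" "Y ! 0 = 0" "distinct (X @ Y)"
    "set (X @ Y) = {..<h}" using inst_steps[OF G'(1)] by blast
  have "length Y = 1" using G'(2) XY(1) by (simp add: inst_pgt_def)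
  then have "Y = [0]" using XY(3) by (cases Y) auto
  then have "0 \<notin> set X" "insert 0 (set X) = {..<h}" using XY(4,5) by auto
  then have "set X = {..<h} - {0}" by blast
  also have "\<dots> = {1..<h}" by auto
  finally have "set X = {1..<h}" .
  then show thesis using that[of X] G'(3) XY(1) by (simp add: inst_pgt_def)
qed

text \<open>Sorting by cardinality puts a template after all its proper subsets, so it is a leaf
  when its turn comes. Read backwards, the list goes from outer to inner templates.\<close>

definition expansion :: "nat list" where
  "expansion = sort_key (\<lambda>i. card (T i)) [1..<h]"

lemma expansion: "set expansion = {1..<h}" "distinct expansion" "length expansion = h - 1"
  by (simp_all add: expansion_def)

lemma expansion_sorted: "i \<le> j \<Longrightarrow> j < h - 1 \<Longrightarrow> card (T (expansion ! i)) \<le> card (T (expansion ! j))"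
  using sorted_sort_key[of "\<lambda>i. card (T i)" "[1..<h]", folded expansion_def] expansion(3)
  by (auto simp: sorted_iff_nth_mono)

lemma inst_verts_psubset: "inst_verts X S \<subset> inst_verts X S' \<Longrightarrow> S \<subset> S'"
  using copy_choice_ex inst_vert_in by (metis psubsetE psubsetI subsetD subsetI)

lemma expansion_steps:
  "l \<le> h - 1 \<Longrightarrow> inst_step\<^sup>*\<^sup>* (initial_pgt G)
     (inst_pgt (rev (take l expansion)) (filter (\<lambda>i. i \<notin> set (take l expansion)) [0..<h]))"
proof (induction l)
  case 0
  then show ?case by (simp add: initial_inst)
next
  case (Suc l)
  let ?X = "rev (take l expansion)" and ?Y = "filter (\<lambda>i. i \<notin> set (take l expansion)) [0..<h]"
  define a where "a = expansion ! l"
  have l: "l < length expansion" using Suc.prems expansion(3) by simp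
  have take: "take (Suc l) expansion = take l expansion @ [a]"
    unfolding a_def by (rule take_Suc_conv_app_nth[OF l])
  have a: "a \<in> {1..<h}" using l expansion(1) by (metis a_def nth_mem)
  have na: "a \<notin> set (take l expansion)"
    using expansion(2) take by (metis distinct_append distinct_take not_distinct_conv_prefix)
  have "0 \<notin> set (take l expansion)" using expansion(1) by (metis atLeastLessThan_iff in_set_takeD not_one_le_zero)
  then have Y0: "?Y = 0 # filter (\<lambda>i. i \<notin> set (take l expansion)) [1..<h]"
    using h_pos by (simp add: upt_conv_Cons)
  have "a \<in> set ?Y" using a na by auto
  then obtain i where i: "i < length ?Y" "?Y ! i = a" by (metis in_set_conv_nth)
  have "?Y ! 0 = 0" by (simp add: Y0)
  then have "i \<noteq> 0" using i(2) a by (intro notI) simp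
  have "leaf_template (inst_pgt ?X ?Y) i"
    unfolding leaf_template_def
  proof (intro conjI notI)
    show "i < length (templates (inst_pgt ?X ?Y))" using i by (simp add: inst_pgt_def)
    assume "\<exists>j < length (templates (inst_pgt ?X ?Y)).
      templates (inst_pgt ?X ?Y) ! j \<subset> templates (inst_pgt ?X ?Y) ! i"
    then obtain j where j: "j < length ?Y"
      "templates (inst_pgt ?X ?Y) ! j \<subset> templates (inst_pgt ?X ?Y) ! i"
      unfolding inst_pgt_def by (metis length_map pgt.select_convs(2))
    then have j': "inst_verts ?X (T (?Y ! j)) \<subset> inst_verts ?X (T a)"
      using i by (simp add: inst_pgt_def)
    define b where "b = ?Y ! j"
    have b: "T b \<subset> T a" using inst_verts_psubset[OF j'] by (simp add: b_def)
    have "b \<in> set ?Y" using j nth_mem b_def by blast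
    then have "b < h" "b \<notin> set (take l expansion)" by auto
    moreover have "b \<noteq> 0" using b T_0 T_sub[of a] a by auto
    ultimately have "b \<in> set expansion" by (simp add: expansion(1))
    then obtain l' where l': "l' < length expansion" "b = expansion ! l'" by (metis in_set_conv_nth)
    have "l \<le> l'"
      using \<open>b \<notin> _\<close> l' by (metis in_set_conv_nth length_take linorder_not_le min_less_iff_conj nth_take)
    then have "card (T a) \<le> card (T b)"
      using expansion_sorted[of l l'] l' expansion(3) by (simp add: a_def)
    moreover have "finite (T a)" using T_sub[of a] a finite_V finite_subset by auto
    ultimately show False using psubset_card_mono[OF _ b] by simp
  qed
  then have step: "inst_step (inst_pgt ?X ?Y) (expand_template i (inst_pgt ?X ?Y))"
    using \<open>i \<noteq> 0\<close> by (rule inst_step.intros[rotated])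
  have "expand_template i (inst_pgt ?X ?Y) = inst_pgt (a # ?X) (remove_nth i ?Y)"
    using expand_inst[of i ?Y ?X] i a na by simp
  also have "remove_nth i ?Y = filter (\<lambda>j. j \<notin> set (take (Suc l) expansion)) [0..<h]"
    using remove_nth_filter[of ?Y i] i take by (auto intro!: filter_cong)
  finally show ?case using step Suc take by (auto intro: rtranclp.rtrancl_into_rtrancl)
qed

lemma instantiation_ex: "is_instantiation G (inst_graph (rev expansion))"
proof -
  have "filter (\<lambda>i. i \<notin> {1..<h}) [0..<h] = [0]"
    using h_pos by (subst upt_conv_Cons) (auto simp: filter_empty_conv)
  then show ?thesis
    using expansion_steps[of "h - 1"] expansion(1,3) unfolding is_instantiation_def
    by (intro exI[of _ "inst_pgt (rev expansion) [0]"]) (simp add: inst_pgt_def)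
qed

text \<open>The order of expansion only permutes the lists of copy indices; equality of instances
  depends on the set of expanded templates.\<close>

lemma inst_vert_eq_iff:
  assumes "set X = {1..<h}"
  shows "inst_vert X f u = inst_vert X g v \<longleftrightarrow> u = v \<and> (\<forall>i \<in> inner_templates u. f i = g i)"
  using assms by (auto simp: inst_vert_def inner_templates_def)

end

section \<open>Occurrences in template-acyclic graphs\<close>

lemma exI3: "P a b c \<Longrightarrow> \<exists>x y z. P x y z"
  by blast

context template_graph
begin

abbreviation "t \<equiv> tmpl G"
abbreviation "par \<equiv> tmpl_parent G"

text \<open>The templates around \<open>v\<close> from the outermost to the innermost, without the
  root template. Entering a template appends to this list just as it appends to a label.\<close>

definition chain :: "'a \<Rightarrow> nat list" where
  "chain v = filter (\<lambda>i. v \<in> T i) (rev expansion)"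

lemma set_chain: "set (chain v) = inner_templates v"
  by (auto simp: chain_def expansion inner_templates_def)

lemma distinct_chain: "distinct (chain v)"
  by (simp add: chain_def expansion)

lemma chain_same:
  assumes "u \<in> V" "v \<in> V" "t u = t v"
  shows "chain u = chain v"
  unfolding chain_def using assms
  by (intro filter_cong) (auto simp: expansion mem_T_iff)

lemma parD:
  assumes "par i j"
  shows "i < h" "j < h" "T j \<subset> T i" "i \<noteq> j" "j \<noteq> 0"
  using assms T_0 T_sub by (auto simp: tmpl_parent_def)

lemma par_least:
  assumes "par i j" "l < h" "T j \<subset> T l"
  shows "T i \<subseteq> T l"
proof -
  have "i < h" "T j \<subset> T i" using assms(1) by (auto simp: tmpl_parent_def)
  moreover obtain v where "v \<in> T j" using T_sub[of j] assms(1) by (metis ex_in_conv tmpl_parent_def)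
  ultimately have "T i \<subseteq> T l \<or> T l \<subset> T i" using laminar_common[of i l v] assms by blast
  then show ?thesis using assms by (auto simp: tmpl_parent_def)
qed

lemma par_unique:
  assumes "par i j" "par i' j"
  shows "i = i'"
proof (rule T_inj)
  show "T i = T i'"
    using par_least[OF assms(1) parD(1,3)[OF assms(2)]]
      par_least[OF assms(2) parD(1,3)[OF assms(1)]] by (rule subset_antisym)
qed (use parD assms in auto)

lemma par_exists:
  assumes "0 < j" "j < h"
  shows "\<exists>i. par i j"
proof -
  have "T j \<subset> T 0" using laminar[of j 0] T_sub[of j] T_0 assms h_pos by auto
  then have "\<exists>i. (i < h \<and> T j \<subset> T i) \<and> (\<forall>l. l < h \<and> T j \<subset> T l \<longrightarrow> card (T i) \<le> card (T l))"
    using h_pos by (intro ex_has_least_nat[where k = 0]) auto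
  then obtain i where i: "i < h" "T j \<subset> T i"
    "\<And>l. l < h \<Longrightarrow> T j \<subset> T l \<Longrightarrow> card (T i) \<le> card (T l)" by blast
  have "\<forall>l < h. T j \<subset> T l \<longrightarrow> \<not> T l \<subset> T i"
  proof (intro allI impI)
    fix l assume that: "l < h" "T j \<subset> T l"
    show "\<not> T l \<subset> T i"
    using i(3)[OF that] psubset_card_mono[of "T i" "T l"] T_sub[OF i(1)] finite_V
    by (meson finite_subset leD)
  qed
  then show ?thesis using i assms unfolding tmpl_parent_def by blast
qed

lemma parent_index_eq: "par i j \<Longrightarrow> parent_index G j = i"
  using parD(5)[of i j] par_unique by (auto simp: parent_index_def intro!: the_equality)

text \<open>For the root template \<open>parent_index\<close> returns the default 0, the root
  itself; the inequality of the two templates rules this out, and the program tests it for the same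
  reason.\<close>

lemma parent_index_iff:
  assumes "u \<in> V" "v \<in> V" "t u \<noteq> t v"
  shows "parent_index G (t v) = t u \<longleftrightarrow> par (t u) (t v)"
proof
  assume *: "parent_index G (t v) = t u"
  have "t v \<noteq> 0" using assms(3) * unfolding parent_index_def by metis
  then obtain i where "par i (t v)" using par_exists tmpl(1)[OF assms(2)] by blast
  then show "par (t u) (t v)" using parent_index_eq * by simp
qed (rule parent_index_eq)

text \<open>A template other than \<open>t v\<close> contains \<open>v\<close> iff it contains
  \<open>u\<close>, since the parent is the least template properly above
  \<open>t v\<close>.\<close>

lemma chain_down:
  assumes "u \<in> V" "v \<in> V" "par (t u) (t v)"
  shows "chain v = chain u @ [t v]"
proof -
  let ?\<tau> = "t v" and ?X = "rev expansion"
  have \<tau>: "?\<tau> \<in> set expansion" using parD[OF assms(3)] by (auto simp: expansion)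
  then obtain a where a: "a < h - 1" "expansion ! a = ?\<tau>" by (metis expansion(3) in_set_conv_nth)
  define ys where "ys = rev (take a expansion)"
  define xs where "xs = rev (drop (Suc a) expansion)"
  have "expansion = take a expansion @ expansion ! a # drop (Suc a) expansion"
    using a(1) expansion(3) by (intro id_take_nth_drop) simp
  from arg_cong[OF this, of rev] have X: "?X = xs @ ?\<tau> # ys"
    by (simp add: xs_def ys_def a(2))
  have in_u: "u \<in> T i \<longleftrightarrow> T (t u) \<subseteq> T i" and in_v: "v \<in> T i \<longleftrightarrow> i = ?\<tau> \<or> T (t u) \<subseteq> T i"
    if "i \<in> set ?X" for i
  proof -
    have i: "i < h" using that by (simp add: expansion)
    show "u \<in> T i \<longleftrightarrow> T (t u) \<subseteq> T i" using mem_T_iff[OF assms(1) i] .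
    have "T ?\<tau> \<subseteq> T i \<longleftrightarrow> i = ?\<tau> \<or> T (t u) \<subseteq> T i"
      using par_least[OF assms(3) i] parD[OF assms(3)] T_inj[OF i, of ?\<tau>] by blast
    then show "v \<in> T i \<longleftrightarrow> i = ?\<tau> \<or> T (t u) \<subseteq> T i" using mem_T_iff[OF assms(2) i] by simp
  qed
  \<comment> \<open>Whatever stands behind \<open>t v\<close> is no larger than \<open>t v\<close>
    and therefore too small to contain \<open>t u\<close>.\<close>
  have ys: "\<not> T (t u) \<subseteq> T i" if "i \<in> set (?\<tau> # ys)" for i
  proof -
    have "card (T i) \<le> card (T ?\<tau>)"
    proof (cases "i = ?\<tau>")
      case False
      then have "i \<in> set (take a expansion)" using that by (simp add: ys_def)
      then obtain b where "b < a" "i = expansion ! b"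
        by (metis in_set_conv_nth length_take min_less_iff_conj nth_take)
      then show ?thesis using expansion_sorted[of b a] a by simp
    qed simp
    moreover have "card (T ?\<tau>) < card (T (t u))"
      using parD[OF assms(3)] T_sub finite_V by (meson finite_subset psubset_card_mono)
    moreover have "i < h"
      using that \<tau> by (auto simp: ys_def expansion dest!: in_set_takeD)
    then have "finite (T i)" using T_sub[of i] finite_V finite_subset by blast
    ultimately show ?thesis by (meson card_mono leD le_trans)
  qed
  have "distinct (xs @ ?\<tau> # ys)" unfolding X[symmetric] by (simp add: expansion(2))
  then have d: "?\<tau> \<notin> set xs \<union> set ys" by simp
  have "chain u = filter (\<lambda>i. T (t u) \<subseteq> T i) (xs @ ?\<tau> # ys)"
    unfolding chain_def X[symmetric] by (rule filter_cong) (use in_u in auto)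
  also have "\<dots> = filter (\<lambda>i. T (t u) \<subseteq> T i) xs"
    using ys by (simp add: filter_empty_conv)
  finally have u: "chain u = filter (\<lambda>i. T (t u) \<subseteq> T i) xs" .
  have "chain v = filter (\<lambda>i. i = ?\<tau> \<or> T (t u) \<subseteq> T i) (xs @ ?\<tau> # ys)"
    unfolding chain_def X[symmetric] by (rule filter_cong) (use in_v in auto)
  also have "\<dots> = filter (\<lambda>i. i = ?\<tau> \<or> T (t u) \<subseteq> T i) xs @ [?\<tau>]"
    using ys d by (auto simp: filter_empty_conv)
  also have "filter (\<lambda>i. i = ?\<tau> \<or> T (t u) \<subseteq> T i) xs = filter (\<lambda>i. T (t u) \<subseteq> T i) xs"
    using d by (intro filter_cong) auto
  finally show ?thesis using u by simp
qed

end

lemma vwalk_arcs_map: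
  "set (vwalk_arcs (map f [0..<Suc n])) = {(f i, f (Suc i)) | i. i < n}"
proof (induction n)
  case (Suc n)
  have snoc: "set (vwalk_arcs (xs @ [x, y])) = insert (x, y) (set (vwalk_arcs (xs @ [x])))" for xs and x y :: 'a
    by (induction xs rule: vwalk_arcs.induct) auto
  have "map f [0..<Suc (Suc n)] = map f [0..<n] @ [f n, f (Suc n)]" by simp
  moreover have "map f [0..<n] @ [f n] = map f [0..<Suc n]" by simp
  ultimately have "set (vwalk_arcs (map f [0..<Suc (Suc n)])) =
      insert (f n, f (Suc n)) (set (vwalk_arcs (map f [0..<Suc n])))"
    by (metis snoc)
  then show ?case using Suc by (auto simp: less_Suc_eq)
qed simp

locale acyclic_template_graph = template_graph +
  assumes no_skip: "no_skipping G" and acyclic: "template_acyclic G"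
begin

lemma arc_cases:
  assumes "(u, v) \<in> E"
  shows "t u = t v \<or> par (t u) (t v) \<or> par (t v) (t u)"
  using no_skip assms by (auto simp: no_skipping_def)

text \<open>Acyclicity in the form needed for images of tree paths. Template-cycles may repeat
  vertices, so two arbitrary chains of arcs can be concatenated, with \<open>0\<close>,
  \<open>a\<close> and \<open>a + b\<close> as the three positions.\<close>

lemma no_return:
  assumes "(u, v) \<in> E\<^sup>*" "(v, w) \<in> E\<^sup>*" "u \<in> V" "t u = t w"
  shows "t v = t u"
proof (rule ccontr)
  assume neq: "t v \<noteq> t u"
  obtain a b where "(u, v) \<in> E ^^ a" "(v, w) \<in> E ^^ b"
    using assms by (auto simp: rtrancl_power)
  then obtain f g where f: "f 0 = u" "f a = v" "\<And>i. i < a \<Longrightarrow> (f i, f (Suc i)) \<in> E"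
    and g: "g 0 = v" "g b = w" "\<And>i. i < b \<Longrightarrow> (g i, g (Suc i)) \<in> E"
    unfolding relpow_fun_conv by blast
  have ab: "0 < a" "0 < b" using neq assms(4) f g by (auto intro!: Nat.gr0I)
  define f' where "f' i = (if i \<le> a then f i else g (i - a))" for i
  have f': "(f' i, f' (Suc i)) \<in> E" if "i < a + b" for i
  proof (cases "i < a")
    case True
    then show ?thesis using f(3)[OF True] by (simp add: f'_def)
  next
    case False
    then have "f' i = g (i - a)" "f' (Suc i) = g (Suc (i - a))"
      using f(2) g(1) by (auto simp: f'_def Suc_diff_le)
    then show ?thesis using g(3)[of "i - a"] that False by simp
  qed
  let ?p = "map f' [0..<Suc (a + b)]"
  have V: "f' i \<in> V" if "i \<le> a + b" for i
  proof (cases i)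
    case 0
    then show ?thesis using f(1) assms(3) by (simp add: f'_def)
  next
    case (Suc i')
    then show ?thesis using f'[of i'] that E_verts by auto
  qed
  have "set (vwalk_arcs ?p) \<subseteq> arcs_ends (with_proj (tgraph G))"
    unfolding vwalk_arcs_map using f' by (auto simp: arcs_ends_def arc_to_ends_def)
  moreover have "set ?p \<subseteq> V" using V by auto
  ultimately have "vwalk ?p (with_proj (tgraph G))" by (auto simp: vwalk_def)
  moreover have "?p ! 0 = u" "?p ! a = v" "?p ! (a + b) = w"
    using f g ab by (auto simp: f'_def nth_append simp del: upt_Suc)
  moreover have "a + b < length ?p" by simp
  ultimately have "template_cycle G ?p"
    unfolding template_cycle_def using neq assms(4) ab
    by (intro conjI exI3[of _ 0 a "a + b"]) auto
  then show False using acyclic by (auto simp: template_acyclic_def)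
qed

end

section \<open>Occurrences, copy choices and labels\<close>

locale pattern_occurrence = acyclic_template_graph G + arc_tree tas k r d
  for G :: "'a pgt" and tas k r d
begin

text \<open>Node \<open>x\<close> is placed at the instance of \<open>\<phi> x\<close> lying in copy \<open>F x i\<close> of template \<open>i\<close>.\<close>

definition placed :: "'a \<Rightarrow> (nat \<Rightarrow> 'a) \<Rightarrow> (nat \<Rightarrow> nat \<Rightarrow> nat) \<Rightarrow> bool" where
  "placed v \<phi> F \<longleftrightarrow> \<phi> r = v \<and> (\<forall>x < k. \<phi> x \<in> V \<and> copy_choice (F x)) \<and>
     (\<forall>(x, y) \<in> set tas. (\<phi> x, \<phi> y) \<in> E \<and>
        (\<forall>i \<in> inner_templates (\<phi> x) \<inter> inner_templates (\<phi> y). F x i = F y i)) \<and>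
     (\<forall>x < k. \<forall>y < k. \<phi> x = \<phi> y \<longrightarrow> (\<forall>i \<in> inner_templates (\<phi> x). F x i = F y i) \<longrightarrow> x = y)"

lemma occurs_imp_placed:
  assumes "pverts A = {..<k}" "parcs A = set tas" "occurs_rooted_at A r G v"
  shows "\<exists>\<phi> F. placed v \<phi> F"
proof -
  obtain H \<psi> where H: "is_instantiation G H" "occurrence A H \<psi>" "fst (\<psi> r) = v"
    using assms(3) by (auto simp: occurs_rooted_at_def)
  obtain X where X: "H = inst_graph X" "set X = {1..<h}" using instantiationE[OF H(1)] .
  define \<phi> where "\<phi> x = fst (\<psi> x)" for x
  have "\<forall>x \<in> {..<k}. \<exists>f. \<psi> x = inst_vert X f (\<phi> x) \<and> copy_choice f \<and> \<phi> x \<in> V"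
  proof
    fix x assume "x \<in> {..<k}"
    then have "\<psi> x \<in> inst_verts X V"
      using H(2) assms(1) X(1) unfolding occurrence_def inst_graph_def by auto
    then show "\<exists>f. \<psi> x = inst_vert X f (\<phi> x) \<and> copy_choice f \<and> \<phi> x \<in> V"
      by (auto simp: inst_verts_def \<phi>_def)
  qed
  then obtain F where F: "\<And>x. x < k \<Longrightarrow> \<psi> x = inst_vert X (F x) (\<phi> x)"
    "\<And>x. x < k \<Longrightarrow> copy_choice (F x)" "\<And>x. x < k \<Longrightarrow> \<phi> x \<in> V"
    by (metis lessThan_iff)
  have "placed v \<phi> F"
    unfolding placed_def
  proof (intro conjI allI impI ballI)
    show "\<phi> r = v" using H(3) by (simp add: \<phi>_def)
    fix a assume "a \<in> set tas"
    then obtain x y where a: "a = (x, y)" "(x, y) \<in> set tas" by (metis prod.collapse)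
    then have xy: "x < k" "y < k" using arc by auto
    have "(\<psi> x, \<psi> y) \<in> parcs (inst_graph X)"
      using H(2) a(2) assms(2) X(1) by (auto simp: occurrence_def)
    then obtain f u w where f: "\<psi> x = inst_vert X f u" "\<psi> y = inst_vert X f w" "(u, w) \<in> E"
      by (auto simp: inst_graph_def)
    then have "u = \<phi> x" "w = \<phi> y" by (simp_all add: \<phi>_def)
    then show "case a of (x, y) \<Rightarrow> (\<phi> x, \<phi> y) \<in> E \<and>
        (\<forall>i \<in> inner_templates (\<phi> x) \<inter> inner_templates (\<phi> y). F x i = F y i)"
      using f F(1)[OF xy(1)] F(1)[OF xy(2)] a inst_vert_eq_iff[OF X(2)] by auto
  next
    fix x y assume xy: "x < k" "y < k" "\<phi> x = \<phi> y" "\<forall>i \<in> inner_templates (\<phi> x). F x i = F y i"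
    then have "\<psi> x = \<psi> y" using F(1) inst_vert_eq_iff[OF X(2)] by simp
    then show "x = y" using H(2) assms(1) xy by (auto simp: occurrence_def inj_on_def)
  qed (use F in auto)
  then show ?thesis by blast
qed

lemma placed_imp_occurs:
  assumes "pverts A = {..<k}" "parcs A = set tas" "placed v \<phi> F"
  shows "occurs_rooted_at A r G v"
proof -
  let ?X = "rev expansion"
  have X: "set ?X = {1..<h}" by (simp add: expansion)
  define \<psi> where "\<psi> x = inst_vert ?X (F x) (\<phi> x)" for x
  have p: "\<phi> x \<in> V" "copy_choice (F x)" if "x < k" for x
    using assms(3) that by (auto simp: placed_def)
  have "occurrence A (inst_graph ?X) \<psi>"
    unfolding occurrence_def assms(1,2)
  proof (intro conjI ballI)
    show "inj_on \<psi> {..<k}"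
      using assms(3) by (auto simp: inj_on_def \<psi>_def placed_def inst_vert_eq_iff[OF X])
    show "\<psi> ` {..<k} \<subseteq> pverts (inst_graph ?X)"
      using p by (auto simp: \<psi>_def inst_graph_def inst_vert_in)
    fix a assume "a \<in> set tas"
    then obtain x y where a: "a = (x, y)" "(x, y) \<in> set tas" by (metis prod.collapse)
    then have xy: "x < k" "y < k" using arc by auto
    \<comment> \<open>One choice has to serve both ends: it follows \<open>F x\<close> on the
      templates around \<open>\<phi> x\<close>, and on the common ones \<open>F y\<close> agrees
      with it.\<close>
    define f where "f i = (if i \<in> inner_templates (\<phi> x) then F x i else F y i)" for i
    have "copy_choice f" using p(2)[OF xy(1)] p(2)[OF xy(2)] by (simp add: copy_choice_def f_def)
    moreover have "\<psi> x = inst_vert ?X f (\<phi> x)" by (simp add: \<psi>_def inst_vert_eq_iff[OF X] f_def)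
    moreover have "\<psi> y = inst_vert ?X f (\<phi> y)"
      using assms(3) a(2) by (auto simp: \<psi>_def inst_vert_eq_iff[OF X] f_def placed_def)
    moreover have "(\<phi> x, \<phi> y) \<in> E" using assms(3) a(2) by (auto simp: placed_def)
    ultimately show "case a of (x, y) \<Rightarrow> (\<psi> x, \<psi> y) \<in> parcs (inst_graph ?X)"
      using a(1) by (auto simp: inst_graph_def)
  qed
  moreover have "fst (\<psi> r) = v" using assms(3) by (simp add: \<psi>_def placed_def)
  ultimately show ?thesis using instantiation_ex by (auto simp: occurs_rooted_at_def)
qed

text \<open>At most \<open>k\<close> copies of a template are used, so that copy indices may be assumed to be at most
  \<open>k\<close>.\<close>

lemma placed_le:
  assumes "placed v \<phi> F"
  shows "\<exists>F'. placed v \<phi> F' \<and> (\<forall>x < k. \<forall>i. F' x i \<le> k)"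
proof -
  define L where "L i = (\<lambda>x. F x i) ` {..<k}" for i
  have L: "finite (L i)" "card (L i) \<le> k" for i
    unfolding L_def using card_image_le[of "{..<k}" "\<lambda>x. F x i"] by auto
  \<comment> \<open>The copies in use are renumbered from 1, separately for each template. Only
    equality of indices matters, and no more copies can be in use than \<open>P i\<close>.\<close>
  have "\<forall>i. \<exists>g. bij_betw g (L i) {1..card (L i)}"
    using L(1) by (intro allI finite_same_card_bij) auto
  then obtain g where g: "\<And>i. bij_betw (g i) (L i) {1..card (L i)}" by metis
  define F' where "F' x i = g i (F x i)" for x i
  have L_P: "card (L i) \<le> P i" if "i < h" for i
  proof -
    have "L i \<subseteq> {1..P i}" using assms that by (auto simp: L_def placed_def copy_choice_def)
    then have "card (L i) \<le> card {1..P i}" by (intro card_mono) auto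
    then show ?thesis by simp
  qed
  have range: "F' x i \<in> {1..card (L i)}" if "x < k" for x i
    using g[of i] that by (auto simp: F'_def L_def bij_betw_def)
  have eq: "F' x i = F' y i \<longleftrightarrow> F x i = F y i" if "x < k" "y < k" for x y i
    using g[of i] that by (auto simp: F'_def L_def bij_betw_def inj_on_def)
  have "copy_choice (F' x)" if "x < k" for x
    unfolding copy_choice_def
  proof (intro allI impI)
    fix i assume "i < h"
    then show "1 \<le> F' x i \<and> F' x i \<le> P i" using range[OF that, of i] L_P[of i] by auto
  qed
  moreover have "\<forall>(x, y) \<in> set tas. \<forall>i \<in> inner_templates (\<phi> x) \<inter> inner_templates (\<phi> y). F' x i = F' y i"
    using assms arc eq by (fastforce simp: placed_def)
  ultimately have "placed v \<phi> F'"
    using assms eq unfolding placed_def by (simp add: split_beta)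
  moreover have "\<forall>x < k. \<forall>i. F' x i \<le> k"
    using range L(2) by (meson atLeastAtMost_iff le_trans)
  ultimately show ?thesis by blast
qed

definition down :: "'a \<Rightarrow> 'a \<Rightarrow> bool" where
  "down u v \<longleftrightarrow> par (t u) (t v)"

text \<open>\<open>\<rho> x\<close> lists the copies entered on the way from the root to \<open>x\<close>. Since there are no
  template-cycles, a walk can go up only before it enters a copy for the first time.\<close>

definition labels :: "'a \<Rightarrow> (nat \<Rightarrow> 'a) \<Rightarrow> (nat \<Rightarrow> nat list) \<Rightarrow> bool" where
  "labels v \<phi> \<rho> \<longleftrightarrow> \<phi> r = v \<and> v \<in> V \<and> \<rho> r = [] \<and>
     (\<forall>(x, y) \<in> set tas. (\<phi> x, \<phi> y) \<in> E \<and>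
        (if down (\<phi> x) (\<phi> y) then \<exists>j < min k (P (t (\<phi> y))). \<rho> y = \<rho> x @ [j] else \<rho> y = \<rho> x))"

context
  fixes v \<phi> \<rho> assumes labels: "labels v \<phi> \<rho>"
begin

lemma labels_arc: "(x, y) \<in> set tas \<Longrightarrow> (\<phi> x, \<phi> y) \<in> E"
  using labels by (auto simp: labels_def)

lemma labels_V: "x < k \<Longrightarrow> \<phi> x \<in> V"
proof (induction rule: tree_induct)
  case root
  then show ?case using labels by (simp add: labels_def)
qed (use labels_arc E_verts in blast)

lemma labels_desc: "desc x y \<Longrightarrow> (\<phi> x, \<phi> y) \<in> E\<^sup>*"
  by (induction rule: rtrancl_induct) (auto intro: labels_arc rtrancl.rtrancl_into_rtrancl)

lemma labels_no_return:
  assumes "desc w x" "(x, y) \<in> set tas" "w < k" "t (\<phi> w) = t (\<phi> y)"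
  shows "t (\<phi> x) = t (\<phi> w)"
  using no_return[OF labels_desc[OF assms(1)] _ labels_V[OF assms(3)] assms(4)]
    labels_arc[OF assms(2)] by blast

text \<open>The third part is the goal: the templates around \<open>\<phi> x\<close> are an initial
  piece \<open>b\<close> shared with the root, followed by the entered ones \<open>g\<close>, one
  label each. The other two parts record what has been visited. After an entry, the template above
  that of \<open>\<phi> x\<close> is that of an ancestor, so going up would return to it; before any
  entry, every template of the root that has been left is that of an ancestor, so the first entry
  leads to a template outside \<open>chain v\<close>.\<close>

lemma labels_inv:
  assumes "x < k"
  shows "(\<rho> x \<noteq> [] \<longrightarrow> (\<exists>w < k. desc w x \<and> par (t (\<phi> w)) (t (\<phi> x)))) \<and>
     (\<rho> x = [] \<longrightarrow> (\<forall>i \<in> set (chain v) - set (chain (\<phi> x)). \<exists>w < k. desc w x \<and> t (\<phi> w) = i)) \<and>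
     (\<exists>b g b'. chain (\<phi> x) = b @ g \<and> length g = length (\<rho> x) \<and> chain v = b @ b' \<and>
        (g \<noteq> [] \<longrightarrow> hd g \<notin> set (chain v)) \<and> (\<forall>i < length g. \<rho> x ! i < P (g ! i)))"
    (is "?A x \<and> ?B x \<and> ?C x")
  using assms
proof (induction rule: tree_induct)
  case root
  have "\<phi> r = v" "\<rho> r = []" using labels by (auto simp: labels_def)
  then show ?case by (intro conjI exI3[of _ "chain v" "[]" "[]"]) auto
next
  case (arc x y)
  then have A: "?A x" and B: "?B x" and C: "?C x" by blast+
  obtain b g b' where C': "chain (\<phi> x) = b @ g" "length g = length (\<rho> x)" "chain v = b @ b'"
    "g \<noteq> [] \<Longrightarrow> hd g \<notin> set (chain v)" "\<And>i. i < length g \<Longrightarrow> \<rho> x ! i < P (g ! i)"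
    using C by blast
  have xy: "x < k" "y < k" using arc_tree.arc[OF arc_tree_axioms arc(1)] by auto
  have V: "\<phi> x \<in> V" "\<phi> y \<in> V" using labels_V xy by auto
  have E: "(\<phi> x, \<phi> y) \<in> E" using labels_arc arc(1) by blast
  have dxy: "desc x y" using arc(1) by blast
  have dtrans: "desc w y" if "desc w x" for w
    using that arc(1) by (rule rtrancl.rtrancl_into_rtrancl)
  show ?case
  proof (cases "down (\<phi> x) (\<phi> y)")
    case True
    then have p: "par (t (\<phi> x)) (t (\<phi> y))" by (simp add: down_def)
    have "\<exists>j < min k (P (t (\<phi> y))). \<rho> y = \<rho> x @ [j]"
      using labels arc(1) True by (auto simp: labels_def)
    then obtain j where j: "j < P (t (\<phi> y))" "\<rho> y = \<rho> x @ [j]" by auto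
    have cy: "chain (\<phi> y) = chain (\<phi> x) @ [t (\<phi> y)]" by (rule chain_down[OF V p])
    \<comment> \<open>The first template entered cannot be one that was left on the way up.\<close>
    have new: "t (\<phi> y) \<notin> set (chain v)" if "g = []"
    proof
      assume "t (\<phi> y) \<in> set (chain v)"
      moreover have "t (\<phi> y) \<notin> set (chain (\<phi> x))" using distinct_chain[of "\<phi> y"] cy by simp
      moreover have "\<rho> x = []" using that C'(2) by simp
      ultimately obtain w where w: "w < k" "desc w x" "t (\<phi> w) = t (\<phi> y)" using B by blast
      then have "t (\<phi> x) = t (\<phi> w)" using labels_no_return arc(1) by blast
      then show False using w parD(4)[OF p] by simp
    qed
    have "?C y"
      using C' cy j new by (intro exI3[of _ b "g @ [t (\<phi> y)]" b'])
        (auto simp: nth_append less_Suc_eq hd_append)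
    moreover have "?A y" using p dxy xy by blast
    ultimately show ?thesis using j(2) by simp
  next
    case F: False
    then have \<rho>: "\<rho> y = \<rho> x" using labels arc(1) by (auto simp: labels_def)
    show ?thesis
    proof (cases "t (\<phi> x) = t (\<phi> y)")
      case True
      then have "chain (\<phi> x) = chain (\<phi> y)" by (intro chain_same V)
      then show ?thesis using A B C \<rho> True dtrans by metis
    next
      case False
      then have p: "par (t (\<phi> y)) (t (\<phi> x))" using arc_cases[OF E] F by (auto simp: down_def)
      have cx: "chain (\<phi> x) = chain (\<phi> y) @ [t (\<phi> x)]" by (rule chain_down[OF V(2,1) p])
      have nil: "\<rho> x = []"
      proof (rule ccontr)
        assume "\<rho> x \<noteq> []"
        then obtain w where w: "w < k" "desc w x" "par (t (\<phi> w)) (t (\<phi> x))" using A by blast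
        then have "t (\<phi> w) = t (\<phi> y)" using par_unique[OF _ p] by blast
        then show False using labels_no_return[OF w(2) arc(1) w(1)] False by simp
      qed
      have "?B y"
      proof (intro impI ballI)
        fix i assume i: "i \<in> set (chain v) - set (chain (\<phi> y))"
        show "\<exists>w < k. desc w y \<and> t (\<phi> w) = i"
        proof (cases "i = t (\<phi> x)")
          case True
          then show ?thesis using dxy xy by blast
        next
          case False
          then have "i \<in> set (chain v) - set (chain (\<phi> x))" using i cx by auto
          then show ?thesis using B nil dtrans by blast
        qed
      qed
      moreover have "g = []" using nil C'(2) by simp
      then have "?C y" using C'(1,3) cx nil \<rho>
        by (intro exI3[of _ "chain (\<phi> y)" "[]" "[t (\<phi> x)] @ b'"]) auto
      ultimately show ?thesis using nil \<rho> by simp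
    qed
  qed
qed

lemma labels_up_nil:
  assumes "(x, y) \<in> set tas" "\<not> down (\<phi> x) (\<phi> y)" "t (\<phi> x) \<noteq> t (\<phi> y)"
  shows "\<rho> x = []" "chain (\<phi> x) = chain (\<phi> y) @ [t (\<phi> x)]"
proof -
  have xy: "x < k" "y < k" using arc[OF assms(1)] by auto
  have p: "par (t (\<phi> y)) (t (\<phi> x))"
    using arc_cases[OF labels_arc[OF assms(1)]] assms by (auto simp: down_def)
  show "chain (\<phi> x) = chain (\<phi> y) @ [t (\<phi> x)]"
    by (rule chain_down[OF labels_V[OF xy(2)] labels_V[OF xy(1)] p])
  show "\<rho> x = []"
  proof (rule ccontr)
    assume "\<rho> x \<noteq> []"
    then obtain w where w: "w < k" "desc w x" "par (t (\<phi> w)) (t (\<phi> x))"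
      using labels_inv[OF xy(1)] by blast
    then have "t (\<phi> w) = t (\<phi> y)" using par_unique[OF _ p] by blast
    then show False using labels_no_return[OF w(2) assms(1) w(1)] assms(3) by simp
  qed
qed

lemma labels_length: "x < k \<Longrightarrow> length (\<rho> x) \<le> d x \<and> set (\<rho> x) \<subseteq> {..<k}"
proof (induction rule: tree_induct)
  case root
  then show ?case using labels by (simp add: labels_def)
next
  case (arc x y)
  have "d y = Suc (d x)" using arc_tree.arc[OF arc_tree_axioms arc(1)] by simp
  moreover have "\<rho> y = \<rho> x \<or> (\<exists>j < k. \<rho> y = \<rho> x @ [j])"
    using labels arc(1) by (auto simp: labels_def split: if_splits)
  ultimately show ?case using arc(2) by auto
qed

end

text \<open>Copies of templates that are never left are inherited from the root, and each entered
  copy is read off at the head of the entering arc. Vertex and label therefore determine all copies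
  around a node.\<close>

lemma placed_imp_labels:
  assumes "placed v \<phi> F"
  shows "\<exists>\<rho>. labels v \<phi> \<rho> \<and> inj_on (\<lambda>x. (\<phi> x, \<rho> x)) {..<k}"
proof -
  obtain F where F: "placed v \<phi> F" "\<forall>x < k. \<forall>i. F x i \<le> k" using placed_le[OF assms] by blast
  have V: "\<phi> x \<in> V" and cc: "copy_choice (F x)" if "x < k" for x
    using F(1) that by (auto simp: placed_def)
  have agree: "F x i = F y i"
    if "(x, y) \<in> set tas" "i \<in> set (chain (\<phi> x))" "i \<in> set (chain (\<phi> y))" for x y i
    using F(1) that by (auto simp: placed_def set_chain)
  have E: "(\<phi> x, \<phi> y) \<in> E" if "(x, y) \<in> set tas" for x y
    using F(1) that by (auto simp: placed_def)
  \<comment> \<open>Copies are numbered from 1, entries of labels from 0.\<close>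
  obtain \<rho> where \<rho>: "\<rho> r = []" "\<And>x y. (x, y) \<in> set tas \<Longrightarrow>
      \<rho> y = (if down (\<phi> x) (\<phi> y) then \<rho> x @ [F y (t (\<phi> y)) - 1] else \<rho> x)"
    using tree_rec[of "[]" "\<lambda>x y l. if down (\<phi> x) (\<phi> y) then l @ [F y (t (\<phi> y)) - 1] else l"]
    by blast
  have "F y (t (\<phi> y)) - 1 < min k (P (t (\<phi> y)))" if "(x, y) \<in> set tas" for x y
  proof -
    have y: "y < k" using arc[OF that] by simp
    have "t (\<phi> y) < h" using tmpl[OF V[OF y]] by simp
    then have "1 \<le> F y (t (\<phi> y))" "F y (t (\<phi> y)) \<le> P (t (\<phi> y))"
      using cc[OF y] by (auto simp: copy_choice_def)
    then show ?thesis using F(2) y by (simp add: Suc_le_eq[symmetric])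
  qed
  moreover have "\<phi> r = v" "v \<in> V" using F(1) V root by (auto simp: placed_def)
  ultimately have L: "labels v \<phi> \<rho>" unfolding labels_def using \<rho> E by auto
  have inv: "\<exists>b g b'. chain (\<phi> x) = b @ g \<and> length g = length (\<rho> x) \<and> chain v = b @ b' \<and>
      (\<forall>i \<in> set b. F x i = F r i) \<and> map (\<lambda>i. F x i - 1) g = \<rho> x" if "x < k" for x
    using that
  proof (induction rule: tree_induct)
    case root
    then show ?case using \<rho>(1) \<open>\<phi> r = v\<close> by (intro exI3[of _ "chain v" "[]" "[]"]) auto
  next
    case (arc x y)
    then obtain b g b' where C: "chain (\<phi> x) = b @ g" "length g = length (\<rho> x)" "chain v = b @ b'"
      "\<And>i. i \<in> set b \<Longrightarrow> F x i = F r i" "map (\<lambda>i. F x i - 1) g = \<rho> x" by blast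
    have xy: "x < k" "y < k" using arc_tree.arc[OF arc_tree_axioms arc(1)] by auto
    show ?case
    proof (cases "down (\<phi> x) (\<phi> y)")
      case True
      then have p: "par (t (\<phi> x)) (t (\<phi> y))" by (simp add: down_def)
      have cy: "chain (\<phi> y) = b @ (g @ [t (\<phi> y)])"
        using chain_down[OF V[OF xy(1)] V[OF xy(2)] p] C(1) by simp
      have "\<rho> y = \<rho> x @ [F y (t (\<phi> y)) - 1]" using \<rho>(2)[OF arc(1)] True by simp
      moreover have "F x i = F y i" if "i \<in> set b \<union> set g" for i
        using agree[OF arc(1), of i] that C(1) cy by auto
      moreover from this have "map (\<lambda>i. F y i - 1) g = \<rho> x"
        unfolding C(5)[symmetric] by (intro map_cong) auto
      ultimately show ?thesis using C cy
        by (intro exI3[of _ b "g @ [t (\<phi> y)]" b']) auto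
    next
      case F: False
      then have \<rho>': "\<rho> y = \<rho> x" using \<rho>(2)[OF arc(1)] by simp
      show ?thesis
      proof (cases "t (\<phi> x) = t (\<phi> y)")
        case True
        then have c: "chain (\<phi> x) = chain (\<phi> y)" by (intro chain_same V xy)
        have "F x i = F y i" if "i \<in> set b \<union> set g" for i
        proof -
          have "i \<in> set (chain (\<phi> x))" using that C(1) by auto
          then show ?thesis using agree[OF arc(1), of i] c by simp
        qed
        moreover from this have "map (\<lambda>i. F y i - 1) g = \<rho> x"
          unfolding C(5)[symmetric] by (intro map_cong) auto
        ultimately show ?thesis using C c \<rho>' by (intro exI3[of _ b g b']) auto
      next
        case False
        have up: "\<rho> x = []" "chain (\<phi> x) = chain (\<phi> y) @ [t (\<phi> x)]"
          using labels_up_nil[OF L arc(1) F False] by auto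
        then have b: "b = chain (\<phi> y) @ [t (\<phi> x)]" using C(1,2) by simp
        then have "F x i = F y i" if "i \<in> set (chain (\<phi> y))" for i
          using agree[OF arc(1), of i] that up by auto
        then show ?thesis using C(3,4) b \<rho>' up(1)
          by (intro exI3[of _ "chain (\<phi> y)" "[]" "[t (\<phi> x)] @ b'"]) auto
      qed
    qed
  qed
  have "inj_on (\<lambda>x. (\<phi> x, \<rho> x)) {..<k}"
  proof (rule inj_onI)
    fix x y assume "x \<in> {..<k}" "y \<in> {..<k}" and eq: "(\<phi> x, \<rho> x) = (\<phi> y, \<rho> y)"
    then have xy: "x < k" "y < k" by auto
    obtain b g where 1: "chain (\<phi> x) = b @ g" "length g = length (\<rho> x)"
      "\<forall>i \<in> set b. F x i = F r i" "map (\<lambda>i. F x i - 1) g = \<rho> x" using inv[OF xy(1)] by blast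
    obtain b' g' where 2: "chain (\<phi> y) = b' @ g'" "length g' = length (\<rho> y)"
      "\<forall>i \<in> set b'. F y i = F r i" "map (\<lambda>i. F y i - 1) g' = \<rho> y" using inv[OF xy(2)] by blast
    \<comment> \<open>The chains are equal as the vertices are, and the length of the label tells
      where each chain splits.\<close>
    have "b = b' \<and> g = g'" using 1(1,2) 2(1,2) eq by simp
    then have "F x i = F y i" if i: "i \<in> set (chain (\<phi> x))" for i
    proof (cases "i \<in> set g")
      case True
      then have "F x i - 1 = F y i - 1" using 1(4) 2(4) eq \<open>b = b' \<and> g = g'\<close> by (metis map_eq_conv prod.inject)
      moreover have "i < h" using i by (simp add: set_chain inner_templates_def)
      ultimately show ?thesis using cc[OF xy(1)] cc[OF xy(2)] by (metis copy_choice_def le_add_diff_inverse)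
    next
      case False
      then show ?thesis using i 1 2 \<open>b = b' \<and> g = g'\<close> by auto
    qed
    then show "x = y" using F(1) xy eq by (auto simp: placed_def set_chain)
  qed
  then show ?thesis using L by blast
qed

text \<open>Entered templates receive the copy given by their label and all others copy 1. Different
  labels over the same vertex yield different copies because both chains split at the same
  position.\<close>

lemma labels_imp_placed:
  assumes L: "labels v \<phi> \<rho>" and inj: "inj_on (\<lambda>x. (\<phi> x, \<rho> x)) {..<k}"
  shows "\<exists>F. placed v \<phi> F"
proof -
  \<comment> \<open>The entered templates are the innermost ones, so the labels go with the last
    \<open>length (\<rho> x)\<close> templates of the chain.\<close>
  define m where "m x = map_of (zip (drop (length (chain (\<phi> x)) - length (\<rho> x)) (chain (\<phi> x))) (\<rho> x))" for x
  define F where "F x i = (case m x i of Some j \<Rightarrow> j + 1 | None \<Rightarrow> 1)" for x i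
  have V: "\<phi> x \<in> V" if "x < k" for x by (rule labels_V[OF L that])
  have inv: "\<exists>b g b'. chain (\<phi> x) = b @ g \<and> length g = length (\<rho> x) \<and> chain v = b @ b' \<and>
      (g \<noteq> [] \<longrightarrow> hd g \<notin> set (chain v)) \<and> (\<forall>i < length g. \<rho> x ! i < P (g ! i)) \<and>
      m x = map_of (zip g (\<rho> x))" if xk: "x < k" for x
  proof -
    obtain b g b' where *: "chain (\<phi> x) = b @ g" "length g = length (\<rho> x)" "chain v = b @ b'"
      "g \<noteq> [] \<longrightarrow> hd g \<notin> set (chain v)" "\<forall>i < length g. \<rho> x ! i < P (g ! i)"
      using labels_inv[OF L xk] by blast
    then have "m x = map_of (zip g (\<rho> x))" by (simp add: m_def)
    then show ?thesis using * by (intro exI3[of _ b g b'] conjI)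
  qed
  have "copy_choice (F x)" if xk: "x < k" for x
    unfolding copy_choice_def
  proof (intro allI impI conjI)
    fix i assume i: "i < h"
    obtain b g where g: "length g = length (\<rho> x)" "\<And>i. i < length g \<Longrightarrow> \<rho> x ! i < P (g ! i)"
      "m x = map_of (zip g (\<rho> x))" using inv[OF xk] by blast
    show "1 \<le> F x i" by (simp add: F_def split: option.split)
    show "F x i \<le> P i"
    proof (cases "m x i")
      case None
      then show ?thesis using P_pos[OF i] by (simp add: F_def)
    next
      case (Some j)
      then have "(i, j) \<in> set (zip g (\<rho> x))" using g(3) by (simp add: map_of_SomeD)
      then obtain l where "l < length g" "g ! l = i" "\<rho> x ! l = j" by (auto simp: set_zip)
      then show ?thesis using g(2)[of l] Some by (simp add: F_def)
    qed
  qed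
  moreover have "\<forall>i \<in> inner_templates (\<phi> x) \<inter> inner_templates (\<phi> y). F x i = F y i"
    if xy: "(x, y) \<in> set tas" for x y
  proof
    fix i assume "i \<in> inner_templates (\<phi> x) \<inter> inner_templates (\<phi> y)"
    then have i: "i \<in> set (chain (\<phi> x))" "i \<in> set (chain (\<phi> y))" by (auto simp: set_chain)
    have k: "x < k" "y < k" using arc[OF xy] by auto
    obtain b g where g: "chain (\<phi> x) = b @ g" "length g = length (\<rho> x)"
      "m x = map_of (zip g (\<rho> x))" using inv[OF k(1)] by blast
    show "F x i = F y i"
    proof (cases "down (\<phi> x) (\<phi> y)")
      case True
      then have cy: "chain (\<phi> y) = chain (\<phi> x) @ [t (\<phi> y)]"
        using chain_down V k by (auto simp: down_def)
      have "\<exists>j < min k (P (t (\<phi> y))). \<rho> y = \<rho> x @ [j]"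
        using L xy True by (auto simp: labels_def)
      then obtain j where j: "\<rho> y = \<rho> x @ [j]" by blast
      have "m y = map_of (zip (g @ [t (\<phi> y)]) (\<rho> x @ [j]))"
        unfolding m_def cy j using g by simp
      moreover have "i \<noteq> t (\<phi> y)" using i(1) distinct_chain[of "\<phi> y"] cy by auto
      ultimately have "m y i = m x i" using g
        by (auto simp: map_add_def map_of_zip_is_None eq_commute[of None] split: option.split)
      then show ?thesis by (simp add: F_def)
    next
      case F: False
      then have \<rho>: "\<rho> y = \<rho> x" using L xy by (auto simp: labels_def)
      show ?thesis
      proof (cases "t (\<phi> x) = t (\<phi> y)")
        case True
        then have "chain (\<phi> x) = chain (\<phi> y)" by (intro chain_same V k)
        then show ?thesis using \<rho> by (simp add: F_def m_def)
      next
        case False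
        then have "\<rho> x = []" using labels_up_nil[OF L xy F] by simp
        then show ?thesis using \<rho> by (simp add: F_def m_def)
      qed
    qed
  qed
  moreover have "x = y" if xy: "x < k" "y < k" "\<phi> x = \<phi> y"
    and agree: "\<forall>i \<in> inner_templates (\<phi> x). F x i = F y i" for x y
  proof -
    obtain b g b' where 1: "chain (\<phi> x) = b @ g" "length g = length (\<rho> x)" "chain v = b @ b'"
      "g \<noteq> [] \<longrightarrow> hd g \<notin> set (chain v)" "m x = map_of (zip g (\<rho> x))" using inv[OF xy(1)] by blast
    obtain c e c' where 2: "chain (\<phi> y) = c @ e" "length e = length (\<rho> y)" "chain v = c @ c'"
      "e \<noteq> [] \<longrightarrow> hd e \<notin> set (chain v)" "m y = map_of (zip e (\<rho> y))" using inv[OF xy(2)] by blast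
    \<comment> \<open>With a longer label the chain would split earlier, and its first entered
      template would fall into the piece that the other node shares with the root.\<close>
    have shorter: False
      if "b @ g = c @ e" "length g < length e" "chain v = b @ b'" "e \<noteq> [] \<longrightarrow> hd e \<notin> set (chain v)"
      for b g c e b'
    proof -
      have "length c < length b" using arg_cong[OF that(1), of length] that(2) by simp
      have "e \<noteq> []" using that(2) by auto
      then have "hd e = (c @ e) ! length c" by (simp add: hd_conv_nth nth_append)
      also have "\<dots> = b ! length c" using that(1) \<open>length c < length b\<close> by (metis nth_append)
      finally show False using that(3,4) \<open>e \<noteq> []\<close> \<open>length c < length b\<close> by auto
    qed
    have bg: "b @ g = c @ e" using 1(1) 2(1) xy(3) by simp
    have "\<not> length g < length e" using shorter[OF bg _ 1(3) 2(4)] by blast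
    moreover have "\<not> length e < length g" using shorter[OF bg[symmetric] _ 2(3) 1(4)] by blast
    ultimately have "length g = length e" by simp
    then have g: "g = e" using 1(1) 2(1) xy(3) by simp
    have dg: "distinct g" using distinct_chain[of "\<phi> x"] 1(1) by simp
    have "\<rho> x = \<rho> y"
    proof (rule nth_equalityI)
      show "length (\<rho> x) = length (\<rho> y)" using 1(2) 2(2) g by simp
      fix l assume "l < length (\<rho> x)"
      then have l: "l < length g" "l < length (\<rho> y)" using 1(2) 2(2) g by auto
      have "m x (g ! l) = Some (\<rho> x ! l)" "m y (g ! l) = Some (\<rho> y ! l)"
        using 1(2,5) 2(2,5) g dg l by (auto simp: map_of_zip_nth)
      moreover have "g ! l \<in> inner_templates (\<phi> x)"
        unfolding set_chain[symmetric] 1(1) using l(1) by simp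
      ultimately show "\<rho> x ! l = \<rho> y ! l" using agree by (force simp: F_def)
    qed
    then show ?thesis using inj xy by (auto simp: inj_on_def)
  qed
  ultimately have "placed v \<phi> F"
    unfolding placed_def using L V labels_arc[OF L] by (auto simp: labels_def)
  then show ?thesis by blast
qed

text \<open>If enough copies are available, every arc entering a template may enter a copy of its own.\<close>

definition components :: "'a \<Rightarrow> (nat \<Rightarrow> 'a) \<Rightarrow> (nat \<Rightarrow> nat) \<Rightarrow> bool" where
  "components v \<phi> \<kappa> \<longleftrightarrow> \<phi> r = v \<and> v \<in> V \<and> \<kappa> r = r \<and>
     (\<forall>(x, y) \<in> set tas. (\<phi> x, \<phi> y) \<in> E \<and> \<kappa> y = (if down (\<phi> x) (\<phi> y) then y else \<kappa> x))"

text \<open>Labels are constant on a component, so equal component names imply equal labels.\<close>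

lemma labels_imp_components:
  assumes L: "labels v \<phi> \<rho>" and inj: "inj_on (\<lambda>x. (\<phi> x, \<rho> x)) {..<k}"
  shows "\<exists>\<kappa>. components v \<phi> \<kappa> \<and> inj_on (\<lambda>x. (\<phi> x, \<kappa> x)) {..<k}"
proof -
  obtain \<kappa> where \<kappa>: "\<kappa> r = r"
    "\<And>x y. (x, y) \<in> set tas \<Longrightarrow> \<kappa> y = (if down (\<phi> x) (\<phi> y) then y else \<kappa> x)"
    using tree_rec[of r "\<lambda>x y l. if down (\<phi> x) (\<phi> y) then y else l"] by blast
  have eq: "\<rho> (\<kappa> x) = \<rho> x" if "x < k" for x
    using that
  proof (induction rule: tree_induct)
    case root
    then show ?case using \<kappa> by simp
  next
    case (arc x y)
    then show ?case using \<kappa>(2)[OF arc(1)] L by (auto simp: labels_def)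
  qed
  have "components v \<phi> \<kappa>" using L \<kappa> by (auto simp: components_def labels_def)
  moreover have "inj_on (\<lambda>x. (\<phi> x, \<kappa> x)) {..<k}"
  proof (rule inj_onI)
    fix x y assume "x \<in> {..<k}" "y \<in> {..<k}" "(\<phi> x, \<kappa> x) = (\<phi> y, \<kappa> y)"
    then have "(\<phi> x, \<rho> x) = (\<phi> y, \<rho> y)" using eq[of x] eq[of y] by auto
    then show "x = y" using inj \<open>x \<in> _\<close> \<open>y \<in> _\<close> by (auto simp: inj_on_def)
  qed
  ultimately show ?thesis by blast
qed

text \<open>An entering arc takes the copy numbered by its head \<open>y\<close>, which is below
  \<open>k\<close> and thus available. The last entry of a label then names the component, with
  \<open>r\<close> for the empty label.\<close>

lemma components_imp_labels:
  assumes C: "components v \<phi> \<kappa>" and inj: "inj_on (\<lambda>x. (\<phi> x, \<kappa> x)) {..<k}"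
    and big: "\<And>u w. (u, w) \<in> E \<Longrightarrow> down u w \<Longrightarrow> k \<le> P (t w)"
  shows "\<exists>\<rho>. labels v \<phi> \<rho> \<and> inj_on (\<lambda>x. (\<phi> x, \<rho> x)) {..<k}"
proof -
  obtain \<rho> where \<rho>: "\<rho> r = []"
    "\<And>x y. (x, y) \<in> set tas \<Longrightarrow> \<rho> y = (if down (\<phi> x) (\<phi> y) then \<rho> x @ [y] else \<rho> x)"
    using tree_rec[of "[]" "\<lambda>x y l. if down (\<phi> x) (\<phi> y) then l @ [y] else l"] by blast
  have c: "(\<phi> x, \<phi> y) \<in> E" "\<kappa> y = (if down (\<phi> x) (\<phi> y) then y else \<kappa> x)"
    if "(x, y) \<in> set tas" for x y
    using C that by (auto simp: components_def)
  have eq: "\<kappa> x = (if \<rho> x = [] then r else last (\<rho> x))" if "x < k" for x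
    using that
  proof (induction rule: tree_induct)
    case root
    then show ?case using \<rho> C by (simp add: components_def)
  next
    case (arc x y)
    then show ?case using c(2)[OF arc(1)] \<rho>(2)[OF arc(1)] by auto
  qed
  have "y < min k (P (t (\<phi> y)))" if "(x, y) \<in> set tas" "down (\<phi> x) (\<phi> y)" for x y
    using big[OF c(1)[OF that(1)] that(2)] arc[OF that(1)] by simp
  then have "labels v \<phi> \<rho>" unfolding labels_def using C \<rho> c by (auto simp: components_def)
  moreover have "inj_on (\<lambda>x. (\<phi> x, \<rho> x)) {..<k}"
  proof (rule inj_onI)
    fix x y assume "x \<in> {..<k}" "y \<in> {..<k}" "(\<phi> x, \<rho> x) = (\<phi> y, \<rho> y)"
    then have "(\<phi> x, \<kappa> x) = (\<phi> y, \<kappa> y)" using eq[of x] eq[of y] by auto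
    then show "x = y" using inj \<open>x \<in> _\<close> \<open>y \<in> _\<close> by (auto simp: inj_on_def)
  qed
  ultimately show ?thesis by blast
qed

end

section \<open>The target graph of color coding\<close>

text \<open>Bijective base-\<open>k\<close> numeration: the digits run from 1 to \<open>k\<close>,
  so the empty list gets 0 and lists of different lengths never collide.\<close>

fun encode_labels :: "nat \<Rightarrow> nat list \<Rightarrow> nat" where
  "encode_labels k l = foldl (\<lambda>a j. a * k + j + 1) 0 l"

lemma encode_labels_Nil [simp]: "encode_labels k [] = 0"
  by simp

lemma encode_labels_snoc [simp]: "encode_labels k (l @ [j]) = encode_labels k l * k + j + 1"
  by simp

declare encode_labels.simps [simp del]

lemma encode_labels_less: "set l \<subseteq> {..<k} \<Longrightarrow> encode_labels k l < (k + 1) ^ length l"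
proof (induction l rule: rev_induct)
  case (snoc j l)
  then have "encode_labels k l + 1 \<le> (k + 1) ^ length l" "j < k" by auto
  then have "(encode_labels k l + 1) * k + 1 \<le> (k + 1) ^ length l * k + (k + 1) ^ length l"
    by (intro add_mono mult_right_mono) auto
  then show ?case using \<open>j < k\<close> by (simp add: algebra_simps)
qed simp

lemma encode_labels_inj:
  "set l \<subseteq> {..<k} \<Longrightarrow> set l' \<subseteq> {..<k} \<Longrightarrow> encode_labels k l = encode_labels k l' \<Longrightarrow> l = l'"
proof (induction l arbitrary: l' rule: rev_induct)
  case Nil
  then show ?case by (cases l' rule: rev_cases) auto
next
  case (snoc j l)
  then obtain j' m where l': "l' = m @ [j']" by (cases l' rule: rev_cases) auto
  have eq: "encode_labels k l * k + j = encode_labels k m * k + j'" and j: "j < k" "j' < k"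
    using snoc.prems l' by auto
  have "(encode_labels k l * k + j) div k = encode_labels k l"
    "(encode_labels k m * k + j') div k = encode_labels k m" using j by auto
  then have "encode_labels k l = encode_labels k m" using eq by metis
  moreover from this eq have "j = j'" by simp
  ultimately show ?case using snoc l' by auto
qed

locale numbered_target = pattern_occurrence G tas k r d
  for G :: "nat pgt" and tas k r d +
  fixes n R q :: nat and small :: bool
  assumes V: "V = {..<n}"
    and q_small: "small \<Longrightarrow> q = (k + 1) ^ k"
    and q_big: "\<not> small \<Longrightarrow> q = 1"
    and big: "\<not> small \<Longrightarrow> (u, w) \<in> E \<Longrightarrow> down u w \<Longrightarrow> k \<le> P (t w)"
begin

text \<open>The vertex with number \<open>num \<tau> u \<rho>\<close> stands for the instance of \<open>u\<close> that is reached by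
  entering the copies encoded by \<open>\<rho>\<close>, in the \<open>\<tau>\<close>-th of \<open>R\<close> disjoint copies of the target graph.\<close>

definition num :: "nat \<Rightarrow> nat \<Rightarrow> nat \<Rightarrow> nat" where
  "num \<tau> u \<rho> = (\<tau> * n + u) * q + \<rho>"

text \<open>Codes not below \<open>q\<close> are dropped. Labels that come from the pattern have
  fewer than \<open>k\<close> entries, so their codes are below \<open>(k + 1) ^ k\<close> and no
  arc needed for an occurrence is lost.\<close>

definition E0 :: "nat rel" where
  "E0 = {(num \<tau> u \<rho>, num \<tau> w \<rho>') | \<tau> u w \<rho> \<rho>'. \<tau> < R \<and> (u, w) \<in> E \<and> \<rho> < q \<and> \<rho>' < q \<and>
     (\<not> down u w \<and> \<rho>' = \<rho> \<or>
      down u w \<and> small \<and> (\<exists>j < min k (P (t w)). \<rho>' = \<rho> * k + j + 1))}"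

definition E1 :: "nat rel" where
  "E1 = {(num \<tau> u \<rho>, num \<tau> w \<rho>) | \<tau> u w \<rho>. \<tau> < R \<and> (u, w) \<in> E \<and> \<rho> < q \<and> down u w \<and> \<not> small}"

lemma q_pos: "0 < q"
  using q_small q_big by (cases small) auto

lemma num_div: "u < n \<Longrightarrow> \<rho> < q \<Longrightarrow> num \<tau> u \<rho> mod q = \<rho> \<and> num \<tau> u \<rho> div q mod n = u \<and>
    num \<tau> u \<rho> div q div n = \<tau>"
  by (simp add: num_def)

lemma num_less: "\<tau> < R \<Longrightarrow> u < n \<Longrightarrow> \<rho> < q \<Longrightarrow> num \<tau> u \<rho> < R * n * q"
proof -
  assume *: "\<tau> < R" "u < n" "\<rho> < q"
  have "\<tau> * n + u + 1 \<le> R * n"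
    using * mult_le_mono1[of "\<tau> + 1" R n] by (simp add: algebra_simps)
  then have "(\<tau> * n + u + 1) * q \<le> R * n * q" by (rule mult_le_mono1)
  then show "num \<tau> u \<rho> < R * n * q" using * by (simp add: num_def algebra_simps)
qed

lemma E_less: "(u, w) \<in> E \<Longrightarrow> u < n \<and> w < n"
  using E_verts V by auto

lemma E0_E1_less: "E0 \<subseteq> {..<R * n * q} \<times> {..<R * n * q}" "E1 \<subseteq> {..<R * n * q} \<times> {..<R * n * q}"
  using E_less num_less by (fastforce simp: E0_def E1_def)+

text \<open>Arcs never change the trial, so an embedding stays within one copy of the target, and
  there vertex and code determine the target vertex. With lists, all nodes belong to the component
  \<open>r\<close>; without them, the code is always 0.\<close>

lemma embeds_imp_placed:
  assumes emb: "embeds E0 E1 (num \<tau> v 0) \<psi> \<kappa>" and v: "v < n"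
  shows "\<exists>\<phi> F. placed v \<phi> F"
proof -
  define \<phi> where "\<phi> x = \<psi> x div q mod n" for x
  define \<rho> where "\<rho> x = \<psi> x mod q" for x
  have inj: "inj_on (\<lambda>x. (\<psi> x, \<kappa> x)) {..<k}" and r: "\<psi> r = num \<tau> v 0" "\<kappa> r = r"
    and e: "\<And>x y. (x, y) \<in> set tas \<Longrightarrow>
      (\<psi> x, \<psi> y) \<in> E0 \<and> \<kappa> y = \<kappa> x \<or> (\<psi> x, \<psi> y) \<in> E1 \<and> \<kappa> y = y"
    using emb by (auto simp: embeds_def)
  have arcE: "(\<phi> x, \<phi> y) \<in> E \<and> \<psi> x div q div n = \<psi> y div q div n \<and>
      (\<kappa> y = \<kappa> x \<and> (\<not> down (\<phi> x) (\<phi> y) \<and> \<rho> y = \<rho> x \<or>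
         down (\<phi> x) (\<phi> y) \<and> small \<and> (\<exists>j < min k (P (t (\<phi> y))). \<rho> y = \<rho> x * k + j + 1)) \<or>
       down (\<phi> x) (\<phi> y) \<and> \<not> small \<and> \<kappa> y = y)" if xy: "(x, y) \<in> set tas" for x y
    using e[OF xy]
  proof
    assume "(\<psi> x, \<psi> y) \<in> E0 \<and> \<kappa> y = \<kappa> x"
    then obtain \<tau> u w a b where *: "\<psi> x = num \<tau> u a" "\<psi> y = num \<tau> w b" "(u, w) \<in> E" "a < q" "b < q"
      "\<not> down u w \<and> b = a \<or> down u w \<and> small \<and> (\<exists>j < min k (P (t w)). b = a * k + j + 1)"
      "\<kappa> y = \<kappa> x"
      unfolding E0_def by blast
    have "\<phi> x = u" "\<phi> y = w" "\<rho> x = a" "\<rho> y = b" "\<psi> x div q div n = \<tau>" "\<psi> y div q div n = \<tau>"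
      using num_div[of u a \<tau>] num_div[of w b \<tau>] E_less[OF *(3)] * by (simp_all add: \<phi>_def \<rho>_def)
    then show ?thesis using * by simp
  next
    assume "(\<psi> x, \<psi> y) \<in> E1 \<and> \<kappa> y = y"
    then obtain \<tau> u w a where *: "\<psi> x = num \<tau> u a" "\<psi> y = num \<tau> w a" "(u, w) \<in> E" "a < q"
      "down u w" "\<not> small" "\<kappa> y = y"
      unfolding E1_def by blast
    have "\<phi> x = u" "\<phi> y = w" "\<psi> x div q div n = \<tau>" "\<psi> y div q div n = \<tau>"
      using num_div[of u a \<tau>] num_div[of w a \<tau>] E_less[OF *(3)] * by (simp_all add: \<phi>_def)
    then show ?thesis using * by simp
  qed
  have root: "\<phi> r = v" "\<rho> r = 0" "\<psi> r div q div n = \<tau>"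
    using r num_div[OF v q_pos] by (simp_all add: \<phi>_def \<rho>_def)
  have \<tau>: "\<psi> x div q div n = \<tau>" if "x < k" for x
    using that
  proof (induction rule: tree_induct)
    case (arc x y)
    then show ?case using arcE[OF arc(1)] by simp
  qed (rule root)
  have \<psi>: "\<psi> x = \<psi> y" if "x < k" "y < k" "\<phi> x = \<phi> y" "\<rho> x = \<rho> y" for x y
  proof -
    have "\<psi> x div q = \<psi> y div q"
      using \<tau>[OF that(1)] \<tau>[OF that(2)] that(3) unfolding \<phi>_def by (metis div_mult_mod_eq)
    then show ?thesis using that(4) unfolding \<rho>_def by (metis div_mult_mod_eq)
  qed
  show ?thesis
  proof (cases small)
    case True
    have \<kappa>: "\<kappa> x = r" if "x < k" for x
      using that
    proof (induction rule: tree_induct)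
      case (arc x y)
      then show ?case using arcE[OF arc(1)] True by auto
    qed (rule r)
    \<comment> \<open>The last digit of a code is recovered modulo \<open>k\<close>, after undoing
      the shift of the digits by 1.\<close>
    obtain L where L: "L r = []" "\<And>x y. (x, y) \<in> set tas \<Longrightarrow>
        L y = (if down (\<phi> x) (\<phi> y) then L x @ [(\<rho> y - 1) mod k] else L x)"
      using tree_rec[of "[]" "\<lambda>x y l. if down (\<phi> x) (\<phi> y) then l @ [(\<rho> y - 1) mod k] else l"] by blast
    have lab: "if down (\<phi> x) (\<phi> y) then \<exists>j < min k (P (t (\<phi> y))). L y = L x @ [j] \<and> \<rho> y = \<rho> x * k + j + 1
        else L y = L x \<and> \<rho> y = \<rho> x" if xy: "(x, y) \<in> set tas" for x y
    proof (cases "down (\<phi> x) (\<phi> y)")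
      case T: True
      then obtain j where j: "j < min k (P (t (\<phi> y)))" "\<rho> y = \<rho> x * k + j + 1"
        using arcE[OF xy] True by blast
      then have "(\<rho> y - 1) mod k = j" by simp
      then show ?thesis using L(2)[OF xy] T j by auto
    next
      case False
      then show ?thesis using L(2)[OF xy] arcE[OF xy] by auto
    qed
    have lab_L: "labels v \<phi> L"
      unfolding labels_def
    proof (intro conjI ballI)
      fix a assume "a \<in> set tas"
      then obtain x y where a: "a = (x, y)" "(x, y) \<in> set tas" by (metis prod.collapse)
      then show "case a of (x, y) \<Rightarrow> (\<phi> x, \<phi> y) \<in> E \<and>
          (if down (\<phi> x) (\<phi> y) then \<exists>j < min k (P (t (\<phi> y))). L y = L x @ [j] else L y = L x)"
        using lab[OF a(2)] arcE[OF a(2)] by (cases "down (\<phi> x) (\<phi> y)") auto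
    qed (use root L(1) v V in auto)
    have code: "encode_labels k (L x) = \<rho> x" if "x < k" for x
      using that
    proof (induction rule: tree_induct)
      case (arc x y)
      then show ?case using lab[OF arc(1)] by (auto split: if_splits)
    qed (use root L in simp)
    have "inj_on (\<lambda>x. (\<phi> x, L x)) {..<k}"
    proof (rule inj_onI)
      fix x y assume *: "x \<in> {..<k}" "y \<in> {..<k}" "(\<phi> x, L x) = (\<phi> y, L y)"
      then have "\<rho> x = \<rho> y" using code[of x] code[of y] by simp
      then have "\<psi> x = \<psi> y" using \<psi>[of x y] * by simp
      then show "x = y" using inj_onD[OF inj, of x y] * \<kappa> by simp
    qed
    from labels_imp_placed[OF lab_L this] obtain F where "placed v \<phi> F" ..
    then show ?thesis by (intro exI)
  next
    case False
    then have "q = 1" by (rule q_big)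
    then have \<rho>: "\<rho> x = 0" for x by (simp add: \<rho>_def)
    have comp: "components v \<phi> \<kappa>"
      unfolding components_def using root r arcE False v V by auto
    have "inj_on (\<lambda>x. (\<phi> x, \<kappa> x)) {..<k}"
    proof (rule inj_onI)
      fix x y assume *: "x \<in> {..<k}" "y \<in> {..<k}" "(\<phi> x, \<kappa> x) = (\<phi> y, \<kappa> y)"
      then have "\<psi> x = \<psi> y" using \<psi>[of x y] * \<rho> by simp
      then show "x = y" using inj_onD[OF inj, of x y] * by simp
    qed
    then have "\<exists>L. labels v \<phi> L \<and> inj_on (\<lambda>x. (\<phi> x, L x)) {..<k}"
      by (rule components_imp_labels[OF comp]) (rule big[OF False])
    then obtain L where L: "labels v \<phi> L" "inj_on (\<lambda>x. (\<phi> x, L x)) {..<k}" by (elim exE conjE)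
    obtain F where "placed v \<phi> F" using labels_imp_placed[OF L] ..
    then show ?thesis by (intro exI)
  qed
qed

lemma num_shift: "num \<tau> u \<rho> = \<tau> * (n * q) + (u * q + \<rho>)"
  by (simp add: num_def algebra_simps)

text \<open>\<open>\<psi>\<close> and \<open>\<kappa>\<close> do not depend on the trial: the same
  image is found in every copy of the target, shifted by a multiple of \<open>n * q\<close>. This
  turns the copies into independent trials for one fixed set.\<close>

lemma placed_imp_embeds:
  assumes "placed v \<phi> F"
  shows "\<exists>\<psi> \<kappa>. (\<forall>x < k. \<psi> x < n * q) \<and>
     (\<forall>\<tau> < R. embeds E0 E1 (num \<tau> v 0) (\<lambda>x. \<tau> * (n * q) + \<psi> x) \<kappa>)"
proof -
  obtain L where L: "labels v \<phi> L" "inj_on (\<lambda>x. (\<phi> x, L x)) {..<k}"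
    using placed_imp_labels[OF assms] by blast
  have \<phi>: "\<phi> x < n" if "x < k" for x using labels_V[OF L(1) that] V by simp
  have less: "(u * q + \<rho>) < n * q" if "u < n" "\<rho> < q" for u \<rho>
  proof -
    have "(u + 1) * q \<le> n * q" using that by (intro mult_le_mono1) simp
    then show ?thesis using that by simp
  qed
  show ?thesis
  proof (cases small)
    case True
    define \<psi> where "\<psi> x = \<phi> x * q + encode_labels k (L x)" for x
    have set: "set (L x) \<subseteq> {..<k}" if "x < k" for x using labels_length[OF L(1) that] by simp
    have code: "encode_labels k (L x) < q" if "x < k" for x
    proof -
      have "length (L x) \<le> k" using labels_length[OF L(1) that] depth_less[OF that] by simp
      then have "(k + 1) ^ length (L x) \<le> (k + 1) ^ k" by (intro power_increasing) auto
      then show ?thesis using encode_labels_less[OF set[OF that]] q_small[OF True] by simp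
    qed
    have "embeds E0 E1 (num \<tau> v 0) (\<lambda>x. \<tau> * (n * q) + \<psi> x) (\<lambda>_. r)" if \<tau>: "\<tau> < R" for \<tau>
    proof -
      have num: "\<tau> * (n * q) + \<psi> x = num \<tau> (\<phi> x) (encode_labels k (L x))" for x
        by (simp add: num_shift \<psi>_def)
      have "(num \<tau> (\<phi> x) (encode_labels k (L x)), num \<tau> (\<phi> y) (encode_labels k (L y))) \<in> E0"
        if xy: "(x, y) \<in> set tas" for x y
      proof -
        have k: "x < k" "y < k" using arc[OF xy] by auto
        have "\<not> down (\<phi> x) (\<phi> y) \<and> encode_labels k (L y) = encode_labels k (L x) \<or>
            down (\<phi> x) (\<phi> y) \<and> small \<and>
            (\<exists>j < min k (P (t (\<phi> y))). encode_labels k (L y) = encode_labels k (L x) * k + j + 1)"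
        proof (cases "down (\<phi> x) (\<phi> y)")
          case T: True
          then have "\<exists>j < min k (P (t (\<phi> y))). L y = L x @ [j]"
            using L(1) xy by (auto simp: labels_def)
          then obtain j where "j < min k (P (t (\<phi> y)))" "L y = L x @ [j]" by blast
          then have "j < min k (P (t (\<phi> y))) \<and> encode_labels k (L y) = encode_labels k (L x) * k + j + 1"
            by simp
          then show ?thesis using T True by blast
        next
          case False
          then have "L y = L x" using L(1) xy by (auto simp: labels_def)
          then show ?thesis using False by simp
        qed
        then show ?thesis
          unfolding E0_def using \<tau> labels_arc[OF L(1) xy] code[OF k(1)] code[OF k(2)] by blast
      qed
      moreover have "\<phi> r = v" "L r = []" using L(1) by (auto simp: labels_def)
      moreover have "inj_on (\<lambda>x. (num \<tau> (\<phi> x) (encode_labels k (L x)), r)) {..<k}"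
      proof (rule inj_onI)
        fix x y assume *: "x \<in> {..<k}" "y \<in> {..<k}" "(num \<tau> (\<phi> x) (encode_labels k (L x)), r) =
          (num \<tau> (\<phi> y) (encode_labels k (L y)), r)"
        then have xy: "x < k" "y < k" by auto
        have "num \<tau> (\<phi> x) (encode_labels k (L x)) = num \<tau> (\<phi> y) (encode_labels k (L y))"
          using *(3) by blast
        then have eq: "\<phi> x = \<phi> y" "encode_labels k (L x) = encode_labels k (L y)"
          using num_div[OF \<phi>[OF xy(1)] code[OF xy(1)], of \<tau>]
            num_div[OF \<phi>[OF xy(2)] code[OF xy(2)], of \<tau>] by metis+
        have "L x = L y" by (rule encode_labels_inj[OF set[OF xy(1)] set[OF xy(2)] eq(2)])
        then show "x = y" using inj_onD[OF L(2), of x y] * eq by simp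
      qed
      ultimately show ?thesis unfolding embeds_def num by auto
    qed
    moreover have "\<forall>x < k. \<psi> x < n * q" using less \<phi> code by (simp add: \<psi>_def)
    ultimately show ?thesis by blast
  next
    case False
    then have q: "q = 1" by (rule q_big)
    obtain \<kappa> where \<kappa>: "components v \<phi> \<kappa>" "inj_on (\<lambda>x. (\<phi> x, \<kappa> x)) {..<k}"
      using labels_imp_components[OF L] by blast
    have "embeds E0 E1 (num \<tau> v 0) (\<lambda>x. \<tau> * (n * q) + \<phi> x) \<kappa>" if \<tau>: "\<tau> < R" for \<tau>
    proof -
      have num: "\<tau> * (n * q) + \<phi> x = num \<tau> (\<phi> x) 0" for x
        unfolding num_shift by (simp add: q)
      have "(num \<tau> (\<phi> x) 0, num \<tau> (\<phi> y) 0) \<in> E0 \<and> \<kappa> y = \<kappa> x \<or>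
          (num \<tau> (\<phi> x) 0, num \<tau> (\<phi> y) 0) \<in> E1 \<and> \<kappa> y = y" if xy: "(x, y) \<in> set tas" for x y
      proof -
        have c: "(\<phi> x, \<phi> y) \<in> E" "\<kappa> y = (if down (\<phi> x) (\<phi> y) then y else \<kappa> x)"
          using \<kappa>(1) xy by (auto simp: components_def)
        show ?thesis
        proof (cases "down (\<phi> x) (\<phi> y)")
          case True
          then have "(num \<tau> (\<phi> x) 0, num \<tau> (\<phi> y) 0) \<in> E1"
            unfolding E1_def using c(1) \<tau> False q by blast
          then show ?thesis using c(2) True by simp
        next
          case F: False
          then have "(num \<tau> (\<phi> x) 0, num \<tau> (\<phi> y) 0) \<in> E0"
            unfolding E0_def using c(1) \<tau> q by blast
          then show ?thesis using c(2) F by simp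
        qed
      qed
      moreover have "\<phi> r = v" "\<kappa> r = r" using \<kappa>(1) by (auto simp: components_def)
      moreover have "inj_on (\<lambda>x. (num \<tau> (\<phi> x) 0, \<kappa> x)) {..<k}"
        unfolding num[symmetric] using \<kappa>(2) by (auto simp: inj_on_def)
      ultimately show ?thesis unfolding embeds_def num by auto
    qed
    moreover have "\<forall>x < k. \<phi> x < n * q" using \<phi> q by simp
    ultimately show ?thesis by blast
  qed
qed

end

section \<open>Random colorings\<close>

lemma prob_bind_pmf:
  "measure_pmf.prob (bind_pmf p f) A = measure_pmf.expectation p (\<lambda>x. measure_pmf.prob (f x) A)"
proof -
  have "ennreal (measure_pmf.prob (bind_pmf p f) A) = (\<integral>\<^sup>+ x. ennreal (measure_pmf.prob (f x) A) \<partial>measure_pmf p)"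
    by (simp add: measure_pmf.emeasure_eq_measure[symmetric])
  also have "\<dots> = ennreal (measure_pmf.expectation p (\<lambda>x. measure_pmf.prob (f x) A))"
    by (intro nn_integral_eq_integral measure_pmf.integrable_const_bound[where B = 1]) auto
  finally show ?thesis by (simp add: integral_nonneg_AE)
qed

lemma integrable_unit_interval:
  fixes f :: "'a \<Rightarrow> real"
  assumes "\<And>x. 0 \<le> f x \<and> f x \<le> 1"
  shows "integrable (measure_pmf p) f"
  using assms by (intro measure_pmf.integrable_const_bound[where B = 1]) auto

lemma expectation_unit_interval:
  fixes f :: "'a \<Rightarrow> real"
  assumes "\<And>x. 0 \<le> f x \<and> f x \<le> 1"
  shows "0 \<le> measure_pmf.expectation p f \<and> measure_pmf.expectation p f \<le> 1"
  using assms integrable_unit_interval[OF assms]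
  by (intro conjI integral_nonneg measure_pmf.integral_le_const) auto

text \<open>Colors are revealed one position at a time, and \<open>S\<close> holds those already
  taken; the induction needs arbitrary \<open>S\<close>, the application only the empty set.\<close>

lemma prob_rainbow:
  assumes "0 < k" "I \<subseteq> {..<N}" "S \<subseteq> {..<k}" "card I + card S \<le> k"
  shows "(\<Prod>j < card I. (real k - real (card S + j)) / real k) \<le>
    measure_pmf.prob (replicate_pmf N (pmf_of_set {..<k}))
      {xs. inj_on (nth xs) I \<and> nth xs ` I \<inter> S = {}}"
  using assms(2-4)
proof (induction N arbitrary: I S)
  case 0
  then show ?case by simp
next
  case (Suc N)
  let ?p = "pmf_of_set {..<k}" and ?q = "replicate_pmf N (pmf_of_set {..<k})"
  define good where "good I S = {xs. inj_on (nth xs) I \<and> nth xs ` I \<inter> S = {}}"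
    for I :: "nat set" and S :: "nat set"
  define J where "J = {i. Suc i \<in> I}"
  have fin: "finite I" "finite J" "finite S" and J: "J \<subseteq> {..<N}"
    using Suc.prems finite_subset[of I] finite_subset[of J "{..<N}"] finite_subset[of S]
    by (auto simp: J_def)
  have I: "I = Suc ` J \<union> (I \<inter> {0})"
  proof (intro set_eqI iffI)
    fix i assume "i \<in> I"
    then show "i \<in> Suc ` J \<union> (I \<inter> {0})" by (cases i) (auto simp: J_def)
  qed (auto simp: J_def)
  have card: "card I = card J + (if 0 \<in> I then 1 else 0)"
    by (subst I, subst card_Un_disjoint) (use fin in \<open>auto simp: card_image\<close>)
  have prob: "measure_pmf.prob (replicate_pmf (Suc N) ?p) (good I S) =
      (\<Sum>x < k. measure_pmf.prob ?q {xs. x # xs \<in> good I S}) / real k"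
    using assms(1)
    by (simp add: prob_bind_pmf map_pmf_def[symmetric] integral_pmf_of_set lessThan_empty_iff vimage_def)
  have mono: "measure_pmf.prob ?q A \<le> measure_pmf.prob ?q B" if "A \<subseteq> B" for A B
    using that by (intro measure_pmf.finite_measure_mono) auto
  show ?case
  proof (cases "0 \<in> I")
    case False
    have "x # xs \<in> good I S \<longleftrightarrow> xs \<in> good J S" for x xs
    proof -
      have I': "I = Suc ` J" using I False by auto
      show ?thesis unfolding good_def I' by (auto simp: inj_on_def image_image)
    qed
    then have "measure_pmf.prob (replicate_pmf (Suc N) ?p) (good I S) = measure_pmf.prob ?q (good J S)"
      unfolding prob using assms(1) by simp
    then show ?thesis using Suc.IH[OF J, of S] Suc.prems card False by (simp add: good_def)
  next
    case True
    have sub: "good J (insert x S) \<subseteq> {xs. x # xs \<in> good I S}" if "x \<notin> S" for x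
    proof
      fix xs assume "xs \<in> good J (insert x S)"
      moreover have I': "I = insert 0 (Suc ` J)" using I True by auto
      ultimately show "xs \<in> {xs. x # xs \<in> good I S}"
        using that unfolding good_def I' by (auto simp: inj_on_def image_image)
    qed
    define f where "f = (\<Prod>j < card J. (real k - real (Suc (card S + j))) / real k)"
    have "f \<le> measure_pmf.prob ?q (good J (insert x S))" if "x \<in> {..<k} - S" for x
      using Suc.IH[OF J, of "insert x S"] Suc.prems card True that fin
      by (simp add: good_def f_def add.assoc)
    then have le: "f \<le> measure_pmf.prob ?q {xs. x # xs \<in> good I S}" if "x \<in> {..<k} - S" for x
      using mono[OF sub[of x]] that by (meson DiffD2 le_less_trans linorder_not_le)
    \<comment> \<open>Each of the \<open>k - card S\<close> free colors for the first position
      leaves the remaining positions with a success probability of at least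
      \<open>f\<close>.\<close>
    have "real (k - card S) * f = (\<Sum>x \<in> {..<k} - S. f)"
      using Suc.prems(2) fin by (simp add: card_Diff_subset)
    also have "\<dots> \<le> (\<Sum>x \<in> {..<k} - S. measure_pmf.prob ?q {xs. x # xs \<in> good I S})"
      by (intro sum_mono le)
    also have "\<dots> \<le> (\<Sum>x < k. measure_pmf.prob ?q {xs. x # xs \<in> good I S})"
      by (intro sum_mono2) auto
    finally have "real (k - card S) * f / real k \<le> measure_pmf.prob (replicate_pmf (Suc N) ?p) (good I S)"
      unfolding prob by (rule divide_right_mono) simp
    moreover have "(\<Prod>j < card I. (real k - real (card S + j)) / real k) = real (k - card S) * f / real k"
      using card True Suc.prems(3) by (simp add: prod.lessThan_Suc_shift f_def ac_simps del: prod.lessThan_Suc)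
    ultimately show ?thesis by (simp add: good_def)
  qed
qed

text \<open>The term \<open>k ^ k / k!\<close> of the exponential series gives
  \<open>k! / k ^ k \<ge> exp (- k)\<close>. The bound 4 instead of Euler's number makes the number
  of trials an integer that the program can compute from \<open>2 ^ k\<close>.\<close>

lemma rainbow_bound:
  assumes "i \<le> k" "0 < k"
  shows "1 / 4 ^ k \<le> (\<Prod>j < i. (real k - real j) / real k)"
proof -
  have "summable (\<lambda>n. inverse (fact n) * real k ^ n)" by (rule summable_exp)
  then have "sum (\<lambda>n. inverse (fact n) * real k ^ n) {k} \<le> (\<Sum>n. inverse (fact n) * real k ^ n)"
    by (intro sum_le_suminf) auto
  also have "\<dots> = exp (real k)" by (simp add: exp_def divide_inverse mult.commute scaleR_conv_of_real)
  also have "\<dots> = exp 1 ^ k" by (simp add: exp_of_nat_mult[symmetric])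
  also have "\<dots> \<le> 4 ^ k" using exp_le by (intro power_mono) auto
  finally have "real k ^ k \<le> 4 ^ k * fact k" by (simp add: field_simps)
  then have "1 / 4 ^ k \<le> fact k / real k ^ k" using assms(2) by (simp add: field_simps)
  also have "fact k / real k ^ k = (\<Prod>j < k. (real k - real j) / real k)"
  proof -
    have "fact k = (\<Prod>j < k. real (k - j))"
      by (subst fact_prod_rev) (simp add: atLeast0LessThan)
    also have "\<dots> = (\<Prod>j < k. real k - real j)" by (intro prod.cong) auto
    finally show ?thesis by (simp add: prod_dividef)
  qed
  \<comment> \<open>Dropping the factors from \<open>i\<close> on can only enlarge the product, as
    they lie between 0 and 1.\<close>
  also have "\<dots> \<le> (\<Prod>j < i. (real k - real j) / real k)"
  proof -
    have "(\<Prod>j < k. (real k - real j) / real k) =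
        (\<Prod>j < i. (real k - real j) / real k) * (\<Prod>j \<in> {i..<k}. (real k - real j) / real k)"
      using assms(1) by (metis atLeast0LessThan prod.atLeastLessThan_concat zero_le)
    also have "\<dots> \<le> (\<Prod>j < i. (real k - real j) / real k) * 1"
      using assms by (intro mult_left_mono prod_le_1 prod_nonneg) (auto simp: field_simps)
    finally show ?thesis by simp
  qed
  finally show ?thesis .
qed

text \<open>The coloring is cut into \<open>R\<close> blocks of length \<open>N\<close>, one for
  each trial, and the first block is split off in the induction.\<close>

lemma prob_no_rainbow_trial:
  assumes "0 < k" "I \<subseteq> {..<N}" "card I \<le> k"
  shows "measure_pmf.prob (replicate_pmf (R * N) (pmf_of_set {..<k}))
     {xs. \<forall>\<tau> < R. \<not> inj_on (nth xs) ((+) (\<tau> * N) ` I)} \<le> (1 - 1 / 4 ^ k) ^ R"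
proof (induction R)
  case (Suc R)
  let ?p = "\<lambda>N. replicate_pmf N (pmf_of_set {..<k})"
  let ?bad = "\<lambda>R. {xs. \<forall>\<tau> < R. \<not> inj_on (nth xs) ((+) (\<tau> * N) ` I)}"
  have one: "measure_pmf.prob (?p N) {xs. \<not> inj_on (nth xs) I} \<le> 1 - 1 / 4 ^ k"
  proof -
    have "1 / 4 ^ k \<le> measure_pmf.prob (?p N) {xs. inj_on (nth xs) I}"
      using rainbow_bound[OF assms(3,1)] prob_rainbow[OF assms(1,2), of "{}"] assms(3) by simp
    moreover have "measure_pmf.prob (?p N) {xs. \<not> inj_on (nth xs) I} =
        1 - measure_pmf.prob (?p N) {xs. inj_on (nth xs) I}"
      using measure_pmf.prob_compl[of "{xs. inj_on (nth xs) I}" "?p N"]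
      by (simp add: Compl_eq_Diff_UNIV[symmetric] Collect_neg_eq)
    ultimately show ?thesis by simp
  qed
  \<comment> \<open>Bounding the indicator by a product of functions of the two pieces makes the
    double expectation factor.\<close>
  have split: "indicator (?bad (Suc R)) (xs @ ys) \<le>
      (indicator {xs. \<not> inj_on (nth xs) I} xs * indicator (?bad R) ys :: real)"
    if "length xs = N" for xs ys :: "nat list"
  proof -
    have "xs \<in> {xs. \<not> inj_on (nth xs) I} \<and> ys \<in> ?bad R" if bad: "xs @ ys \<in> ?bad (Suc R)"
    proof
      have "\<not> inj_on (nth (xs @ ys)) ((+) (0 * N) ` I)" using bad by blast
      moreover have "(xs @ ys) ! i = xs ! i" if "i \<in> I" for i
        using that assms(2) \<open>length xs = N\<close> by (auto simp: nth_append)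
      ultimately show "xs \<in> {xs. \<not> inj_on (nth xs) I}" by (simp add: inj_on_def)
      show "ys \<in> ?bad R"
      proof (intro CollectI allI impI)
        fix \<tau> assume "\<tau> < R"
        then have "\<not> inj_on (nth (xs @ ys)) ((+) (Suc \<tau> * N) ` I)" using bad by blast
        moreover have "(xs @ ys) ! (Suc \<tau> * N + i) = ys ! (\<tau> * N + i)" for i
          using \<open>length xs = N\<close> by (simp add: nth_append)
        ultimately show "\<not> inj_on (nth ys) ((+) (\<tau> * N) ` I)" by (simp add: inj_on_def)
      qed
    qed
    then show ?thesis by (auto simp: indicator_def)
  qed
  have "measure_pmf.prob (?p (Suc R * N)) (?bad (Suc R)) =
      measure_pmf.expectation (?p N) (\<lambda>xs. measure_pmf.expectation (?p (R * N))
        (\<lambda>ys. indicator (?bad (Suc R)) (xs @ ys)))"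
    by (simp add: replicate_pmf_distrib prob_bind_pmf)
  also have "\<dots> \<le> measure_pmf.expectation (?p N) (\<lambda>xs. measure_pmf.expectation (?p (R * N))
        (\<lambda>ys. indicator {xs. \<not> inj_on (nth xs) I} xs * indicator (?bad R) ys))"
  proof (intro integral_mono_AE integrable_unit_interval expectation_unit_interval)
    show "AE xs in ?p N. measure_pmf.expectation (?p (R * N)) (\<lambda>ys. indicator (?bad (Suc R)) (xs @ ys) :: real)
       \<le> measure_pmf.expectation (?p (R * N))
        (\<lambda>ys. indicator {xs. \<not> inj_on (nth xs) I} xs * indicator (?bad R) ys)"
    proof (subst AE_measure_pmf_iff, intro ballI)
      fix xs assume "xs \<in> set_pmf (?p N)"
      then have "length xs = N" by (simp add: set_replicate_pmf)
      then show "measure_pmf.expectation (?p (R * N)) (\<lambda>ys. indicator (?bad (Suc R)) (xs @ ys) :: real)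
       \<le> measure_pmf.expectation (?p (R * N))
        (\<lambda>ys. indicator {xs. \<not> inj_on (nth xs) I} xs * indicator (?bad R) ys)"
        using split by (intro integral_mono integrable_unit_interval) (auto simp: indicator_def)
    qed
  qed (auto simp: indicator_def)
  also have "\<dots> = measure_pmf.prob (?p N) {xs. \<not> inj_on (nth xs) I} * measure_pmf.prob (?p (R * N)) (?bad R)"
    by simp
  also have "\<dots> \<le> (1 - 1 / 4 ^ k) * (1 - 1 / 4 ^ k) ^ R"
    by (intro mult_mono one Suc.IH) auto
  finally show ?case by simp
qed simp

text \<open>The number of trials makes the failure probability for one vertex at most
  \<open>exp (- real ((\<alpha> + 1) * L))\<close>, where \<open>2 ^ L\<close> exceeds
  \<open>n\<close>; the union bound over at most \<open>n\<close> vertices uses up one of the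
  \<open>\<alpha> + 1\<close> factors \<open>1 / n\<close>.\<close>

lemma prob_rainbow_trials:
  assumes "0 < k" "finite S" "card S \<le> n" "0 < n" "n < 2 ^ L"
    and I: "\<And>v. v \<in> S \<Longrightarrow> I v \<subseteq> {..<N} \<and> card (I v) \<le> k"
    and R: "R = 4 ^ k * (\<alpha> + 1) * L"
  shows "1 - 1 / real n ^ \<alpha> \<le> measure_pmf.prob (replicate_pmf (R * N) (pmf_of_set {..<k}))
     {xs. \<forall>v \<in> S. \<exists>\<tau> < R. inj_on (nth xs) ((+) (\<tau> * N) ` I v)}"
proof -
  let ?p = "replicate_pmf (R * N) (pmf_of_set {..<k})"
  let ?bad = "\<lambda>v. {xs. \<forall>\<tau> < R. \<not> inj_on (nth xs) ((+) (\<tau> * N) ` I v)}"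
  have "(1 - 1 / 4 ^ k) ^ R \<le> exp (- (1 / 4 ^ k) :: real) ^ R"
    using exp_ge_add_one_self[of "- (1 / 4 ^ k) :: real"] by (intro power_mono) (auto simp: field_simps)
  also have "\<dots> = exp (- (real R / 4 ^ k))" by (simp add: exp_of_nat_mult[symmetric])
  also have "real R / 4 ^ k = real ((\<alpha> + 1) * L)" unfolding R by (simp only: of_nat_mult mult.assoc) simp
  also have "exp (- real ((\<alpha> + 1) * L)) = 1 / (exp 1 ^ L) ^ (\<alpha> + 1)"
  proof -
    have "exp (real m) = exp 1 ^ m" for m by (metis exp_of_nat_mult mult.right_neutral)
    then show ?thesis
      by (simp only: exp_minus power_mult[symmetric] inverse_eq_divide mult.commute)
  qed
  also have "\<dots> \<le> 1 / real n ^ (\<alpha> + 1)"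
  proof -
    have "real n \<le> 2 ^ L" using assms(5) by (metis less_imp_le of_nat_le_iff of_nat_numeral of_nat_power)
    also have "(2::real) ^ L \<le> exp 1 ^ L"
      using exp_ge_add_one_self[of 1] by (intro power_mono) auto
    finally show ?thesis using assms(4) by (intro divide_left_mono power_mono mult_pos_pos) auto
  qed
  finally have b: "(1 - 1 / 4 ^ k :: real) ^ R \<le> 1 / real n ^ (\<alpha> + 1)" .
  have "measure_pmf.prob ?p (\<Union>v \<in> S. ?bad v) \<le> (\<Sum>v \<in> S. measure_pmf.prob ?p (?bad v))"
    using assms(2) by (intro measure_pmf.finite_measure_subadditive_finite) auto
  also have "\<dots> \<le> (\<Sum>v \<in> S. 1 / real n ^ (\<alpha> + 1))"
    using prob_no_rainbow_trial[OF assms(1)] I b by (intro sum_mono) (meson order_trans)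
  also have "\<dots> = real (card S) * (1 / real n ^ (\<alpha> + 1))" by simp
  also have "\<dots> \<le> real n * (1 / real n ^ (\<alpha> + 1))"
    using assms(3) by (intro mult_right_mono) auto
  also have "\<dots> = 1 / real n ^ \<alpha>" using assms(4) by simp
  finally have "measure_pmf.prob ?p (\<Union>v \<in> S. ?bad v) \<le> 1 / real n ^ \<alpha>" .
  moreover have "measure_pmf.prob ?p (- (\<Union>v \<in> S. ?bad v)) = 1 - measure_pmf.prob ?p (\<Union>v \<in> S. ?bad v)"
    using measure_pmf.prob_compl[of "\<Union>v \<in> S. ?bad v" ?p] by (simp add: Compl_eq_Diff_UNIV)
  ultimately have "1 - 1 / real n ^ \<alpha> \<le> measure_pmf.prob ?p (- (\<Union>v \<in> S. ?bad v))"
    by linarith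
  also have "- (\<Union>v \<in> S. ?bad v) = {xs. \<forall>v \<in> S. \<exists>\<tau> < R. inj_on (nth xs) ((+) (\<tau> * N) ` I v)}"
    by auto
  finally show ?thesis .
qed

section \<open>A structured language for the RAM\<close>

lemma ram_run_add: "ram_run w (a + b) cfg = bind_pmf (ram_run w a cfg) (ram_run w b)"
  by (induction a arbitrary: cfg)
    (auto simp: bind_return_pmf bind_assoc_pmf intro!: bind_pmf_cong)

lemma ram_run_Nil: "ram_run w t ([], s) = return_pmf ([], s)"
  by (induction t) (simp_all add: bind_return_pmf)

text \<open>For code without random choices. The rest \<open>K\<close> of the stack is arbitrary so
  that runs can be composed, and the number of steps is exact, as \<open>ram_run\<close> is indexed
  by it.\<close>

definition runs :: "nat \<Rightarrow> com \<Rightarrow> ram_state \<Rightarrow> nat \<Rightarrow> ram_state \<Rightarrow> bool" where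
  "runs w c s t s' \<longleftrightarrow> (\<forall>K. ram_run w t (c # K, s) = return_pmf (K, s'))"

lemma runs_Const: "runs w (Const r x) (R, M) 1 (R(r := x mod 2 ^ w), M)"
  by (simp add: runs_def bind_return_pmf)

lemma runs_Arith:
  "runs w (Arith r f a b) (R, M) 1 (R(r := binop_sem f (R a) (R b) mod 2 ^ w), M)"
  by (simp add: runs_def bind_return_pmf)

lemma runs_Load: "runs w (Load r a) (R, M) 1 (R(r := M (R a)), M)"
  by (simp add: runs_def bind_return_pmf)

lemma runs_Store: "runs w (Store a r) (R, M) 1 (R, M(R a := R r))"
  by (simp add: runs_def bind_return_pmf)

lemma runs_Seq:
  assumes "runs w c s t s'" "runs w d s' t' s''"
  shows "runs w (Seq c d) s (t + t' + 1) s''"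
  using assms by (simp add: runs_def ram_run_add bind_return_pmf)

lemma runs_Cond:
  assumes "runs w (if R r \<noteq> 0 then c else d) (R, M) t s'"
  shows "runs w (Cond r c d) (R, M) (t + 1) s'"
  using assms by (simp add: runs_def bind_return_pmf)

lemma runs_Loop_exit: "R r = 0 \<Longrightarrow> runs w (Loop r c) (R, M) 1 (R, M)"
  by (simp add: runs_def bind_return_pmf)

lemma runs_Loop_step:
  assumes "R r \<noteq> 0" "runs w c (R, M) t s'" "runs w (Loop r c) s' t' s''"
  shows "runs w (Loop r c) (R, M) (t + t' + 1) s''"
  using assms by (simp add: runs_def ram_run_add bind_return_pmf)

section \<open>Expressions and statements, and their compilation\<close>

datatype aexp = Num nat | Var nat | Bin binop aexp aexp | Arr nat aexp

datatype stmt =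
    Skip
  | Assign nat aexp
  | Update nat aexp aexp
  | Then stmt stmt
  | IfNZ aexp stmt stmt
  | For nat aexp stmt

type_synonym st = "(nat \<Rightarrow> nat) \<times> (nat \<Rightarrow> nat \<Rightarrow> nat)"

fun set_var :: "nat \<Rightarrow> nat \<Rightarrow> st \<Rightarrow> st" where
  "set_var x y (v, arr) = (v(x := y), arr)"

fun set_arr :: "nat \<Rightarrow> nat \<Rightarrow> nat \<Rightarrow> st \<Rightarrow> st" where
  "set_arr a i y (v, arr) = (v, arr(a := (arr a)(i := y)))"

primrec eval :: "aexp \<Rightarrow> st \<Rightarrow> nat" where
  "eval (Num c) s = c"
| "eval (Var x) s = fst s x"
| "eval (Bin f a b) s = binop_sem f (eval a s) (eval b s)"
| "eval (Arr a e) s = snd s a (eval e s)"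

primrec sem :: "stmt \<Rightarrow> st \<Rightarrow> st" where
  "sem Skip s = s"
| "sem (Assign x e) s = set_var x (eval e s) s"
| "sem (Update a i e) s = set_arr a (eval i s) (eval e s) s"
| "sem (Then c d) s = sem d (sem c s)"
| "sem (IfNZ e c d) s = (if eval e s \<noteq> 0 then sem c s else sem d s)"
| "sem (For x e c) s = fold (\<lambda>i s. sem c (set_var x i s)) [0..<eval e s] s"

text \<open>Register 0 holds the start of the work area, where the arrays 1 to 8 are interleaved, so
  that none of them needs a size; array 0 is the input area in front of it. Variables are the
  registers below \<open>nregs\<close>, the registers above serve as temporaries.\<close>

definition nregs :: nat where "nregs = 40"

definition addr :: "nat \<Rightarrow> nat \<Rightarrow> nat \<Rightarrow> nat" where
  "addr B a i = (if a = 0 then i else B + (8 * i + (a - 1)))"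

definition comp_addr :: "nat \<Rightarrow> nat \<Rightarrow> com" where
  "comp_addr a t = (if a = 0 then Const (Suc t) 0 else
     Seq (Const (Suc t) 8) (Seq (Arith t Mul t (Suc t)) (Seq (Const (Suc t) (a - 1))
       (Seq (Arith t Add t (Suc t)) (Arith t Add t 0)))))"

primrec comp_aexp :: "aexp \<Rightarrow> nat \<Rightarrow> com" where
  "comp_aexp (Num c) t = Const t c"
| "comp_aexp (Var x) t = Seq (Const t 0) (Arith t Add t x)"
| "comp_aexp (Bin f a b) t =
     Seq (comp_aexp a t) (Seq (comp_aexp b (Suc t)) (Arith t f t (Suc t)))"
| "comp_aexp (Arr a e) t = Seq (comp_aexp e t) (Seq (comp_addr a t) (Load t t))"

text \<open>There is no move instruction, so a register is copied by clearing the target and adding.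
  A loop counts down in \<open>t\<close> and up in \<open>t + 1\<close>, hence the temporaries of
  its body start at \<open>t + 2\<close>.\<close>

primrec comp :: "stmt \<Rightarrow> nat \<Rightarrow> com" where
  "comp Skip t = Const t 0"
| "comp (Assign x e) t = Seq (comp_aexp e t) (Seq (Const x 0) (Arith x Add x t))"
| "comp (Update a i e) t =
     Seq (comp_aexp i t) (Seq (comp_addr a t) (Seq (comp_aexp e (Suc t)) (Store t (Suc t))))"
| "comp (Then c d) t = Seq (comp c t) (comp d t)"
| "comp (IfNZ e c d) t = Seq (comp_aexp e t) (Cond t (comp c t) (comp d t))"
| "comp (For x e c) t = Seq (comp_aexp e t) (Seq (Const (t + 1) 0)
     (Loop t (Seq (Const x 0) (Seq (Arith x Add x (t + 1)) (Seq (comp c (t + 2))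
       (Seq (Const (t + 2) 1) (Seq (Arith (t + 1) Add (t + 1) (t + 2))
         (Arith t Sub t (t + 2)))))))))"

definition cost_addr :: "nat \<Rightarrow> nat" where
  "cost_addr a = (if a = 0 then 1 else 9)"

primrec cost_aexp :: "aexp \<Rightarrow> nat" where
  "cost_aexp (Num c) = 1"
| "cost_aexp (Var x) = 3"
| "cost_aexp (Bin f a b) = cost_aexp a + cost_aexp b + 3"
| "cost_aexp (Arr a e) = cost_aexp e + cost_addr a + 3"

text \<open>Loop bounds are evaluated in the initial state; this is an upper bound on the running time
  for statements which do not modify the variables occurring in loop bounds.\<close>

primrec cost :: "stmt \<Rightarrow> st \<Rightarrow> nat" where
  "cost Skip s = 1"
| "cost (Assign x e) s = cost_aexp e + 4"
| "cost (Update a i e) s = cost_aexp i + cost_addr a + cost_aexp e + 4"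
| "cost (Then c d) s = cost c s + cost d s + 1"
| "cost (IfNZ e c d) s = cost_aexp e + 2 + max (cost c s) (cost d s)"
| "cost (For x e c) s = cost_aexp e + 4 + eval e s * (cost c s + 11)"

text \<open>An exponent: with all stored values at most \<open>U\<close>, an expression evaluates to
  at most \<open>U ^ leaves e\<close>, since sums and products of such powers are bounded by their
  product. The 3 makes room for the computation of an address.\<close>

primrec leaves :: "aexp \<Rightarrow> nat" where
  "leaves (Num c) = 1"
| "leaves (Var x) = 1"
| "leaves (Bin f a b) = leaves a + leaves b"
| "leaves (Arr a e) = leaves e + 3"

primrec width :: "stmt \<Rightarrow> nat" where
  "width Skip = 0"
| "width (Assign x e) = leaves e"
| "width (Update a i e) = leaves i + 3 + leaves e"
| "width (Then c d) = max (width c) (width d)"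
| "width (IfNZ e c d) = max (leaves e) (max (width c) (width d))"
| "width (For x e c) = max (leaves e) (width c)"

primrec exp_vars :: "aexp \<Rightarrow> nat set" where
  "exp_vars (Num c) = {}"
| "exp_vars (Var x) = {x}"
| "exp_vars (Bin f a b) = exp_vars a \<union> exp_vars b"
| "exp_vars (Arr a e) = exp_vars e"

primrec exp_arrs :: "aexp \<Rightarrow> nat set" where
  "exp_arrs (Num c) = {}"
| "exp_arrs (Var x) = {}"
| "exp_arrs (Bin f a b) = exp_arrs a \<union> exp_arrs b"
| "exp_arrs (Arr a e) = insert a (exp_arrs e)"

primrec mods :: "stmt \<Rightarrow> nat set" where
  "mods Skip = {}"
| "mods (Assign x e) = {x}"
| "mods (Update a i e) = {}"
| "mods (Then c d) = mods c \<union> mods d"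
| "mods (IfNZ e c d) = mods c \<union> mods d"
| "mods (For x e c) = insert x (mods c)"

primrec upds :: "stmt \<Rightarrow> nat set" where
  "upds Skip = {}"
| "upds (Assign x e) = {}"
| "upds (Update a i e) = {a}"
| "upds (Then c d) = upds c \<union> upds d"
| "upds (IfNZ e c d) = upds c \<union> upds d"
| "upds (For x e c) = upds c"

primrec bound_vars :: "stmt \<Rightarrow> nat set" where
  "bound_vars Skip = {}"
| "bound_vars (Assign x e) = {}"
| "bound_vars (Update a i e) = {}"
| "bound_vars (Then c d) = bound_vars c \<union> bound_vars d"
| "bound_vars (IfNZ e c d) = bound_vars c \<union> bound_vars d"
| "bound_vars (For x e c) = exp_vars e \<union> bound_vars c"

text \<open>A loop bound that reads an array could change through updates; otherwise
  \<open>cost\<close> depends on the variables in the bounds only.\<close>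

primrec pure_bounds :: "stmt \<Rightarrow> bool" where
  "pure_bounds Skip \<longleftrightarrow> True"
| "pure_bounds (Assign x e) \<longleftrightarrow> True"
| "pure_bounds (Update a i e) \<longleftrightarrow> True"
| "pure_bounds (Then c d) \<longleftrightarrow> pure_bounds c \<and> pure_bounds d"
| "pure_bounds (IfNZ e c d) \<longleftrightarrow> pure_bounds c \<and> pure_bounds d"
| "pure_bounds (For x e c) \<longleftrightarrow> exp_arrs e = {} \<and> pure_bounds c"

primrec safe_aexp :: "nat \<Rightarrow> nat \<Rightarrow> aexp \<Rightarrow> st \<Rightarrow> bool" where
  "safe_aexp U B (Num c) s \<longleftrightarrow> c \<le> U"
| "safe_aexp U B (Var x) s \<longleftrightarrow> x < nregs"
| "safe_aexp U B (Bin f a b) s \<longleftrightarrow> safe_aexp U B a s \<and> safe_aexp U B b s"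
| "safe_aexp U B (Arr a e) s \<longleftrightarrow> safe_aexp U B e s \<and> a \<le> 8 \<and> (a = 0 \<longrightarrow> eval e s < B)"

text \<open>Every stored value is at most \<open>U\<close>, so that arithmetic modulo
  \<open>2 ^ w\<close> is exact for large \<open>w\<close>. Register 0 is never assigned, and array
  0 is accessed only below \<open>B\<close>, where the interleaved arrays have not begun.\<close>

primrec safe :: "nat \<Rightarrow> nat \<Rightarrow> stmt \<Rightarrow> st \<Rightarrow> bool" where
  "safe U B Skip s \<longleftrightarrow> True"
| "safe U B (Assign x e) s \<longleftrightarrow> 0 < x \<and> x < nregs \<and> safe_aexp U B e s \<and> eval e s \<le> U"
| "safe U B (Update a i e) s \<longleftrightarrow> a \<le> 8 \<and> safe_aexp U B i s \<and> (a = 0 \<longrightarrow> eval i s < B) \<and>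
     safe_aexp U B e s \<and> eval e s \<le> U"
| "safe U B (Then c d) s \<longleftrightarrow> safe U B c s \<and> safe U B d (sem c s)"
| "safe U B (IfNZ e c d) s \<longleftrightarrow>
     safe_aexp U B e s \<and> (if eval e s \<noteq> 0 then safe U B c s else safe U B d s)"
| "safe U B (For x e c) s \<longleftrightarrow> 0 < x \<and> x < nregs \<and> safe_aexp U B e s \<and> eval e s \<le> U \<and>
     (\<forall>i < eval e s.
        safe U B c (set_var x i (fold (\<lambda>i s. sem c (set_var x i s)) [0..<i] s)))"

definition represents :: "nat \<Rightarrow> ram_state \<Rightarrow> st \<Rightarrow> bool" where
  "represents B S s \<longleftrightarrow> (\<forall>x < nregs. fst S x = fst s x) \<and> (\<forall>i < B. snd S i = snd s 0 i) \<and>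
     (\<forall>a \<in> {1..8}. \<forall>i. snd S (addr B a i) = snd s a i)"

definition bounded :: "nat \<Rightarrow> st \<Rightarrow> bool" where
  "bounded U s \<longleftrightarrow> (\<forall>x < nregs. fst s x \<le> U) \<and> (\<forall>a i. snd s a i \<le> U)"

lemma fst_set_var [simp]: "fst (set_var x y s) = (fst s)(x := y)"
  by (cases s) simp

lemma snd_set_var [simp]: "snd (set_var x y s) = snd s"
  by (cases s) simp

lemma fst_set_arr [simp]: "fst (set_arr a i y s) = fst s"
  by (cases s) simp

lemma snd_set_arr [simp]: "snd (set_arr a i y s) = (snd s)(a := (snd s a)(i := y))"
  by (cases s) simp

lemma leaves_pos: "0 < leaves e"
  by (induction e) auto

lemma add_le_mult:
  fixes a b :: nat
  assumes "2 \<le> a" "2 \<le> b"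
  shows "a + b \<le> a * b"
proof -
  obtain c d where "a = c + 2" "b = d + 2"
    using assms by (metis le_Suc_ex add.commute)
  then show ?thesis by (simp add: algebra_simps)
qed

lemma eval_le:
  assumes "bounded U s" "safe_aexp U B e s" "2 \<le> U"
  shows "eval e s \<le> U ^ leaves e"
  using assms(2)
proof (induction e)
  case (Bin f a b)
  have *: "2 \<le> U ^ leaves a" "2 \<le> U ^ leaves b"
    using assms(3) leaves_pos[of a] leaves_pos[of b]
    by (metis (no_types) Suc_leI le_trans one_le_numeral power_increasing power_one_right
        self_le_power)+
  have A: "eval a s \<le> U ^ leaves a" and B: "eval b s \<le> U ^ leaves b"
    using Bin by auto
  have "U ^ leaves a * 1 \<le> U ^ leaves a * U ^ leaves b"
    using * by (intro mult_le_mono) auto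
  with A have 1: "eval a s \<le> U ^ leaves a * U ^ leaves b" by linarith
  show ?case
  proof (cases f)
    case Add
    have "eval a s + eval b s \<le> U ^ leaves a * U ^ leaves b"
      using A B add_le_mult[OF *] by linarith
    then show ?thesis using Add by (simp add: power_add)
  next
    case Sub
    then show ?thesis using 1 by (simp add: power_add)
  next
    case Mul
    then show ?thesis using A B by (simp add: power_add mult_le_mono)
  next
    case Div
    have "eval a s div eval b s \<le> eval a s" by simp
    from le_trans[OF this 1] Div show ?thesis by (simp add: power_add)
  next
    case Mod
    have "eval a s mod eval b s \<le> eval a s" by simp
    from le_trans[OF this 1] Mod show ?thesis by (simp add: power_add)
  qed
next
  case (Arr a e)
  have "snd s a (eval e s) \<le> U ^ 1" using assms(1) by (simp add: bounded_def)
  also have "\<dots> \<le> U ^ leaves (Arr a e)" using assms(3) by (intro power_increasing) auto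
  finally show ?case by simp
qed (use assms in \<open>auto simp: bounded_def\<close>)

lemma addr_le:
  fixes i U l B a :: nat
  assumes "i \<le> U ^ l" "16 \<le> U" "B \<le> U" "a \<le> 8" "0 < l"
  shows "8 * i + 15 + B \<le> U ^ (l + 3)"
proof -
  have "U \<le> U ^ l" using assms by (intro self_le_power) auto
  \<comment> \<open>Eight powers for \<open>8 * i\<close>, one for 15 and one for \<open>B\<close>;
    the assumption \<open>16 \<le> U\<close> absorbs these ten.\<close>
  then have "8 * i + 15 + B \<le> 10 * U ^ l"
    using assms by linarith
  also have "\<dots> \<le> U * U ^ l" using assms by simp
  also have "\<dots> \<le> U ^ (l + 3)" using assms by (simp add: power_add power3_eq_cube)
  finally show ?thesis .
qed

lemma comp_addr_runs:
  assumes "8 * R t + 15 + B < 2 ^ w" "a = 0 \<or> R 0 = B" "a \<le> 8" "0 < t"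
  shows "\<exists>R'. runs w (comp_addr a t) (R, M) (cost_addr a) (R', M) \<and> R' t = addr B a (R t) \<and>
     (\<forall>x < t. R' x = R x)"
proof (cases "a = 0")
  case True
  then show ?thesis using runs_Const[of w "Suc t" 0 R M]
    by (auto simp: comp_addr_def cost_addr_def addr_def intro!: exI[of _ "R(Suc t := 0 mod 2 ^ w)"])
next
  case False
  define R1 where "R1 = R(Suc t := 8 mod 2 ^ w)"
  define R2 where "R2 = R1(t := binop_sem Mul (R1 t) (R1 (Suc t)) mod 2 ^ w)"
  define R3 where "R3 = R2(Suc t := (a - 1) mod 2 ^ w)"
  define R4 where "R4 = R3(t := binop_sem Add (R3 t) (R3 (Suc t)) mod 2 ^ w)"
  define R5 where "R5 = R4(t := binop_sem Add (R4 t) (R4 0) mod 2 ^ w)"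
  have h1: "runs w (Const (Suc t) 8) (R, M) 1 (R1, M)" unfolding R1_def by (rule runs_Const)
  have h2: "runs w (Arith t Mul t (Suc t)) (R1, M) 1 (R2, M)" unfolding R2_def by (rule runs_Arith)
  have h3: "runs w (Const (Suc t) (a - 1)) (R2, M) 1 (R3, M)" unfolding R3_def by (rule runs_Const)
  have h4: "runs w (Arith t Add t (Suc t)) (R3, M) 1 (R4, M)" unfolding R4_def by (rule runs_Arith)
  have h5: "runs w (Arith t Add t 0) (R4, M) 1 (R5, M)" unfolding R5_def by (rule runs_Arith)
  have "runs w (comp_addr a t) (R, M) (1 + (1 + (1 + (1 + 1 + 1) + 1) + 1) + 1) (R5, M)"
    using runs_Seq[OF h1 runs_Seq[OF h2 runs_Seq[OF h3 runs_Seq[OF h4 h5]]]] False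
    by (simp add: comp_addr_def)
  moreover have "R5 t = addr B a (R t)" "\<forall>x < t. R5 x = R x"
    using assms False by (auto simp: R5_def R4_def R3_def R2_def R1_def addr_def)
  ultimately show ?thesis using False
    by (intro exI[of _ R5]) (auto simp: cost_addr_def eval_nat_numeral)
qed

text \<open>Register 0 may differ from \<open>B\<close> if the expression reads the input only; this
  covers the computation of \<open>B\<close> itself.\<close>

lemma comp_aexp_runs:
  assumes "represents B (R, M) s" "bounded U s" "safe_aexp U B e s" "16 \<le> U" "B \<le> U"
    "U ^ leaves e < 2 ^ w" "exp_arrs e \<subseteq> {0} \<or> R 0 = B" "nregs \<le> t"
  shows "\<exists>R'. runs w (comp_aexp e t) (R, M) (cost_aexp e) (R', M) \<and> R' t = eval e s \<and>
     (\<forall>x < t. R' x = R x)"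
  using assms
proof (induction e arbitrary: R t)
  case (Num c)
  have "c < 2 ^ w" using Num by simp
  define R1 where "R1 = R(t := c)"
  have "runs w (comp_aexp (Num c) t) (R, M) (cost_aexp (Num c)) (R1, M)"
    using runs_Const[of w t c R M] \<open>c < 2 ^ w\<close> by (simp add: R1_def)
  moreover have "R1 t = c" "\<forall>x < t. R1 x = R x" by (simp_all add: R1_def)
  ultimately show ?case by (intro exI[of _ R1]) auto
next
  case (Var x)
  have x: "x < nregs" "R x = fst s x" using Var by (auto simp: represents_def)
  have "fst s x < 2 ^ w" using Var x by (auto simp: bounded_def intro: le_less_trans)
  moreover have "runs w (comp_aexp (Var x) t) (R, M) (1 + 1 + 1)
     ((R(t := 0 mod 2 ^ w))(t := binop_sem Add ((R(t := 0 mod 2 ^ w)) t)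
        ((R(t := 0 mod 2 ^ w)) x) mod 2 ^ w), M)"
    unfolding comp_aexp.simps by (rule runs_Seq runs_Const runs_Arith)+
  ultimately show ?case using x Var.prems(8)
    by (auto simp: eval_nat_numeral intro!: exI[of _ "R(t := fst s x)"])
next
  case (Bin f a b)
  have "2 \<le> U" using Bin.prems by simp
  have "leaves a \<le> leaves (Bin f a b)" "leaves b \<le> leaves (Bin f a b)" by auto
  then have la: "U ^ leaves a < 2 ^ w" "U ^ leaves b < 2 ^ w"
    using Bin.prems(6) \<open>2 \<le> U\<close>
    by (meson le_less_trans le_trans one_le_numeral power_increasing)+
  obtain R1 where R1: "runs w (comp_aexp a t) (R, M) (cost_aexp a) (R1, M)" "R1 t = eval a s"
    "\<forall>x < t. R1 x = R x"
    using Bin.IH(1)[of R t] Bin.prems la by auto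
  have "0 < t" using Bin.prems(8) by (simp add: nregs_def)
  have "represents B (R1, M) s" using Bin.prems(1,8) R1(3) by (auto simp: represents_def)
  moreover have "exp_arrs b \<subseteq> {0} \<or> R1 0 = B" using Bin.prems(7) R1(3) \<open>0 < t\<close> by auto
  ultimately obtain R2 where R2: "runs w (comp_aexp b (Suc t)) (R1, M) (cost_aexp b) (R2, M)"
    "R2 (Suc t) = eval b s" "\<forall>x < Suc t. R2 x = R1 x"
    using Bin.IH(2)[of R1 "Suc t"] Bin.prems la by auto
  have le: "eval (Bin f a b) s < 2 ^ w"
    using eval_le[OF Bin.prems(2,3) \<open>2 \<le> U\<close>] Bin.prems(6) by linarith
  define R3 where "R3 = R2(t := binop_sem f (R2 t) (R2 (Suc t)) mod 2 ^ w)"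
  have "runs w (comp_aexp (Bin f a b) t) (R, M) (cost_aexp a + (cost_aexp b + 1 + 1) + 1) (R3, M)"
    unfolding comp_aexp.simps R3_def by (rule runs_Seq R1 R2 runs_Arith)+
  moreover have "R2 t = eval a s" using R2(3) R1(2) by auto
  then have "R3 t = eval (Bin f a b) s" "\<forall>x < t. R3 x = R x"
    using le R2 R1(3) by (auto simp: R3_def)
  ultimately show ?case
    by (intro exI[of _ R3]) (auto simp: eval_nat_numeral)
next
  case (Arr a e)
  have "2 \<le> U" using Arr.prems by simp
  have "leaves e \<le> leaves (Arr a e)" by auto
  then have la: "U ^ leaves e < 2 ^ w"
    using Arr.prems(6) \<open>2 \<le> U\<close>
    by (meson le_less_trans le_trans one_le_numeral power_increasing)
  obtain R1 where R1: "runs w (comp_aexp e t) (R, M) (cost_aexp e) (R1, M)" "R1 t = eval e s"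
    "\<forall>x < t. R1 x = R x"
    using Arr.IH[of R t] Arr.prems la by auto
  have "0 < t" using Arr.prems(8) by (simp add: nregs_def)
  have "8 * eval e s + 15 + B \<le> U ^ (leaves e + 3)"
    using Arr.prems eval_le[OF Arr.prems(2) _ \<open>2 \<le> U\<close>] leaves_pos
    by (intro addr_le[of _ _ _ _ a]) auto
  then have *: "8 * R1 t + 15 + B < 2 ^ w" using Arr.prems(6) R1(2) by simp
  have a: "a = 0 \<or> R1 0 = B" "a \<le> 8" using Arr.prems R1(3) \<open>0 < t\<close> by auto
  obtain R2 where R2: "runs w (comp_addr a t) (R1, M) (cost_addr a) (R2, M)"
    "R2 t = addr B a (R1 t)" "\<forall>x < t. R2 x = R1 x"
    using comp_addr_runs[OF * a \<open>0 < t\<close>] by blast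
  define R3 where "R3 = R2(t := M (R2 t))"
  have "runs w (comp_aexp (Arr a e) t) (R, M) (cost_aexp e + (cost_addr a + 1 + 1) + 1) (R3, M)"
    unfolding comp_aexp.simps R3_def by (rule runs_Seq R1 R2 runs_Load)+
  moreover have **: "M (R2 t) = eval (Arr a e) s"
  proof (cases "a = 0")
    case True
    then show ?thesis using Arr.prems(1,3) R2(2) R1(2) by (auto simp: represents_def addr_def)
  next
    case False
    then show ?thesis using Arr.prems(1,3) R2(2) R1(2) by (auto simp: represents_def)
  qed
  have "R3 t = eval (Arr a e) s" "\<forall>x < t. R3 x = R x"
    using ** R2 R1(3) by (auto simp: R3_def)
  ultimately show ?case
    by (intro exI[of _ R3]) (auto simp: eval_nat_numeral)
qed

lemma addr_inj:
  assumes "addr B a i = addr B a' i'" "a \<in> {1..8}" "a' \<in> {1..8}"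
  shows "a = a' \<and> i = i'"
proof -
  have *: "8 * i + (a - 1) = 8 * i' + (a' - 1)" using assms by (auto simp: addr_def)
  then have "(8 * i + (a - 1)) div 8 = (8 * i' + (a' - 1)) div 8" by simp
  then have "i = i'" using assms by auto
  then show ?thesis using * assms by auto
qed

lemma represents_set_var:
  "represents B (R, M) s \<Longrightarrow> R' x = y \<Longrightarrow> (\<forall>z < nregs. z \<noteq> x \<longrightarrow> R' z = R z) \<Longrightarrow>
    represents B (R', M) (set_var x y s)"
  by (auto simp: represents_def)

lemma represents_set_arr:
  assumes "represents B (R, M) s" "\<forall>z < nregs. R' z = R z" "a \<le> 8" "a = 0 \<longrightarrow> i < B"
  shows "represents B (R', M(addr B a i := y)) (set_arr a i y s)"
proof -
  have "addr B a' i' = addr B a i \<longleftrightarrow> a' = a \<and> i' = i" if "a' \<in> {1..8}" for a' i'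
  proof (cases "a = 0")
    case True
    then show ?thesis using that assms(4) by (auto simp: addr_def)
  next
    case False
    then show ?thesis using addr_inj[of B a' i' a i] that assms(3) by auto
  qed
  moreover have "i' = addr B a i \<longleftrightarrow> a = 0 \<and> i' = i" if "i' < B" for i'
    using that assms(4) by (auto simp: addr_def)
  ultimately show ?thesis using assms(1,2) by (auto simp: represents_def)
qed

lemma eval_cong:
  "exp_arrs e = {} \<Longrightarrow> \<forall>x \<in> exp_vars e. fst s x = fst s' x \<Longrightarrow> eval e s = eval e s'"
  by (induction e) auto

lemma cost_cong:
  "pure_bounds c \<Longrightarrow> \<forall>x \<in> bound_vars c. fst s x = fst s' x \<Longrightarrow> cost c s = cost c s'"
proof (induction c)
  case (For x e c)
  then have "eval e s = eval e s'" by (intro eval_cong) auto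
  then show ?case using For by auto
qed auto

lemma sem_frame: "x \<notin> mods c \<Longrightarrow> fst (sem c s) x = fst s x"
proof (induction c arbitrary: s)
  case (For y e c)
  have "fst (fold (\<lambda>i s. sem c (set_var y i s)) xs s) x = fst s x" for xs
    using For by (induction xs arbitrary: s) auto
  then show ?case by simp
qed auto

lemma sem_frame_arr: "a \<notin> upds c \<Longrightarrow> snd (sem c s) a = snd s a"
proof (induction c arbitrary: s)
  case (For y e c)
  have "snd (fold (\<lambda>i s. sem c (set_var y i s)) xs s) a = snd s a" for xs
    using For by (induction xs arbitrary: s) auto
  then show ?case by simp
qed auto

lemma power_less_mono:
  fixes U :: nat
  assumes "U ^ l < W" "l' \<le> l" "16 \<le> U"
  shows "U ^ l' < W"
  using assms by (meson le_less_trans le_trans one_le_numeral power_increasing)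

text \<open>The time is bounded by the cost in the initial state although the state changes, because
  no variable of a loop bound is modified. Registers from \<open>nregs\<close> up to
  \<open>t\<close> are preserved; they hold the counters of the surrounding loops.\<close>

lemma comp_runs:
  assumes "represents B (R, M) s" "bounded U s" "safe U B c s" "16 \<le> U" "B \<le> U"
    "U ^ width c < 2 ^ w" "R 0 = B" "nregs \<le> t" "pure_bounds c" "mods c \<inter> bound_vars c = {}"
    "16 < (2::nat) ^ w"
  shows "\<exists>R' M' \<tau>. runs w (comp c t) (R, M) \<tau> (R', M') \<and> \<tau> \<le> cost c s \<and>
     represents B (R', M') (sem c s) \<and> bounded U (sem c s) \<and> R' 0 = B \<and>
     (\<forall>x. nregs \<le> x \<longrightarrow> x < t \<longrightarrow> R' x = R x)"
  using assms
proof (induction c arbitrary: R M s t)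
  case Skip
  define R1 where "R1 = R(t := 0)"
  have "runs w (comp Skip t) (R, M) 1 (R1, M)"
    using runs_Const[of w t 0 R M] by (simp add: R1_def)
  moreover have "\<forall>x. x \<noteq> t \<longrightarrow> R1 x = R x" by (simp add: R1_def)
  ultimately show ?case using Skip.prems(1,2,7,8)
    by (intro exI3[of _ R1 M 1]) (auto simp: represents_def nregs_def)
next
  case (Assign x e)
  obtain R1 where R1: "runs w (comp_aexp e t) (R, M) (cost_aexp e) (R1, M)" "R1 t = eval e s"
    "\<forall>y < t. R1 y = R y"
    using comp_aexp_runs[OF Assign.prems(1,2) _ Assign.prems(4,5), of e w t] Assign.prems by auto
  define R2 where "R2 = R1(x := 0 mod 2 ^ w)"
  define R3 where "R3 = R2(x := binop_sem Add (R2 x) (R2 t) mod 2 ^ w)"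
  have "runs w (comp (Assign x e) t) (R, M) (cost_aexp e + (1 + 1 + 1) + 1) (R3, M)"
    unfolding comp.simps R3_def R2_def by (rule runs_Seq R1 runs_Const runs_Arith)+
  moreover have x: "x < t" "0 < x" "x < nregs" using Assign.prems by auto
  moreover have "leaves e \<noteq> 0" using leaves_pos[of e] by simp
  then have "eval e s < 2 ^ w"
    using Assign.prems(3,4,6) self_le_power[of U "leaves e"] leaves_pos[of e] by fastforce
  then have "R3 x = eval e s" "\<forall>y. y \<noteq> x \<longrightarrow> R3 y = R1 y"
    using R1 x by (auto simp: R3_def R2_def)
  ultimately show ?case
    using Assign.prems(1,2,3,7,8) R1
    by (intro exI3[of _ R3 M "cost_aexp e + (1 + 1 + 1) + 1"])
      (auto simp: bounded_def intro!: represents_set_var)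
next
  case (Update a i e)
  have i: "safe_aexp U B i s" "safe_aexp U B e s" "a \<le> 8" "a = 0 \<longrightarrow> eval i s < B"
    using Update.prems by auto
  have la: "U ^ leaves i < 2 ^ w" "U ^ leaves e < 2 ^ w" "U ^ (leaves i + 3) < 2 ^ w"
    using Update.prems(4,6) by (auto elim!: power_less_mono)
  obtain R1 where R1: "runs w (comp_aexp i t) (R, M) (cost_aexp i) (R1, M)" "R1 t = eval i s"
    "\<forall>y < t. R1 y = R y"
    using comp_aexp_runs[OF Update.prems(1,2) i(1) Update.prems(4,5) la(1), of t] Update.prems
    by auto
  have "0 < t" using Update.prems(8) by (simp add: nregs_def)
  have "2 \<le> U" using Update.prems(4) by simp
  have "8 * eval i s + 15 + B \<le> U ^ (leaves i + 3)"
    using Update.prems eval_le[OF Update.prems(2) i(1) \<open>2 \<le> U\<close>] leaves_pos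
    by (intro addr_le[of _ _ _ _ a]) auto
  then have *: "8 * R1 t + 15 + B < 2 ^ w" using la R1(2) by linarith
  have a: "a = 0 \<or> R1 0 = B" "a \<le> 8" using Update.prems R1(3) \<open>0 < t\<close> by auto
  obtain R2 where R2: "runs w (comp_addr a t) (R1, M) (cost_addr a) (R2, M)"
    "R2 t = addr B a (R1 t)" "\<forall>x < t. R2 x = R1 x"
    using comp_addr_runs[OF * a \<open>0 < t\<close>] by blast
  have r2: "represents B (R2, M) s"
    using Update.prems(1,8) R1(3) R2(3) by (auto simp: represents_def)
  have z2: "R2 0 = B" using R2(3) R1(3) \<open>0 < t\<close> Update.prems(7) by auto
  obtain R3 where R3: "runs w (comp_aexp e (Suc t)) (R2, M) (cost_aexp e) (R3, M)"
    "R3 (Suc t) = eval e s" "\<forall>y < Suc t. R3 y = R2 y"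
    using comp_aexp_runs[OF r2 Update.prems(2) i(2) Update.prems(4,5) la(2), of "Suc t"]
      Update.prems z2
    by auto
  define M1 where "M1 = M(R3 t := R3 (Suc t))"
  have "runs w (comp (Update a i e) t) (R, M)
     (cost_aexp i + (cost_addr a + (cost_aexp e + 1 + 1) + 1) + 1) (R3, M1)"
    unfolding comp.simps M1_def by (rule runs_Seq R1 R2 R3 runs_Store)+
  moreover have "represents B (R3, M1) (sem (Update a i e) s)"
    using R3 R2 R1(2) i(3,4) Update.prems(8) unfolding M1_def
    by (auto intro!: represents_set_arr[OF r2])
  ultimately show ?case
    using Update.prems(2,3,7) R1(3) R2(3) R3(3) \<open>0 < t\<close>
    by (intro exI3[of _ R3 M1 "cost_aexp i + (cost_addr a + (cost_aexp e + 1 + 1) + 1) + 1"])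
      (auto simp: bounded_def)
next
  case (Then c d)
  have la: "U ^ width c < 2 ^ w" "U ^ width d < 2 ^ w"
    using Then.prems(4,6) by (auto elim!: power_less_mono)
  obtain R1 M1 t1 where 1: "runs w (comp c t) (R, M) t1 (R1, M1)" "t1 \<le> cost c s"
     "represents B (R1, M1) (sem c s)" "bounded U (sem c s)" "R1 0 = B"
     "\<forall>x. nregs \<le> x \<longrightarrow> x < t \<longrightarrow> R1 x = R x"
    using Then.IH(1)[OF Then.prems(1,2) _ Then.prems(4,5) la(1) Then.prems(7,8)] Then.prems(3,9,10,11)
    by fastforce
  obtain R2 M2 t2 where 2: "runs w (comp d t) (R1, M1) t2 (R2, M2)" "t2 \<le> cost d (sem c s)"
     "represents B (R2, M2) (sem d (sem c s))" "bounded U (sem d (sem c s))" "R2 0 = B"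
     "\<forall>x. nregs \<le> x \<longrightarrow> x < t \<longrightarrow> R2 x = R1 x"
    using Then.IH(2)[OF 1(3,4) _ Then.prems(4,5) la(2) 1(5) Then.prems(8)] Then.prems(3,9,10,11)
    by fastforce
  \<comment> \<open>The loop bounds in \<open>d\<close> do not involve what \<open>c\<close>
    modifies.\<close>
  have "cost d (sem c s) = cost d s"
    using Then.prems(9,10) by (intro cost_cong) (auto intro!: sem_frame)
  then show ?case
    using 1 2 runs_Seq[OF 1(1) 2(1)]
    by (intro exI3[of _ R2 M2 "t1 + t2 + 1"]) auto
next
  case (IfNZ e c d)
  have e: "safe_aexp U B e s" using IfNZ.prems by auto
  have la: "U ^ width c < 2 ^ w" "U ^ width d < 2 ^ w" "U ^ leaves e < 2 ^ w"
    using IfNZ.prems(4,6) by (auto elim!: power_less_mono)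
  obtain R1 where R1: "runs w (comp_aexp e t) (R, M) (cost_aexp e) (R1, M)" "R1 t = eval e s"
    "\<forall>y < t. R1 y = R y"
    using comp_aexp_runs[OF IfNZ.prems(1,2) e IfNZ.prems(4,5) la(3), of t] IfNZ.prems
    by auto
  have "0 < t" using IfNZ.prems(8) by (simp add: nregs_def)
  have r1: "represents B (R1, M) s" "R1 0 = B"
    using IfNZ.prems(1,7,8) R1(3) \<open>0 < t\<close> by (auto simp: represents_def)
  have "\<exists>R' M' \<tau>. runs w (if R1 t \<noteq> 0 then comp c t else comp d t) (R1, M) \<tau> (R', M') \<and>
     \<tau> \<le> max (cost c s) (cost d s) \<and>
     represents B (R', M') (sem (IfNZ e c d) s) \<and> bounded U (sem (IfNZ e c d) s) \<and> R' 0 = B \<and>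
     (\<forall>x. nregs \<le> x \<longrightarrow> x < t \<longrightarrow> R' x = R1 x)"
  proof (cases "R1 t \<noteq> 0")
    case True
    have "\<exists>R' M' \<tau>. runs w (comp c t) (R1, M) \<tau> (R', M') \<and> \<tau> \<le> cost c s \<and>
     represents B (R', M') (sem c s) \<and> bounded U (sem c s) \<and> R' 0 = B \<and>
     (\<forall>x. nregs \<le> x \<longrightarrow> x < t \<longrightarrow> R' x = R1 x)"
      using IfNZ.IH(1)[OF r1(1) IfNZ.prems(2) _ IfNZ.prems(4,5) la(1) r1(2) IfNZ.prems(8)]
        IfNZ.prems(3,9,10,11) True R1(2) by fastforce
    then show ?thesis using True R1(2) by (simp add: le_max_iff_disj) blast
  next
    case False
    have "\<exists>R' M' \<tau>. runs w (comp d t) (R1, M) \<tau> (R', M') \<and> \<tau> \<le> cost d s \<and>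
     represents B (R', M') (sem d s) \<and> bounded U (sem d s) \<and> R' 0 = B \<and>
     (\<forall>x. nregs \<le> x \<longrightarrow> x < t \<longrightarrow> R' x = R1 x)"
      using IfNZ.IH(2)[OF r1(1) IfNZ.prems(2) _ IfNZ.prems(4,5) la(2) r1(2) IfNZ.prems(8)]
        IfNZ.prems(3,9,10,11) False R1(2) by fastforce
    then show ?thesis using False R1(2) by (simp add: le_max_iff_disj) blast
  qed
  then obtain R' M' \<tau> where 2: "runs w (if R1 t \<noteq> 0 then comp c t else comp d t) (R1, M) \<tau> (R', M')"
     "\<tau> \<le> max (cost c s) (cost d s)"
     "represents B (R', M') (sem (IfNZ e c d) s)" "bounded U (sem (IfNZ e c d) s)" "R' 0 = B"
     "\<forall>x. nregs \<le> x \<longrightarrow> x < t \<longrightarrow> R' x = R1 x" by blast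
  have "runs w (comp (IfNZ e c d) t) (R, M) (cost_aexp e + (\<tau> + 1) + 1) (R', M')"
    unfolding comp.simps by (rule runs_Seq R1 runs_Cond 2)+
  then show ?case using 2 R1(3)
    by (intro exI3[of _ R' M' "cost_aexp e + (\<tau> + 1) + 1"]) auto
next
  case (For x e c)
  let ?body = "Seq (Const x 0) (Seq (Arith x Add x (t + 1)) (Seq (comp c (t + 2))
       (Seq (Const (t + 2) 1) (Seq (Arith (t + 1) Add (t + 1) (t + 2)) (Arith t Sub t (t + 2))))))"
  let ?it = "\<lambda>i. fold (\<lambda>i s. sem c (set_var x i s)) [0..<i] s"
  have e: "safe_aexp U B e s" and x: "0 < x" "x < nregs" and N: "eval e s \<le> U"
    and body: "\<And>i. i < eval e s \<Longrightarrow> safe U B c (set_var x i (?it i))"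
    using For.prems by auto
  have la: "U ^ width c < 2 ^ w" "U ^ leaves e < 2 ^ w"
    using For.prems(4,6) by (auto elim!: power_less_mono)
  have "U ^ 1 < 2 ^ w"
    by (rule power_less_mono[OF la(2)]) (use leaves_pos[of e] For.prems(4) in auto)
  then have Uw: "U < 2 ^ w" by simp
  obtain R1 where R1: "runs w (comp_aexp e t) (R, M) (cost_aexp e) (R1, M)" "R1 t = eval e s"
    "\<forall>y < t. R1 y = R y"
    using comp_aexp_runs[OF For.prems(1,2) e For.prems(4,5) la(2), of t] For.prems
    by auto
  have "0 < t" using For.prems(8) by (simp add: nregs_def)
  have frame: "fst (?it i) y = fst s y" if "y \<notin> insert x (mods c)" for i y
    using that by (induction i) (auto simp: sem_frame)
  \<comment> \<open>Induction on the number \<open>j\<close> of remaining iterations, after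
    \<open>i\<close> of them. Two counters are kept because the loop tests for zero while
    \<open>x\<close> runs upwards.\<close>
  have loop: "\<exists>R' M' \<tau>. runs w (Loop t ?body) (R, M) \<tau> (R', M') \<and>
     \<tau> \<le> j * (cost c s + 11) + 1 \<and>
     represents B (R', M') (?it (eval e s)) \<and> bounded U (?it (eval e s)) \<and> R' 0 = B \<and>
     (\<forall>x. nregs \<le> x \<longrightarrow> x < t \<longrightarrow> R' x = R x)"
    if "j + i = eval e s" "R t = j" "R (t + 1) = i" "represents B (R, M) (?it i)"
      "bounded U (?it i)" "R 0 = B" for i j R M
    using that
  proof (induction j arbitrary: i R M)
    case 0
    then show ?case using runs_Loop_exit[of R t w ?body M]
      by (intro exI3[of _ R M 1]) auto
  next
    case (Suc j)
    have i: "i < eval e s" using Suc.prems(1) by simp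
    define R2 where "R2 = R(x := 0 mod 2 ^ w)"
    define R3 where "R3 = R2(x := binop_sem Add (R2 x) (R2 (t + 1)) mod 2 ^ w)"
    have xt: "x < t" using x For.prems(8) by simp
    have iw: "i < 2 ^ w" using i N Uw by simp
    have R3: "R3 = R(x := i)"
      using iw xt Suc.prems(3) by (auto simp: R3_def R2_def)
    have r3: "represents B (R3, M) (set_var x i (?it i))"
      unfolding R3 using Suc.prems(4) by (auto intro: represents_set_var)
    have b3: "bounded U (set_var x i (?it i))"
      using Suc.prems(5) i N by (auto simp: bounded_def)
    have z3: "R3 0 = B" using Suc.prems(6) x R3 by auto
    have p: "nregs \<le> t + 2" "pure_bounds c" "mods c \<inter> bound_vars c = {}"
      using For.prems(8,9,10) by auto
    obtain R4 M4 t4 where 4: "runs w (comp c (t + 2)) (R3, M) t4 (R4, M4)"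
       "t4 \<le> cost c (set_var x i (?it i))"
       "represents B (R4, M4) (sem c (set_var x i (?it i)))"
       "bounded U (sem c (set_var x i (?it i)))" "R4 0 = B"
       "\<forall>x. nregs \<le> x \<longrightarrow> x < t + 2 \<longrightarrow> R4 x = R3 x"
      using For.IH[OF r3 b3 body[OF i] For.prems(4,5) la(1) z3 p For.prems(11)] by blast
    have c4: "cost c (set_var x i (?it i)) = cost c s"
      using For.prems(9,10) frame by (intro cost_cong) auto
    define R5 where "R5 = R4(t + 2 := 1 mod 2 ^ w)"
    define R6 where "R6 = R5(t + 1 := binop_sem Add (R5 (t + 1)) (R5 (t + 2)) mod 2 ^ w)"
    define R7 where "R7 = R6(t := binop_sem Sub (R6 t) (R6 (t + 2)) mod 2 ^ w)"
    have runb: "runs w ?body (R, M) (1 + (1 + (t4 + (1 + (1 + 1 + 1) + 1) + 1) + 1) + 1) (R7, M4)"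
      unfolding R7_def R6_def R5_def
      by (rule runs_Seq runs_Const[of w x 0 R M, folded R2_def]
          runs_Arith[of w x Add x "t + 1" R2 M, folded R3_def] 4(1) runs_Const runs_Arith)+
    have v: "R4 t = Suc j" "R4 (t + 1) = i"
      using 4(6) For.prems(8) R3 xt Suc.prems(2,3) by auto
    have "1 < (2::nat) ^ w" using For.prems(11) by linarith
    then have w1: "1 mod 2 ^ w = (1::nat)" by (rule mod_less)
    have si: "Suc i < 2 ^ w" "j < 2 ^ w" using Suc.prems(1) N Uw by linarith+
    have R7: "R7 t = j" "R7 (t + 1) = Suc i"
      using v si w1 by (auto simp: R7_def R6_def R5_def)
    have R7': "R7 y = R4 y" if "y < t" for y
      using that by (auto simp: R7_def R6_def R5_def)
    have it: "?it (Suc i) = sem c (set_var x i (?it i))" by simp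
    have r7: "represents B (R7, M4) (?it (Suc i))"
      unfolding it using 4(3) R7' For.prems(8) by (auto simp: represents_def)
    have "j + Suc i = eval e s" using Suc.prems(1) by simp
    moreover have "bounded U (?it (Suc i))" using 4(4) it by simp
    moreover have "R7 0 = B" using R7'[of 0] 4(5) \<open>0 < t\<close> by simp
    ultimately obtain R8 M8 t8 where 8: "runs w (Loop t ?body) (R7, M4) t8 (R8, M8)"
     "t8 \<le> j * (cost c s + 11) + 1"
     "represents B (R8, M8) (?it (eval e s))" "bounded U (?it (eval e s))" "R8 0 = B"
     "\<forall>x. nregs \<le> x \<longrightarrow> x < t \<longrightarrow> R8 x = R7 x"
      using Suc.IH[of "Suc i" R7 M4] R7(1,2) r7 \<open>0 < t\<close> by metis
    have "R t \<noteq> 0" using Suc.prems(2) by simp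
    from runs_Loop_step[OF this runb 8(1)] show ?case
      using 8 4(2,6) c4 R7' R3 xt x
      by (intro exI3[of _ R8 M8 "1 + (1 + (t4 + (1 + (1 + 1 + 1) + 1) + 1) + 1) + 1 + t8 + 1"]) auto
  qed
  define R2 where "R2 = R1(t + 1 := 0 mod 2 ^ w)"
  have "represents B (R2, M) (?it 0)"
    using For.prems(1,8) R1(3) by (auto simp: represents_def R2_def)
  moreover have "R2 t = eval e s" "R2 (t + 1) = 0" "R2 0 = B"
    using R1(2,3) For.prems(7) \<open>0 < t\<close> by (auto simp: R2_def)
  ultimately obtain R' M' \<tau> where l: "runs w (Loop t ?body) (R2, M) \<tau> (R', M')"
     "\<tau> \<le> eval e s * (cost c s + 11) + 1"
     "represents B (R', M') (?it (eval e s))" "bounded U (?it (eval e s))" "R' 0 = B"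
     "\<forall>x. nregs \<le> x \<longrightarrow> x < t \<longrightarrow> R' x = R2 x"
    using loop[of "eval e s" 0 R2 M] For.prems(2) by auto
  have "runs w (comp (For x e c) t) (R, M) (cost_aexp e + (1 + \<tau> + 1) + 1) (R', M')"
    unfolding comp.simps
    by (rule runs_Seq R1(1) runs_Const[of w "t + 1" 0 R1 M, folded R2_def] l(1))+
  then show ?case using l R1(3)
    by (intro exI3[of _ R' M' "cost_aexp e + (1 + \<tau> + 1) + 1"])
      (auto simp: R2_def)
qed

abbreviation plus_exp (infixl "[+]" 65) where "a [+] b \<equiv> Bin Add a b"
abbreviation minus_exp (infixl "[-]" 65) where "a [-] b \<equiv> Bin Sub a b"
abbreviation times_exp (infixl "[*]" 70) where "a [*] b \<equiv> Bin Mul a b"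
abbreviation div_exp (infixl "[div]" 70) where "a [div] b \<equiv> Bin Div a b"
abbreviation mod_exp (infixl "[mod]" 70) where "a [mod] b \<equiv> Bin Mod a b"
abbreviation then_stmt (infixr ";;" 60) where "c ;; d \<equiv> Then c d"
abbreviation assign_stmt (infix "<-" 61) where "x <- e \<equiv> Assign x e"

text \<open>Truncated subtraction leaves at most one nonzero summand, so nothing cancels.\<close>

definition neq_exp :: "aexp \<Rightarrow> aexp \<Rightarrow> aexp" where
  "neq_exp a b = (a [-] b) [+] (b [-] a)"

lemma neq_exp [simp]:
  "eval (neq_exp a b) s = 0 \<longleftrightarrow> eval a s = eval b s"
  "safe_aexp U B (neq_exp a b) s \<longleftrightarrow> safe_aexp U B a s \<and> safe_aexp U B b s"
  "exp_vars (neq_exp a b) = exp_vars a \<union> exp_vars b"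
  "exp_arrs (neq_exp a b) = exp_arrs a \<union> exp_arrs b"
  "leaves (neq_exp a b) = 2 * leaves a + 2 * leaves b"
  "cost_aexp (neq_exp a b) = 2 * cost_aexp a + 2 * cost_aexp b + 9"
  by (auto simp: neq_exp_def)

definition iter :: "nat \<Rightarrow> stmt \<Rightarrow> nat \<Rightarrow> st \<Rightarrow> st" where
  "iter x c i s = fold (\<lambda>i s. sem c (set_var x i s)) [0..<i] s"

text \<open>Safety and the invariant are treated together, since safety of an iteration is only
  known in states that satisfy the invariant.\<close>

lemma for_rule:
  assumes "0 < x" "x < nregs" "safe_aexp U B e s" "eval e s \<le> U" "I 0 s"
    and "\<And>i s'. i < eval e s \<Longrightarrow> I i s' \<Longrightarrow>
      safe U B c (set_var x i s') \<and> I (Suc i) (sem c (set_var x i s'))"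
  shows "safe U B (For x e c) s \<and> I (eval e s) (sem (For x e c) s)"
proof -
  have I: "I i (iter x c i s)" if "i \<le> eval e s" for i
    using that
  proof (induction i)
    case (Suc i)
    then show ?case using assms(6)[of i "iter x c i s"] by (simp add: iter_def)
  qed (use assms(5) in \<open>simp add: iter_def\<close>)
  then show ?thesis using assms by (simp add: iter_def)
qed

text \<open>Cells of the table (array 8) are only ever set to 1, so that what a loop iteration has achieved
  there is not destroyed by the later ones.\<close>

primrec sets_only :: "stmt \<Rightarrow> bool" where
  "sets_only Skip \<longleftrightarrow> True"
| "sets_only (Assign x e) \<longleftrightarrow> True"
| "sets_only (Update a i e) \<longleftrightarrow> a = 8 \<longrightarrow> e = Num 1"
| "sets_only (Then c d) \<longleftrightarrow> sets_only c \<and> sets_only d"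
| "sets_only (IfNZ e c d) \<longleftrightarrow> sets_only c \<and> sets_only d"
| "sets_only (For x e c) \<longleftrightarrow> sets_only c"

definition grows :: "st \<Rightarrow> st \<Rightarrow> bool" where
  "grows s s' \<longleftrightarrow> (\<forall>i. snd s 8 i \<noteq> 0 \<longrightarrow> snd s' 8 i \<noteq> 0)"

lemma grows_refl [simp]: "grows s s"
  by (simp add: grows_def)

lemma grows_set_var [simp]: "grows (set_var x i s) s' = grows s s'" "grows s (set_var x i s') = grows s s'"
  by (simp_all add: grows_def)

lemma grows_trans: "grows s s' \<Longrightarrow> grows s' s'' \<Longrightarrow> grows s s''"
  by (simp add: grows_def)

lemma sets_only_grows: "sets_only c \<Longrightarrow> grows s (sem c s)"
proof (induction c arbitrary: s)
  case (Then c d)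
  then show ?case
    using Then.IH(1)[of s] Then.IH(2)[of "sem c s"] grows_trans[of s "sem c s" "sem d (sem c s)"]
    by simp
next
  case (For x e c)
  have "grows s (fold (\<lambda>i s. sem c (set_var x i s)) xs s)" for xs
  proof (induction xs arbitrary: s)
    case (Cons i xs)
    have "grows s (sem c (set_var x i s))" using For.IH[of "set_var x i s"] For.prems by simp
    from grows_trans[OF this Cons.IH[of "sem c (set_var x i s)"]] show ?case by simp
  qed simp
  then show ?case by simp
qed (auto simp: grows_def)

text \<open>In addition to an invariant, every iteration leaves a result \<open>Q i\<close>, which
  survives the later iterations because the table only grows.\<close>

lemma for_grow_rule:
  assumes "0 < x" "x < nregs" "safe_aexp U B e s" "eval e s \<le> U" "J s"
    and "\<And>i s'. i < eval e s \<Longrightarrow> J s' \<Longrightarrow>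
      safe U B c (set_var x i s') \<and> J (sem c (set_var x i s')) \<and> Q i (sem c (set_var x i s'))"
    and "sets_only c"
    and "\<And>i s s'. grows s s' \<Longrightarrow> Q i s \<Longrightarrow> Q i s'"
  shows "safe U B (For x e c) s \<and> J (sem (For x e c) s) \<and>
    (\<forall>i < eval e s. Q i (sem (For x e c) s))"
proof -
  let ?I = "\<lambda>j s'. J s' \<and> (\<forall>i < j. Q i s')"
  have "safe U B (For x e c) s \<and> ?I (eval e s) (sem (For x e c) s)"
  proof (rule for_rule[OF assms(1-4)])
    show "?I 0 s" using assms(5) by simp
    fix i s' assume i: "i < eval e s" and I: "?I i s'"
    have "grows s' (sem c (set_var x i s'))"
      using sets_only_grows[OF assms(7), of "set_var x i s'"] by simp
    then show "safe U B c (set_var x i s') \<and> ?I (Suc i) (sem c (set_var x i s'))"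
      using assms(6)[OF i] I assms(8) by (auto simp: less_Suc_eq)
  qed
  then show ?thesis by simp
qed

section \<open>The program\<close>

text \<open>Variables 1 to 5 hold the first five input numbers, 6 tells whether some arc enters a template
  with less than \<open>k\<close> copies, 7 is the number of lists of copies that have to be distinguished, 8 the
  number of trials, 9 is \<open>2 ^ k\<close>, and 10 and 11 are the numbers of target vertices and of potential
  target arcs. Array 1 holds the powers of 2, arrays 2 and 3 the arcs of the pattern, 4 and 5 those of
  the target graph, 6 their kind (0 absent, 1 within a component, 2 starting a new component), 7 the
  colors and 8 the table of the dynamic program.\<close>

definition read_phase :: stmt where
  "read_phase = (1 <- Arr 0 (Num 0) ;; 2 <- Arr 0 (Num 1) ;; 3 <- Arr 0 (Num 2) ;;
     4 <- Arr 0 (Num 3) ;; 5 <- Arr 0 (Num 4))"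

text \<open>Registers 16 and 17 receive the ends of the arc, 18 and 19 their templates, 20 whether
  the arc enters a template and 21 the number of copies of the template of the head. The test for
  different templates comes first because the root counts as its own parent.\<close>

definition read_arc :: stmt where
  "read_arc = (
     16 <- Arr 0 (Num 5 [+] Num 2 [*] Var 15) ;;
     17 <- Arr 0 (Num 6 [+] Num 2 [*] Var 15) ;;
     18 <- Arr 0 (Num 5 [+] Num 2 [*] Var 2 [+] Var 16) ;;
     19 <- Arr 0 (Num 5 [+] Num 2 [*] Var 2 [+] Var 17) ;;
     20 <- Num 0 ;;
     IfNZ (neq_exp (Var 18) (Var 19))
       (IfNZ (neq_exp (Arr 0 (Num 5 [+] Num 2 [*] Var 2 [+] Var 1 [+] Var 19)) (Var 18))
          Skip (20 <- Num 1))
       Skip ;;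
     21 <- Arr 0 (Num 5 [+] Num 2 [*] Var 2 [+] Var 1 [+] Var 3 [+] Var 19))"

text \<open>The logarithm is found by doubling: variable 13 grows until it exceeds \<open>n\<close>,
  and 12 counts the doublings. The number of trials is \<open>4 ^ k\<close> times
  \<open>\<alpha> + 1\<close> times that count.\<close>

definition setup_phase :: "nat \<Rightarrow> stmt" where
  "setup_phase \<alpha> = (
     9 <- Num 1 ;;
     For 14 (Var 4) (Update 1 (Var 14) (Var 9) ;; 9 <- Var 9 [*] Num 2) ;;
     13 <- Num 1 ;; 12 <- Num 0 ;;
     For 14 (Var 1) (IfNZ (Var 1 [+] Num 1 [-] Var 13)
       (13 <- Var 13 [*] Num 2 ;; 12 <- Var 12 [+] Num 1) Skip) ;;
     6 <- Num 0 ;;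
     For 15 (Var 2) (read_arc ;;
       IfNZ (Var 20 [*] (Var 4 [-] Var 21)) (6 <- Num 1) Skip) ;;
     7 <- Num 1 ;;
     IfNZ (Var 6) (For 14 (Var 4) (7 <- Var 7 [*] (Var 4 [+] Num 1))) Skip ;;
     8 <- Var 9 [*] Var 9 [*] Num (\<alpha> + 1) [*] Var 12 ;;
     10 <- Var 8 [*] Var 1 [*] Var 7 ;;
     11 <- Var 8 [*] Var 2 [*] Var 7 [*] Var 4 ;;
     For 14 (Var 4 [-] Num 1) (
       Update 2 (Var 14) (Arr 0 (Num 5 [+] Num 2 [*] Var 2 [+] Var 1 [+] Num 2 [*] Var 3 [+] Num 2 [*] Var 14)) ;;
       Update 3 (Var 14) (Arr 0 (Num 6 [+] Num 2 [*] Var 2 [+] Var 1 [+] Num 2 [*] Var 3 [+] Num 2 [*] Var 14))))"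

text \<open>Every trial, arc, label and copy number owns one slot, whether or not it gives an arc.
  Where no copy has to be chosen, only copy number 0 yields an arc; surplus slots get kind
  0.\<close>

definition slot_stmt :: stmt where
  "slot_stmt = (
     IfNZ (Var 20)
       (IfNZ (Var 6)
          (25 <- Var 23 [*] Var 4 [+] Var 24 [+] Num 1 ;;
           IfNZ ((Var 21 [-] Var 24) [*] (Var 7 [-] Var 25)) (26 <- Num 1) (26 <- Num 0))
          (25 <- Var 23 ;; IfNZ (Var 24) (26 <- Num 0) (26 <- Num 2)))
       (25 <- Var 23 ;; IfNZ (Var 24) (26 <- Num 0) (26 <- Num 1)) ;;
     Update 4 (Var 27) ((Var 22 [*] Var 1 [+] Var 16) [*] Var 7 [+] Var 23) ;;
     Update 5 (Var 27) ((Var 22 [*] Var 1 [+] Var 17) [*] Var 7 [+] Var 25) ;;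
     Update 6 (Var 27) (Var 26) ;;
     27 <- Var 27 [+] Num 1)"

definition arcs_phase :: stmt where
  "arcs_phase = (27 <- Num 0 ;;
     For 22 (Var 8) (For 15 (Var 2) (read_arc ;; For 23 (Var 7) (For 24 (Var 4) slot_stmt))))"

definition cell :: "aexp \<Rightarrow> aexp \<Rightarrow> aexp \<Rightarrow> aexp \<Rightarrow> aexp" where
  "cell z x j s = ((z [*] Var 4 [+] x) [*] Var 4 [+] j) [*] Var 9 [+] s"

text \<open>Realises the rule \<open>other\<close>: nodes that are not the tail of the current arc
  take over their entries.\<close>

definition copy_stmt :: stmt where
  "copy_stmt = For 33 (Var 10) (For 28 (Var 4) (IfNZ (neq_exp (Var 28) (Var 31))
     (For 29 (Var 9) (IfNZ (Arr 8 (cell (Var 33) (Var 28) (Var 24) (Var 29)))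
        (Update 8 (cell (Var 33) (Var 28) (Var 24 [+] Num 1) (Var 29)) (Num 1)) Skip)) Skip))"

text \<open>Variable 35 drops from 1 to 0 at the first common bit and stays there because
  subtraction is truncated.\<close>

definition disjoint_stmt :: stmt where
  "disjoint_stmt = (35 <- Num 1 ;; For 14 (Var 4) (35 <- Var 35 [-]
     ((Var 29 [div] Arr 1 (Var 14)) [mod] Num 2) [*] ((Var 30 [div] Arr 1 (Var 14)) [mod] Num 2)))"

text \<open>Realises the rules \<open>reset\<close> (kind 2) and \<open>inner\<close> (kind 1);
  disjoint color sets are united by adding their bit masks.\<close>

definition join_stmt :: stmt where
  "join_stmt = IfNZ (Arr 8 (cell (Var 16) (Var 31) (Var 24) (Var 29)) [*]
      Arr 8 (cell (Var 17) (Var 32) (Var 4 [-] Num 1) (Var 30)))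
    (IfNZ (Arr 6 (Var 15) [-] Num 1)
      (Update 8 (cell (Var 16) (Var 31) (Var 24 [+] Num 1) (Var 29)) (Num 1))
      (disjoint_stmt ;; IfNZ (Var 35)
        (Update 8 (cell (Var 16) (Var 31) (Var 24 [+] Num 1) (Var 29 [+] Var 30)) (Num 1)) Skip))
    Skip"

definition joins_stmt :: stmt where
  "joins_stmt = For 15 (Var 11) (IfNZ (Arr 6 (Var 15))
     (16 <- Arr 4 (Var 15) ;; 17 <- Arr 5 (Var 15) ;;
      For 29 (Var 9) (For 30 (Var 9) join_stmt)) Skip)"

definition init_phase :: stmt where
  "init_phase = For 33 (Var 10) (For 28 (Var 4)
     (Update 8 (cell (Var 33) (Var 28) (Num 0) (Arr 1 (Arr 7 (Var 33)))) (Num 1)))"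

text \<open>The arcs of the pattern may be listed in any order. Instead of sorting them, the pass is
  repeated \<open>k\<close> times, each time completing one more level of the tree from the
  bottom.\<close>

definition rounds_phase :: stmt where
  "rounds_phase = For 34 (Var 4) (For 24 (Var 4 [-] Num 1)
     (31 <- Arr 2 (Var 24) ;; 32 <- Arr 3 (Var 24) ;; copy_stmt ;; joins_stmt))"

text \<open>The answers overwrite the first cells of the input, which is no longer read at this
  point. The root is looked up with code 0, that of the empty label.\<close>

definition output_phase :: stmt where
  "output_phase = For 17 (Var 1) (36 <- Num 0 ;;
     For 22 (Var 8) (For 29 (Var 9) (IfNZ
       (Arr 8 (cell ((Var 22 [*] Var 1 [+] Var 17) [*] Var 7) (Var 5) (Var 4 [-] Num 1) (Var 29)))
       (36 <- Num 1) Skip)) ;;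
     Update 0 (Var 17) (Var 36))"

section \<open>Layout of the input and size parameters\<close>

lemma length_encode_arcs: "length (encode_arcs es) = 2 * length es"
  by (induction es) (auto simp: encode_arcs_def)

lemma nth_encode_arcs:
  assumes "i < length es"
  shows "encode_arcs es ! (2 * i) = fst (es ! i)" "encode_arcs es ! (2 * i + 1) = snd (es ! i)"
proof -
  have "encode_arcs es ! (2 * i) = fst (es ! i) \<and> encode_arcs es ! (2 * i + 1) = snd (es ! i)"
    using assms
  proof (induction es arbitrary: i)
    case (Cons e es)
    have *: "encode_arcs (e # es) = fst e # snd e # encode_arcs es"
      by (simp add: encode_arcs_def split_beta)
    show ?case using Cons unfolding * by (cases i) simp_all
  qed simp
  then show "encode_arcs es ! (2 * i) = fst (es ! i)" "encode_arcs es ! (2 * i + 1) = snd (es ! i)"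
    by simp_all
qed

locale occurrence_problem = pattern_occurrence G tas k r d
  for G :: "nat pgt" and tas k r d +
  fixes n :: nat and es :: "(nat \<times> nat) list" and \<alpha> U :: nat
  assumes V: "V = {..<n}" and E: "E = set es" and distinct_es: "distinct es"
begin

abbreviation "m \<equiv> length es"

definition xs :: "nat list" where
  "xs = encode_input G n es k r tas"

abbreviation "B \<equiv> length xs"

definition small :: bool where
  "small \<longleftrightarrow> (\<exists>(u, w) \<in> E. down u w \<and> P (t w) < k)"

definition q :: nat where
  "q = (if small then (k + 1) ^ k else 1)"

definition L :: nat where
  "L = (LEAST l. n < 2 ^ l)"

definition R :: nat where
  "R = 2 ^ k * 2 ^ k * (\<alpha> + 1) * L"

definition N :: nat where
  "N = R * n * q"

definition EV :: nat where
  "EV = R * m * q * k"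

lemma not_small: "\<not> small \<Longrightarrow> (u, w) \<in> E \<Longrightarrow> down u w \<Longrightarrow> k \<le> P (t w)"
  unfolding small_def by (metis (mono_tags, lifting) case_prodI not_le)

sublocale numbered_target G tas k r d n R q small
  by unfold_locales (simp_all add: V q_def not_small)

lemma n_pos: "0 < n"
  using T_sub[of 0] h_pos T_0 V by auto

lemma k_pos: "0 < k"
  using root by simp

lemma length_xs: "B = 5 + 2 * m + n + 2 * h + 2 * (k - 1)"
  by (simp add: xs_def encode_input_def length_encode_arcs length_params length_tas)

lemma xs_nth:
  "xs ! 0 = n" "xs ! 1 = m" "xs ! 2 = h" "xs ! 3 = k" "xs ! 4 = r"
  "e < m \<Longrightarrow> xs ! (5 + 2 * e) = fst (es ! e)"
  "e < m \<Longrightarrow> xs ! (6 + 2 * e) = snd (es ! e)"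
  "v < n \<Longrightarrow> xs ! (5 + 2 * m + v) = t v"
  "i < h \<Longrightarrow> xs ! (5 + 2 * m + n + i) = parent_index G i"
  "i < h \<Longrightarrow> xs ! (5 + 2 * m + n + h + i) = P i"
  "i < k - 1 \<Longrightarrow> xs ! (5 + 2 * m + n + 2 * h + 2 * i) = fst (tas ! i)"
  "i < k - 1 \<Longrightarrow> xs ! (6 + 2 * m + n + 2 * h + 2 * i) = snd (tas ! i)"
proof -
  let ?a = "encode_arcs es" and ?b = "map t [0..<n]" and ?c = "map (parent_index G) [0..<h]"
    and ?p = "params G" and ?f = "encode_arcs tas"
  have xs: "xs = [n, m, h, k, r] @ ?a @ ?b @ ?c @ ?p @ ?f"
    by (simp add: xs_def encode_input_def)
  show "xs ! 0 = n" "xs ! 1 = m" "xs ! 2 = h" "xs ! 3 = k" "xs ! 4 = r" by (simp_all add: xs)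
  have skip: "xs ! (5 + i) = (?a @ ?b @ ?c @ ?p @ ?f) ! i" for i
    unfolding xs using nth_append_length_plus[of "[n, m, h, k, r]"] by simp
  show "xs ! (5 + 2 * e) = fst (es ! e)" if "e < m"
    using that nth_encode_arcs(1)[OF that] skip[of "2 * e"] by (simp add: nth_append length_encode_arcs)
  show "xs ! (6 + 2 * e) = snd (es ! e)" if "e < m"
    using that nth_encode_arcs(2)[OF that] skip[of "2 * e + 1"] by (simp add: nth_append length_encode_arcs)
  have skip: "xs ! (5 + 2 * m + i) = (?b @ ?c @ ?p @ ?f) ! i" for i
    using skip[of "2 * m + i"] nth_append_length_plus[of ?a] by (simp add: length_encode_arcs add.assoc)
  show "xs ! (5 + 2 * m + v) = t v" if "v < n" using that skip[of v] by (simp add: nth_append)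
  have skip: "xs ! (5 + 2 * m + n + i) = (?c @ ?p @ ?f) ! i" for i
    using skip[of "n + i"] nth_append_length_plus[of ?b] by (simp add: add.assoc)
  show "xs ! (5 + 2 * m + n + i) = parent_index G i" if "i < h"
    using that skip[of i] by (simp add: nth_append)
  have skip: "xs ! (5 + 2 * m + n + h + i) = (?p @ ?f) ! i" for i
    using skip[of "h + i"] nth_append_length_plus[of ?c] by (simp add: add.assoc)
  show "xs ! (5 + 2 * m + n + h + i) = P i" if "i < h"
    using that skip[of i] by (simp add: nth_append length_params)
  have skip: "xs ! (5 + 2 * m + n + 2 * h + i) = ?f ! i" for i
  proof -
    have "5 + 2 * m + n + 2 * h + i = 5 + 2 * m + n + h + (h + i)" by simp
    then have "xs ! (5 + 2 * m + n + 2 * h + i) = (?p @ ?f) ! (h + i)" using skip by metis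
    also have "\<dots> = ?f ! i" using nth_append_length_plus[of ?p ?f i] unfolding length_params .
    finally show ?thesis .
  qed
  show "xs ! (5 + 2 * m + n + 2 * h + 2 * i) = fst (tas ! i)" if "i < k - 1"
    using that skip[of "2 * i"] nth_encode_arcs(1)[of i tas] length_tas by simp
  show "xs ! (6 + 2 * m + n + 2 * h + 2 * i) = snd (tas ! i)" if "i < k - 1"
  proof -
    have "6 + 2 * m + n + 2 * h + 2 * i = 5 + 2 * m + n + 2 * h + (2 * i + 1)" by simp
    then have "xs ! (6 + 2 * m + n + 2 * h + 2 * i) = ?f ! (2 * i + 1)" using skip by metis
    then show ?thesis using that nth_encode_arcs(2)[of i tas] length_tas by simp
  qed
qed

lemma es_less: "e < m \<Longrightarrow> fst (es ! e) < n \<and> snd (es ! e) < n"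
  using E_less[of "fst (es ! e)" "snd (es ! e)"] E nth_mem[of e es] by simp

lemma L: "n < 2 ^ L" "l < L \<Longrightarrow> 2 ^ l \<le> n" "L \<le> n"
proof -
  have *: "n < 2 ^ n" by (rule less_exp)
  show "n < 2 ^ L" unfolding L_def by (rule LeastI[of "\<lambda>l. n < 2 ^ l", OF *])
  show "2 ^ l \<le> n" if "l < L" using not_less_Least[OF that[unfolded L_def]] by simp
  show "L \<le> n" unfolding L_def by (rule Least_le[of "\<lambda>l. n < 2 ^ l", OF *])
qed

end

text \<open>\<open>U\<close> bounds every value that is stored. The summand \<open>q * k\<close> is
  there because the head of a slot is stored even if its code is not below \<open>q\<close>, and
  \<open>2 * n\<close> because the search for \<open>L\<close> overshoots by one doubling.\<close>

locale bounded_problem = occurrence_problem +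
  assumes U: "16 \<le> U" "B \<le> U" "\<And>x. x \<in> set xs \<Longrightarrow> x \<le> U" "\<alpha> + 8 \<le> U" "2 * n \<le> U"
    "2 ^ k \<le> U" "R \<le> U" "N + q * k + k \<le> U" "EV \<le> U" "q \<le> U"
begin

definition input_ctx :: "st \<Rightarrow> bool" where
  "input_ctx s \<longleftrightarrow> fst s 1 = n \<and> fst s 2 = m \<and> fst s 3 = h \<and> fst s 4 = k \<and> fst s 5 = r \<and>
     (\<forall>i < B. snd s 0 i = xs ! i)"

lemma input_ctx_frame:
  assumes "mods c \<inter> {1..5} = {}" "0 \<notin> upds c" "input_ctx s"
  shows "input_ctx (sem c s)"
proof -
  have "fst (sem c s) x = fst s x" if "x \<in> {1..5}" for x
    using that assms(1) by (intro sem_frame) auto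
  then show ?thesis using assms(2,3) by (simp add: input_ctx_def sem_frame_arr)
qed

lemma input_ctx_set_var [simp]: "x > 5 \<Longrightarrow> input_ctx (set_var x i s) = input_ctx s"
  by (simp add: input_ctx_def)

lemma input_ctx_set_arr [simp]: "a > 0 \<Longrightarrow> input_ctx (set_arr a i y s) = input_ctx s"
  by (simp add: input_ctx_def)

lemma xs_le: "i < B \<Longrightarrow> xs ! i \<le> U"
  using U(3) nth_mem by blast

lemma read_phase:
  assumes "\<forall>i < B. snd s 0 i = xs ! i"
  shows "safe U B read_phase s" "input_ctx (sem read_phase s)" "snd (sem read_phase s) = snd s"
proof -
  have B: "0 < B" "1 < B" "2 < B" "3 < B" "4 < B" by (simp_all add: length_xs)
  have *: "snd s 0 0 = n" "snd s 0 1 = m" "snd s 0 2 = h" "snd s 0 3 = k" "snd s 0 4 = r"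
    using assms B xs_nth(1-5) by auto
  have le: "n \<le> U" "m \<le> U" "h \<le> U" "k \<le> U" "r \<le> U"
    using xs_le[OF B(1)] xs_le[OF B(2)] xs_le[OF B(3)] xs_le[OF B(4)] xs_le[OF B(5)]
    unfolding xs_nth(1-5) .
  show "safe U B read_phase s" using * le B U(1) by (simp add: read_phase_def nregs_def)
  show "input_ctx (sem read_phase s)" using * assms by (simp add: read_phase_def input_ctx_def)
  show "snd (sem read_phase s) = snd s" by (simp add: read_phase_def)
qed

lemma read_arc:
  assumes ctx: "input_ctx s" and e: "fst s 15 = e" "e < m" and uw: "es ! e = (u, w)"
  shows "safe U B read_arc s" "fst (sem read_arc s) 16 = u" "fst (sem read_arc s) 17 = w"
    "fst (sem read_arc s) 20 = of_bool (down u w)" "fst (sem read_arc s) 21 = P (t w)"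
    "snd (sem read_arc s) = snd s"
proof -
  have lt: "u < n" "w < n" using es_less[OF e(2)] uw by simp_all
  have V': "u \<in> V" "w \<in> V" using lt V by auto
  have th: "t u < h" "t w < h" using tmpl(1) V' by auto
  have v: "fst s 1 = n" "fst s 2 = m" "fst s 3 = h" and i: "\<And>i. i < B \<Longrightarrow> snd s 0 i = xs ! i"
    using ctx by (auto simp: input_ctx_def)
  have b: "5 + 2 * e < B" "6 + 2 * e < B" "5 + 2 * m + u < B" "5 + 2 * m + w < B"
    "5 + 2 * m + n + t w < B" "5 + 2 * m + n + h + t w < B"
    using e(2) lt th by (auto simp: length_xs)
  have x: "snd s 0 (5 + 2 * e) = u" "snd s 0 (6 + 2 * e) = w" "snd s 0 (5 + 2 * m + u) = t u"
    "snd s 0 (5 + 2 * m + w) = t w" "snd s 0 (5 + 2 * m + n + t w) = parent_index G (t w)"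
    "snd s 0 (5 + 2 * m + n + h + t w) = P (t w)"
    using b i xs_nth(6,7)[OF e(2)] xs_nth(8)[OF lt(1)] xs_nth(8)[OF lt(2)] xs_nth(9)[OF th(2)]
      xs_nth(10)[OF th(2)] uw by simp_all
  have le: "u \<le> U" "w \<le> U" "t u \<le> U" "t w \<le> U" "parent_index G (t w) \<le> U" "P (t w) \<le> U"
    using xs_le[OF b(1)] xs_le[OF b(2)] xs_le[OF b(3)] xs_le[OF b(4)] xs_le[OF b(5)] xs_le[OF b(6)]
      xs_nth(6,7)[OF e(2)] xs_nth(8)[OF lt(1)] xs_nth(8)[OF lt(2)] xs_nth(9)[OF th(2)]
      xs_nth(10)[OF th(2)] uw by simp_all
  have dn: "down u w \<longleftrightarrow> t u \<noteq> t w \<and> parent_index G (t w) = t u"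
    using parent_index_iff[OF V'] parD(4) unfolding down_def by blast
  show "safe U B read_arc s"
    using x le b v e U(1) by (simp add: read_arc_def nregs_def)
  show "fst (sem read_arc s) 16 = u" "fst (sem read_arc s) 17 = w"
    "fst (sem read_arc s) 21 = P (t w)" "snd (sem read_arc s) = snd s"
    using x v e by (simp_all add: read_arc_def)
  show "fst (sem read_arc s) 20 = of_bool (down u w)"
    using x v e unfolding dn by (simp add: read_arc_def)
qed

definition setup_ctx :: "st \<Rightarrow> bool" where
  "setup_ctx s \<longleftrightarrow> input_ctx s \<and> fst s 6 = of_bool small \<and> fst s 7 = q \<and> fst s 8 = R \<and>
     fst s 9 = 2 ^ k \<and> fst s 10 = N \<and> fst s 11 = EV \<and> (\<forall>i < k. snd s 1 i = 2 ^ i) \<and>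
     (\<forall>i < k - 1. snd s 2 i = fst (tas ! i) \<and> snd s 3 i = snd (tas ! i))"

lemma setup_ctx_frame:
  assumes "mods c \<inter> {1..11} = {}" "upds c \<inter> {0..3} = {}" "setup_ctx s"
  shows "setup_ctx (sem c s)"
proof -
  have "fst (sem c s) x = fst s x" if "x \<in> {1..11}" for x
    using that assms(1) by (intro sem_frame) auto
  moreover have "snd (sem c s) a = snd s a" if "a \<in> {0..3}" for a
    using that assms(2) by (intro sem_frame_arr) auto
  moreover have "input_ctx (sem c s)"
    using assms by (intro input_ctx_frame) (auto simp: setup_ctx_def disjoint_iff)
  ultimately show ?thesis using assms(3) by (simp add: setup_ctx_def)
qed

lemma setup_ctx_set_var [simp]: "x > 11 \<Longrightarrow> setup_ctx (set_var x i s) = setup_ctx s"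
  by (simp add: setup_ctx_def)

lemma setup_ctx_set_arr [simp]: "a > 3 \<Longrightarrow> setup_ctx (set_arr a i y s) = setup_ctx s"
  by (simp add: setup_ctx_def)

lemma k_le: "k \<le> U" and m_le: "m \<le> U" and n_le: "n \<le> U"
  using U(2,5) length_xs U(6) less_exp[of k] by linarith+

lemma pow_le: "i \<le> k \<Longrightarrow> (2::nat) ^ i \<le> U"
  using U(6) power_increasing[of i k "2::nat"] by linarith

lemma setup_phase:
  assumes ctx: "input_ctx s"
  shows "safe U B (setup_phase \<alpha>) s \<and> setup_ctx (sem (setup_phase \<alpha>) s) \<and>
    (\<forall>a > 3. snd (sem (setup_phase \<alpha>) s) a = snd s a)"
proof -
  note U' = U(1) k_le m_le n_le
  define c1 where "c1 = For 14 (Var 4) (Update 1 (Var 14) (Var 9) ;; 9 <- Var 9 [*] Num 2)"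
  define c2 where "c2 = For 14 (Var 1) (IfNZ (Var 1 [+] Num 1 [-] Var 13)
       (13 <- Var 13 [*] Num 2 ;; 12 <- Var 12 [+] Num 1) Skip)"
  define c3 where "c3 = For 15 (Var 2) (read_arc ;;
       IfNZ (Var 20 [*] (Var 4 [-] Var 21)) (6 <- Num 1) Skip)"
  define c4 where "c4 = IfNZ (Var 6) (For 14 (Var 4) (7 <- Var 7 [*] (Var 4 [+] Num 1))) Skip"
  define c5 where "c5 = For 14 (Var 4 [-] Num 1) (
       Update 2 (Var 14) (Arr 0 (Num 5 [+] Num 2 [*] Var 2 [+] Var 1 [+] Num 2 [*] Var 3 [+] Num 2 [*] Var 14)) ;;
       Update 3 (Var 14) (Arr 0 (Num 6 [+] Num 2 [*] Var 2 [+] Var 1 [+] Num 2 [*] Var 3 [+] Num 2 [*] Var 14)))"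
  have prog: "setup_phase \<alpha> = (9 <- Num 1 ;; c1 ;; 13 <- Num 1 ;; 12 <- Num 0 ;; c2 ;; 6 <- Num 0 ;;
      c3 ;; 7 <- Num 1 ;; c4 ;; 8 <- Var 9 [*] Var 9 [*] Num (\<alpha> + 1) [*] Var 12 ;;
      10 <- Var 8 [*] Var 1 [*] Var 7 ;; 11 <- Var 8 [*] Var 2 [*] Var 7 [*] Var 4 ;; c5)"
    by (simp add: setup_phase_def c1_def c2_def c3_def c4_def c5_def)
  have 1: "safe U B c1 s' \<and> input_ctx (sem c1 s') \<and> fst (sem c1 s') 9 = 2 ^ k \<and>
      (\<forall>i < k. snd (sem c1 s') 1 i = 2 ^ i)"
    if s': "input_ctx s'" "fst s' 9 = 1" for s'
  proof -
    let ?I = "\<lambda>i s. input_ctx s \<and> fst s 9 = 2 ^ i \<and> (\<forall>i' < i. snd s 1 i' = 2 ^ i')"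
    have k: "eval (Var 4) s' = k" using s' by (simp add: input_ctx_def)
    have "safe U B c1 s' \<and> ?I (eval (Var 4) s') (sem c1 s')"
      unfolding c1_def
    proof (rule for_rule)
      fix i s assume "i < eval (Var 4) s'" and I: "?I i s"
      then have "i < k" using k by simp
      then show "safe U B (Update 1 (Var 14) (Var 9) ;; 9 <- Var 9 [*] Num 2) (set_var 14 i s) \<and>
          ?I (Suc i) (sem (Update 1 (Var 14) (Var 9) ;; 9 <- Var 9 [*] Num 2) (set_var 14 i s))"
        using I pow_le[of i] pow_le[of "Suc i"] U' by (simp add: nregs_def less_Suc_eq mult.commute)
    qed (use s' k U' in \<open>auto simp: nregs_def\<close>)
    then show ?thesis using k by simp
  qed
  have 2: "safe U B c2 s' \<and> fst (sem c2 s') 12 = L"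
    if s': "input_ctx s'" "fst s' 13 = 1" "fst s' 12 = 0" for s'
  proof -
    \<comment> \<open>The loop runs \<open>n\<close> times, which suffices as
      \<open>L \<le> n\<close>; after \<open>L\<close> rounds nothing changes any more.\<close>
    let ?I = "\<lambda>i (s :: st). fst s 1 = n \<and> fst s 12 = min i L \<and> fst s 13 = 2 ^ (min i L)"
    have n: "eval (Var 1) s' = n" using s' by (simp add: input_ctx_def)
    have "safe U B c2 s' \<and> ?I (eval (Var 1) s') (sem c2 s')"
      unfolding c2_def
    proof (rule for_rule)
      fix i s assume "i < eval (Var 1) s'" and I: "?I i s"
      show "safe U B (IfNZ (Var 1 [+] Num 1 [-] Var 13)
            (13 <- Var 13 [*] Num 2 ;; 12 <- Var 12 [+] Num 1) Skip) (set_var 14 i s) \<and>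
          ?I (Suc i) (sem (IfNZ (Var 1 [+] Num 1 [-] Var 13)
            (13 <- Var 13 [*] Num 2 ;; 12 <- Var 12 [+] Num 1) Skip) (set_var 14 i s))"
      proof (cases "i < L")
        case True
        then have "2 ^ i \<le> n" "Suc i \<le> n" using L(2)[of i] L(3) by auto
        moreover have "2 * 2 ^ i \<le> U" "Suc i \<le> U" using calculation U(5) n_le by linarith+
        ultimately show ?thesis using True I U' by (simp add: nregs_def min_def mult.commute)
      next
        case False
        then have "min i L = L" "min (Suc i) L = L" by auto
        then show ?thesis using I L(1) U' by (simp add: nregs_def)
      qed
    qed (use s' n U' in \<open>auto simp: nregs_def\<close>)
    then show ?thesis using n L(3) by simp
  qed
  have 3: "safe U B c3 s' \<and> fst (sem c3 s') 6 = of_bool small"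
    if s': "input_ctx s'" "fst s' 6 = 0" for s'
  proof -
    let ?b = "\<lambda>i. down (fst (es ! i)) (snd (es ! i)) \<and> P (t (snd (es ! i))) < k"
    let ?I = "\<lambda>i s. input_ctx s \<and> fst s 6 = of_bool (\<exists>i' < i. ?b i')"
    have m: "eval (Var 2) s' = m" using s' by (simp add: input_ctx_def)
    have "safe U B c3 s' \<and> ?I (eval (Var 2) s') (sem c3 s')"
      unfolding c3_def
    proof (rule for_rule)
      fix i s assume "i < eval (Var 2) s'" and I: "?I i s"
      then have i: "i < m" using m by simp
      have c: "input_ctx (set_var 15 i s)" "fst (set_var 15 i s) 15 = i" using I by auto
      note ra = read_arc[OF c(1,2) i surjective_pairing]
      have c': "input_ctx (sem read_arc (set_var 15 i s))"
        by (rule input_ctx_frame) (use I in \<open>auto simp: read_arc_def\<close>)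
      have 6: "fst (sem read_arc (set_var 15 i s)) 6 = fst s 6"
        by (subst sem_frame) (auto simp: read_arc_def)
      have 4: "fst (sem read_arc (set_var 15 i s)) 4 = k"
        using c' by (simp add: input_ctx_def)
      show "safe U B (read_arc ;; IfNZ (Var 20 [*] (Var 4 [-] Var 21)) (6 <- Num 1) Skip) (set_var 15 i s) \<and>
          ?I (Suc i) (sem (read_arc ;; IfNZ (Var 20 [*] (Var 4 [-] Var 21)) (6 <- Num 1) Skip) (set_var 15 i s))"
        using ra c' I 6 4 U' by (auto simp: nregs_def less_Suc_eq)
    qed (use s' m U' in \<open>auto simp: nregs_def\<close>)
    moreover have "small \<longleftrightarrow> (\<exists>i' < m. ?b i')"
    proof -
      have "(\<exists>a \<in> set es. down (fst a) (snd a) \<and> P (t (snd a)) < k) \<longleftrightarrow> (\<exists>i' < m. ?b i')"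
        by (metis in_set_conv_nth)
      then show ?thesis by (simp add: small_def E split_beta)
    qed
    ultimately show ?thesis using m by simp
  qed
  have 4: "safe U B c4 s' \<and> fst (sem c4 s') 7 = q"
    if s': "input_ctx s'" "fst s' 7 = 1" "fst s' 6 = of_bool small" for s'
  proof (cases small)
    case True
    let ?I = "\<lambda>i (s :: st). fst s 4 = k \<and> fst s 7 = (k + 1) ^ i"
    have k: "eval (Var 4) s' = k" using s' by (simp add: input_ctx_def)
    have "safe U B (For 14 (Var 4) (7 <- Var 7 [*] (Var 4 [+] Num 1))) s' \<and>
        ?I (eval (Var 4) s') (sem (For 14 (Var 4) (7 <- Var 7 [*] (Var 4 [+] Num 1))) s')"
    proof (rule for_rule)
      fix i s assume "i < eval (Var 4) s'" and I: "?I i s"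
      then have "Suc i \<le> k" using k by simp
      then have "(k + 1) ^ Suc i \<le> (k + 1) ^ k" by (intro power_increasing) auto
      then have "(k + 1) ^ Suc i \<le> U" using U(10) True by (simp add: q_def)
      then show "safe U B (7 <- Var 7 [*] (Var 4 [+] Num 1)) (set_var 14 i s) \<and>
          ?I (Suc i) (sem (7 <- Var 7 [*] (Var 4 [+] Num 1)) (set_var 14 i s))"
        using I U' by (simp add: nregs_def mult.commute)
    qed (use s' k U' in \<open>auto simp: nregs_def\<close>)
    then show ?thesis using s' k True unfolding c4_def by (simp add: q_def nregs_def)
  next
    case False
    then show ?thesis using s' unfolding c4_def by (simp add: q_def nregs_def)
  qed
  have 5: "safe U B c5 s' \<and> (\<forall>i < k - 1. snd (sem c5 s') 2 i = fst (tas ! i) \<and> snd (sem c5 s') 3 i = snd (tas ! i))"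
    if s': "input_ctx s'" for s'
  proof -
    let ?I = "\<lambda>i s. input_ctx s \<and> (\<forall>i' < i. snd s 2 i' = fst (tas ! i') \<and> snd s 3 i' = snd (tas ! i'))"
    have k: "eval (Var 4 [-] Num 1) s' = k - 1" using s' by (simp add: input_ctx_def)
    have "safe U B c5 s' \<and> ?I (eval (Var 4 [-] Num 1) s') (sem c5 s')"
      unfolding c5_def
    proof (rule for_rule)
      fix i s assume "i < eval (Var 4 [-] Num 1) s'" and I: "?I i s"
      then have i: "i < k - 1" using k by simp
      have v: "fst s 1 = n" "fst s 2 = m" "fst s 3 = h" "fst s 4 = k"
        and x: "\<And>i. i < B \<Longrightarrow> snd s 0 i = xs ! i"
        using I by (auto simp: input_ctx_def)
      have b: "5 + 2 * m + n + 2 * h + 2 * i < B" "6 + 2 * m + n + 2 * h + 2 * i < B"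
        using i by (auto simp: length_xs)
      have y: "snd s 0 (5 + 2 * m + n + 2 * h + 2 * i) = fst (tas ! i)"
        "snd s 0 (6 + 2 * m + n + 2 * h + 2 * i) = snd (tas ! i)"
        using b x xs_nth(11,12)[OF i] by simp_all
      have le: "fst (tas ! i) \<le> U" "snd (tas ! i) \<le> U"
        using xs_le[OF b(1)] xs_le[OF b(2)] xs_nth(11,12)[OF i] by simp_all
      show "safe U B (Update 2 (Var 14) (Arr 0 (Num 5 [+] Num 2 [*] Var 2 [+] Var 1 [+] Num 2 [*] Var 3 [+] Num 2 [*] Var 14)) ;;
          Update 3 (Var 14) (Arr 0 (Num 6 [+] Num 2 [*] Var 2 [+] Var 1 [+] Num 2 [*] Var 3 [+] Num 2 [*] Var 14))) (set_var 14 i s) \<and>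
        ?I (Suc i) (sem (Update 2 (Var 14) (Arr 0 (Num 5 [+] Num 2 [*] Var 2 [+] Var 1 [+] Num 2 [*] Var 3 [+] Num 2 [*] Var 14)) ;;
          Update 3 (Var 14) (Arr 0 (Num 6 [+] Num 2 [*] Var 2 [+] Var 1 [+] Num 2 [*] Var 3 [+] Num 2 [*] Var 14))) (set_var 14 i s))"
        using I v y le b U' by (simp add: nregs_def less_Suc_eq)
    qed (use s' k U' in \<open>auto simp: nregs_def input_ctx_def\<close>)
    then show ?thesis using k by simp
  qed
  have mods: "mods c1 = {9, 14}" "mods c2 = {12, 13, 14}" "mods c3 = {6, 15, 16, 17, 18, 19, 20, 21}"
    "mods c4 = {7, 14}" "mods c5 = {14}" "upds c1 = {1}" "upds c2 = {}" "upds c3 = {}" "upds c4 = {}"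
    "upds c5 = {2, 3}"
    by (auto simp: c1_def c2_def c3_def c4_def c5_def read_arc_def)
  have fr: "input_ctx (sem c s)" if "c \<in> {c1, c2, c3, c4, c5}" "input_ctx s" for c s
    using that mods by (auto intro!: input_ctx_frame)
  define s1 where "s1 = sem (9 <- Num 1) s"
  define s2 where "s2 = sem (12 <- Num 0) (sem (13 <- Num 1) (sem c1 s1))"
  define s3 where "s3 = sem (6 <- Num 0) (sem c2 s2)"
  define s4 where "s4 = sem (7 <- Num 1) (sem c3 s3)"
  define s5 where "s5 = sem (8 <- Var 9 [*] Var 9 [*] Num (\<alpha> + 1) [*] Var 12) (sem c4 s4)"
  define s6 where "s6 = sem (11 <- Var 8 [*] Var 2 [*] Var 7 [*] Var 4) (sem (10 <- Var 8 [*] Var 1 [*] Var 7) s5)"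
  have c: "input_ctx s1" using ctx by (simp add: s1_def)
  have r1: "safe U B c1 s1" "input_ctx (sem c1 s1)" "fst (sem c1 s1) 9 = 2 ^ k"
    "\<forall>i < k. snd (sem c1 s1) 1 i = 2 ^ i"
    using 1[OF c] by (auto simp: s1_def)
  have c2: "input_ctx s2" "fst s2 13 = 1" "fst s2 12 = 0" using r1 by (auto simp: s2_def)
  have r2: "safe U B c2 s2" "fst (sem c2 s2) 12 = L" using 2[OF c2] by auto
  have c3: "input_ctx s3" "fst s3 6 = 0" using fr[of c2 s2] c2 by (auto simp: s3_def)
  have r3: "safe U B c3 s3" "fst (sem c3 s3) 6 = of_bool small" using 3[OF c3] by auto
  have c4: "input_ctx s4" "fst s4 7 = 1" "fst s4 6 = of_bool small"
    using fr[of c3 s3] c3 r3 by (auto simp: s4_def)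
  have r4: "safe U B c4 s4" "fst (sem c4 s4) 7 = q" using 4[OF c4] by auto
  have v5: "fst (sem c4 s4) 9 = 2 ^ k" "fst (sem c4 s4) 12 = L" "fst (sem c4 s4) 6 = of_bool small"
    "snd (sem c4 s4) 1 = snd (sem c1 s1) 1"
    using r1 r2 c4 by (auto simp: sem_frame sem_frame_arr mods s4_def s3_def s2_def)
  have i4: "input_ctx (sem c4 s4)" using fr c4 by auto
  have c5: "input_ctx s6" "fst s6 6 = of_bool small" "fst s6 7 = q" "fst s6 8 = R" "fst s6 9 = 2 ^ k"
    "fst s6 10 = N" "fst s6 11 = EV" "snd s6 1 = snd (sem c1 s1) 1"
    using v5 i4 r4 by (simp_all add: s6_def s5_def R_def N_def EV_def input_ctx_def)
  have r5: "safe U B c5 s6" "\<forall>i < k - 1. snd (sem c5 s6) 2 i = fst (tas ! i) \<and> snd (sem c5 s6) 3 i = snd (tas ! i)"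
    using 5[OF c5(1)] by auto
  have sem: "sem (setup_phase \<alpha>) s = sem c5 s6"
    unfolding prog s6_def s5_def s4_def s3_def s2_def s1_def by simp
  have "setup_ctx (sem c5 s6)"
    unfolding setup_ctx_def using c5 r5 r1(4) fr[of c5 s6] by (auto simp: sem_frame sem_frame_arr mods)
  moreover have "safe U B (setup_phase \<alpha>) s"
  proof -
    have "R \<le> U" "N \<le> U" "EV \<le> U" "Suc \<alpha> \<le> U" using U by linarith+
    note this[unfolded EV_def N_def R_def]
    moreover have "fst (sem c4 s4) 1 = n" "fst (sem c4 s4) 2 = m" "fst (sem c4 s4) 4 = k"
      using i4 by (auto simp: input_ctx_def)
    moreover have "safe U B c5 (sem (11 <- Var 8 [*] Var 2 [*] Var 7 [*] Var 4) (sem (10 <- Var 8 [*] Var 1 [*] Var 7) s5))"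
      using r5 by (simp add: s6_def)
    ultimately show ?thesis
      unfolding prog using r1(1) r2(1) r3(1) r4 U' v5
      by (simp add: nregs_def s1_def s2_def s3_def s4_def s5_def)
  qed
  moreover have "snd (sem c5 s6) a = snd s a" if "a > 3" for a
    using that by (simp add: sem_frame_arr mods s6_def s5_def s4_def s3_def s2_def s1_def)
  ultimately show ?thesis using sem by simp
qed

end

section \<open>Correctness of the program\<close>

context occurrence_problem
begin

section \<open>The arcs of the target graph as numbered slots\<close>

definition slot_of :: "nat \<Rightarrow> nat \<Rightarrow> nat \<Rightarrow> nat \<Rightarrow> nat \<times> nat \<times> nat" where
  "slot_of \<tau> e \<rho> j = (case es ! e of (u, w) \<Rightarrow>
     (num \<tau> u \<rho>, num \<tau> w (if down u w \<and> small then \<rho> * k + j + 1 else \<rho>),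
      if down u w then
        if small then of_bool (j < P (t w) \<and> \<rho> * k + j + 1 < q) else if j = 0 then 2 else 0
      else if j = 0 then 1 else 0))"

text \<open>Decodes \<open>slot_index\<close>, a mixed-radix number with the copy as lowest digit
  and the trial as highest; this is the order in which the nested loops write the slots.\<close>

definition slot :: "nat \<Rightarrow> nat \<times> nat \<times> nat" where
  "slot c = slot_of (c div k div q div m) (c div k div q mod m) (c div k mod q) (c mod k)"

definition slot_index :: "nat \<Rightarrow> nat \<Rightarrow> nat \<Rightarrow> nat \<Rightarrow> nat" where
  "slot_index \<tau> e \<rho> j = ((\<tau> * m + e) * q + \<rho>) * k + j"

lemma slot_slot_index: "e < m \<Longrightarrow> \<rho> < q \<Longrightarrow> j < k \<Longrightarrow> slot (slot_index \<tau> e \<rho> j) = slot_of \<tau> e \<rho> j"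
  by (cases "es = []") (simp_all add: slot_def slot_index_def)

lemma mult_add_less: "a < c \<Longrightarrow> b < w \<Longrightarrow> a * w + b < c * (w :: nat)"
proof -
  assume "a < c" "b < w"
  then have "a * w + b < (a + 1) * w" by simp
  also have "\<dots> \<le> c * w" using \<open>a < c\<close> by (intro mult_le_mono1) simp
  finally show ?thesis .
qed

lemma slot_index_less:
  "\<tau> < R \<Longrightarrow> e < m \<Longrightarrow> \<rho> < q \<Longrightarrow> j < k \<Longrightarrow> slot_index \<tau> e \<rho> j < EV"
  unfolding slot_index_def EV_def by (intro mult_add_less)

lemma slot_index_exhaust:
  assumes "c < EV"
  obtains \<tau> e \<rho> j where "c = slot_index \<tau> e \<rho> j" "\<tau> < R" "e < m" "\<rho> < q" "j < k"
proof
  have pos: "0 < m" "0 < q" "0 < k" using assms by (auto simp: EV_def intro!: Nat.gr0I)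
  show "c div k div q mod m < m" "c div k mod q < q" "c mod k < k" using pos by auto
  show "c div k div q div m < R"
    using assms unfolding EV_def by (intro less_mult_imp_div_less) (simp add: mult.assoc)
  show "c = slot_index (c div k div q div m) (c div k div q mod m) (c div k mod q) (c mod k)"
    unfolding slot_index_def by (simp only: div_mult_mod_eq)
qed

lemma E0_slots: "(y, z) \<in> E0 \<longleftrightarrow> (\<exists>c < EV. slot c = (y, z, 1))"
proof
  assume "(y, z) \<in> E0"
  then obtain \<tau> u w \<rho> \<rho>' where *: "y = num \<tau> u \<rho>" "z = num \<tau> w \<rho>'" "\<tau> < R" "(u, w) \<in> E" "\<rho> < q"
     "\<rho>' < q" "\<not> down u w \<and> \<rho>' = \<rho> \<or> down u w \<and> small \<and> (\<exists>j < min k (P (t w)). \<rho>' = \<rho> * k + j + 1)"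
    unfolding E0_def by blast
  obtain e where e: "e < m" "es ! e = (u, w)" using *(4) E by (metis in_set_conv_nth)
  obtain j where "j < k" "slot_of \<tau> e \<rho> j = (y, z, 1)"
  proof (cases "down u w")
    case True
    then obtain j where "j < k" "j < P (t w)" "\<rho>' = \<rho> * k + j + 1" "small" using *(7) by auto
    then show ?thesis using that[of j] * e True by (simp add: slot_of_def)
  next
    case False
    then show ?thesis using that[of 0] * e k_pos by (simp add: slot_of_def)
  qed
  then show "\<exists>c < EV. slot c = (y, z, 1)"
    using slot_index_less[OF *(3) e(1) *(5)] slot_slot_index[OF e(1) *(5)] by metis
next
  assume "\<exists>c < EV. slot c = (y, z, 1)"
  then obtain c where c: "c < EV" "slot c = (y, z, 1)" by blast
  obtain \<tau> e \<rho> j where *: "c = slot_index \<tau> e \<rho> j" "\<tau> < R" "e < m" "\<rho> < q" "j < k"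
    using slot_index_exhaust[OF c(1)] .
  obtain u w where uw: "es ! e = (u, w)" by (metis prod.exhaust)
  then have "(u, w) \<in> E" using *(3) E by (metis nth_mem)
  moreover have s: "slot_of \<tau> e \<rho> j = (y, z, 1)" using c(2) * slot_slot_index by simp
  have "\<exists>\<rho>'. y = num \<tau> u \<rho> \<and> z = num \<tau> w \<rho>' \<and> \<rho>' < q \<and>
     (\<not> down u w \<and> \<rho>' = \<rho> \<or> down u w \<and> small \<and> (\<exists>j < min k (P (t w)). \<rho>' = \<rho> * k + j + 1))"
    using s uw *(4,5) by (auto simp: slot_of_def of_bool_def split: if_splits)
  ultimately show "(y, z) \<in> E0" unfolding E0_def using *(2,4) by blast
qed

lemma E1_slots: "(y, z) \<in> E1 \<longleftrightarrow> (\<exists>c < EV. slot c = (y, z, 2))"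
proof
  assume "(y, z) \<in> E1"
  then obtain \<tau> u w \<rho> where *: "y = num \<tau> u \<rho>" "z = num \<tau> w \<rho>" "\<tau> < R" "(u, w) \<in> E" "\<rho> < q"
     "down u w" "\<not> small"
    unfolding E1_def by blast
  obtain e where e: "e < m" "es ! e = (u, w)" using *(4) E by (metis in_set_conv_nth)
  have "slot_of \<tau> e \<rho> 0 = (y, z, 2)" using * e by (simp add: slot_of_def)
  then show "\<exists>c < EV. slot c = (y, z, 2)"
    using slot_index_less[OF *(3) e(1) *(5) k_pos] slot_slot_index[OF e(1) *(5) k_pos] by metis
next
  assume "\<exists>c < EV. slot c = (y, z, 2)"
  then obtain c where c: "c < EV" "slot c = (y, z, 2)" by blast
  obtain \<tau> e \<rho> j where *: "c = slot_index \<tau> e \<rho> j" "\<tau> < R" "e < m" "\<rho> < q" "j < k"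
    using slot_index_exhaust[OF c(1)] .
  obtain u w where uw: "es ! e = (u, w)" by (metis prod.exhaust)
  then have "(u, w) \<in> E" using *(3) E by (metis nth_mem)
  moreover have "slot_of \<tau> e \<rho> j = (y, z, 2)" using c(2) * slot_slot_index by simp
  then have "y = num \<tau> u \<rho> \<and> z = num \<tau> w \<rho> \<and> down u w \<and> \<not> small"
    using uw *(4,5) by (auto simp: slot_of_def of_bool_def split: if_splits)
  ultimately show "(y, z) \<in> E1" unfolding E1_def using *(2,4) by blast
qed

lemma slot_flag: "slot c = (y, z, f) \<Longrightarrow> f \<le> 2"
  by (auto simp: slot_def slot_of_def split: prod.splits if_splits)

end

context bounded_problem
begin

lemma slot_stmt:
  assumes ctx: "setup_ctx s" and v: "fst s 22 = \<tau>" "fst s 15 = e" "fst s 16 = u" "fst s 17 = w"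
    "fst s 20 = of_bool (down u w)" "fst s 21 = P (t w)" "fst s 23 = \<rho>" "fst s 24 = j"
    "fst s 27 = c"
    and b: "\<tau> < R" "e < m" "\<rho> < q" "j < k" "c < EV" and e: "es ! e = (u, w)"
  shows "safe U B slot_stmt s" "fst (sem slot_stmt s) 27 = Suc c"
    "snd (sem slot_stmt s) 4 = (snd s 4)(c := fst (slot_of \<tau> e \<rho> j))"
    "snd (sem slot_stmt s) 5 = (snd s 5)(c := fst (snd (slot_of \<tau> e \<rho> j)))"
    "snd (sem slot_stmt s) 6 = (snd s 6)(c := snd (snd (slot_of \<tau> e \<rho> j)))"
proof -
  have x: "fst s 1 = n" "fst s 4 = k" "fst s 6 = of_bool small" "fst s 7 = q"
    using ctx by (auto simp: setup_ctx_def input_ctx_def)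
  have lt: "u < n" "w < n" using es_less[OF b(2)] e by auto
  have nu: "num \<tau> u 0 + q \<le> N" "num \<tau> w 0 + q \<le> N" if "a < n" for a
  proof -
    have "num \<tau> a (q - 1) < N" if "a < n" for a
      using num_less[OF b(1) that, of "q - 1"] q_pos by (simp add: N_def)
    from this[OF lt(1)] this[OF lt(2)] show "num \<tau> u 0 + q \<le> N" "num \<tau> w 0 + q \<le> N"
      using q_pos by (simp_all add: num_def)
  qed
  have \<rho>': "\<rho> * k + j + 1 \<le> q * k" using mult_add_less[OF b(3,4)] by simp
  have le: "(\<tau> * n + u) * q + \<rho> \<le> U" "(\<tau> * n + w) * q + \<rho> \<le> U" "\<rho> * k + j + 1 \<le> U" "\<rho> \<le> U"
    "(\<tau> * n + w) * q + (\<rho> * k + j + 1) \<le> U" "c + 1 \<le> U"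
    using nu[OF lt(1)] \<rho>' b U(8,9) by (auto simp: num_def)
  define c0 where "c0 = IfNZ (Var 20)
       (IfNZ (Var 6)
          (25 <- Var 23 [*] Var 4 [+] Var 24 [+] Num 1 ;;
           IfNZ ((Var 21 [-] Var 24) [*] (Var 7 [-] Var 25)) (26 <- Num 1) (26 <- Num 0))
          (25 <- Var 23 ;; IfNZ (Var 24) (26 <- Num 0) (26 <- Num 2)))
       (25 <- Var 23 ;; IfNZ (Var 24) (26 <- Num 0) (26 <- Num 1))"
  define c1 where "c1 = (
     Update 4 (Var 27) ((Var 22 [*] Var 1 [+] Var 16) [*] Var 7 [+] Var 23) ;;
     Update 5 (Var 27) ((Var 22 [*] Var 1 [+] Var 17) [*] Var 7 [+] Var 25) ;;
     Update 6 (Var 27) (Var 26) ;;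
     27 <- Var 27 [+] Num 1)"
  have prog: "slot_stmt = (c0 ;; c1)" by (simp add: slot_stmt_def c0_def c1_def)
  define p where "p = (if down u w \<and> small then \<rho> * k + j + 1 else \<rho>)"
  define f where "f = snd (snd (slot_of \<tau> e \<rho> j))"
  have f: "f = (if down u w then
        if small then of_bool (j < P (t w) \<and> \<rho> * k + j + 1 < q) else if j = 0 then 2 else 0
      else if j = 0 then 1 else 0)" by (simp add: f_def slot_of_def e)
  have s0: "safe U B c0 s" "fst (sem c0 s) 25 = p" "fst (sem c0 s) 26 = f" "snd (sem c0 s) = snd s"
    using v x le U(1) unfolding c0_def p_def f
    by (cases "down u w"; cases small; cases "j = 0"; simp add: nregs_def)+
  have fr: "fst (sem c0 s) y = fst s y" if "y \<notin> {25, 26}" for y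
    by (rule sem_frame) (use that in \<open>auto simp: c0_def\<close>)
  define s' where "s' = sem c0 s"
  have v': "fst s' 22 = \<tau>" "fst s' 16 = u" "fst s' 17 = w" "fst s' 23 = \<rho>" "fst s' 27 = c"
    "fst s' 1 = n" "fst s' 7 = q" "fst s' 25 = p" "fst s' 26 = f" "snd s' = snd s"
    using v x fr s0 unfolding s'_def by simp_all
  have p: "(\<tau> * n + w) * q + p \<le> U" using le by (simp add: p_def)
  have "f \<le> U" using U(1) by (simp add: f)
  then have s1: "safe U B c1 s'" "fst (sem c1 s') 27 = Suc c"
    "snd (sem c1 s') 4 = (snd s 4)(c := num \<tau> u \<rho>)"
    "snd (sem c1 s') 5 = (snd s 5)(c := num \<tau> w p)"
    "snd (sem c1 s') 6 = (snd s 6)(c := f)"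
    using v' le p U(1) unfolding c1_def by (simp_all add: nregs_def num_def)
  have "fst (slot_of \<tau> e \<rho> j) = num \<tau> u \<rho>" "fst (snd (slot_of \<tau> e \<rho> j)) = num \<tau> w p"
    by (simp_all add: slot_of_def e p_def)
  then show "safe U B slot_stmt s" "fst (sem slot_stmt s) 27 = Suc c"
    "snd (sem slot_stmt s) 4 = (snd s 4)(c := fst (slot_of \<tau> e \<rho> j))"
    "snd (sem slot_stmt s) 5 = (snd s 5)(c := fst (snd (slot_of \<tau> e \<rho> j)))"
    "snd (sem slot_stmt s) 6 = (snd s 6)(c := snd (snd (slot_of \<tau> e \<rho> j)))"
    using s0 s1 unfolding prog s'_def f_def by simp_all
qed

definition slots_upto :: "nat \<Rightarrow> st \<Rightarrow> bool" where
  "slots_upto c s \<longleftrightarrow> setup_ctx s \<and> fst s 27 = c \<and>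
     (\<forall>c' < c. (snd s 4 c', snd s 5 c', snd s 6 c') = slot c')"

lemma slots_upto_set_var [simp]: "x > 11 \<Longrightarrow> x \<noteq> 27 \<Longrightarrow> slots_upto c (set_var x i s) = slots_upto c s"
  by (simp add: slots_upto_def)

text \<open>The invariant \<open>slots_upto\<close> serves all four loops: the slot reached at the
  end of an inner loop is the first one of the next iteration outside, by the carry of mixed-radix
  numbers.\<close>

lemma arcs_phase:
  assumes ctx: "setup_ctx s"
  shows "safe U B arcs_phase s \<and> setup_ctx (sem arcs_phase s) \<and>
    (\<forall>c < EV. (snd (sem arcs_phase s) 4 c, snd (sem arcs_phase s) 5 c, snd (sem arcs_phase s) 6 c) = slot c)"
proof -
  have U': "1 \<le> U" "R \<le> U" "m \<le> U" "q \<le> U" "k \<le> U" using U k_le m_le by auto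
  let ?jl = "For 24 (Var 4) slot_stmt"
  let ?\<rho>l = "For 23 (Var 7) ?jl"
  let ?el = "For 15 (Var 2) (read_arc ;; ?\<rho>l)"
  let ?\<tau>l = "For 22 (Var 8) ?el"
  have vals: "fst s 2 = m" "fst s 4 = k" "fst s 7 = q" "fst s 8 = R" if "setup_ctx s" for s
    using that by (auto simp: setup_ctx_def input_ctx_def)
  define loc where "loc \<tau> e u w s \<longleftrightarrow> fst s 22 = \<tau> \<and> fst s 15 = e \<and> fst s 16 = u \<and> fst s 17 = w \<and>
    fst s 20 = of_bool (down u w) \<and> fst s 21 = P (t w)" for \<tau> e u w and s :: st
  have loc_fr: "loc \<tau> e u w (sem c s) = loc \<tau> e u w s" if "mods c \<inter> {15..22} = {}" for \<tau> e u w c s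
  proof -
    have "fst (sem c s) x = fst s x" if "x \<in> {15..22}" for x
      using that \<open>mods c \<inter> {15..22} = {}\<close> by (intro sem_frame) auto
    then show ?thesis by (simp add: loc_def)
  qed
  have loc_sv: "loc \<tau> e u w (set_var x i s) = loc \<tau> e u w s" if "x > 22" for \<tau> e u w x i s
    using that unfolding loc_def by simp
  have j_loop: "safe U B ?jl s \<and> slots_upto (slot_index \<tau> e (Suc \<rho>) 0) (sem ?jl s) \<and> loc \<tau> e u w (sem ?jl s)"
    if I: "slots_upto (slot_index \<tau> e \<rho> 0) s" "loc \<tau> e u w s" "fst s 23 = \<rho>"
      and b: "\<tau> < R" "e < m" "\<rho> < q" "es ! e = (u, w)" for \<tau> e \<rho> u w s
  proof -
    let ?I = "\<lambda>j s. slots_upto (slot_index \<tau> e \<rho> j) s \<and> loc \<tau> e u w s \<and> fst s 23 = \<rho>"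
    have k: "eval (Var 4) s = k" using I vals by (simp add: slots_upto_def)
    have "safe U B ?jl s \<and> ?I (eval (Var 4) s) (sem ?jl s)"
    proof (rule for_rule)
      fix j s' assume "j < eval (Var 4) s" and I: "?I j s'"
      then have j: "j < k" using k by simp
      let ?s = "set_var 24 j s'" and ?c = "slot_index \<tau> e \<rho> j"
      have c: "?c < EV" by (rule slot_index_less[OF b(1-3) j])
      have ctx: "setup_ctx ?s" using I by (simp add: slots_upto_def)
      have vs: "fst ?s 22 = \<tau>" "fst ?s 15 = e" "fst ?s 16 = u" "fst ?s 17 = w"
        "fst ?s 20 = of_bool (down u w)" "fst ?s 21 = P (t w)" "fst ?s 23 = \<rho>" "fst ?s 24 = j"
        "fst ?s 27 = ?c"
        using I by (simp_all add: loc_def slots_upto_def)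
      note sl = slot_stmt[OF ctx vs b(1-3) j c b(4)]
      have Sc: "slot_index \<tau> e \<rho> (Suc j) = Suc ?c" by (simp add: slot_index_def)
      have "setup_ctx (sem slot_stmt ?s)"
        by (rule setup_ctx_frame[OF _ _ ctx]) (auto simp: slot_stmt_def)
      moreover have "\<forall>c' < ?c. (snd s' 4 c', snd s' 5 c', snd s' 6 c') = slot c'"
        using I by (simp add: slots_upto_def)
      ultimately have "slots_upto (Suc ?c) (sem slot_stmt ?s)"
        unfolding slots_upto_def using sl(2-5) slot_slot_index[OF b(2,3) j]
        by (auto simp: less_Suc_eq)
      moreover have "loc \<tau> e u w (sem slot_stmt ?s)"
        by (subst loc_fr) (use I in \<open>auto simp: slot_stmt_def loc_sv\<close>)
      moreover have "fst (sem slot_stmt ?s) 23 = \<rho>"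
        by (subst sem_frame) (use I in \<open>auto simp: slot_stmt_def\<close>)
      ultimately show "safe U B slot_stmt ?s \<and> ?I (Suc j) (sem slot_stmt ?s)"
        using sl(1) Sc by simp
    qed (use I k U' in \<open>auto simp: nregs_def\<close>)
    moreover have "slot_index \<tau> e (Suc \<rho>) 0 = slot_index \<tau> e \<rho> k" by (simp add: slot_index_def)
    ultimately show ?thesis unfolding k by simp
  qed
  have \<rho>_loop: "safe U B ?\<rho>l s \<and> slots_upto (slot_index \<tau> (Suc e) 0 0) (sem ?\<rho>l s) \<and> fst (sem ?\<rho>l s) 22 = \<tau>"
    if I: "slots_upto (slot_index \<tau> e 0 0) s" "loc \<tau> e u w s"
      and b: "\<tau> < R" "e < m" "es ! e = (u, w)" for \<tau> e u w s
  proof -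
    let ?I = "\<lambda>\<rho> s. slots_upto (slot_index \<tau> e \<rho> 0) s \<and> loc \<tau> e u w s"
    have q: "eval (Var 7) s = q" using I vals by (simp add: slots_upto_def)
    have "safe U B ?\<rho>l s \<and> ?I (eval (Var 7) s) (sem ?\<rho>l s)"
    proof (rule for_rule)
      fix \<rho> s' assume "\<rho> < eval (Var 7) s" and I: "?I \<rho> s'"
      then have "\<rho> < q" using q by simp
      then show "safe U B ?jl (set_var 23 \<rho> s') \<and> ?I (Suc \<rho>) (sem ?jl (set_var 23 \<rho> s'))"
        using I b by (intro j_loop) (simp_all add: loc_sv)
    qed (use I q U' in \<open>auto simp: nregs_def\<close>)
    moreover have "slot_index \<tau> (Suc e) 0 0 = slot_index \<tau> e q 0" by (simp add: slot_index_def)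
    moreover have "loc \<tau> e u w s' \<Longrightarrow> fst s' 22 = \<tau>" for s' by (simp add: loc_def)
    ultimately show ?thesis unfolding q by simp
  qed
  have e_loop: "safe U B ?el s \<and> slots_upto (slot_index (Suc \<tau>) 0 0 0) (sem ?el s)"
    if I: "slots_upto (slot_index \<tau> 0 0 0) s" "fst s 22 = \<tau>" and b: "\<tau> < R" for \<tau> s
  proof -
    let ?I = "\<lambda>e s. slots_upto (slot_index \<tau> e 0 0) s \<and> fst s 22 = \<tau>"
    have m: "eval (Var 2) s = m" using I vals by (simp add: slots_upto_def)
    have "safe U B ?el s \<and> ?I (eval (Var 2) s) (sem ?el s)"
    proof (rule for_rule)
      fix e s' assume "e < eval (Var 2) s" and I: "?I e s'"
      then have e: "e < m" using m by simp
      obtain u w where uw: "es ! e = (u, w)" by (metis prod.exhaust)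
      let ?s = "set_var 15 e s'"
      have c: "input_ctx ?s" "fst ?s 15 = e" using I by (auto simp: slots_upto_def setup_ctx_def)
      note ra = read_arc[OF c e uw]
      have fr: "fst (sem read_arc ?s) x = fst ?s x" if "x \<notin> {16..21}" for x
        by (rule sem_frame) (use that in \<open>auto simp: read_arc_def\<close>)
      have "setup_ctx (sem read_arc ?s)"
        by (rule setup_ctx_frame) (use I in \<open>auto simp: read_arc_def slots_upto_def\<close>)
      then have "slots_upto (slot_index \<tau> e 0 0) (sem read_arc ?s)"
        using I ra(6) fr[of 27] by (simp add: slots_upto_def)
      moreover have "loc \<tau> e u w (sem read_arc ?s)"
        unfolding loc_def using ra fr[of 22] fr[of 15] I by simp
      ultimately show "safe U B (read_arc ;; ?\<rho>l) ?s \<and> ?I (Suc e) (sem (read_arc ;; ?\<rho>l) ?s)"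
        using \<rho>_loop[OF _ _ b e uw] ra(1) by (simp del: safe.simps(6) sem.simps(6))
    qed (use I m U' in \<open>auto simp: nregs_def\<close>)
    moreover have "slot_index (Suc \<tau>) 0 0 0 = slot_index \<tau> m 0 0" by (simp add: slot_index_def)
    ultimately show ?thesis unfolding m by simp
  qed
  let ?s = "sem (27 <- Num 0) s"
  have R: "eval (Var 8) ?s = R" using ctx vals by simp
  have s0: "slots_upto (slot_index 0 0 0 0) ?s" using ctx by (simp add: slots_upto_def slot_index_def)
  have "safe U B ?\<tau>l ?s \<and> slots_upto (slot_index (eval (Var 8) ?s) 0 0 0) (sem ?\<tau>l ?s)"
  proof (rule for_rule)
    fix \<tau> s' assume "\<tau> < eval (Var 8) ?s" and I: "slots_upto (slot_index \<tau> 0 0 0) s'"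
    then have "\<tau> < R" using R by simp
    then show "safe U B ?el (set_var 22 \<tau> s') \<and> slots_upto (slot_index (Suc \<tau>) 0 0 0) (sem ?el (set_var 22 \<tau> s'))"
      using I by (intro e_loop) simp_all
  qed (use s0 R U' in \<open>auto simp: nregs_def\<close>)
  moreover have "slot_index R 0 0 0 = EV" by (simp add: slot_index_def EV_def)
  ultimately show ?thesis
    using U' R unfolding arcs_phase_def slots_upto_def
    by (simp add: nregs_def del: safe.simps(6) sem.simps(6))
qed

end

section \<open>The dynamic program under a fixed coloring\<close>

locale colored_problem = bounded_problem +
  fixes cs :: "nat list"
  assumes length_cs: "length cs = N" and cs_less: "set cs \<subseteq> {..<k}"
begin

sublocale color_coding tas k r d N E0 E1 "nth cs"
proof
  show "E0 \<subseteq> {..<N} \<times> {..<N}" "E1 \<subseteq> {..<N} \<times> {..<N}" using E0_E1_less by (simp_all add: N_def)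
  show "cs ! z < k" if "z < N" for z
  proof -
    have "cs ! z \<in> set cs" using that length_cs by simp
    then show ?thesis using cs_less by blast
  qed
qed

definition ctx :: "st \<Rightarrow> bool" where
  "ctx s \<longleftrightarrow> setup_ctx s \<and> (\<forall>c < EV. (snd s 4 c, snd s 5 c, snd s 6 c) = slot c) \<and>
     (\<forall>z < N. snd s 7 z = cs ! z)"

lemma ctx_frame:
  assumes "mods c \<inter> {1..11} = {}" "upds c \<inter> {0..7} = {}" "ctx s"
  shows "ctx (sem c s)"
proof -
  have "snd (sem c s) a = snd s a" if "a \<in> {0..7}" for a
    using that assms(2) by (intro sem_frame_arr) auto
  moreover have "setup_ctx (sem c s)"
    using assms by (intro setup_ctx_frame) (auto simp: ctx_def disjoint_iff)
  ultimately show ?thesis using assms(3) by (simp add: ctx_def)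
qed

lemma ctx_set_var [simp]: "x > 11 \<Longrightarrow> ctx (set_var x i s) = ctx s"
  by (simp add: ctx_def)

lemma ctx_set_arr [simp]: "ctx (set_arr 8 i y s) = ctx s"
  by (simp add: ctx_def)

lemma ctx_vals:
  assumes "ctx s"
  shows "fst s 1 = n" "fst s (Suc 0) = n" "fst s 4 = k" "fst s 5 = r" "fst s 7 = q" "fst s 8 = R"
    "fst s 9 = 2 ^ k" "fst s 10 = N" "fst s 11 = EV"
  using assms by (auto simp: ctx_def setup_ctx_def input_ctx_def)

definition index :: "nat \<Rightarrow> nat \<Rightarrow> nat \<Rightarrow> nat \<Rightarrow> nat" where
  "index z x j v = ((z * k + x) * k + j) * 2 ^ k + v"

text \<open>Distinct entries occupy distinct cells, so setting one cell adds a single entry to the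
  table.\<close>

lemma index_inj:
  assumes "index z x j v = index z' x' j' v'" "x < k" "x' < k" "j < k" "j' < k" "v < 2 ^ k" "v' < 2 ^ k"
  shows "z = z' \<and> x = x' \<and> j = j' \<and> v = v'"
proof -
  have v: "index z x j v mod 2 ^ k = v" "index z x j v div 2 ^ k = (z * k + x) * k + j"
    if "v < 2 ^ k" for z x j v using that by (simp_all add: index_def)
  have "v = v'" "(z * k + x) * k + j = (z' * k + x') * k + j'"
    using v[OF assms(6)] v[OF assms(7)] assms(1) by metis+
  moreover have j: "((z * k + x) * k + j) mod k = j" "((z * k + x) * k + j) div k = z * k + x"
    if "j < k" for z x j using that by simp_all
  have "j = j'" "z * k + x = z' * k + x'"
    using j[OF assms(4)] j[OF assms(5)] calculation(2) by metis+
  moreover have x: "(z * k + x) mod k = x" "(z * k + x) div k = z" if "x < k" for z x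
    using that by simp_all
  have "x = x'" "z = z'"
    using x[OF assms(2)] x[OF assms(3)] calculation(4) by metis+
  ultimately show ?thesis by blast
qed

definition entry :: "st \<Rightarrow> nat \<Rightarrow> nat \<Rightarrow> nat \<Rightarrow> nat \<Rightarrow> bool" where
  "entry s z x j v \<longleftrightarrow> snd s 8 (index z x j v) \<noteq> 0"

lemma entry_grows: "grows s s' \<Longrightarrow> entry s z x j v \<Longrightarrow> entry s' z x j v"
  by (simp add: grows_def entry_def)

lemma entry_set_var [simp]: "entry (set_var y i s) z x j v = entry s z x j v"
  by (simp add: entry_def)

text \<open>Soundness is preserved by every single update and so can be an invariant of all loops,
  whereas completeness is reached only level by level.\<close>

definition sound :: "st \<Rightarrow> bool" where
  "sound s \<longleftrightarrow> ctx s \<and> (\<forall>z < N. \<forall>x < k. \<forall>j < k. \<forall>v < 2 ^ k.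
     entry s z x j v \<longrightarrow> colorful z x j (set_decode v))"

lemma sound_set_var [simp]: "x > 11 \<Longrightarrow> sound (set_var x i s) = sound s"
  by (simp add: sound_def)

lemma sound_set:
  assumes "sound s" "colorful z x j (set_decode v)" "z < N" "x < k" "j < k" "v < 2 ^ k"
  shows "sound (set_arr 8 (index z x j v) 1 s)" "entry (set_arr 8 (index z x j v) 1 s) z x j v"
proof -
  show "entry (set_arr 8 (index z x j v) 1 s) z x j v" by (simp add: entry_def)
  show "sound (set_arr 8 (index z x j v) 1 s)"
    unfolding sound_def
  proof (intro conjI allI impI)
    show "ctx (set_arr 8 (index z x j v) 1 s)" using assms(1) by (simp add: sound_def)
    fix z' x' j' v'
    assume *: "z' < N" "x' < k" "j' < k" "v' < 2 ^ k" "entry (set_arr 8 (index z x j v) 1 s) z' x' j' v'"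
    show "colorful z' x' j' (set_decode v')"
    proof (cases "index z' x' j' v' = index z x j v")
      case True
      then show ?thesis using index_inj[of z' x' j' v' z x j v] * assms by auto
    next
      case False
      then have "entry s z' x' j' v'" using *(5) by (simp add: entry_def)
      then show ?thesis using assms(1) * by (simp add: sound_def)
    qed
  qed
qed

lemma eval_cell: "fst s 4 = k \<Longrightarrow> fst s 9 = 2 ^ k \<Longrightarrow>
    eval (cell a b c e) s = index (eval a s) (eval b s) (eval c s) (eval e s)"
  by (simp add: cell_def index_def)

lemma safe_cell: "safe_aexp U B (cell a b c e) s \<longleftrightarrow>
    safe_aexp U B a s \<and> safe_aexp U B b s \<and> safe_aexp U B c s \<and> safe_aexp U B e s"
  by (auto simp: cell_def nregs_def)

lemma decode_subset: "v < 2 ^ k \<Longrightarrow> set_decode v \<subseteq> {..<k}"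
proof
  fix i assume v: "v < 2 ^ k" and "i \<in> set_decode v"
  then have "odd (v div 2 ^ i)" by (simp add: set_decode_def)
  then have "2 ^ i \<le> v" by (metis div_less even_zero not_le)
  then have "2 ^ i < (2::nat) ^ k" using v by linarith
  then show "i \<in> {..<k}" by simp
qed

lemma encode_less: "S \<subseteq> {..<k} \<Longrightarrow> set_encode S < 2 ^ k"
proof -
  assume "S \<subseteq> {..<k}"
  then have "set_encode S \<le> sum ((^) 2) {..<k}"
    unfolding set_encode_def by (intro sum_mono2) auto
  also have "\<dots> < 2 ^ k" by (induction k) auto
  finally show ?thesis .
qed

lemma finite_color_set: "S \<subseteq> {..<k} \<Longrightarrow> finite S"
  by (rule finite_subset) auto

lemma decode_power: "set_decode (2 ^ c) = {c}"
  using set_encode_inverse[of "{c}"] by (simp add: set_encode_def)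

text \<open>The bit masks of disjoint sets add without carries.\<close>

lemma decode_add:
  assumes "set_decode v \<inter> set_decode v' = {}"
  shows "set_decode (v + v') = set_decode v \<union> set_decode v'"
proof -
  have "set_encode (set_decode v \<union> set_decode v') = v + v'"
    using assms unfolding set_encode_def by (subst sum.union_disjoint)
      (simp_all add: finite_set_decode set_encode_def[symmetric])
  then show ?thesis using set_encode_inverse[of "set_decode v \<union> set_decode v'"] by (simp add: finite_set_decode)
qed

lemma le_U: "N \<le> U" "EV \<le> U" "k \<le> U" "2 ^ k \<le> U" "R \<le> U" "n \<le> U" "1 \<le> U" "2 \<le> U"
  using U k_le n_le by auto

lemma init_phase:
  assumes c: "ctx s" and z: "snd s 8 = (\<lambda>_. 0)"
  shows "safe U B init_phase s \<and> sound (sem init_phase s) \<and>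
    (\<forall>z < N. \<forall>x < k. entry (sem init_phase s) z x 0 (2 ^ (cs ! z)))"
proof -
  let ?b = "Update 8 (cell (Var 33) (Var 28) (Num 0) (Arr 1 (Arr 7 (Var 33)))) (Num 1)"
  let ?i = "For 28 (Var 4) ?b"
  have s: "sound s" using c z by (simp add: sound_def entry_def)
  have x_loop: "safe U B ?i s \<and> sound (sem ?i s) \<and> (\<forall>x < k. entry (sem ?i s) z x 0 (2 ^ (cs ! z)))"
    if s: "sound s" "fst s 33 = z" "z < N" for s z
  proof -
    have k: "eval (Var 4) s = k" using s ctx_vals by (simp add: sound_def)
    have "safe U B ?i s \<and> (sound (sem ?i s) \<and> fst (sem ?i s) 33 = z) \<and>
        (\<forall>x < eval (Var 4) s. entry (sem ?i s) z x 0 (2 ^ (cs ! z)))"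
    proof (rule for_grow_rule)
      fix x s' assume "x < eval (Var 4) s" and J: "sound s' \<and> fst s' 33 = z"
      then have x: "x < k" using k by simp
      have cx: "ctx s'" using J by (simp add: sound_def)
      have col: "cs ! z < k" by (rule color_less[OF s(3)])
      have ev: "eval (Arr 1 (Arr 7 (Var 33))) (set_var 28 x s') = 2 ^ (cs ! z)"
        using cx J s(3) col by (simp add: ctx_def setup_ctx_def)
      have lt: "(2::nat) ^ (cs ! z) < 2 ^ k" using col by simp
      have "colorful z x 0 (set_decode (2 ^ (cs ! z)))"
        using base[OF s(3) x] by (simp add: decode_power)
      note ss = sound_set[OF _ this s(3) x k_pos lt, of "set_var 28 x s'"]
      have ad: "eval (cell (Var 33) (Var 28) (Num 0) (Arr 1 (Arr 7 (Var 33)))) (set_var 28 x s') =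
          index z x 0 (2 ^ (cs ! z))"
        using J ctx_vals[OF cx] ev by (subst eval_cell) (simp_all del: eval.simps(4))
      then have sem: "sem ?b (set_var 28 x s') = set_arr 8 (index z x 0 (2 ^ (cs ! z))) 1 (set_var 28 x s')"
        by simp
      show "safe U B ?b (set_var 28 x s') \<and> (sound (sem ?b (set_var 28 x s')) \<and>
          fst (sem ?b (set_var 28 x s')) 33 = z) \<and> entry (sem ?b (set_var 28 x s')) z x 0 (2 ^ (cs ! z))"
        unfolding sem using ss J le_U by (simp add: safe_cell nregs_def)
    qed (use s k le_U in \<open>auto simp: nregs_def entry_grows\<close>)
    then show ?thesis using k by simp
  qed
  have N: "eval (Var 10) s = N" using c ctx_vals by simp
  have "safe U B init_phase s \<and> sound (sem init_phase s) \<and>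
      (\<forall>z < eval (Var 10) s. \<forall>x < k. entry (sem init_phase s) z x 0 (2 ^ (cs ! z)))"
    unfolding init_phase_def
  proof (rule for_grow_rule)
    fix z s' assume "z < eval (Var 10) s" and J: "sound s'"
    then have "z < N" using N by simp
    then show "safe U B ?i (set_var 33 z s') \<and> sound (sem ?i (set_var 33 z s')) \<and>
        (\<forall>x < k. entry (sem ?i (set_var 33 z s')) z x 0 (2 ^ (cs ! z)))"
      using J by (intro x_loop) simp_all
  qed (use s N le_U in \<open>auto simp: nregs_def entry_grows\<close>)
  then show ?thesis using N by simp
qed

lemma copy_stmt:
  assumes s: "sound s" and v: "fst s 24 = j" "fst s 31 = a" and j: "tas ! j = (a, b)" "j < k - 1"
  shows "safe U B copy_stmt s \<and> sound (sem copy_stmt s) \<and>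
    (\<forall>z < N. \<forall>x < k. x \<noteq> a \<longrightarrow> (\<forall>v < 2 ^ k. entry s z x j v \<longrightarrow> entry (sem copy_stmt s) z x (Suc j) v))"
proof -
  let ?b = "IfNZ (Arr 8 (cell (Var 33) (Var 28) (Var 24) (Var 29)))
        (Update 8 (cell (Var 33) (Var 28) (Var 24 [+] Num 1) (Var 29)) (Num 1)) Skip"
  let ?v = "For 29 (Var 9) ?b"
  let ?x = "IfNZ (neq_exp (Var 28) (Var 31)) ?v Skip"
  let ?z = "For 28 (Var 4) ?x"
  \<comment> \<open>Entries are compared with the state \<open>s\<close> before the pass;
    \<open>grows s s'\<close> ensures that they are still present when their turn comes.\<close>
  define J where "J s' \<longleftrightarrow> sound s' \<and> fst s' 24 = j \<and> fst s' 31 = a \<and> grows s s'" for s'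
  have J_sv: "J (set_var y i s') = J s'" if "y \<in> {28, 29, 33}" for y i s'
    using that by (auto simp: J_def)
  have Jc: "fst s' 4 = k" "fst s' 9 = 2 ^ k" "fst s' 10 = N" if "J s'" for s'
    using that ctx_vals by (auto simp: J_def sound_def)
  have v_loop: "safe U B ?v s0 \<and> (J (sem ?v s0) \<and> fst (sem ?v s0) 33 = z \<and> fst (sem ?v s0) 28 = x) \<and>
      (\<forall>v < 2 ^ k. entry s z x j v \<longrightarrow> entry (sem ?v s0) z x (Suc j) v)"
    if J: "J s0" and zx: "fst s0 33 = z" "fst s0 28 = x" "z < N" "x < k" "x \<noteq> a" for s0 z x
  proof -
    have K: "eval (Var 9) s0 = 2 ^ k" using Jc[OF J] by simp
    have "safe U B ?v s0 \<and> (J (sem ?v s0) \<and> fst (sem ?v s0) 33 = z \<and> fst (sem ?v s0) 28 = x) \<and>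
        (\<forall>v < eval (Var 9) s0. entry s z x j v \<longrightarrow> entry (sem ?v s0) z x (Suc j) v)"
    proof (rule for_grow_rule)
      fix v s' assume "v < eval (Var 9) s0" and J': "J s' \<and> fst s' 33 = z \<and> fst s' 28 = x"
      then have v: "v < 2 ^ k" using K by simp
      let ?s = "set_var 29 v s'"
      have J'': "J s'" and vs: "fst ?s 33 = z" "fst ?s 28 = x" "fst ?s 29 = v" "fst ?s 24 = j"
        "fst ?s 4 = k" "fst ?s 9 = 2 ^ k"
        using J' Jc by (auto simp: J_def)
      have ad: "eval (cell (Var 33) (Var 28) (Var 24) (Var 29)) ?s = index z x j v"
        "eval (cell (Var 33) (Var 28) (Var 24 [+] Num 1) (Var 29)) ?s = index z x (Suc j) v"
        using vs by (simp_all add: eval_cell)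
      have ex: "entry ?s z x j v" if "entry s z x j v"
        using that J'' entry_grows[of s s'] by (simp add: J_def)
      show "safe U B ?b ?s \<and> (J (sem ?b ?s) \<and> fst (sem ?b ?s) 33 = z \<and> fst (sem ?b ?s) 28 = x) \<and>
          (entry s z x j v \<longrightarrow> entry (sem ?b ?s) z x (Suc j) v)"
      proof (cases "entry ?s z x j v")
        case False
        then have zero: "snd s' 8 (index z x j v) = 0" by (simp add: entry_def)
        have ne: "\<not> entry s z x j v" using False ex by blast
        have sem: "sem ?b ?s = ?s" using ad zero by simp
        have "J (sem ?b ?s)" unfolding sem using J'' J_sv[of 29 v s'] by simp
        moreover have "safe U B ?b ?s" using ad zero by (simp add: safe_cell nregs_def)
        moreover have "fst (sem ?b ?s) 33 = z" "fst (sem ?b ?s) 28 = x" unfolding sem by (rule vs)+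
        ultimately show ?thesis using ne by blast
      next
        case True
        then have sem: "sem ?b ?s = set_arr 8 (index z x (Suc j) v) 1 ?s" using ad by (simp add: entry_def)
        have so: "sound ?s" using J'' by (simp add: J_def)
        then have "colorful z x j (set_decode v)"
          using True zx v j by (simp add: sound_def)
        then have c: "colorful z x (Suc j) (set_decode v)"
          using j zx(5) by (intro other) simp_all
        have "Suc j < k" using j(2) by simp
        note ss = sound_set[OF so c zx(3,4) this v]
        have "grows s (set_arr 8 (index z x (Suc j) v) 1 ?s)"
          using J'' by (simp add: J_def grows_def)
        then have "J (sem ?b ?s)" unfolding sem using ss(1) J'' by (simp add: J_def)
        then show ?thesis using ss(2) vs le_U sem by (simp add: safe_cell nregs_def)
      qed
    qed (use J zx K le_U in \<open>auto simp: nregs_def entry_grows\<close>)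
    then show ?thesis unfolding K by blast
  qed
  have x_loop: "safe U B ?z s0 \<and> J (sem ?z s0) \<and>
      (\<forall>x < k. x \<noteq> a \<longrightarrow> (\<forall>v < 2 ^ k. entry s z x j v \<longrightarrow> entry (sem ?z s0) z x (Suc j) v))"
    if J: "J s0" and z: "fst s0 33 = z" "z < N" for s0 z
  proof -
    have K: "eval (Var 4) s0 = k" using Jc[OF J] by simp
    have "safe U B ?z s0 \<and> (J (sem ?z s0) \<and> fst (sem ?z s0) 33 = z) \<and>
        (\<forall>x < eval (Var 4) s0. x \<noteq> a \<longrightarrow>
          (\<forall>v < 2 ^ k. entry s z x j v \<longrightarrow> entry (sem ?z s0) z x (Suc j) v))"
    proof (rule for_grow_rule)
      fix x s' assume "x < eval (Var 4) s0" and J': "J s' \<and> fst s' 33 = z"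
      then have x: "x < k" using K by simp
      let ?s = "set_var 28 x s'"
      have c: "eval (neq_exp (Var 28) (Var 31)) ?s = 0 \<longleftrightarrow> x = a" "safe_aexp U B (neq_exp (Var 28) (Var 31)) ?s"
        using J' by (simp_all add: J_def nregs_def)
      show "safe U B ?x ?s \<and> (J (sem ?x ?s) \<and> fst (sem ?x ?s) 33 = z) \<and> (x \<noteq> a \<longrightarrow>
          (\<forall>v < 2 ^ k. entry s z x j v \<longrightarrow> entry (sem ?x ?s) z x (Suc j) v))"
      proof (cases "x = a")
        case True
        then show ?thesis using c J' J_sv[of 28 x s'] by (simp del: safe.simps(6) sem.simps(6))
      next
        case False
        have "J ?s" "fst ?s 33 = z" "fst ?s 28 = x" using J' J_sv[of 28 x s'] by simp_all
        from v_loop[OF this z(2) x False] show ?thesis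
          using c False by (simp del: safe.simps(6) sem.simps(6))
      qed
    qed (use J z K le_U in \<open>auto simp: nregs_def entry_grows\<close>)
    then show ?thesis unfolding K by blast
  qed
  have J: "J s" using s v by (simp add: J_def)
  have N: "eval (Var 10) s = N" using Jc[OF J] by simp
  have "safe U B copy_stmt s \<and> J (sem copy_stmt s) \<and>
      (\<forall>z < eval (Var 10) s. \<forall>x < k. x \<noteq> a \<longrightarrow>
         (\<forall>v < 2 ^ k. entry s z x j v \<longrightarrow> entry (sem copy_stmt s) z x (Suc j) v))"
    unfolding copy_stmt_def
  proof (rule for_grow_rule)
    fix z s' assume "z < eval (Var 10) s" and J: "J s'"
    then have "z < N" using N by simp
    then show "safe U B ?z (set_var 33 z s') \<and> J (sem ?z (set_var 33 z s')) \<and>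
        (\<forall>x < k. x \<noteq> a \<longrightarrow>
         (\<forall>v < 2 ^ k. entry s z x j v \<longrightarrow> entry (sem ?z (set_var 33 z s')) z x (Suc j) v))"
      using J J_sv[of 33 z s'] by (intro x_loop) simp_all
  qed (use J N le_U in \<open>auto simp: nregs_def entry_grows\<close>)
  then show ?thesis using N by (simp add: J_def)
qed

end

lemma sem_IfNZ:
  "eval e s \<noteq> 0 \<Longrightarrow> sem (IfNZ e c c') s = sem c s"
  "eval e s = 0 \<Longrightarrow> sem (IfNZ e c c') s = sem c' s"
  by simp_all

lemma safe_IfNZ:
  "eval e s \<noteq> 0 \<Longrightarrow> safe U B (IfNZ e c c') s \<longleftrightarrow> safe_aexp U B e s \<and> safe U B c s"
  "eval e s = 0 \<Longrightarrow> safe U B (IfNZ e c c') s \<longleftrightarrow> safe_aexp U B e s \<and> safe U B c' s"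
  by simp_all

context colored_problem
begin

lemma disjoint_stmt:
  assumes ctx: "ctx s" and v: "fst s 29 = v" "fst s 30 = v'"
  shows "safe U B disjoint_stmt s \<and>
    (fst (sem disjoint_stmt s) 35 \<noteq> 0 \<longleftrightarrow> (\<forall>i < k. i \<notin> set_decode v \<inter> set_decode v'))"
proof -
  let ?b = "35 <- Var 35 [-] ((Var 29 [div] Arr 1 (Var 14)) [mod] Num 2) [*]
      ((Var 30 [div] Arr 1 (Var 14)) [mod] Num 2)"
  let ?s = "set_var 35 1 s"
  let ?I = "\<lambda>i s. ctx s \<and> fst s 29 = v \<and> fst s 30 = v' \<and>
     fst s 35 = of_bool (\<forall>i' < i. i' \<notin> set_decode v \<inter> set_decode v')"
  have k: "eval (Var 4) ?s = k" using ctx_vals[OF ctx] by simp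
  have "safe U B (For 14 (Var 4) ?b) ?s \<and> ?I (eval (Var 4) ?s) (sem (For 14 (Var 4) ?b) ?s)"
  proof (rule for_rule)
    fix i s' assume "i < eval (Var 4) ?s" and I: "?I i s'"
    then have i: "i < k" using k by simp
    have p: "snd s' 1 i = 2 ^ i" using I i by (simp add: ctx_def setup_ctx_def)
    have bit: "u div 2 ^ i mod 2 = of_bool (i \<in> set_decode u)" for u
      by (simp add: set_decode_def mod_2_eq_odd)
    let ?t = "set_var 14 i s'"
    have "eval (Var 35 [-] ((Var 29 [div] Arr 1 (Var 14)) [mod] Num 2) [*]
        ((Var 30 [div] Arr 1 (Var 14)) [mod] Num 2)) ?t =
        of_bool (\<forall>i' < i. i' \<notin> set_decode v \<inter> set_decode v') -
        of_bool (i \<in> set_decode v) * of_bool (i \<in> set_decode v')"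
      using I p by (simp add: bit)
    also have "\<dots> = (of_bool (\<forall>i' < Suc i. i' \<notin> set_decode v \<inter> set_decode v') :: nat)"
      by (auto simp: less_Suc_eq)
    finally have ev: "eval (Var 35 [-] ((Var 29 [div] Arr 1 (Var 14)) [mod] Num 2) [*]
        ((Var 30 [div] Arr 1 (Var 14)) [mod] Num 2)) ?t =
        of_bool (\<forall>i' < Suc i. i' \<notin> set_decode v \<inter> set_decode v')" .
    have "of_bool (\<forall>i' < Suc i. i' \<notin> set_decode v \<inter> set_decode v') \<le> U"
      using le_U(7) by (simp add: of_bool_def)
    then have "safe U B ?b ?t"
      using ev le_U unfolding safe.simps(2) by (simp add: nregs_def del: eval.simps)
    moreover have "sem ?b ?t = set_var 35 (of_bool (\<forall>i' < Suc i. i' \<notin> set_decode v \<inter> set_decode v')) ?t"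
      using ev by simp
    ultimately show "safe U B ?b ?t \<and> ?I (Suc i) (sem ?b ?t)"
      using I by simp
  qed (use ctx v k le_U in \<open>auto simp: nregs_def\<close>)
  then have l: "safe U B (For 14 (Var 4) ?b) ?s"
    "fst (sem (For 14 (Var 4) ?b) ?s) 35 \<noteq> 0 \<longleftrightarrow> (\<forall>i < k. i \<notin> set_decode v \<inter> set_decode v')"
    unfolding k by auto
  show ?thesis
    using l le_U unfolding disjoint_stmt_def
    by (simp add: nregs_def del: safe.simps(6) sem.simps(6))
qed

lemma join_stmt:
  assumes s: "sound s" and v: "fst s 15 = c" "fst s 16 = z" "fst s 17 = z'" "fst s 29 = v"
      "fst s 30 = v'" "fst s 24 = j" "fst s 31 = a" "fst s 32 = b"
    and c: "c < EV" "slot c = (z, z', f)" "f \<noteq> 0" and j: "tas ! j = (a, b)" "j < k - 1"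
    and lt: "v < 2 ^ k" "v' < 2 ^ k"
  shows "safe U B join_stmt s \<and> sound (sem join_stmt s) \<and>
    (entry s z a j v \<and> entry s z' b (k - 1) v' \<longrightarrow>
      (f = 2 \<longrightarrow> entry (sem join_stmt s) z a (Suc j) v) \<and>
      (f = 1 \<longrightarrow> set_decode v \<inter> set_decode v' = {} \<longrightarrow> entry (sem join_stmt s) z a (Suc j) (v + v')))"
proof -
  let ?g = "Arr 8 (cell (Var 16) (Var 31) (Var 24) (Var 29)) [*]
      Arr 8 (cell (Var 17) (Var 32) (Var 4 [-] Num 1) (Var 30))"
  let ?u2 = "Update 8 (cell (Var 16) (Var 31) (Var 24 [+] Num 1) (Var 29)) (Num 1)"
  let ?u1 = "Update 8 (cell (Var 16) (Var 31) (Var 24 [+] Num 1) (Var 29 [+] Var 30)) (Num 1)"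
  let ?j = "IfNZ (Arr 6 (Var 15) [-] Num 1) ?u2 (disjoint_stmt ;; IfNZ (Var 35) ?u1 Skip)"
  have cx: "ctx s" using s by (simp add: sound_def)
  note cv = ctx_vals[OF cx]
  have "(a, b) \<in> set tas" using j length_tas by (metis nth_mem)
  then have ab: "a < k" "b < k" using arc by auto
  have f: "f = 1 \<or> f = 2" using slot_flag[OF c(2)] c(3) by linarith
  \<comment> \<open>A slot of kind 1 or 2 is an arc of the target, so both its ends are valid vertex
    numbers.\<close>
  have zN: "z < N" "z' < N"
    using f E0_slots[of z z'] E1_slots[of z z'] c arcs_less by blast+
  have k1: "j < k" "Suc j < k" "k - 1 < k" using j(2) by auto
  have g: "eval ?g s \<noteq> 0 \<longleftrightarrow> entry s z a j v \<and> entry s z' b (k - 1) v'"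
    using v cv by (simp add: eval_cell entry_def)
  have sg: "safe_aexp U B ?g s" using le_U by (simp add: safe_cell nregs_def)
  show ?thesis
  proof (cases "entry s z a j v \<and> entry s z' b (k - 1) v'")
    case False
    then have "eval ?g s = 0" using g by blast
    then have "sem join_stmt s = s" "safe U B join_stmt s"
      unfolding join_stmt_def using sg by (simp_all only: sem_IfNZ safe_IfNZ sem.simps(1) safe.simps(1))
    then show ?thesis using s False by metis
  next
    case True
    then have e: "entry s z a j v" "entry s z' b (k - 1) v'" by auto
    have cf: "colorful z a j (set_decode v)" "colorful z' b (k - 1) (set_decode v')"
      using s e zN ab k1 lt by (auto simp: sound_def)
    have "eval ?g s \<noteq> 0" using True g by blast
    then have top: "sem join_stmt s = sem ?j s" "safe U B join_stmt s = safe U B ?j s"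
      unfolding join_stmt_def using sg by (simp_all only: sem_IfNZ safe_IfNZ simp_thms)
    have "snd s 6 c = f"
      using cx c(1,2) unfolding ctx_def by (metis snd_conv)
    then have fl: "eval (Arr 6 (Var 15) [-] Num 1) s = f - 1" using v by simp
    from f show ?thesis
    proof
      assume f2: "f = 2"
      have E: "(z, z') \<in> E1" using E1_slots c f2 by blast
      have c': "colorful z a (Suc j) (set_decode v)"
        by (rule reset[OF cf(1) j(2,1) E cf(2)])
      have sem: "sem ?j s = set_arr 8 (index z a (Suc j) v) 1 s"
        using fl f2 v cv by (simp add: eval_cell del: eval.simps(3,4)) (simp add: eval_cell)
      have "safe U B ?j s" using fl f2 v le_U by (simp add: safe_cell nregs_def)
      moreover have "f \<noteq> 1" using f2 by simp
      ultimately show ?thesis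
        unfolding top sem using sound_set[OF s c' zN(1) ab(1) k1(2) lt(1)] by blast
    next
      assume f1: "f = 1"
      have E: "(z, z') \<in> E0" using E0_slots c f1 by blast
      let ?s = "sem disjoint_stmt s"
      note d = disjoint_stmt[OF cx v(4,5)]
      have fr: "fst ?s y = fst s y" if "y \<notin> {14, 35}" for y
        by (rule sem_frame) (use that in \<open>auto simp: disjoint_stmt_def\<close>)
      have sn: "snd ?s 8 = snd s 8"
        by (rule sem_frame_arr) (simp add: disjoint_stmt_def)
      have "ctx ?s" by (rule ctx_frame[OF _ _ cx]) (auto simp: disjoint_stmt_def)
      then have so: "sound ?s" using s sn by (simp add: sound_def entry_def)
      have split: "sem ?j s = sem (IfNZ (Var 35) ?u1 Skip) ?s"
        "safe U B ?j s \<longleftrightarrow> safe U B (IfNZ (Var 35) ?u1 Skip) ?s"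
        using fl f1 d v le_U by (simp_all add: nregs_def)
      have dis: "(\<forall>i < k. i \<notin> set_decode v \<inter> set_decode v') \<longleftrightarrow> set_decode v \<inter> set_decode v' = {}"
        using decode_subset[OF lt(1)] by blast
      show ?thesis
      proof (cases "set_decode v \<inter> set_decode v' = {}")
        case F: False
        then have "fst ?s 35 = 0" using d dis by blast
        then have "eval (Var 35) ?s = 0" by simp
        then have "sem (IfNZ (Var 35) ?u1 Skip) ?s = ?s" "safe U B (IfNZ (Var 35) ?u1 Skip) ?s"
          by (simp_all only: sem_IfNZ safe_IfNZ sem.simps(1) safe.simps(1)) (simp add: nregs_def)
        moreover have "f \<noteq> 2" using f1 by simp
        ultimately show ?thesis unfolding top split using so F by metis
      next
        case T: True
        then have nz: "fst ?s 35 \<noteq> 0" using d dis by blast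
        have dec: "set_decode (v + v') = set_decode v \<union> set_decode v'" by (rule decode_add[OF T])
        have c': "colorful z a (Suc j) (set_decode (v + v'))"
          unfolding dec by (rule inner[OF cf(1) j(2,1) E cf(2) T])
        have "v + v' = set_encode (set_decode (v + v'))" by simp
        also have "\<dots> < 2 ^ k"
          unfolding dec by (rule encode_less) (use decode_subset lt in blast)
        finally have lt': "v + v' < 2 ^ k" .
        have sem: "sem (IfNZ (Var 35) ?u1 Skip) ?s = set_arr 8 (index z a (Suc j) (v + v')) 1 ?s"
          using nz fr v cv by (simp add: eval_cell)
        have "safe U B (IfNZ (Var 35) ?u1 Skip) ?s"
          using le_U by (simp add: safe_cell nregs_def)
        moreover have "f \<noteq> 2" using f1 by simp
        ultimately show ?thesis
          unfolding top split sem using sound_set[OF so c' zN(1) ab(1) k1(2) lt'] by blast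
      qed
    qed
  qed
qed

text \<open>Two states occur because premises are read in the table before the pass over the slots
  and conclusions are found in a later one.\<close>

definition joined :: "st \<Rightarrow> st \<Rightarrow> nat \<Rightarrow> nat \<Rightarrow> nat \<Rightarrow> nat \<times> nat \<times> nat \<Rightarrow> nat \<Rightarrow> nat \<Rightarrow> bool" where
  "joined s s' j a b e v v' \<longleftrightarrow> (case e of (z, z', f) \<Rightarrow>
     entry s z a j v \<and> entry s z' b (k - 1) v' \<longrightarrow>
      (f = 2 \<longrightarrow> entry s' z a (Suc j) v) \<and>
      (f = 1 \<longrightarrow> set_decode v \<inter> set_decode v' = {} \<longrightarrow> entry s' z a (Suc j) (v + v')))"

lemma joined_grows: "grows s' s'' \<Longrightarrow> joined s s' j a b e v v' \<Longrightarrow> joined s s'' j a b e v v'"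
  using entry_grows[of s' s''] by (auto simp: joined_def)

lemma joins_stmt:
  assumes s: "sound s" and v: "fst s 24 = j" "fst s 31 = a" "fst s 32 = b"
    and j: "tas ! j = (a, b)" "j < k - 1"
  shows "safe U B joins_stmt s \<and> sound (sem joins_stmt s) \<and>
    (\<forall>c < EV. \<forall>v < 2 ^ k. \<forall>v' < 2 ^ k. joined s (sem joins_stmt s) j a b (slot c) v v')"
proof -
  let ?v' = "For 30 (Var 9) join_stmt"
  let ?v = "For 29 (Var 9) ?v'"
  let ?b = "IfNZ (Arr 6 (Var 15)) (16 <- Arr 4 (Var 15) ;; 17 <- Arr 5 (Var 15) ;; ?v) Skip"
  define J where "J s' \<longleftrightarrow> sound s' \<and> fst s' 24 = j \<and> fst s' 31 = a \<and> fst s' 32 = b \<and> grows s s'" for s'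
  have J_sv: "J (set_var y i s') = J s'" if "y \<in> {15, 16, 17, 29, 30}" for y i s'
    using that by (auto simp: J_def)
  have Jc: "fst s' 9 = 2 ^ k" "fst s' 11 = EV" if "J s'" for s'
    using that ctx_vals by (auto simp: J_def sound_def)
  define loc where "loc c z z' s' \<longleftrightarrow> fst s' 15 = c \<and> fst s' 16 = z \<and> fst s' 17 = z'" for c z z' and s' :: st
  have v'_loop: "safe U B ?v' s0 \<and> (J (sem ?v' s0) \<and> loc c z z' (sem ?v' s0)) \<and>
      (\<forall>v' < 2 ^ k. joined s (sem ?v' s0) j a b (slot c) v v')"
    if I: "J s0" "loc c z z' s0" "fst s0 29 = v" "v < 2 ^ k" and c: "c < EV" "slot c = (z, z', f)" "f \<noteq> 0"
    for s0 c z z' f v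
  proof -
    have K: "eval (Var 9) s0 = 2 ^ k" using Jc I by simp
    have "safe U B ?v' s0 \<and> (J (sem ?v' s0) \<and> loc c z z' (sem ?v' s0) \<and> fst (sem ?v' s0) 29 = v) \<and>
        (\<forall>v' < eval (Var 9) s0. joined s (sem ?v' s0) j a b (slot c) v v')"
    proof (rule for_grow_rule)
      fix v' s' assume "v' < eval (Var 9) s0" and J': "J s' \<and> loc c z z' s' \<and> fst s' 29 = v"
      then have v': "v' < 2 ^ k" using K by simp
      let ?s = "set_var 30 v' s'"
      have "sound ?s" "fst ?s 15 = c" "fst ?s 16 = z" "fst ?s 17 = z'" "fst ?s 29 = v"
        "fst ?s 30 = v'" "fst ?s 24 = j" "fst ?s 31 = a" "fst ?s 32 = b"
        using J' by (auto simp: J_def loc_def)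
      note js = join_stmt[OF this c j I(4) v']
      have fr: "fst (sem join_stmt ?s) y = fst ?s y" if "y \<notin> {14, 35}" for y
        by (rule sem_frame) (use that in \<open>auto simp: join_stmt_def disjoint_stmt_def\<close>)
      have so: "sets_only join_stmt" by (simp add: join_stmt_def disjoint_stmt_def)
      have gr: "grows s ?s" using J' by (simp add: J_def)
      have "grows s (sem join_stmt ?s)" by (rule grows_trans[OF gr sets_only_grows[OF so]])
      then have "J (sem join_stmt ?s)" "loc c z z' (sem join_stmt ?s)" "fst (sem join_stmt ?s) 29 = v"
        using js J' by (simp_all add: J_def loc_def fr)
      moreover have "joined s (sem join_stmt ?s) j a b (slot c) v v'"
        unfolding joined_def c(2) using js entry_grows[OF gr] by simp
      ultimately show "safe U B join_stmt ?s \<and> (J (sem join_stmt ?s) \<and> loc c z z' (sem join_stmt ?s) \<and>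
          fst (sem join_stmt ?s) 29 = v) \<and> joined s (sem join_stmt ?s) j a b (slot c) v v'"
        using js by blast
    qed (use I K le_U in \<open>auto simp: nregs_def joined_grows join_stmt_def disjoint_stmt_def\<close>)
    then show ?thesis unfolding K by blast
  qed
  have v_loop: "safe U B ?v s0 \<and> J (sem ?v s0) \<and>
      (\<forall>v < 2 ^ k. \<forall>v' < 2 ^ k. joined s (sem ?v s0) j a b (slot c) v v')"
    if I: "J s0" "loc c z z' s0" and c: "c < EV" "slot c = (z, z', f)" "f \<noteq> 0"
    for s0 c z z' f
  proof -
    have K: "eval (Var 9) s0 = 2 ^ k" using Jc I by simp
    have "safe U B ?v s0 \<and> (J (sem ?v s0) \<and> loc c z z' (sem ?v s0)) \<and>
        (\<forall>v < eval (Var 9) s0. \<forall>v' < 2 ^ k. joined s (sem ?v s0) j a b (slot c) v v')"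
    proof (rule for_grow_rule)
      fix v s' assume "v < eval (Var 9) s0" and J': "J s' \<and> loc c z z' s'"
      then have v: "v < 2 ^ k" using K by simp
      have "J (set_var 29 v s')" "loc c z z' (set_var 29 v s')" "fst (set_var 29 v s') 29 = v"
        using J' J_sv[of 29 v s'] by (simp_all add: loc_def)
      from v'_loop[OF this v c]
      show "safe U B ?v' (set_var 29 v s') \<and> (J (sem ?v' (set_var 29 v s')) \<and>
          loc c z z' (sem ?v' (set_var 29 v s'))) \<and>
          (\<forall>v' < 2 ^ k. joined s (sem ?v' (set_var 29 v s')) j a b (slot c) v v')" by blast
    qed (use I K le_U in \<open>auto simp: nregs_def joined_grows join_stmt_def disjoint_stmt_def\<close>)
    then show ?thesis unfolding K by blast
  qed
  have J: "J s" using s v by (simp add: J_def)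
  have N: "eval (Var 11) s = EV" using Jc[OF J] by simp
  have "safe U B joins_stmt s \<and> J (sem joins_stmt s) \<and>
      (\<forall>c < eval (Var 11) s. \<forall>v < 2 ^ k. \<forall>v' < 2 ^ k. joined s (sem joins_stmt s) j a b (slot c) v v')"
    unfolding joins_stmt_def
  proof (rule for_grow_rule)
    fix c s' assume "c < eval (Var 11) s" and J': "J s'"
    then have c: "c < EV" using N by simp
    obtain z z' f where sl: "slot c = (z, z', f)" by (metis prod.exhaust)
    let ?s = "set_var 15 c s'"
    have "(snd s' 4 c, snd s' 5 c, snd s' 6 c) = slot c"
      using J' c by (simp add: J_def sound_def ctx_def)
    then have a: "snd s' 4 c = z" "snd s' 5 c = z'" "snd s' 6 c = f" using sl by auto
    show "safe U B ?b ?s \<and> J (sem ?b ?s) \<and>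
        (\<forall>v < 2 ^ k. \<forall>v' < 2 ^ k. joined s (sem ?b ?s) j a b (slot c) v v')"
    proof (cases "f = 0")
      case True
      then have "eval (Arr 6 (Var 15)) ?s = 0" using a by simp
      then have "sem ?b ?s = ?s" "safe U B ?b ?s"
        by (simp_all only: sem_IfNZ safe_IfNZ sem.simps(1) safe.simps(1)) (simp add: nregs_def)
      moreover have "joined s ?s j a b (slot c) v v'" for v v' by (simp add: joined_def sl True)
      moreover have "J ?s" using J' J_sv[of 15 c s'] by simp
      ultimately show ?thesis by metis
    next
      case False
      let ?t = "set_var 17 z' (set_var 16 z ?s)"
      have t: "J ?t" "loc c z z' ?t" using J' by (simp_all add: J_sv loc_def)
      note l = v_loop[OF t c sl False]
      have sem: "sem ?b ?s = sem ?v ?t" using a False by (simp del: sem.simps(6))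
      have zN: "f = 1 \<or> f = 2" using slot_flag[OF sl] False by linarith
      then have "z < N" "z' < N" using E0_slots[of z z'] E1_slots[of z z'] c sl arcs_less by blast+
      then have "z \<le> U" "z' \<le> U" using le_U(1) by linarith+
      then have "safe U B ?b ?s" using a False l by (simp add: nregs_def del: sem.simps(6) safe.simps(6))
      then show ?thesis using l unfolding sem by blast
    qed
  qed (use J N le_U in \<open>auto simp: nregs_def joined_grows join_stmt_def disjoint_stmt_def\<close>)
  then show ?thesis unfolding N J_def by blast
qed

text \<open>Levels are counted from the bottom: \<open>i = 0\<close> concerns no node, as depths are
  below \<open>k\<close>, and \<open>i = k\<close> concerns all. \<open>l\<close> is the number of
  arcs treated in the current pass.\<close>

definition complete :: "nat \<Rightarrow> nat \<Rightarrow> st \<Rightarrow> bool" where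
  "complete i l s \<longleftrightarrow> (\<forall>z x j S. k \<le> d x + i \<longrightarrow> j \<le> l \<longrightarrow> colorful z x j S \<longrightarrow>
     entry s z x j (set_encode S))"

lemma complete_grows: "grows s s' \<Longrightarrow> complete i l s \<Longrightarrow> complete i l s'"
  using entry_grows by (auto simp: complete_def)

lemma complete_set_var [simp]: "complete i l (set_var x y s) = complete i l s"
  by (simp add: complete_def)

text \<open>A child lies one level deeper, so its entries were completed in the previous round,
  wherever its own arcs stand in the list.\<close>

lemma complete_step:
  assumes j: "tas ! j = (a, b)" "j < k - 1"
    and c1: "complete i (k - 1) s1" "complete (Suc i) j s1"
    and g: "grows s1 s2" "grows s2 s3"
    and copy: "\<And>z x v. z < N \<Longrightarrow> x < k \<Longrightarrow> x \<noteq> a \<Longrightarrow> v < 2 ^ k \<Longrightarrow> entry s1 z x j v \<Longrightarrow> entry s2 z x (Suc j) v"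
    and join: "\<And>c v v'. c < EV \<Longrightarrow> v < 2 ^ k \<Longrightarrow> v' < 2 ^ k \<Longrightarrow> joined s2 s3 j a b (slot c) v v'"
  shows "complete (Suc i) (Suc j) s3"
  unfolding complete_def
proof (intro allI impI)
  fix z x l S assume x: "k \<le> d x + Suc i" and l: "l \<le> Suc j" and cf: "colorful z x l S"
  show "entry s3 z x l (set_encode S)"
  proof (cases "l = Suc j")
    case False
    then have "entry s1 z x l (set_encode S)" using c1(2) x l cf by (simp add: complete_def)
    then show ?thesis using g entry_grows by blast
  next
    case True
    have e1: "entry s1 z x j (set_encode S1)" if "colorful z x j S1" for S1
      using c1(2) x that unfolding complete_def by blast
    have sub: "S1 \<subseteq> {..<k}" if "colorful z x j S1" for z x j S1 using colorful_bounds[OF that] by simp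
    have e2: "entry s1 z' y (k - 1) (set_encode S2)" if "colorful z' y (k - 1) S2" "(x, y) \<in> set tas" for z' y S2
    proof -
      have "k \<le> d y + i" using x arc[OF that(2)] by simp
      then show ?thesis using c1(1) that(1) unfolding complete_def by blast
    qed
    from cf show ?thesis
    proof (cases rule: colorful.cases)
      case (other j')
      then have jj: "j' = j" using True by simp
      then have cf': "colorful z x j S" and xa: "x \<noteq> a" using other j by auto
      have "entry s2 z x (Suc j) (set_encode S)"
        using copy[OF _ _ xa encode_less[OF sub[OF cf']] e1[OF cf']] colorful_bounds[OF cf'] by simp
      then show ?thesis using True g entry_grows by blast
    next
      case (inner j' S1 y z' S2)
      then have jj: "j' = j" using True by simp
      then have xy: "a = x" "b = y" using inner j by auto
      have cf': "colorful z x j S1" "colorful z' y (k - 1) S2" using inner jj by auto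
      have mem: "(x, y) \<in> set tas" using j xy length_tas by (metis nth_mem)
      have es: "entry s2 z x j (set_encode S1)" "entry s2 z' y (k - 1) (set_encode S2)"
        using e1[OF cf'(1)] e2[OF cf'(2) mem] g entry_grows by blast+
      obtain c where c: "c < EV" "slot c = (z, z', 1)" using inner E0_slots by blast
      have fin: "finite S1" "finite S2" using sub[OF cf'(1)] sub[OF cf'(2)] finite_color_set by auto
      have "entry s3 z x (Suc j) (set_encode S1 + set_encode S2)"
        using join[OF c(1) encode_less[OF sub[OF cf'(1)]] encode_less[OF sub[OF cf'(2)]]] es inner fin
        unfolding joined_def c(2) xy by (simp add: set_encode_inverse)
      moreover have "set_encode S = set_encode S1 + set_encode S2"
        using inner fin unfolding set_encode_def by (simp add: sum.union_disjoint)
      ultimately show ?thesis using True by simp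
    next
      case (reset j' y z' S2)
      then have jj: "j' = j" using True by simp
      then have xy: "a = x" "b = y" using reset j by auto
      have cf': "colorful z x j S" "colorful z' y (k - 1) S2" using reset jj by auto
      have mem: "(x, y) \<in> set tas" using j xy length_tas by (metis nth_mem)
      have es: "entry s2 z x j (set_encode S)" "entry s2 z' y (k - 1) (set_encode S2)"
        using e1[OF cf'(1)] e2[OF cf'(2) mem] g entry_grows by blast+
      obtain c where c: "c < EV" "slot c = (z, z', 2)" using reset E1_slots by blast
      have "entry s3 z x (Suc j) (set_encode S)"
        using join[OF c(1) encode_less[OF sub[OF cf'(1)]] encode_less[OF sub[OF cf'(2)]]] es
        unfolding joined_def c(2) xy by simp
      then show ?thesis using True by simp
    qed (use True in simp)
  qed
qed

lemma rounds_phase: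
  assumes s: "sound s" and b: "\<And>z x. z < N \<Longrightarrow> x < k \<Longrightarrow> entry s z x 0 (2 ^ (cs ! z))"
  shows "safe U B rounds_phase s \<and> sound (sem rounds_phase s) \<and> complete k (k - 1) (sem rounds_phase s)"
proof -
  let ?body = "31 <- Arr 2 (Var 24) ;; 32 <- Arr 3 (Var 24) ;; copy_stmt ;; joins_stmt"
  let ?j = "For 24 (Var 4 [-] Num 1) ?body"
  have so: "sets_only ?body"
    by (simp add: copy_stmt_def joins_stmt_def join_stmt_def disjoint_stmt_def)
  \<comment> \<open>Before any arc is treated, only the rule \<open>base\<close> applies, and its
    entries were set by the initialisation.\<close>
  have zero: "complete i 0 s'" if "grows s s'" for i s'
    unfolding complete_def
  proof (intro allI impI)
    fix z x j S assume "j \<le> 0" "colorful z x j S"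
    then have "colorful z x 0 S" by simp
    then show "entry s' z x j (set_encode S)"
    proof (cases rule: colorful.cases)
      case base
      then have "set_encode S = 2 ^ (cs ! z)" by (simp add: set_encode_def)
      then show ?thesis using b[of z x] base entry_grows[OF that] \<open>j \<le> 0\<close> by simp
    qed
  qed
  have vals: "fst s' 4 = k" if "sound s'" for s' using that ctx_vals by (auto simp: sound_def)
  have j_loop: "safe U B ?j s0 \<and> (sound (sem ?j s0) \<and> grows s (sem ?j s0)) \<and> complete (Suc i) (k - 1) (sem ?j s0)"
    if I: "sound s0" "grows s s0" "complete i (k - 1) s0" for s0 i
  proof -
    let ?I = "\<lambda>j s. sound s \<and> grows s0 s \<and> complete (Suc i) j s"
    have K: "eval (Var 4 [-] Num 1) s0 = k - 1" using vals[OF I(1)] by simp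
    have "safe U B ?j s0 \<and> ?I (eval (Var 4 [-] Num 1) s0) (sem ?j s0)"
    proof (rule for_rule)
      show "?I 0 s0" using I zero by simp
      fix j s' assume "j < eval (Var 4 [-] Num 1) s0" and I': "?I j s'"
      then have j: "j < k - 1" using K by simp
      obtain a b where ab: "tas ! j = (a, b)" by (metis prod.exhaust)
      let ?s0 = "set_var 24 j s'"
      let ?s1 = "set_var 32 b (set_var 31 a ?s0)"
      have "snd s' 2 j = a" "snd s' 3 j = b"
        using I' j ab by (simp_all add: sound_def ctx_def setup_ctx_def)
      moreover have "(a, b) \<in> set tas" using ab j length_tas by (metis nth_mem)
      then have "a \<le> U" "b \<le> U" using arc[of a b] le_U(3) by auto
      ultimately have split: "sem ?body ?s0 = sem joins_stmt (sem copy_stmt ?s1)"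
        "safe U B ?body ?s0 \<longleftrightarrow> safe U B copy_stmt ?s1 \<and> safe U B joins_stmt (sem copy_stmt ?s1)"
        by (simp_all add: nregs_def)
      have s1: "sound ?s1" "fst ?s1 24 = j" "fst ?s1 31 = a" "fst ?s1 32 = b" using I' by simp_all
      note cp = copy_stmt[OF s1(1-3) ab j]
      let ?s2 = "sem copy_stmt ?s1"
      have "fst ?s2 y = fst ?s1 y" if "y \<notin> {28, 29, 33}" for y
        by (rule sem_frame) (use that in \<open>auto simp: copy_stmt_def\<close>)
      then have s2: "fst ?s2 24 = j" "fst ?s2 31 = a" "fst ?s2 32 = b" using s1 by simp_all
      note jn = joins_stmt[OF conjunct1[OF conjunct2[OF cp]] s2 ab j]
      let ?s3 = "sem joins_stmt ?s2"
      have g: "grows ?s1 ?s2" "grows ?s2 ?s3"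
        by (rule sets_only_grows; simp add: copy_stmt_def joins_stmt_def join_stmt_def disjoint_stmt_def)+
      have g': "grows s0 ?s1" using I' by simp
      have "complete i (k - 1) ?s1" by (rule complete_grows[OF g' I(3)])
      moreover have "complete (Suc i) j ?s1" using I' by simp
      ultimately have "complete (Suc i) (Suc j) ?s3"
        using cp jn by (intro complete_step[OF ab j _ _ g]) blast+
      moreover have "grows s0 ?s3" using g g' grows_trans by blast
      ultimately show "safe U B ?body ?s0 \<and> ?I (Suc j) (sem ?body ?s0)"
        unfolding split using cp jn by blast
    qed (use I K le_U in \<open>auto simp: nregs_def\<close>)
    then show ?thesis unfolding K using grows_trans[OF I(2)] by blast
  qed
  let ?I = "\<lambda>i s'. sound s' \<and> grows s s' \<and> complete i (k - 1) s'"
  have K: "eval (Var 4) s = k" using vals[OF s] by simp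
  have "safe U B rounds_phase s \<and> ?I (eval (Var 4) s) (sem rounds_phase s)"
    unfolding rounds_phase_def
  proof (rule for_rule)
    have "complete 0 (k - 1) s" unfolding complete_def
    proof (intro allI impI)
      fix z x j S assume "k \<le> d x + 0" "colorful z x j S"
      then show "entry s z x j (set_encode S)"
        using depth_less[of x] colorful_bounds[of z x j S] by simp
    qed
    then show "?I 0 s" using s by simp
    fix i s' assume "?I i s'"
    then show "safe U B ?j (set_var 34 i s') \<and> ?I (Suc i) (sem ?j (set_var 34 i s'))"
      using j_loop[of "set_var 34 i s'" i] by simp
  qed (use K le_U in \<open>auto simp: nregs_def\<close>)
  then show ?thesis unfolding K by blast
qed

lemma output_phase:
  assumes s: "sound s"
  shows "safe U B output_phase s \<and> (\<forall>w < n. snd (sem output_phase s) 0 w \<noteq> 0 \<longleftrightarrow>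
    (\<exists>\<tau> < R. \<exists>v < 2 ^ k. entry s (num \<tau> w 0) r (k - 1) v))"
proof -
  let ?c = "IfNZ (Arr 8 (cell ((Var 22 [*] Var 1 [+] Var 17) [*] Var 7) (Var 5) (Var 4 [-] Num 1) (Var 29)))
       (36 <- Num 1) Skip"
  let ?v = "For 29 (Var 9) ?c"
  let ?\<tau> = "For 22 (Var 8) ?v"
  let ?b = "36 <- Num 0 ;; ?\<tau> ;; Update 0 (Var 17) (Var 36)"
  define J where "J s' \<longleftrightarrow> fst s' 1 = n \<and> fst s' 4 = k \<and> fst s' 5 = r \<and> fst s' 7 = q \<and> fst s' 8 = R \<and>
    fst s' 9 = 2 ^ k \<and> snd s' 8 = snd s 8" for s' :: st
  have J_sv: "J (set_var y i s') = J s'" if "y > 11" for y i s' using that by (simp add: J_def)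
  let ?e = "\<lambda>\<tau> w v. entry s (num \<tau> w 0) r (k - 1) v"
  have v_loop: "safe U B ?v s0 \<and> J (sem ?v s0) \<and> fst (sem ?v s0) 17 = w \<and>
      fst (sem ?v s0) 36 = of_bool (Q \<or> (\<exists>v < 2 ^ k. ?e \<tau> w v))"
    if I: "J s0" "fst s0 17 = w" "fst s0 22 = \<tau>" "fst s0 36 = of_bool Q" for s0 w \<tau> Q
  proof -
    let ?I = "\<lambda>i s'. J s' \<and> fst s' 17 = w \<and> fst s' 22 = \<tau> \<and> fst s' 36 = of_bool (Q \<or> (\<exists>v < i. ?e \<tau> w v))"
    have K: "eval (Var 9) s0 = 2 ^ k" using I by (simp add: J_def)
    have "safe U B ?v s0 \<and> ?I (eval (Var 9) s0) (sem ?v s0)"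
    proof (rule for_rule)
      fix v s' assume I': "?I v s'"
      let ?s = "set_var 29 v s'"
      have ev: "eval (Arr 8 (cell ((Var 22 [*] Var 1 [+] Var 17) [*] Var 7) (Var 5) (Var 4 [-] Num 1) (Var 29))) ?s
          = snd s 8 (index (num \<tau> w 0) r (k - 1) v)"
        using I' by (simp add: J_def eval_cell num_def)
      have sf: "safe_aexp U B (Arr 8 (cell ((Var 22 [*] Var 1 [+] Var 17) [*] Var 7) (Var 5) (Var 4 [-] Num 1) (Var 29))) ?s"
        using le_U by (simp add: safe_cell nregs_def)
      show "safe U B ?c ?s \<and> ?I (Suc v) (sem ?c ?s)"
      proof (cases "?e \<tau> w v")
        case True
        then have "sem ?c ?s = set_var 36 1 ?s" "safe U B ?c ?s"
          using ev sf le_U by (simp_all add: entry_def nregs_def del: eval.simps(4) safe_aexp.simps(4))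
        then show ?thesis using True I' J_sv by auto
      next
        case False
        then have "sem ?c ?s = ?s" "safe U B ?c ?s"
          using ev sf le_U by (simp_all add: entry_def nregs_def del: eval.simps(4) safe_aexp.simps(4))
        then show ?thesis using False I' J_sv by (auto simp: less_Suc_eq)
      qed
    qed (use I K le_U in \<open>auto simp: nregs_def\<close>)
    then show ?thesis unfolding K by blast
  qed
  have \<tau>_loop: "safe U B ?\<tau> s0 \<and> J (sem ?\<tau> s0) \<and> fst (sem ?\<tau> s0) 17 = w \<and>
      fst (sem ?\<tau> s0) 36 = of_bool (\<exists>\<tau> < R. \<exists>v < 2 ^ k. ?e \<tau> w v)"
    if I: "J s0" "fst s0 17 = w" "fst s0 36 = 0" for s0 w
  proof -
    let ?I = "\<lambda>i s'. J s' \<and> fst s' 17 = w \<and> fst s' 36 = of_bool (\<exists>\<tau> < i. \<exists>v < 2 ^ k. ?e \<tau> w v)"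
    have K: "eval (Var 8) s0 = R" using I by (simp add: J_def)
    have "safe U B ?\<tau> s0 \<and> ?I (eval (Var 8) s0) (sem ?\<tau> s0)"
    proof (rule for_rule)
      fix \<tau> s' assume I': "?I \<tau> s'"
      have "J (set_var 22 \<tau> s')" "fst (set_var 22 \<tau> s') 17 = w" "fst (set_var 22 \<tau> s') 22 = \<tau>"
        "fst (set_var 22 \<tau> s') 36 = of_bool (\<exists>\<tau>' < \<tau>. \<exists>v < 2 ^ k. ?e \<tau>' w v)"
        using I' J_sv by simp_all
      note l = v_loop[OF this]
      have "(\<exists>\<tau>' < \<tau>. \<exists>v < 2 ^ k. ?e \<tau>' w v) \<or> (\<exists>v < 2 ^ k. ?e \<tau> w v) \<longleftrightarrow> (\<exists>\<tau>' < Suc \<tau>. \<exists>v < 2 ^ k. ?e \<tau>' w v)"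
        by (auto simp: less_Suc_eq)
      note eq = this
      from l show "safe U B ?v (set_var 22 \<tau> s') \<and> ?I (Suc \<tau>) (sem ?v (set_var 22 \<tau> s'))"
        unfolding eq by blast
    qed (use I K le_U in \<open>auto simp: nregs_def\<close>)
    then show ?thesis unfolding K by blast
  qed
  let ?I = "\<lambda>i s'. J s' \<and> (\<forall>w < i. snd s' 0 w \<noteq> 0 \<longleftrightarrow> (\<exists>\<tau> < R. \<exists>v < 2 ^ k. ?e \<tau> w v))"
  have J: "J s" using s ctx_vals by (simp add: J_def sound_def)
  have K: "eval (Var 1) s = n" using J by (simp add: J_def)
  have "safe U B output_phase s \<and> ?I (eval (Var 1) s) (sem output_phase s)"
    unfolding output_phase_def
  proof (rule for_rule)
    show "?I 0 s" using J by simp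
    fix w s' assume "w < eval (Var 1) s" and I: "?I w s'"
    then have w: "w < n" using K by simp
    let ?s = "set_var 36 0 (set_var 17 w s')"
    have "J ?s" "fst ?s 17 = w" "fst ?s 36 = 0" using I by (simp_all add: J_sv)
    note l = \<tau>_loop[OF this]
    have sn: "snd (sem ?\<tau> ?s) 0 = snd s' 0" by (subst sem_frame_arr) auto
    have sem: "sem ?b (set_var 17 w s') = set_arr 0 w (of_bool (\<exists>\<tau> < R. \<exists>v < 2 ^ k. ?e \<tau> w v)) (sem ?\<tau> ?s)"
      using l by (simp del: sem.simps(6))
    have "w < B" using w by (simp add: length_xs)
    then have "safe U B ?b (set_var 17 w s')"
      using l le_U by (simp add: nregs_def of_bool_def del: sem.simps(6) safe.simps(6))
    then show "safe U B ?b (set_var 17 w s') \<and> ?I (Suc w) (sem ?b (set_var 17 w s'))"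
      unfolding sem using l I sn by (auto simp: less_Suc_eq J_def simp del: sem.simps(6))
  qed (use K le_U in \<open>auto simp: nregs_def\<close>)
  then show ?thesis unfolding K by blast
qed

lemma main_phase:
  assumes c: "ctx s" and z: "snd s 8 = (\<lambda>_. 0)"
  shows "safe U B (init_phase ;; rounds_phase ;; output_phase) s \<and>
    (\<forall>w < n. snd (sem (init_phase ;; rounds_phase ;; output_phase) s) 0 w \<noteq> 0 \<longleftrightarrow>
      (\<exists>\<tau> < R. \<exists>S. colorful (num \<tau> w 0) r (k - 1) S))"
proof -
  note i = init_phase[OF c z]
  note ro = rounds_phase[OF conjunct1[OF conjunct2[OF i]]]
  have ro': "safe U B rounds_phase (sem init_phase s)" "sound (sem rounds_phase (sem init_phase s))"
    "complete k (k - 1) (sem rounds_phase (sem init_phase s))"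
    using ro i by blast+
  note o = output_phase[OF ro'(2)]
  let ?s = "sem rounds_phase (sem init_phase s)"
  have "(\<exists>v < 2 ^ k. entry ?s (num \<tau> w 0) r (k - 1) v) \<longleftrightarrow> (\<exists>S. colorful (num \<tau> w 0) r (k - 1) S)"
    if "\<tau> < R" "w < n" for \<tau> w
  proof
    have "num \<tau> w 0 < N" using num_less[OF that q_pos] by (simp add: N_def)
    moreover have "k - 1 < k" using k_pos by simp
    ultimately show "\<exists>S. colorful (num \<tau> w 0) r (k - 1) S"
      if "\<exists>v < 2 ^ k. entry ?s (num \<tau> w 0) r (k - 1) v"
      using that ro'(2) root(1) unfolding sound_def by blast
    assume "\<exists>S. colorful (num \<tau> w 0) r (k - 1) S"
    then obtain S where S: "colorful (num \<tau> w 0) r (k - 1) S" by blast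
    then have "entry ?s (num \<tau> w 0) r (k - 1) (set_encode S)"
      using ro'(3) by (auto simp: complete_def)
    then show "\<exists>v < 2 ^ k. entry ?s (num \<tau> w 0) r (k - 1) v"
      using encode_less colorful_bounds[OF S] by blast
  qed
  note eq = this
  have sem: "sem (init_phase ;; rounds_phase ;; output_phase) s = sem output_phase ?s" by simp
  show ?thesis
    unfolding sem
  proof (intro conjI allI impI)
    show "safe U B (init_phase ;; rounds_phase ;; output_phase) s" using i ro'(1) o by simp
    fix w assume w: "w < n"
    have "snd (sem output_phase ?s) 0 w \<noteq> 0 \<longleftrightarrow> (\<exists>\<tau> < R. \<exists>v < 2 ^ k. entry ?s (num \<tau> w 0) r (k - 1) v)"
      using o w by blast
    also have "\<dots> \<longleftrightarrow> (\<exists>\<tau> < R. \<exists>S. colorful (num \<tau> w 0) r (k - 1) S)"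
      using eq[OF _ w] by blast
    finally show "snd (sem output_phase ?s) 0 w \<noteq> 0 \<longleftrightarrow> (\<exists>\<tau> < R. \<exists>S. colorful (num \<tau> w 0) r (k - 1) S)" .
  qed
qed

end

section \<open>Drawing the colors and assembling the program\<close>

definition color_com :: com where
  "color_com = Seq (Const 41 1) (Seq (Const 42 8) (Seq (Const 43 6) (Seq (Arith 43 Add 43 0)
     (Seq (Const 44 0) (Seq (Arith 44 Add 44 10)
     (Loop 44 (Seq (Rand 45 4) (Seq (Store 43 45)
       (Seq (Arith 43 Add 43 42) (Arith 44 Sub 44 41))))))))))"

text \<open>The length of the input, computed from its first four cells.\<close>

definition base_exp :: aexp where
  "base_exp = Num 5 [+] Num 2 [*] Arr 0 (Num 1) [+] Arr 0 (Num 0) [+] Num 2 [*] Arr 0 (Num 2) [+]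
     Num 2 [*] (Arr 0 (Num 3) [-] Num 1)"

definition base_com :: com where
  "base_com = Seq (comp_aexp base_exp nregs) (Seq (Const 0 0) (Arith 0 Add 0 nregs))"

definition main_stmt :: stmt where
  "main_stmt = (init_phase ;; rounds_phase ;; output_phase)"

definition program :: "nat \<Rightarrow> com" where
  "program \<alpha> = Seq (Seq base_com (Seq (comp read_phase nregs)
       (Seq (comp (setup_phase \<alpha>) nregs) (comp arcs_phase nregs))))
     (Seq color_com (comp main_stmt nregs))"

fun fill :: "nat \<Rightarrow> nat list \<Rightarrow> (nat \<Rightarrow> nat) \<Rightarrow> nat \<Rightarrow> nat" where
  "fill a [] M = M"
| "fill a (c # cs) M = fill (a + 8) cs (M(a := c))"

lemma fill_other: "(\<And>i. i < length cs \<Longrightarrow> y \<noteq> a + 8 * i) \<Longrightarrow> fill a cs M y = M y"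
proof (induction cs arbitrary: a M)
  case (Cons c cs)
  have "y \<noteq> a" using Cons.prems[of 0] by simp
  moreover have "y \<noteq> (a + 8) + 8 * i" if "i < length cs" for i
    using Cons.prems[of "Suc i"] that by simp
  ultimately show ?case using Cons.IH[of "a + 8" "M(a := c)"] by (simp add: fun_upd_def)
qed simp

lemma fill_nth: "i < length cs \<Longrightarrow> fill a cs M (a + 8 * i) = cs ! i"
proof (induction cs arbitrary: a M i)
  case (Cons c cs)
  show ?case
  proof (cases i)
    case 0
    have "fill (a + 8) cs (M(a := c)) a = (M(a := c)) a" by (rule fill_other) simp
    then show ?thesis using 0 by simp
  next
    case (Suc i')
    then show ?thesis using Cons.IH[of i' "a + 8" "M(a := c)"] Cons.prems
      by (simp add: add.assoc fun_upd_def)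
  qed
qed simp

text \<open>The loop is written in machine code as the statement language has no random choices.
  Temporary registers end up depending on the draws, which \<open>f\<close> hides; all variables
  keep their values.\<close>

lemma color_loop:
  fixes R M
  defines "loop \<equiv> Loop 44 (Seq (Rand 45 4) (Seq (Store 43 45)
       (Seq (Arith 43 Add 43 42) (Arith 44 Sub 44 41))))"
  assumes "R 44 = j" "R 43 = a" "R 42 = 8" "R 41 = 1" "R 4 = k" "0 < k" "a + 8 * j < 2 ^ w" "j < 2 ^ w"
  shows "\<exists>f. ram_run w (8 * j + 1) (loop # K, (R, M)) =
      map_pmf (\<lambda>cs. (K, (f cs, fill a cs M))) (replicate_pmf j (pmf_of_set {..<k})) \<and>
      (\<forall>cs. \<forall>x < nregs. f cs x = R x)"
  using assms(2-)
proof (induction j arbitrary: R M a)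
  case 0
  then show ?case by (intro exI[of _ "\<lambda>_. R"]) (simp add: loop_def bind_return_pmf)
next
  case (Suc j)
  define Q where "Q x = ((R(45 := x))(43 := a + 8))(44 := j)" for x
  have lt: "a + 8 < 2 ^ w" "j < 2 ^ w" using Suc.prems by auto
  \<comment> \<open>One iteration takes eight steps: the test, three sequencing steps and four
    instructions.\<close>
  have "ram_run w 8 (loop # K, (R, M)) =
      bind_pmf (pmf_of_set {..<k}) (\<lambda>x. return_pmf (loop # K, (Q x, M(a := x))))"
    using Suc.prems lt
    by (simp add: loop_def eval_nat_numeral bind_return_pmf map_pmf_def bind_assoc_pmf Q_def max_def
        Suc_le_eq)
  moreover have "8 * Suc j + 1 = 8 + (8 * j + 1)" by simp
  ultimately have run: "ram_run w (8 * Suc j + 1) (loop # K, (R, M)) =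
      bind_pmf (pmf_of_set {..<k}) (\<lambda>x. ram_run w (8 * j + 1) (loop # K, (Q x, M(a := x))))"
    by (simp only: ram_run_add bind_assoc_pmf bind_return_pmf)
  have "\<forall>x. \<exists>f. ram_run w (8 * j + 1) (loop # K, (Q x, M(a := x))) =
      map_pmf (\<lambda>cs. (K, (f cs, fill (a + 8) cs (M(a := x))))) (replicate_pmf j (pmf_of_set {..<k})) \<and>
      (\<forall>cs. \<forall>y < nregs. f cs y = Q x y)"
    by (rule allI, rule Suc.IH) (use Suc.prems lt in \<open>auto simp: Q_def\<close>)
  from choice[OF this] obtain g where "\<forall>x. ram_run w (8 * j + 1) (loop # K, (Q x, M(a := x))) =
      map_pmf (\<lambda>cs. (K, (g x cs, fill (a + 8) cs (M(a := x))))) (replicate_pmf j (pmf_of_set {..<k})) \<and>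
      (\<forall>cs. \<forall>y < nregs. g x cs y = Q x y)" ..
  then have g: "\<And>x. ram_run w (8 * j + 1) (loop # K, (Q x, M(a := x))) =
      map_pmf (\<lambda>cs. (K, (g x cs, fill (a + 8) cs (M(a := x))))) (replicate_pmf j (pmf_of_set {..<k}))"
      "\<And>x cs y. y < nregs \<Longrightarrow> g x cs y = Q x y"
    by simp_all
  define f where "f cs = (case cs of [] \<Rightarrow> R | x # cs' \<Rightarrow> g x cs')" for cs
  have "f cs y = R y" if "y < nregs" for cs y
    using that g(2) by (auto simp: f_def Q_def nregs_def split: list.split)
  moreover have "ram_run w (8 * Suc j + 1) (loop # K, (R, M)) =
      map_pmf (\<lambda>cs. (K, (f cs, fill a cs M))) (replicate_pmf (Suc j) (pmf_of_set {..<k}))"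
    unfolding run g(1) by (simp add: map_bind_pmf map_pmf_def bind_assoc_pmf bind_return_pmf f_def)
  ultimately show ?case by blast
qed

text \<open>Twelve steps of initialisation precede the \<open>8 * N + 1\<close> of the loop. The
  colors go to array 7, which starts at offset 6 of the work area and has stride 8.\<close>

lemma color_com_run:
  assumes "R 0 = B" "R 4 = k" "R 10 = N" "0 < k" "B + 8 * N + 8 < 2 ^ w"
  shows "\<exists>f. ram_run w (8 * N + 13) (color_com # K, (R, M)) =
      map_pmf (\<lambda>cs. (K, (f cs, fill (B + 6) cs M))) (replicate_pmf N (pmf_of_set {..<k})) \<and>
      (\<forall>cs. \<forall>x < nregs. f cs x = R x)"
proof -
  let ?loop = "Loop 44 (Seq (Rand 45 4) (Seq (Store 43 45)
       (Seq (Arith 43 Add 43 42) (Arith 44 Sub 44 41))))"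
  have lt: "8 < (2 :: nat) ^ w" "6 < (2 :: nat) ^ w" "B + 6 < 2 ^ w" "N < 2 ^ w" "1 < (2 :: nat) ^ w" using assms by linarith+
  have w: "w \<noteq> 0" using lt(5) by (intro notI) simp
  define R' where "R' = R(41 := 1, 42 := 8, 43 := B + 6, 44 := N)"
  have twelve: "12 = Suc (Suc (Suc (Suc (Suc (Suc (Suc (Suc (Suc (Suc (Suc (Suc 0)))))))))))" by simp
  have "ram_run w 12 (color_com # K, (R, M)) = return_pmf (?loop # K, (R', M))"
    using assms lt w unfolding color_com_def R'_def twelve
    by (simp add: bind_return_pmf add.commute fun_upd_twist)
  then have run: "ram_run w (8 * N + 13) (color_com # K, (R, M)) = ram_run w (8 * N + 1) (?loop # K, (R', M))"
    using ram_run_add[of w 12 "8 * N + 1"] by (simp add: bind_return_pmf add.commute)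
  have "\<exists>f. ram_run w (8 * N + 1) (?loop # K, (R', M)) =
      map_pmf (\<lambda>cs. (K, (f cs, fill (B + 6) cs M))) (replicate_pmf N (pmf_of_set {..<k})) \<and>
      (\<forall>cs. \<forall>x < nregs. f cs x = R' x)"
    by (rule color_loop) (use assms lt in \<open>auto simp: R'_def\<close>)
  then show ?thesis unfolding run by (auto simp: R'_def nregs_def)
qed

text \<open>The value 100 is a comfortable common bound; it becomes the exponent of \<open>U\<close>
  in the requirement on the word length.\<close>

lemma width_phases: "width read_phase \<le> 100" "width (setup_phase \<alpha>) \<le> 100" "width arcs_phase \<le> 100"
    "width main_stmt \<le> 100" "leaves base_exp \<le> 100"
  by (simp_all add: read_phase_def setup_phase_def read_arc_def arcs_phase_def slot_stmt_def main_stmt_def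
      init_phase_def rounds_phase_def output_phase_def copy_stmt_def joins_stmt_def join_stmt_def
      disjoint_stmt_def cell_def base_exp_def)

lemma pure_phases: "pure_bounds read_phase" "pure_bounds (setup_phase \<alpha>)" "pure_bounds arcs_phase"
    "pure_bounds main_stmt"
  by (simp_all add: read_phase_def setup_phase_def read_arc_def arcs_phase_def slot_stmt_def main_stmt_def
      init_phase_def rounds_phase_def output_phase_def copy_stmt_def joins_stmt_def join_stmt_def
      disjoint_stmt_def)

lemma bound_vars_phases: "mods read_phase \<inter> bound_vars read_phase = {}"
    "mods (setup_phase \<alpha>) \<inter> bound_vars (setup_phase \<alpha>) = {}"
    "mods arcs_phase \<inter> bound_vars arcs_phase = {}" "mods main_stmt \<inter> bound_vars main_stmt = {}"
  by (simp_all add: read_phase_def setup_phase_def read_arc_def arcs_phase_def slot_stmt_def main_stmt_def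
      init_phase_def rounds_phase_def output_phase_def copy_stmt_def joins_stmt_def join_stmt_def
      disjoint_stmt_def)

lemma runs_Nil_stack: "runs w c s t s' \<Longrightarrow> t \<le> t' \<Longrightarrow> ram_run w t' ([c], s) = return_pmf ([], s')"
proof -
  assume r: "runs w c s t s'" and "t \<le> t'"
  then have "t' = t + (t' - t)" by simp
  then have "ram_run w t' ([c], s) = bind_pmf (ram_run w t ([c], s)) (ram_run w (t' - t))"
    by (metis ram_run_add)
  then show ?thesis using r by (simp add: runs_def bind_return_pmf ram_run_Nil)
qed

locale ram_problem = bounded_problem +
  fixes w :: nat
  assumes word: "U ^ 100 < 2 ^ w"
begin

lemma U_power: "l \<le> 100 \<Longrightarrow> U ^ l < 2 ^ w"
  by (rule power_less_mono[OF word _ U(1)])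

lemma word16: "16 < (2 :: nat) ^ w"
  using U_power[of 1] U(1) by simp

definition start :: st where
  "start = ((\<lambda>_. 0)(0 := B), \<lambda>a i. if a = 0 \<and> i < B then xs ! i else 0)"

lemma start_bounded: "bounded U start"
  using xs_le U(2) by (auto simp: bounded_def start_def)

lemma input_le: "16 \<le> U" "B \<le> U"
  using U by auto

lemma base_com:
  "\<exists>R M \<tau>. runs w base_com (input_state xs) \<tau> (R, M) \<and> \<tau> \<le> 200 \<and>
     represents B (R, M) start \<and> R 0 = B"
proof -
  \<comment> \<open>Register 0 does not hold \<open>B\<close> yet, so the machine starts in
    \<open>start\<close> with that register reset.\<close>
  let ?z = "set_var 0 0 start"
  obtain R M where RM: "input_state xs = (R, M)" by fastforce
  then have R: "R = (\<lambda>_. 0)" and M: "M = (\<lambda>a. if a < B then xs ! a else 0)"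
    by (auto simp: input_state_def)
  have rep: "represents B (R, M) ?z"
    by (auto simp: represents_def R M start_def addr_def)
  have b: "bounded U ?z" using start_bounded U(1) by (simp add: bounded_def)
  have lt: "0 < B" "1 < B" "2 < B" "3 < B" by (simp_all add: length_xs)
  have sf: "safe_aexp U B base_exp ?z" using U(1) lt by (simp add: base_exp_def)
  have ev: "eval base_exp ?z = B"
    using lt xs_nth(1-4) length_xs k_pos by (simp add: base_exp_def start_def)
  obtain R1 where R1: "runs w (comp_aexp base_exp nregs) (R, M) (cost_aexp base_exp) (R1, M)"
    "R1 nregs = B" "\<forall>x < nregs. R1 x = R x"
    using comp_aexp_runs[OF rep b sf input_le U_power[OF width_phases(5)], of nregs] ev
    by (auto simp: base_exp_def)
  have Bw: "B < 2 ^ w" using U_power[of 1] U(2) by simp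
  define R2 where "R2 = R1(0 := 0 mod 2 ^ w)"
  define R3 where "R3 = R2(0 := binop_sem Add (R2 0) (R2 nregs) mod 2 ^ w)"
  have "runs w base_com (R, M) (cost_aexp base_exp + (1 + 1 + 1) + 1) (R3, M)"
    unfolding base_com_def R3_def
    by (rule runs_Seq R1(1) runs_Const[of w 0 0 R1 M, folded R2_def] runs_Arith)+
  moreover have "cost_aexp base_exp + (1 + 1 + 1) + 1 \<le> 200" by (simp add: base_exp_def cost_addr_def)
  moreover have R3: "R3 0 = B" "\<forall>x < nregs. x \<noteq> 0 \<longrightarrow> R3 x = 0"
    using R1 Bw R by (auto simp: R3_def R2_def nregs_def)
  then have "represents B (R3, M) start"
    using rep by (auto simp: represents_def start_def)
  ultimately show ?thesis unfolding RM using R3(1)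
    by (intro exI3[of _ R3 M "cost_aexp base_exp + (1 + 1 + 1) + 1"] conjI)
qed

definition s1 :: st where "s1 = sem read_phase start"
definition s2 :: st where "s2 = sem (setup_phase \<alpha>) s1"
definition s3 :: st where "s3 = sem arcs_phase s2"

lemma phases:
  "safe U B read_phase start" "input_ctx s1" "safe U B (setup_phase \<alpha>) s1" "setup_ctx s2"
  "safe U B arcs_phase s2" "setup_ctx s3"
  "\<And>c. c < EV \<Longrightarrow> (snd s3 4 c, snd s3 5 c, snd s3 6 c) = slot c"
  "snd s3 7 = (\<lambda>_. 0)" "snd s3 8 = (\<lambda>_. 0)"
proof -
  have st: "\<forall>i < B. snd start 0 i = xs ! i" by (simp add: start_def)
  note r = read_phase[OF st, folded s1_def]
  note se = setup_phase[OF r(2), folded s2_def]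
  have se2: "setup_ctx s2" using se by blast
  note ar = arcs_phase[OF se2, folded s3_def]
  show "safe U B read_phase start" "input_ctx s1" "safe U B (setup_phase \<alpha>) s1" "setup_ctx s2"
    "safe U B arcs_phase s2" "setup_ctx s3"
    "\<And>c. c < EV \<Longrightarrow> (snd s3 4 c, snd s3 5 c, snd s3 6 c) = slot c"
    using r se ar by blast+
  have "snd s3 a = (\<lambda>_. 0)" if "a \<in> {7, 8}" for a
  proof -
    have "snd s3 a = snd s2 a"
      unfolding s3_def by (rule sem_frame_arr) (use that in \<open>auto simp: arcs_phase_def read_arc_def slot_stmt_def\<close>)
    also have "\<dots> = snd s1 a" using se that by auto
    also have "\<dots> = (\<lambda>_. 0)" using r(3) that by (auto simp: start_def)
    finally show ?thesis .
  qed
  then show "snd s3 7 = (\<lambda>_. 0)" "snd s3 8 = (\<lambda>_. 0)" by auto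
qed

definition s4 :: "nat list \<Rightarrow> st" where
  "s4 cs = (fst s3, (snd s3)(7 := (\<lambda>i. if i < N then cs ! i else 0)))"

lemma prefix_runs:
  "\<exists>R M \<tau>. runs w (Seq base_com (Seq (comp read_phase nregs)
       (Seq (comp (setup_phase \<alpha>) nregs) (comp arcs_phase nregs)))) (input_state xs) \<tau> (R, M) \<and>
     \<tau> \<le> 203 + cost read_phase start + cost (setup_phase \<alpha>) s1 + cost arcs_phase s2 \<and>
     represents B (R, M) s3 \<and> bounded U s3 \<and> R 0 = B"
proof -
  obtain R0 M0 t0 where 0: "runs w base_com (input_state xs) t0 (R0, M0)" "t0 \<le> 200"
     "represents B (R0, M0) start" "R0 0 = B" using base_com by blast
  obtain R1 M1 t1 where 1: "runs w (comp read_phase nregs) (R0, M0) t1 (R1, M1)"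
    "t1 \<le> cost read_phase start" "represents B (R1, M1) s1" "bounded U s1" "R1 0 = B"
    using comp_runs[OF 0(3) start_bounded phases(1) input_le U_power[OF width_phases(1)] 0(4) order_refl
        pure_phases(1) bound_vars_phases(1) word16] unfolding s1_def by blast
  obtain R2 M2 t2 where 2: "runs w (comp (setup_phase \<alpha>) nregs) (R1, M1) t2 (R2, M2)"
    "t2 \<le> cost (setup_phase \<alpha>) s1" "represents B (R2, M2) s2" "bounded U s2" "R2 0 = B"
    using comp_runs[OF 1(3,4) phases(3) input_le U_power[OF width_phases(2)] 1(5) order_refl
        pure_phases(2) bound_vars_phases(2) word16] unfolding s2_def by blast
  obtain R3 M3 t3 where 3: "runs w (comp arcs_phase nregs) (R2, M2) t3 (R3, M3)"
    "t3 \<le> cost arcs_phase s2" "represents B (R3, M3) s3" "bounded U s3" "R3 0 = B"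
    using comp_runs[OF 2(3,4) phases(5) input_le U_power[OF width_phases(3)] 2(5) order_refl
        pure_phases(3) bound_vars_phases(3) word16] unfolding s3_def by blast
  from runs_Seq[OF 0(1) runs_Seq[OF 1(1) runs_Seq[OF 2(1) 3(1)]]]
  show ?thesis using 0(2) 1(2) 2(2) 3 by (intro exI3[of _ R3 M3 "t0 + (t1 + (t2 + t3 + 1) + 1) + 1"]) auto
qed

text \<open>With the colors fixed, the rest of the program is deterministic and can be analysed for
  each coloring separately. A positive answer is always right, and an occurrence is found as soon as
  some trial colors its image injectively.\<close>

lemma main_correct:
  assumes "length cs = N" "set cs \<subseteq> {..<k}"
  shows "safe U B main_stmt (s4 cs)" "bounded U s3 \<Longrightarrow> bounded U (s4 cs)"
    "v < n \<Longrightarrow> snd (sem main_stmt (s4 cs)) 0 v \<noteq> 0 \<Longrightarrow> \<exists>\<phi> F. placed v \<phi> F"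
    "v < n \<Longrightarrow> \<tau> < R \<Longrightarrow> embeds E0 E1 (num \<tau> v 0) (\<lambda>x. \<tau> * (n * q) + \<psi> x) \<kappa> \<Longrightarrow>
       inj_on (nth cs) ((+) (\<tau> * (n * q)) ` \<psi> ` {..<k}) \<Longrightarrow> snd (sem main_stmt (s4 cs)) 0 v \<noteq> 0"
proof -
  interpret colored_problem G tas k r d n es \<alpha> U cs
    by unfold_locales (use assms in auto)
  have "setup_ctx (s4 cs)"
    using phases(6) by (simp add: setup_ctx_def input_ctx_def s4_def)
  then have c: "ctx (s4 cs)" using phases(7) by (simp add: ctx_def s4_def)
  have z: "snd (s4 cs) 8 = (\<lambda>_. 0)" using phases(9) by (simp add: s4_def)
  note m = main_phase[OF c z, folded main_stmt_def]
  show "safe U B main_stmt (s4 cs)" using m by blast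
  show "bounded U (s4 cs)" if "bounded U s3"
    using that color_less k_le by (auto simp: bounded_def s4_def) (meson le_trans less_imp_le)
  show "\<exists>\<phi> F. placed v \<phi> F" if v: "v < n" "snd (sem main_stmt (s4 cs)) 0 v \<noteq> 0"
  proof -
    obtain \<tau> S where "colorful (num \<tau> v 0) r (k - 1) S" using m v by blast
    from colorful_imp_embeds[OF this] obtain \<psi> \<kappa> where "embeds E0 E1 (num \<tau> v 0) \<psi> \<kappa>" by blast
    from embeds_imp_placed[OF this v(1)] show ?thesis .
  qed
  show "snd (sem main_stmt (s4 cs)) 0 v \<noteq> 0"
    if v: "v < n" "\<tau> < R" and e: "embeds E0 E1 (num \<tau> v 0) (\<lambda>x. \<tau> * (n * q) + \<psi> x) \<kappa>"
      and i: "inj_on (nth cs) ((+) (\<tau> * (n * q)) ` \<psi> ` {..<k})"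
  proof -
    have "num \<tau> v 0 < N" using num_less[OF v(2,1) q_pos] by (simp add: N_def)
    from embeds_imp_colorful[OF e this] i
    have "\<exists>S. colorful (num \<tau> v 0) r (k - 1) S" by (simp add: image_image)
    then show ?thesis using m v by blast
  qed
qed

text \<open>The constant 218 consists of 203 for the prefix, 13 around the coloring loop and 2
  sequencing steps.\<close>

definition run_time :: nat where
  "run_time = 218 + cost read_phase start + cost (setup_phase \<alpha>) s1 + cost arcs_phase s2 + 8 * N +
     cost main_stmt s3"

text \<open>A single time \<open>t\<close> fits all outcomes: the coloring loop takes the same
  number of steps whatever is drawn, and a main phase that halts early idles until its cost bound is
  reached.\<close>

lemma program_outcome:
  "\<exists>t g. t \<le> run_time \<and> ram_outcome w (program \<alpha>) xs t =
     map_pmf (\<lambda>cs. ([], g cs)) (replicate_pmf N (pmf_of_set {..<k})) \<and>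
     (\<forall>cs. length cs = N \<longrightarrow> set cs \<subseteq> {..<k} \<longrightarrow>
        (\<forall>v < n. snd (g cs) v = snd (sem main_stmt (s4 cs)) 0 v))"
proof -
  obtain R M \<tau> where p: "runs w (Seq base_com (Seq (comp read_phase nregs)
       (Seq (comp (setup_phase \<alpha>) nregs) (comp arcs_phase nregs)))) (input_state xs) \<tau> (R, M)"
     "\<tau> \<le> 203 + cost read_phase start + cost (setup_phase \<alpha>) s1 + cost arcs_phase s2"
     "represents B (R, M) s3" "bounded U s3" "R 0 = B"
    using prefix_runs by blast
  let ?P = "replicate_pmf N (pmf_of_set {..<k})"
  have v: "fst s3 4 = k" "fst s3 10 = N" using phases(6) by (auto simp: setup_ctx_def input_ctx_def)
  then have R: "R 4 = k" "R 10 = N" using p(3) by (simp_all add: represents_def nregs_def)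
  have "N \<le> U" "B \<le> U" using U by auto
  then have "B + 8 * N + 8 \<le> 16 * U" using U(1) by linarith
  also have "\<dots> \<le> U ^ 2" using U(1) by (simp add: power2_eq_square)
  finally have "B + 8 * N + 8 \<le> U ^ 2" .
  then have w: "B + 8 * N + 8 < 2 ^ w" using U_power[of 2] by simp
  obtain f where f: "ram_run w (8 * N + 13) (color_com # [comp main_stmt nregs], (R, M)) =
      map_pmf (\<lambda>cs. ([comp main_stmt nregs], (f cs, fill (B + 6) cs M))) ?P"
      "\<And>cs x. x < nregs \<Longrightarrow> f cs x = R x"
    using color_com_run[OF p(5) R k_pos w] by blast
  define g where "g cs = (SOME s'. ram_run w (cost main_stmt s3) ([comp main_stmt nregs], (f cs, fill (B + 6) cs M))
      = return_pmf ([], s'))" for cs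
  have g: "ram_run w (cost main_stmt s3) ([comp main_stmt nregs], (f cs, fill (B + 6) cs M)) =
      return_pmf ([], g cs) \<and> (\<forall>v < n. snd (g cs) v = snd (sem main_stmt (s4 cs)) 0 v)"
    if cs: "length cs = N" "set cs \<subseteq> {..<k}" for cs
  proof -
    have rep: "represents B (f cs, fill (B + 6) cs M) (s4 cs)"
      unfolding represents_def
    proof (intro conjI allI impI ballI)
      show "fst (f cs, fill (B + 6) cs M) x = fst (s4 cs) x" if "x < nregs" for x
        using that f(2) p(3) by (simp add: represents_def s4_def)
      show "snd (f cs, fill (B + 6) cs M) i = snd (s4 cs) 0 i" if "i < B" for i
        using that p(3) by (simp add: represents_def s4_def fill_other)
      fix a i assume a: "a \<in> {1..8 :: nat}"
      show "snd (f cs, fill (B + 6) cs M) (addr B a i) = snd (s4 cs) a i"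
      proof (cases "a = 7 \<and> i < N")
        case True
        then have "addr B a i = (B + 6) + 8 * i" by (simp add: addr_def)
        then show ?thesis using True cs fill_nth[of i cs "B + 6" M] by (simp add: s4_def)
      next
        case False
        have "addr B a i \<noteq> (B + 6) + 8 * i'" if "i' < length cs" for i'
        proof
          assume "addr B a i = (B + 6) + 8 * i'"
          then have "addr B a i = addr B 7 i'" by (simp add: addr_def)
          then show False using addr_inj[OF _ a, of B i 7 i'] False that cs by auto
        qed
        then have "fill (B + 6) cs M (addr B a i) = M (addr B a i)" by (rule fill_other)
        also have "\<dots> = snd s3 a i" using p(3) a by (simp add: represents_def)
        also have "\<dots> = snd (s4 cs) a i" using False phases(8) by (auto simp: s4_def)
        finally show ?thesis by simp
      qed
    qed
    have f0: "f cs 0 = B" using f(2)[of 0 cs] p(5) by (simp add: nregs_def)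
    obtain R' M' t' where 4: "runs w (comp main_stmt nregs) (f cs, fill (B + 6) cs M) t' (R', M')"
      "t' \<le> cost main_stmt (s4 cs)" "represents B (R', M') (sem main_stmt (s4 cs))"
      using comp_runs[OF rep main_correct(2)[OF cs p(4)] main_correct(1)[OF cs] input_le
          U_power[OF width_phases(4)] f0 order_refl pure_phases(4) bound_vars_phases(4) word16] by blast
    have "cost main_stmt (s4 cs) = cost main_stmt s3"
      by (rule cost_cong[OF pure_phases(4)]) (simp add: s4_def)
    then have r: "ram_run w (cost main_stmt s3) ([comp main_stmt nregs], (f cs, fill (B + 6) cs M)) =
      return_pmf ([], (R', M'))" using runs_Nil_stack[OF 4(1)] 4(2) by simp
    then have "g cs = (R', M')" unfolding g_def by simp
    moreover have "n \<le> B" by (simp add: length_xs)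
    ultimately show ?thesis using r 4(3) by (auto simp: represents_def)
  qed
  define t where "t = 1 + (\<tau> + (1 + ((8 * N + 13) + cost main_stmt s3)))"
  have "ram_outcome w (program \<alpha>) xs t = bind_pmf ?P (\<lambda>cs.
      ram_run w (cost main_stmt s3) ([comp main_stmt nregs], (f cs, fill (B + 6) cs M)))"
  proof -
    have "ram_outcome w (program \<alpha>) xs t =
        bind_pmf (ram_run w \<tau> (Seq base_com (Seq (comp read_phase nregs)
          (Seq (comp (setup_phase \<alpha>) nregs) (comp arcs_phase nregs))) # [Seq color_com (comp main_stmt nregs)],
          input_state xs)) (ram_run w (1 + ((8 * N + 13) + cost main_stmt s3)))"
      unfolding ram_outcome_def t_def program_def ram_run_add[of w 1 "\<tau> + _"] ram_run_add[of w \<tau>]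
      by (simp add: bind_return_pmf)
    also have "\<dots> = ram_run w (1 + ((8 * N + 13) + cost main_stmt s3))
        ([Seq color_com (comp main_stmt nregs)], (R, M))"
      using p(1) by (simp add: runs_def bind_return_pmf)
    also have "\<dots> = ram_run w ((8 * N + 13) + cost main_stmt s3) (color_com # [comp main_stmt nregs], (R, M))"
      unfolding ram_run_add[of w 1 "(8 * N + 13) + _"] by (simp add: bind_return_pmf)
    also have "\<dots> = bind_pmf ?P (\<lambda>cs.
      ram_run w (cost main_stmt s3) ([comp main_stmt nregs], (f cs, fill (B + 6) cs M)))"
      unfolding ram_run_add[of w "8 * N + 13"] f(1) by (simp add: map_pmf_def bind_assoc_pmf bind_return_pmf)
    finally show ?thesis .
  qed
  also have "\<dots> = bind_pmf ?P (\<lambda>cs. return_pmf ([], g cs))"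
  proof (rule bind_pmf_cong[OF refl])
    fix cs assume "cs \<in> set_pmf ?P"
    then have "length cs = N" "set cs \<subseteq> {..<k}"
      using k_pos by (auto simp: set_replicate_pmf lessThan_empty_iff)
    then show "ram_run w (cost main_stmt s3) ([comp main_stmt nregs], (f cs, fill (B + 6) cs M)) =
        return_pmf ([], g cs)" using g by blast
  qed
  finally have "ram_outcome w (program \<alpha>) xs t = map_pmf (\<lambda>cs. ([], g cs)) ?P"
    by (simp add: map_pmf_def)
  moreover have "t \<le> run_time" using p(2) by (simp add: t_def run_time_def)
  ultimately show ?thesis using g by blast
qed

text \<open>The error is one-sided, so only vertices in \<open>S\<close> can be answered wrongly.
  For each of them one embedding is fixed in advance, and it suffices that one of its translates is
  colored injectively.\<close>

lemma program_correct:
  assumes A: "pverts A = {..<k}" "parcs A = set tas"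
  shows "\<exists>t \<le> run_time. halts_within w (program \<alpha>) xs t \<and>
    1 - 1 / real n ^ \<alpha> \<le> prob_decides w (program \<alpha>) xs t n (occurs_rooted_at A r G)"
proof -
  let ?P = "replicate_pmf N (pmf_of_set {..<k})"
  obtain t g where t: "t \<le> run_time" and o: "ram_outcome w (program \<alpha>) xs t = map_pmf (\<lambda>cs. ([], g cs)) ?P"
    and g: "\<And>cs v. length cs = N \<Longrightarrow> set cs \<subseteq> {..<k} \<Longrightarrow> v < n \<Longrightarrow>
        snd (g cs) v = snd (sem main_stmt (s4 cs)) 0 v"
    using program_outcome by blast
  have h: "halts_within w (program \<alpha>) xs t" unfolding halts_within_def o by auto
  define S where "S = {v. v < n \<and> occurs_rooted_at A r G v}"
  have occ: "occurs_rooted_at A r G v \<longleftrightarrow> (\<exists>\<phi> F. placed v \<phi> F)" for v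
    using occurs_imp_placed[OF A] placed_imp_occurs[OF A] by blast
  have "\<forall>v. \<exists>\<psi> \<kappa>. v \<in> S \<longrightarrow> (\<forall>x < k. \<psi> x < n * q) \<and>
     (\<forall>\<tau> < R. embeds E0 E1 (num \<tau> v 0) (\<lambda>x. \<tau> * (n * q) + \<psi> x) \<kappa>)"
    using placed_imp_embeds unfolding S_def occ by blast
  then obtain \<psi> \<kappa> where \<psi>: "\<And>v x. v \<in> S \<Longrightarrow> x < k \<Longrightarrow> \<psi> v x < n * q"
    "\<And>v \<tau>. v \<in> S \<Longrightarrow> \<tau> < R \<Longrightarrow> embeds E0 E1 (num \<tau> v 0) (\<lambda>x. \<tau> * (n * q) + \<psi> v x) (\<kappa> v)"
    by metis
  have I: "\<psi> v ` {..<k} \<subseteq> {..<n * q} \<and> card (\<psi> v ` {..<k}) \<le> k" if "v \<in> S" for v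
    using \<psi>(1)[OF that] card_image_le[of "{..<k}" "\<psi> v"] by auto
  have fin: "finite S" "card S \<le> n"
    using card_mono[of "{..<n}" S] finite_subset[of S "{..<n}"] by (auto simp: S_def)
  have Req: "R = 4 ^ k * (\<alpha> + 1) * L"
    unfolding R_def by (simp flip: power_mult_distrib)
  have Neq: "N = R * (n * q)" by (simp add: N_def mult.assoc)
  have "1 - 1 / real n ^ \<alpha> \<le> measure_pmf.prob ?P
     {cs. \<forall>v \<in> S. \<exists>\<tau> < R. inj_on (nth cs) ((+) (\<tau> * (n * q)) ` \<psi> v ` {..<k})}"
    unfolding Neq by (rule prob_rainbow_trials[OF k_pos fin n_pos L(1) I Req])
  \<comment> \<open>Correctness is known for lists of the right length and range only, hence the
    restriction to the support.\<close>
  also have "\<dots> = measure_pmf.prob ?P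
     ({cs. \<forall>v \<in> S. \<exists>\<tau> < R. inj_on (nth cs) ((+) (\<tau> * (n * q)) ` \<psi> v ` {..<k})} \<inter> set_pmf ?P)"
    by (simp add: measure_Int_set_pmf)
  also have "\<dots> \<le> measure_pmf.prob ?P {cs. \<forall>v < n. snd (g cs) v \<noteq> 0 \<longleftrightarrow> occurs_rooted_at A r G v}"
  proof (rule measure_pmf.finite_measure_mono)
    show "{cs. \<forall>v \<in> S. \<exists>\<tau> < R. inj_on (nth cs) ((+) (\<tau> * (n * q)) ` \<psi> v ` {..<k})} \<inter> set_pmf ?P
      \<subseteq> {cs. \<forall>v < n. snd (g cs) v \<noteq> 0 \<longleftrightarrow> occurs_rooted_at A r G v}"
    proof (intro subsetI CollectI allI impI)
      fix cs v
      assume cs: "cs \<in> {cs. \<forall>v \<in> S. \<exists>\<tau> < R. inj_on (nth cs) ((+) (\<tau> * (n * q)) ` \<psi> v ` {..<k})} \<inter> set_pmf ?P"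
        and v: "v < n"
      then have l: "length cs = N" "set cs \<subseteq> {..<k}"
        using k_pos by (auto simp: set_replicate_pmf lessThan_empty_iff)
      show "snd (g cs) v \<noteq> 0 \<longleftrightarrow> occurs_rooted_at A r G v"
        unfolding g[OF l v]
      proof
        assume "snd (sem main_stmt (s4 cs)) 0 v \<noteq> 0"
        then show "occurs_rooted_at A r G v" using main_correct(3)[OF l v] occ by blast
      next
        assume "occurs_rooted_at A r G v"
        then have vS: "v \<in> S" using v by (simp add: S_def)
        then obtain \<tau> where "\<tau> < R" "inj_on (nth cs) ((+) (\<tau> * (n * q)) ` \<psi> v ` {..<k})"
          using cs by blast
        then show "snd (sem main_stmt (s4 cs)) 0 v \<noteq> 0"
          using main_correct(4)[OF l v _ \<psi>(2)[OF vS]] by blast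
      qed
    qed
  qed simp
  also have "\<dots> = prob_decides w (program \<alpha>) xs t n (occurs_rooted_at A r G)"
    unfolding prob_decides_def o by (simp add: vimage_def split_beta)
  finally show ?thesis using h t by blast
qed

end

section \<open>Running time\<close>

text \<open>The largest product of nested loop bounds, which gives the order of growth of
  \<open>cost\<close>; \<open>max 1\<close> accounts for the constant cost of a loop that is not
  entered.\<close>

primrec loops :: "stmt \<Rightarrow> st \<Rightarrow> nat" where
  "loops Skip s = 1"
| "loops (Assign x e) s = 1"
| "loops (Update a i e) s = 1"
| "loops (Then c d) s = max (loops c s) (loops d s)"
| "loops (IfNZ e c d) s = max (loops c s) (loops d s)"
| "loops (For x e c) s = max 1 (eval e s) * loops c s"

primrec cost_const :: "stmt \<Rightarrow> nat" where
  "cost_const Skip = 1"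
| "cost_const (Assign x e) = cost_aexp e + 4"
| "cost_const (Update a i e) = cost_aexp i + cost_addr a + cost_aexp e + 4"
| "cost_const (Then c d) = cost_const c + cost_const d + 1"
| "cost_const (IfNZ e c d) = cost_aexp e + 2 + cost_const c + cost_const d"
| "cost_const (For x e c) = cost_aexp e + 15 + cost_const c"

lemma loops_pos: "1 \<le> loops c s"
  by (induction c) (auto simp: Suc_le_eq)

lemma cost_le_loops: "cost c s \<le> cost_const c * loops c s"
proof (induction c)
  case (Then c d)
  have "cost c s \<le> cost_const c * max (loops c s) (loops d s)"
    "cost d s \<le> cost_const d * max (loops c s) (loops d s)"
    by (rule order_trans[OF Then.IH(1)] order_trans[OF Then.IH(2)], simp)+
  then show ?case using loops_pos[of c s] by (simp add: algebra_simps)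
next
  case (IfNZ e c d)
  let ?m = "max (loops c s) (loops d s)"
  have *: "cost c s \<le> cost_const c * ?m" "cost d s \<le> cost_const d * ?m"
    by (rule order_trans[OF IfNZ.IH(1)] order_trans[OF IfNZ.IH(2)], simp)+
  have "1 \<le> ?m" using loops_pos[of c s] by simp
  then have "cost_aexp e + 2 \<le> (cost_aexp e + 2) * ?m"
    using mult_le_mono2[of 1 ?m "cost_aexp e + 2"] by simp
  then have "cost (IfNZ e c d) s \<le> (cost_aexp e + 2) * ?m + (cost_const c * ?m + cost_const d * ?m)"
    using * unfolding cost.simps by linarith
  then show ?case by (simp add: algebra_simps)
next
  case (For x e c)
  let ?e = "max 1 (eval e s)" and ?l = "loops c s"
  have l: "1 \<le> ?l" by (rule loops_pos)
  have "eval e s * (cost c s + 11) \<le> ?e * (cost_const c * ?l + 11 * ?l)"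
    using For.IH l by (intro mult_le_mono add_le_mono) auto
  moreover have "cost_aexp e + 4 \<le> (cost_aexp e + 4) * (?e * ?l)"
    using mult_le_mono[of 1 ?e 1 ?l] l by simp
  ultimately show ?case by (simp add: algebra_simps)
qed (simp_all)

text \<open>The 226 adds the 8 of \<open>8 * N\<close> to the 218 of
  \<open>run_time\<close>.\<close>

definition total_const :: "nat \<Rightarrow> nat" where
  "total_const \<alpha> = 226 + cost_const read_phase + cost_const (setup_phase \<alpha>) +
     cost_const arcs_phase + cost_const main_stmt"

context ram_problem
begin

lemma R_pos: "0 < R"
proof -
  have "L \<noteq> 0" using L(1) n_pos by (intro notI) simp
  then show ?thesis by (simp add: R_def)
qed

text \<open>The most expensive nest is that of the joins: \<open>k\<close> rounds over fewer than
  \<open>k\<close> arcs, at most \<open>R * max m n * q * k\<close> slots, \<open>4 ^ k\<close>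
  pairs of color sets and \<open>k\<close> bits for the test of disjointness.\<close>

lemma run_time_le:
  "run_time \<le> total_const \<alpha> * (k * (k * ((R * max m n * q * k) * (2 ^ k * (2 ^ k * k)))))"
proof -
  define mx where "mx = max m n"
  have mx: "n \<le> mx" "m \<le> mx" "max 1 m \<le> mx" "0 < mx" using n_pos by (auto simp: mx_def)
  define X where "X = R * mx * q * k"
  define Y where "Y = X * (2 ^ k * (2 ^ k * k))"
  define W where "W = k * (k * Y)"
  note pos = R_pos n_pos k_pos q_pos
  have max1: "max 1 R = R" "max (Suc 0) R = R" "max (Suc 0) q = q" "max (Suc 0) k = k" "max (Suc 0) n = n" "max 1 n = n" "max 1 k = k" "max 1 q = q" "max 1 (2 ^ k :: nat) = 2 ^ k"
    using pos by auto
  have XN: "N \<le> X" and XE: "EV \<le> X"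
    using mult_le_mono[OF mult_le_mono[OF mult_le_mono2[OF mx(1), of R] order_refl[of q]], of 1 k] pos mx
    by (auto simp: X_def N_def EV_def Suc_le_eq)
  have "1 \<le> X" using pos mx(4) by (simp add: X_def Suc_le_eq)
  then have X: "max 1 N \<le> X" "max 1 EV \<le> X" using XN XE by auto
  have XY: "X \<le> Y" using pos by (simp add: Y_def)
  have YW: "Y \<le> W" using pos by (simp add: W_def)
  have kX: "k \<le> X" "n \<le> X" "max 1 m \<le> X"
  proof -
    have "k * 1 \<le> k * (R * mx * q)" "mx * 1 \<le> mx * (R * q * k)"
      using pos mx(4) by (auto simp: Suc_le_eq)
    then have "k \<le> X" "mx \<le> X" by (simp_all add: X_def ac_simps)
    then show "k \<le> X" "n \<le> X" "max 1 m \<le> X" using mx by auto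
  qed
  have k1: "max 1 (k - 1) \<le> k" using pos by simp
  have v1: "fst s1 (Suc 0) = n" "fst s1 2 = m" "fst s1 4 = k"
    using phases(2) by (auto simp: input_ctx_def)
  have v2: "fst s2 (Suc 0) = n" "fst s2 2 = m" "fst s2 4 = k" "fst s2 7 = q" "fst s2 8 = R"
    using phases(4) by (auto simp: input_ctx_def setup_ctx_def)
  have v3: "fst s3 (Suc 0) = n" "fst s3 2 = m" "fst s3 4 = k" "fst s3 7 = q" "fst s3 8 = R"
    "fst s3 9 = 2 ^ k" "fst s3 10 = N" "fst s3 11 = EV"
    using phases(6) by (auto simp: input_ctx_def setup_ctx_def)
  have W1: "1 \<le> W" using \<open>1 \<le> X\<close> XY YW by simp
  have l0: "loops read_phase start \<le> W" using W1 by (simp add: read_phase_def)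
  have l1: "loops (setup_phase \<alpha>) s1 \<le> W"
    using W1 kX k1 XY YW by (simp add: setup_phase_def read_arc_def v1 max1) 
  have "R * (max 1 m * (q * k)) \<le> R * (mx * (q * k))" using mx(3) by simp
  also have "\<dots> = X" by (simp add: X_def mult.assoc)
  finally have l2': "R * (max 1 m * (q * k)) \<le> X" .
  have "max (Suc 0) (q * k) = q * k" using pos by (simp add: Suc_le_eq max_def)
  then have l2: "loops arcs_phase s2 \<le> W"
    using W1 XY YW l2' by (simp add: arcs_phase_def slot_stmt_def read_arc_def v2 max1)
  have a: "max 1 N * (k * 2 ^ k) \<le> Y"
    unfolding Y_def using X(1) pos(3) by (intro mult_le_mono) (auto simp: Suc_le_eq)
  have b: "max 1 EV * (2 ^ k * (2 ^ k * k)) \<le> Y"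
    unfolding Y_def using X(2) by (intro mult_le_mono) auto
  have c: "max 1 N * k \<le> Y"
    by (rule order_trans[OF _ a]) simp
  have d: "n * (R * 2 ^ k) \<le> Y"
  proof -
    have "n * (R * 2 ^ k) = (R * n * 1 * 1) * (2 ^ k * (1 * 1))" by simp
    also have "\<dots> \<le> Y" unfolding Y_def X_def
      using mx pos by (intro mult_le_mono) (auto simp: Suc_le_eq)
    finally show ?thesis .
  qed
  let ?copy = "max 1 N * (k * 2 ^ k)" and ?joins = "max 1 EV * (2 ^ k * (2 ^ k * k))"
  have e: "k * (max 1 (k - 1) * max ?copy ?joins) \<le> W"
    unfolding W_def using k1 a b by (intro mult_le_mono) auto
  have i: "loops init_phase s3 = max 1 N * k"
    using pos by (simp add: init_phase_def v3 max_def)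
  have cp: "loops copy_stmt s3 = ?copy"
    using pos by (simp add: copy_stmt_def v3 max1)
  have js: "loops joins_stmt s3 = ?joins"
    using pos by (simp add: joins_stmt_def join_stmt_def disjoint_stmt_def v3 max1)
  have r: "loops rounds_phase s3 = k * (max 1 (k - 1) * max ?copy ?joins)"
    using loops_pos[of copy_stmt s3] pos
    by (simp add: rounds_phase_def v3 max1 cp[symmetric] js[symmetric] del: One_nat_def)
  have o: "loops output_phase s3 = n * (R * 2 ^ k)"
  proof -
    have "0 < R * 2 ^ k" using pos by simp
    then have "max (Suc 0) (R * 2 ^ k) = R * 2 ^ k" "max (R * 2 ^ k) (Suc 0) = R * 2 ^ k" by linarith+
    then show ?thesis by (simp add: output_phase_def v3 max1)
  qed
  have "loops init_phase s3 \<le> W" "loops rounds_phase s3 \<le> W" "loops output_phase s3 \<le> W"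
    unfolding i r o using order_trans[OF c YW] e order_trans[OF d YW] by blast+
  then have l3: "loops main_stmt s3 \<le> W" by (simp add: main_stmt_def)
  have "run_time \<le> 218 + cost_const read_phase * W + cost_const (setup_phase \<alpha>) * W +
      cost_const arcs_phase * W + 8 * W + cost_const main_stmt * W"
    unfolding run_time_def
    by (intro add_le_mono order_refl mult_le_mono2 order_trans[OF cost_le_loops] l0 l1 l2 l3)
      (use XN XY YW in linarith)
  also have "\<dots> \<le> total_const \<alpha> * W"
    using W1 by (simp add: total_const_def algebra_simps)
  finally show ?thesis unfolding W_def Y_def X_def mx_def .
qed

text \<open>By minimality of \<open>L\<close>, it exceeds the logarithm by at most 1, and the
  maximum with 2 makes the logarithm at least 1; hence the factor 2.\<close>

lemma L_le_log: "real L \<le> 2 * log 2 (real (max 2 n))"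
proof -
  have l: "1 \<le> log 2 (real (max 2 n))" by (subst one_le_log_cancel_iff) auto
  show ?thesis
  proof (cases "L = 0")
    case False
    then have "2 ^ (L - 1) \<le> n" by (intro L(2)) simp
    then have "2 ^ (L - 1) \<le> max 2 n" by simp
    then have "real (2 ^ (L - 1)) \<le> real (max 2 n)" by (simp only: of_nat_le_iff)
    then have "real (L - 1) \<le> log 2 (real (max 2 n))"
      by (subst le_log_iff) (auto simp: powr_realpow)
    then have "real L - 1 \<le> log 2 (real (max 2 n))" using False by (simp add: of_nat_diff)
    then show ?thesis using l by linarith
  qed (use l in simp)
qed

definition time_const :: nat where
  "time_const = 2 * total_const \<alpha> * (\<alpha> + 1)"

text \<open>The trials and the pairs of color sets contribute \<open>4 ^ k\<close> each, and the
  four factors \<open>k\<close> at most \<open>16 ^ k\<close>; together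
  \<open>256 ^ k\<close>.\<close>

lemma run_time_real_le:
  "real run_time \<le> real (time_const * 256 ^ k * q) * real (max m n) * log 2 (real (max 2 n))"
proof -
  have "k \<le> 2 ^ k" using less_exp[of k] by simp
  then have k4: "k ^ 4 \<le> (2 ^ k) ^ 4" by (rule power_mono) simp
  have p: "(2 ^ k) ^ 4 * (2 ^ k) ^ 4 = (256 :: nat) ^ k"
    by (simp flip: power_mult power_add power_mult_distrib) (simp add: power_mult mult.commute[of k])
  have arith: "k * (k * ((t * t * a * l * x * q * k) * (t * (t * k)))) = (k ^ 4 * t ^ 4) * (a * q * x * l)"
    for t a l x q k :: nat
    by (simp only: power4_eq_xxxx ac_simps)
  have "k * (k * ((R * max m n * q * k) * (2 ^ k * (2 ^ k * k)))) =
      (k ^ 4 * (2 ^ k) ^ 4) * ((\<alpha> + 1) * q * max m n * L)"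
    unfolding R_def by (rule arith)
  also have "\<dots> \<le> 256 ^ k * ((\<alpha> + 1) * q * max m n * L)"
    unfolding p[symmetric] using k4 by (intro mult_le_mono1)
  finally have "run_time \<le> total_const \<alpha> * (256 ^ k * ((\<alpha> + 1) * q * max m n * L))"
    using run_time_le mult_le_mono2 order_trans by blast
  then have "real run_time \<le> real (total_const \<alpha> * (256 ^ k * ((\<alpha> + 1) * q * max m n * L)))"
    by (simp only: of_nat_le_iff)
  also have "\<dots> = real (total_const \<alpha> * (256 ^ k * ((\<alpha> + 1) * q * max m n))) * real L"
    by (simp add: ac_simps)
  also have "\<dots> \<le> real (total_const \<alpha> * (256 ^ k * ((\<alpha> + 1) * q * max m n))) *
      (2 * log 2 (real (max 2 n)))"
    by (rule mult_left_mono[OF L_le_log]) simp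
  also have "\<dots> = real (time_const * 256 ^ k * q) * real (max m n) * log 2 (real (max 2 n))"
    by (simp only: time_const_def of_nat_mult of_nat_numeral ac_simps)
  finally show ?thesis .
qed

end

context occurrence_problem
begin

text \<open>From \<open>k = 2\<close> on, \<open>k + 1 \<le> k ^ 2\<close>; the factor 2 is for
  \<open>k = 1\<close>.\<close>

lemma q_le: "q \<le> 2 * (k ^ k) ^ 2"
proof -
  have "(k + 1) ^ k \<le> 2 * (k ^ k) ^ 2"
  proof (cases "k = 1")
    case False
    then have "2 \<le> k" using k_pos by simp
    then have "k + 1 \<le> k ^ 2" using mult_le_mono1[of 2 k k] unfolding power2_eq_square by linarith
    then have "(k + 1) ^ k \<le> (k ^ 2) ^ k" by (rule power_mono) simp
    then show ?thesis by (simp flip: power_mult add: mult.commute)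
  qed simp
  moreover have "1 \<le> (k ^ k) ^ 2" using k_pos by (simp add: Suc_le_eq)
  ultimately show ?thesis by (simp add: q_def)
qed

lemma two_power_le: "2 ^ k \<le> 2 * k ^ k"
proof (cases "k = 1")
  case False
  then have "2 \<le> k" using k_pos by simp
  then have "2 ^ k \<le> k ^ k" by (rule power_mono) simp
  then show ?thesis by simp
qed simp

definition M :: nat where "M = B + Max (set xs)"

text \<open>The number of slots is at most \<open>8 * M ^ 3 * M ^ \<alpha> * k ^ (4 * k)\<close>:
  here \<open>R\<close> contributes \<open>M\<close> for \<open>L\<close>,
  \<open>M ^ \<alpha>\<close> for \<open>\<alpha> + 1\<close> and \<open>k ^ (2 * k)\<close>, while
  \<open>q\<close> gives another \<open>k ^ (2 * k)\<close>. The further factors \<open>M\<close>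
  leave room for constants.\<close>

definition word_bound :: nat where
  "word_bound = M ^ (\<alpha> + 5) * k ^ (4 * k)"

lemma M_ge: "8 \<le> M" "B \<le> M" "n \<le> M" "m \<le> M" "k \<le> M" "x \<in> set xs \<Longrightarrow> x \<le> M"
proof -
  show "B \<le> M" by (simp add: M_def)
  then show "8 \<le> M" "n \<le> M" "m \<le> M" "k \<le> M"
    using h_pos n_pos k_pos unfolding length_xs by linarith+
  show "x \<le> M" if "x \<in> set xs" using Max_ge[OF finite_set that] by (simp add: M_def)
qed

lemma bounded_problem_word_bound: "bounded_problem G tas k r d n es \<alpha> word_bound"
proof -
  define a where "a = M ^ \<alpha>"
  define K where "K = k ^ k"
  define Z where "Z = a * K ^ 4"
  have U: "word_bound = M ^ 5 * Z"
    by (simp add: word_bound_def Z_def a_def K_def power_add flip: power_mult) (simp add: ac_simps)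
  have M: "2 \<le> M" using M_ge by simp
  have "\<alpha> + 1 \<le> 2 ^ \<alpha>" using Suc_leI[OF less_exp[of \<alpha>]] by simp
  also have "\<dots> \<le> a" unfolding a_def by (rule power_mono[OF M]) simp
  finally have a: "\<alpha> + 1 \<le> a" .
  have K: "1 \<le> K" using k_pos by (simp add: K_def Suc_le_eq)
  then have Ki: "K ^ i \<le> K ^ 4" if "i \<le> 4" for i using that by (intro power_increasing)
  have k2: "2 ^ k \<le> 2 * K" using two_power_le by (simp add: K_def)
  have q: "q \<le> 2 * K ^ 2" using q_le by (simp add: K_def)
  have Z: "a \<le> Z" "1 \<le> Z" "K \<le> Z" "K ^ 2 \<le> Z" "a * K ^ 2 \<le> Z"
    unfolding Z_def using mult_le_mono[of 1 a 1 "K ^ 4"] mult_le_mono[of 1 a "K ^ 2" "K ^ 4"]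
      mult_le_mono[of 1 a "K" "K ^ 4"] mult_le_mono[of a a 1 "K ^ 4"] mult_le_mono[of a a "K ^ 2" "K ^ 4"]
      a K Ki[of 2] Ki[of 1] Ki[of 0] by simp_all
  have mono: "x \<le> word_bound" if "x \<le> M ^ 4 * Z" for x
  proof -
    have "M ^ 4 * Z \<le> M ^ 5 * Z" using M by (intro mult_le_mono1 power_increasing) auto
    then show ?thesis using that U by linarith
  qed
  have monoM: "y * Z \<le> M ^ 4 * Z" if "y \<le> M ^ i" "i \<le> 4" for y i
    by (rule mult_le_mono1[OF order_trans[OF that(1) power_increasing[OF that(2)]]]) (use M in simp)
  have mono1: "y * z \<le> word_bound" if "y \<le> M ^ i" "i \<le> 4" "z \<le> Z" for y z i
    using mono[OF order_trans[OF mult_le_mono2[OF that(3)] monoM[OF that(1,2)]]] .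
  have M2: "8 * M \<le> M ^ 2" using M_ge(1) by (simp add: power2_eq_square)
  have M3: "8 * M ^ 2 \<le> M ^ 3" using mult_le_mono1[OF M_ge(1), of "M ^ 2"] by (simp flip: power_Suc)
  have M4: "8 * M ^ 3 \<le> M ^ 4" using mult_le_mono1[OF M_ge(1), of "M ^ 3"] by (simp flip: power_Suc)
  have R: "R \<le> 4 * M * (a * K ^ 2)"
  proof -
    have "R \<le> (2 * K) * (2 * K) * a * M"
      unfolding R_def using k2 a L(3) M_ge(3) by (intro mult_le_mono) auto
    also have "\<dots> = 4 * M * (a * K ^ 2)" by (simp add: power2_eq_square ac_simps)
    finally show ?thesis .
  qed
  have N: "N \<le> 8 * M ^ 2 * Z"
  proof -
    have "N \<le> (4 * M * (a * K ^ 2)) * M * (2 * K ^ 2)"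
      unfolding N_def using R q M_ge(3) by (intro mult_le_mono) auto
    also have "\<dots> = 8 * M ^ 2 * Z" by (simp add: Z_def power2_eq_square power3_eq_cube power4_eq_xxxx)
    finally show ?thesis .
  qed
  have EV: "EV \<le> 8 * M ^ 3 * Z"
  proof -
    have "EV \<le> (4 * M * (a * K ^ 2)) * M * (2 * K ^ 2) * M"
      unfolding EV_def using R q M_ge(4,5) by (intro mult_le_mono) auto
    also have "\<dots> = 8 * M ^ 3 * Z" by (simp add: Z_def power2_eq_square power3_eq_cube power4_eq_xxxx)
    finally show ?thesis .
  qed
  have qk: "q * k + k \<le> 3 * M * Z"
  proof -
    have "q * k \<le> (2 * Z) * M" using q Z(4) M_ge(5) by (intro mult_le_mono) auto
    moreover have "k \<le> Z * M" using mult_le_mono[OF Z(2) M_ge(5)] by simp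
    ultimately show ?thesis by (simp add: ac_simps)
  qed
  show ?thesis
  proof unfold_locales
    show "16 \<le> word_bound" using mono1[of 16 2 1] M2 M_ge(1) Z(2) by simp
    show "B \<le> word_bound" using mono1[of B 1 1] M_ge(2) Z(2) by simp
    show "x \<le> word_bound" if "x \<in> set xs" for x using mono1[of x 1 1] M_ge(6)[OF that] Z(2) by simp
    have "\<alpha> + 8 \<le> 8 * Z" using a Z(1,2) by linarith
    also have "\<dots> \<le> word_bound" using mono1[of 8 1 Z] M_ge(1) by simp
    finally show "\<alpha> + 8 \<le> word_bound" .
    show "2 * n \<le> word_bound" using mono1[of "2 * n" 2 1] M2 M_ge(3) Z(2) by simp
    show "2 ^ k \<le> word_bound" using k2 mono1[of 2 1 K] M Z(3) by simp
    show "R \<le> word_bound" using R mono1[of "4 * M" 2 "a * K ^ 2"] M2 Z(5) by simp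
    have "8 * M ^ 2 + 3 * M \<le> M ^ 4" using M2 M3 M4 by linarith
    from mono1[OF this order_refl order_refl] show "N + q * k + k \<le> word_bound"
      using N qk by (simp add: algebra_simps)
    show "EV \<le> word_bound" using EV mono1[OF M4 order_refl order_refl] by simp
    show "q \<le> word_bound" using q mono1[of 2 1 "K ^ 2"] M Z(4) by simp
  qed
qed

text \<open>Raising 2 to both sides of the assumption gives
  \<open>(k ^ k * M) ^ c \<le> 2 ^ w\<close>, and \<open>c\<close> is at least the sum of the
  exponents, \<open>100 * (\<alpha> + 5)\<close> for \<open>M\<close> and 400 for
  \<open>k ^ k\<close>.\<close>

lemma word_length:
  assumes "word_length_ok c k xs w" "100 * (\<alpha> + 5) + 400 \<le> c"
  shows "word_bound ^ 100 < 2 ^ w"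
proof -
  have M: "2 \<le> M" using M_ge(1) by simp
  have k: "1 \<le> k" using k_pos by simp
  have "real c * (real k * log 2 (real k) + log 2 (real M)) \<le> real w"
    using assms(1) by (simp add: word_length_ok_def M_def)
  then have "2 powr (real c * (real k * log 2 (real k) + log 2 (real M))) \<le> 2 powr real w"
    by simp
  also have "2 powr (real c * (real k * log 2 (real k) + log 2 (real M))) = real ((k ^ k * M) ^ c)"
  proof -
    have "real k * log 2 (real k) + log 2 (real M) = log 2 (real (k ^ k * M))"
      using k M by (simp add: log_mult log_nat_power)
    then have "2 powr (real c * (real k * log 2 (real k) + log 2 (real M))) =
        (2 powr log 2 (real (k ^ k * M))) powr real c"
      by (simp add: powr_powr mult.commute)
    also have "\<dots> = real (k ^ k * M) ^ c" using k M by (simp add: powr_realpow)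
    finally show ?thesis by simp
  qed
  finally have w: "(k ^ k * M) ^ c \<le> 2 ^ w"
    by (simp add: powr_realpow flip: of_nat_le_iff[where 'a = real])
  have "word_bound ^ 100 = M ^ (100 * (\<alpha> + 5)) * (k ^ k) ^ 400"
    by (simp add: word_bound_def power_mult_distrib flip: power_mult) (simp add: ac_simps)
  also have "\<dots> < M ^ c * (k ^ k) ^ c"
    using M k assms(2) by (intro mult_less_le_imp_less power_strict_increasing power_increasing) auto
  also have "\<dots> = (k ^ k * M) ^ c" by (simp add: power_mult_distrib mult.commute)
  finally show ?thesis using w by simp
qed

lemma not_small_large_params:
  assumes "\<forall>i. 1 \<le> i \<and> i < length (params G) \<longrightarrow> k \<le> params G ! i"
  shows "q = 1"
proof -
  have "k \<le> P (t v)" if "down u v" for u v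
    using that assms parD(2,5)[of "t u" "t v"] by (auto simp: down_def length_params)
  then have "\<not> small" by (force simp: small_def)
  then show ?thesis by (simp add: q_def)
qed

end

text \<open>For \<open>k \<ge> 2\<close>, \<open>256 ^ k\<close> is at most
  \<open>k ^ (8 * k)\<close> and \<open>q\<close> at most \<open>2 * k ^ (2 * k)\<close>, whence the
  exponent 10. For \<open>k = 1\<close>, powers of \<open>k\<close> do not help and the leading
  factor has to absorb \<open>256 * 2 * C\<close>.\<close>

lemma time_const_le:
  fixes c C k q :: nat
  assumes "0 < k" "q \<le> 2 * (k ^ k) ^ 2" "512 * C + 10 \<le> c"
  shows "C * 256 ^ k * q \<le> c * k ^ (c * k)"
proof (cases "k = 1")
  case True
  then have "q \<le> 2" using assms(2) by simp
  then have "C * 256 * q \<le> C * 256 * 2" by (rule mult_le_mono2)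
  also have "\<dots> \<le> c" using assms(3) by linarith
  finally show ?thesis using True by simp
next
  case False
  then have k: "2 \<le> k" using assms(1) by simp
  have "256 ^ k = (2 ^ 8 :: nat) ^ k" by simp
  also have "\<dots> \<le> (k ^ 8) ^ k" by (rule power_mono[OF power_mono[OF k]]) auto
  finally have "C * 256 ^ k * q \<le> C * (k ^ 8) ^ k * (2 * (k ^ k) ^ 2)"
    using assms(2) by (intro mult_le_mono) auto
  also have "\<dots> = 2 * C * k ^ (10 * k)"
    by (simp flip: power_mult power_add)
  also have "\<dots> \<le> c * k ^ (c * k)"
    using assms(3) k by (intro mult_le_mono power_increasing) auto
  finally show ?thesis .
qed

text \<open>As \<open>k\<close> is positive, the constant \<open>C\<close> can move into the
  exponent as \<open>2 ^ (C * k)\<close>.\<close>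

lemma time_const_le_two_power:
  fixes c C k :: nat
  assumes "0 < k" "C + 8 \<le> c"
  shows "C * 256 ^ k \<le> 2 ^ (c * k)"
proof -
  have "C \<le> 2 ^ C" using less_exp[of C] by simp
  also have "\<dots> \<le> 2 ^ (C * k)" using assms(1) by (intro power_increasing) auto
  finally have "C * 256 ^ k \<le> 2 ^ (C * k) * 256 ^ k" by simp
  also have "\<dots> = 2 ^ ((C + 8) * k)" by (simp add: power_add add_mult_distrib power_mult[of 2 8 k])
  also have "\<dots> \<le> 2 ^ (c * k)" using assms(2) by (intro power_increasing) auto
  finally show ?thesis .
qed

theorem theorem4:
  fixes \<alpha> :: nat
  shows "\<exists>(p :: com) (c :: nat).
    \<forall>(\<G> :: nat pgt) (A :: nat pair_pre_digraph) (r :: nat) (n :: nat) (m :: nat) (k :: nat)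
      (es :: (nat \<times> nat) list) (tas :: (nat \<times> nat) list) (w :: nat).
      parametric_graph_template \<G> \<and> no_skipping \<G> \<and> template_acyclic \<G> \<and>
      pverts (tgraph \<G>) = {..<n} \<and> parcs (tgraph \<G>) = set es \<and> distinct es \<and> length es = m \<and>
      rooted_tree A r \<and> pverts A = {..<k} \<and> parcs A = set tas \<and> distinct tas \<and>
      word_length_ok c k (encode_input \<G> n es k r tas) w \<longrightarrow>
      (\<exists>t. halts_within w p (encode_input \<G> n es k r tas) t \<and>
           prob_decides w p (encode_input \<G> n es k r tas) t n (occurs_rooted_at A r \<G>)
             \<ge> 1 - 1 / real n ^ \<alpha> \<and>
           real t \<le> real c * real k ^ (c * k) * real (max m n) * log 2 (real (max 2 n)) \<and>
           ((\<forall>i. 1 \<le> i \<and> i < length (params \<G>) \<longrightarrow> k \<le> params \<G> ! i) \<longrightarrow>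
             real t \<le> 2 ^ (c * k) * real (max m n) * log 2 (real (max 2 n))))"
proof -
  define C where "C = 2 * total_const \<alpha> * (\<alpha> + 1)"
  \<comment> \<open>One constant for all purposes: \<open>512 * C\<close> for the leading factor at
    \<open>k = 1\<close>, the rest for the word length; the exponents needed for the running time
    are smaller.\<close>
  define c where "c = 512 * C + 100 * (\<alpha> + 5) + 400"
  show ?thesis
  proof (rule exI[of _ "program \<alpha>"], rule exI[of _ c], intro allI impI)
    fix \<G> :: "nat pgt" and A :: "nat pair_pre_digraph" and r n m k w :: nat
      and es tas :: "(nat \<times> nat) list"
    assume *: "parametric_graph_template \<G> \<and> no_skipping \<G> \<and> template_acyclic \<G> \<and>
      pverts (tgraph \<G>) = {..<n} \<and> parcs (tgraph \<G>) = set es \<and> distinct es \<and> length es = m \<and>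
      rooted_tree A r \<and> pverts A = {..<k} \<and> parcs A = set tas \<and> distinct tas \<and>
      word_length_ok c k (encode_input \<G> n es k r tas) w"
    then have G: "parametric_graph_template \<G>" "no_skipping \<G>" "template_acyclic \<G>"
        "pverts (tgraph \<G>) = {..<n}" "parcs (tgraph \<G>) = set es" "distinct es"
      and A: "pverts A = {..<k}" "parcs A = set tas" and tree: "rooted_tree A r" "distinct tas"
      and m: "length es = m" and w: "word_length_ok c k (encode_input \<G> n es k r tas) w"
      by simp_all
    obtain d where d: "arc_tree tas k r d"
      using rooted_tree_imp_arc_tree[OF tree(1) A tree(2)] by (rule exE)
    have op: "occurrence_problem \<G> tas k r d n es"
      by (intro occurrence_problem.intro pattern_occurrence.intro acyclic_template_graph.intro
          template_graph.intro acyclic_template_graph_axioms.intro occurrence_problem_axioms.intro d)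
        (simp_all add: G)
    \<comment> \<open>The value 0 for \<open>U\<close> is provisional: this interpretation serves to
      obtain \<open>word_bound\<close>, which takes the place of \<open>U\<close> in the next
      one.\<close>
    interpret O: occurrence_problem \<G> tas k r d n es \<alpha> 0 by (rule op)
    have word: "O.word_bound ^ 100 < 2 ^ w"
      by (rule O.word_length[of c]) (use w in \<open>simp_all add: O.xs_def c_def\<close>)
    interpret ram_problem \<G> tas k r d n es \<alpha> O.word_bound w
      by (intro ram_problem.intro O.bounded_problem_word_bound ram_problem_axioms.intro word)
    obtain t where t: "t \<le> run_time" "halts_within w (program \<alpha>) xs t"
        "1 - 1 / real n ^ \<alpha> \<le> prob_decides w (program \<alpha>) xs t n (occurs_rooted_at A r \<G>)"
      using program_correct[OF A] by blast
    define F where "F = real (max m n) * log 2 (real (max 2 n))"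
    have "0 \<le> log 2 (real (max 2 n))" by (rule zero_le_log_cancel_iff[THEN iffD2]) auto
    then have F: "0 \<le> F" by (simp add: F_def)
    have "real t \<le> real run_time" using t(1) by simp
    also have "\<dots> \<le> real (C * 256 ^ k * q) * F"
      using run_time_real_le by (simp add: F_def C_def time_const_def m mult.assoc)
    finally have tF: "real t \<le> real (C * 256 ^ k * q) * F" .
    have le: "real t \<le> real z * F" if "C * 256 ^ k * q \<le> z" for z
      using tF mult_right_mono[OF of_nat_mono[OF that] F] by linarith
    have "real t \<le> real (c * k ^ (c * k)) * F"
      by (rule le, rule time_const_le[OF k_pos q_le]) (simp add: c_def)
    moreover have "real t \<le> real (2 ^ (c * k)) * F"
      if "\<forall>i. 1 \<le> i \<and> i < length (params \<G>) \<longrightarrow> k \<le> params \<G> ! i"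
      by (rule le) (use not_small_large_params[OF that] time_const_le_two_power[OF k_pos, of C c] in
        \<open>simp add: c_def\<close>)
    ultimately show "\<exists>t. halts_within w (program \<alpha>) (encode_input \<G> n es k r tas) t \<and>
           prob_decides w (program \<alpha>) (encode_input \<G> n es k r tas) t n (occurs_rooted_at A r \<G>)
             \<ge> 1 - 1 / real n ^ \<alpha> \<and>
           real t \<le> real c * real k ^ (c * k) * real (max m n) * log 2 (real (max 2 n)) \<and>
           ((\<forall>i. 1 \<le> i \<and> i < length (params \<G>) \<longrightarrow> k \<le> params \<G> ! i) \<longrightarrow>
             real t \<le> 2 ^ (c * k) * real (max m n) * log 2 (real (max 2 n)))"
      using t(2,3) by (intro exI[of _ t] conjI impI) (simp_all add: xs_def F_def mult.assoc)
  qed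
qed

end
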